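(* Let $R$ be a noetherian regular (commutative) ring of prime characteristic $p$ and let $f_1,f_2\in R$ form a regular sequence. Then, for every $F$-finite $F$-module $\mathcal M$ over $R$, the support $\operatorname{Supp}(H^i(K^\bullet(f_1,f_2;\mathcal M)))$ is Zariski-closed in $\operatorname{Spec}(R)$ for each integer $i$.
   Context: $K^\bullet(f_1,f_2;N)$ is the Koszul cocomplex $0\to N\xrightarrow{\binom{f_1}{f_2}}N^{\oplus 2}\xrightarrow{(-f_2\ \ f_1)}N\to 0$ placed in degrees $0,1,2$. Let $R^{(1)}$ be the additive group of $R$ viewed as an $R$-bimodule with the usual left action and right action $r'\cdot r=r^pr'$; the Peskine–Szpiro functor is $\mathbf F(M)=R^{(1)}\otimes_R M$. An $F$-module is an $R$-module $\mathcal M$ with an $R$-module isomorphism $\theta:\mathcal M\to\mathbf F(\mathcal M)$. A generating morphism of $\mathcal M$ is an $R$-module homomorphism $\beta:M\to\mathbf F(M)$ such that $\mathcal M$ is the direct limit of $M\xrightarrow{\beta}\mathbf F(M)\xrightarrow{\mathbf F(\beta)}\mathbf F^2(M)\to\cdots$ and $\theta$ is induced by the maps $\mathbf F^e(\beta):\mathbf F^e(M)\to\mathbf F^{e+1}(M)$. $\mathcal M$ is $F$-finite if it admits a generating morphism $\beta:M\to\mathbf F(M)$ with $M$ a finitely generated $R$-module. *)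

theory Defs
  imports
    "HOL-Algebra.Free_Abelian_Groups"
    "HOL-Algebra.Module"
    "HOL-Algebra.QuotRing"
    "HOL-Algebra.Ring_Divisibility"
    "HOL-Library.Extended_Nat"
    "HOL-Computational_Algebra.Primes"
begin

text \<open>
  An \<open>R\<close>-module is a record satisfying \<^locale>\<open>module\<close>. The fields \<open>mult\<close> and \<open>one\<close>, which
  module records inherit from rings, play no role in that locale and are left unspecified in
  the constructions below. Operations on quotients are written in the style of
  \<^const>\<open>rcoset_mult\<close>: as the union, over all representatives, of the resulting classes, all of
  which coincide.
\<close>

section \<open>Modules\<close>

definition module_hom ::
    "('a, 'r) ring_scheme \<Rightarrow> ('a, 'm, 'c) module_scheme \<Rightarrow> ('a, 'n, 'd) module_scheme \<Rightarrow> ('m \<Rightarrow> 'n) set"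
  where "module_hom R M N =
    {h \<in> carrier M \<rightarrow> carrier N.
       (\<forall>x\<in>carrier M. \<forall>y\<in>carrier M. h (x \<oplus>\<^bsub>M\<^esub> y) = h x \<oplus>\<^bsub>N\<^esub> h y) \<and>
       (\<forall>r\<in>carrier R. \<forall>x\<in>carrier M. h (r \<odot>\<^bsub>M\<^esub> x) = r \<odot>\<^bsub>N\<^esub> h x)}"

definition module_iso ::
    "('a, 'r) ring_scheme \<Rightarrow> ('a, 'm, 'c) module_scheme \<Rightarrow> ('a, 'n, 'd) module_scheme \<Rightarrow> ('m \<Rightarrow> 'n) set"
  where "module_iso R M N = {h \<in> module_hom R M N. bij_betw h (carrier M) (carrier N)}"

definition finitely_generated_module ::
    "('a, 'r) ring_scheme \<Rightarrow> ('a, 'm, 'c) module_scheme \<Rightarrow> bool"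
  where "finitely_generated_module R M \<longleftrightarrow> module R M \<and>
    (\<exists>S \<subseteq> carrier M. finite S \<and> (\<forall>H. submodule H R M \<and> S \<subseteq> H \<longrightarrow> H = carrier M))"

definition self_module :: "('a, 'r) ring_scheme \<Rightarrow> ('a, 'a) module"
  where "self_module R =
    \<lparr>carrier = carrier R, monoid.mult = monoid.mult R, one = one R, zero = zero R, add = add R,
     smult = monoid.mult R\<rparr>"

definition quotient_module :: "('a, 'm, 'c) module_scheme \<Rightarrow> 'm set \<Rightarrow> ('a, 'm set) module"
  where "quotient_module M H =
    \<lparr>carrier = a_rcosets\<^bsub>M\<^esub> H, monoid.mult = undefined, one = undefined,
     zero = H, add = set_add M,
     smult = (\<lambda>r X. \<Union>x\<in>X. H +>\<^bsub>M\<^esub> (r \<odot>\<^bsub>M\<^esub> x))\<rparr>"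

definition power_module :: "('a, 'm, 'c) module_scheme \<Rightarrow> nat \<Rightarrow> ('a, 'm list) module"
  where "power_module M k =
    \<lparr>carrier = {xs. length xs = k \<and> set xs \<subseteq> carrier M}, monoid.mult = undefined, one = undefined,
     zero = replicate k \<zero>\<^bsub>M\<^esub>, add = map2 (add M),
     smult = (\<lambda>r. map (smult M r))\<rparr>"

text \<open>The copy of a module obtained by renaming its elements along a map injective on the carrier.\<close>

definition transport_module :: "('m \<Rightarrow> 'n) \<Rightarrow> ('a, 'm, 'c) module_scheme \<Rightarrow> ('a, 'n) module"
  where "transport_module h M =
    (let g = inv_into (carrier M) h in
    \<lparr>carrier = h ` carrier M, monoid.mult = undefined, one = undefined,
     zero = h \<zero>\<^bsub>M\<^esub>, add = (\<lambda>x y. h (g x \<oplus>\<^bsub>M\<^esub> g y)),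
     smult = (\<lambda>r x. h (r \<odot>\<^bsub>M\<^esub> g x))\<rparr>)"


section \<open>Localization, spectrum and support\<close>

definition fraction ::
    "'a set \<Rightarrow> ('a, 'm, 'c) module_scheme \<Rightarrow> 'm \<Rightarrow> 'a \<Rightarrow> ('m \<times> 'a) set"
  where "fraction S M x s =
    {(y, t). y \<in> carrier M \<and> t \<in> S \<and> (\<exists>u\<in>S. u \<odot>\<^bsub>M\<^esub> (t \<odot>\<^bsub>M\<^esub> x) = u \<odot>\<^bsub>M\<^esub> (s \<odot>\<^bsub>M\<^esub> y))}"

definition localized_module ::
    "('a, 'r) ring_scheme \<Rightarrow> 'a set \<Rightarrow> ('a, 'm, 'c) module_scheme \<Rightarrow> ('a, ('m \<times> 'a) set) module"
  where "localized_module R S M =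
    \<lparr>carrier = {fraction S M x s | x s. x \<in> carrier M \<and> s \<in> S},
     monoid.mult = undefined, one = undefined,
     zero = fraction S M \<zero>\<^bsub>M\<^esub> \<one>\<^bsub>R\<^esub>,
     add = (\<lambda>X Y. \<Union>(x, s)\<in>X. \<Union>(y, t)\<in>Y.
              fraction S M (t \<odot>\<^bsub>M\<^esub> x \<oplus>\<^bsub>M\<^esub> s \<odot>\<^bsub>M\<^esub> y) (s \<otimes>\<^bsub>R\<^esub> t)),
     smult = (\<lambda>r X. \<Union>(x, s)\<in>X. fraction S M (r \<odot>\<^bsub>M\<^esub> x) s)\<rparr>"

definition localized_ring :: "('a, 'r) ring_scheme \<Rightarrow> 'a set \<Rightarrow> ('a \<times> 'a) set ring"
  where "localized_ring R S =
    \<lparr>carrier = carrier (localized_module R S (self_module R)),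
     monoid.mult = (\<lambda>X Y. \<Union>(x, s)\<in>X. \<Union>(y, t)\<in>Y. fraction S (self_module R) (x \<otimes>\<^bsub>R\<^esub> y) (s \<otimes>\<^bsub>R\<^esub> t)),
     one = fraction S (self_module R) \<one>\<^bsub>R\<^esub> \<one>\<^bsub>R\<^esub>,
     zero = zero (localized_module R S (self_module R)),
     add = add (localized_module R S (self_module R))\<rparr>"

definition Spec :: "('a, 'r) ring_scheme \<Rightarrow> 'a set set"
  where "Spec R = {P. primeideal P R}"

definition zariski_closed :: "('a, 'r) ring_scheme \<Rightarrow> 'a set set \<Rightarrow> bool"
  where "zariski_closed R Z \<longleftrightarrow> (\<exists>I. ideal I R \<and> Z = {P \<in> Spec R. I \<subseteq> P})"

definition Supp :: "('a, 'r) ring_scheme \<Rightarrow> ('a, 'm, 'c) module_scheme \<Rightarrow> 'a set set"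
  where "Supp R M =
    {P \<in> Spec R. carrier (localized_module R (carrier R - P) M)
                  \<noteq> {zero (localized_module R (carrier R - P) M)}}"


section \<open>Regular rings and regular sequences\<close>

definition krull_dim :: "('a, 'r) ring_scheme \<Rightarrow> enat"
  where "krull_dim A =
    Sup {enat n | n. \<exists>Q. (\<forall>i\<le>n. Q i \<in> Spec A) \<and> (\<forall>i<n. Q i \<subset> Q (Suc i))}"

definition regular_local_ring :: "('a, 'r) ring_scheme \<Rightarrow> bool"
  where "regular_local_ring A \<longleftrightarrow> cring A \<and> noetherian_ring A \<and>
    (\<exists>m G. {J. maximalideal J A} = {m} \<and>
           G \<subseteq> carrier A \<and> finite G \<and> m = Idl\<^bsub>A\<^esub> G \<and> enat (card G) = krull_dim A)"

definition noetherian_regular_ring :: "('a, 'r) ring_scheme \<Rightarrow> bool"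
  where "noetherian_regular_ring R \<longleftrightarrow> cring R \<and> noetherian_ring R \<and>
    (\<forall>P\<in>Spec R. regular_local_ring (localized_ring R (carrier R - P)))"

definition has_characteristic :: "('a, 'r) ring_scheme \<Rightarrow> nat \<Rightarrow> bool"
  where "has_characteristic R p \<longleftrightarrow> (\<forall>n::nat. [n] \<cdot>\<^bsub>R\<^esub> \<one>\<^bsub>R\<^esub> = \<zero>\<^bsub>R\<^esub> \<longleftrightarrow> p dvd n)"

definition nonzerodivisor :: "('a, 'r) ring_scheme \<Rightarrow> 'a \<Rightarrow> bool"
  where "nonzerodivisor A a \<longleftrightarrow> a \<in> carrier A \<and>
    (\<forall>x\<in>carrier A. a \<otimes>\<^bsub>A\<^esub> x = \<zero>\<^bsub>A\<^esub> \<longrightarrow> x = \<zero>\<^bsub>A\<^esub>)"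

definition regular_sequence :: "('a, 'r) ring_scheme \<Rightarrow> 'a list \<Rightarrow> bool"
  where "regular_sequence R fs \<longleftrightarrow> set fs \<subseteq> carrier R \<and>
    (\<forall>i<length fs. let I = Idl\<^bsub>R\<^esub> (set (take i fs)) in
                    nonzerodivisor (R Quot I) (I +>\<^bsub>R\<^esub> (fs ! i))) \<and>
    Idl\<^bsub>R\<^esub> (set fs) \<noteq> carrier R"


section \<open>Cohomology and the Koszul cocomplex\<close>

definition cohomology ::
    "(int \<Rightarrow> ('a, 'm) module) \<Rightarrow> (int \<Rightarrow> 'm \<Rightarrow> 'm) \<Rightarrow> int \<Rightarrow> ('a, 'm set) module"
  where "cohomology K d i =
    quotient_module (K i\<lparr>carrier := {x \<in> carrier (K i). d i x = \<zero>\<^bsub>K (i + 1)\<^esub>}\<rparr>)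
                    (d (i - 1) ` carrier (K (i - 1)))"

text \<open>
  All terms of the cocomplex are powers of \<open>N\<close>, with lists as elements, so that they share a
  type; \<open>N\<close> itself appears as its first power and the zero module as its power with exponent 0.
\<close>

definition koszul_rank :: "int \<Rightarrow> nat"
  where "koszul_rank i = (if i = 0 \<or> i = 2 then 1 else if i = 1 then 2 else 0)"

definition koszul_module :: "('a, 'm, 'c) module_scheme \<Rightarrow> int \<Rightarrow> ('a, 'm list) module"
  where "koszul_module N i = power_module N (koszul_rank i)"

definition koszul_diff ::
    "('a, 'r) ring_scheme \<Rightarrow> 'a \<Rightarrow> 'a \<Rightarrow> ('a, 'm, 'c) module_scheme \<Rightarrow> int \<Rightarrow> 'm list \<Rightarrow> 'm list"
  where "koszul_diff R f1 f2 N i xs =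
    (if i = 0 then [f1 \<odot>\<^bsub>N\<^esub> (xs ! 0), f2 \<odot>\<^bsub>N\<^esub> (xs ! 0)]
     else if i = 1 then [((\<ominus>\<^bsub>R\<^esub> f2) \<odot>\<^bsub>N\<^esub> (xs ! 0)) \<oplus>\<^bsub>N\<^esub> (f1 \<odot>\<^bsub>N\<^esub> (xs ! 1))]
     else \<zero>\<^bsub>koszul_module N (i + 1)\<^esub>)"

definition koszul_cohomology ::
    "('a, 'r) ring_scheme \<Rightarrow> 'a \<Rightarrow> 'a \<Rightarrow> ('a, 'm, 'c) module_scheme \<Rightarrow> int \<Rightarrow> ('a, 'm list set) module"
  where "koszul_cohomology R f1 f2 N = cohomology (koszul_module N) (koszul_diff R f1 f2 N)"


section \<open>Tensor products\<close>

text \<open>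
  Tensor product over \<open>R\<close> of an \<open>R\<close>-bimodule \<open>B\<close> with a module \<open>M\<close>. The record \<open>B\<close> carries the
  left action, and \<open>ract x r\<close> is the right action \<open>x\<cdot>r\<close>. The product is the free abelian group on
  pairs modulo the subgroup generated by the usual relations, with \<open>R\<close> acting through \<open>B\<close>.
\<close>

definition tensor_relators ::
    "('a, 'r) ring_scheme \<Rightarrow> ('a, 'b, 'c) module_scheme \<Rightarrow> ('b \<Rightarrow> 'a \<Rightarrow> 'b) \<Rightarrow>
     ('a, 'm, 'd) module_scheme \<Rightarrow> ('b \<times> 'm \<Rightarrow>\<^sub>0 int) set"
  where "tensor_relators R B ract M =
    {frag_of (x \<oplus>\<^bsub>B\<^esub> y, m) - frag_of (x, m) - frag_of (y, m) | x y m.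
       x \<in> carrier B \<and> y \<in> carrier B \<and> m \<in> carrier M} \<union>
    {frag_of (x, m \<oplus>\<^bsub>M\<^esub> n) - frag_of (x, m) - frag_of (x, n) | x m n.
       x \<in> carrier B \<and> m \<in> carrier M \<and> n \<in> carrier M} \<union>
    {frag_of (ract x r, m) - frag_of (x, r \<odot>\<^bsub>M\<^esub> m) | x r m.
       x \<in> carrier B \<and> r \<in> carrier R \<and> m \<in> carrier M}"

definition tensor_subgroup ::
    "('a, 'r) ring_scheme \<Rightarrow> ('a, 'b, 'c) module_scheme \<Rightarrow> ('b \<Rightarrow> 'a \<Rightarrow> 'b) \<Rightarrow>
     ('a, 'm, 'd) module_scheme \<Rightarrow> ('b \<times> 'm \<Rightarrow>\<^sub>0 int) set"
  where "tensor_subgroup R B ract M =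
    generate (free_Abelian_group (carrier B \<times> carrier M)) (tensor_relators R B ract M)"

definition tensor_class ::
    "('a, 'r) ring_scheme \<Rightarrow> ('a, 'b, 'c) module_scheme \<Rightarrow> ('b \<Rightarrow> 'a \<Rightarrow> 'b) \<Rightarrow>
     ('a, 'm, 'd) module_scheme \<Rightarrow> ('b \<times> 'm \<Rightarrow>\<^sub>0 int) \<Rightarrow> ('b \<times> 'm \<Rightarrow>\<^sub>0 int) set"
  where "tensor_class R B ract M c =
    tensor_subgroup R B ract M #>\<^bsub>free_Abelian_group (carrier B \<times> carrier M)\<^esub> c"

definition tensor_product ::
    "('a, 'r) ring_scheme \<Rightarrow> ('a, 'b, 'c) module_scheme \<Rightarrow> ('b \<Rightarrow> 'a \<Rightarrow> 'b) \<Rightarrow>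
     ('a, 'm, 'd) module_scheme \<Rightarrow> ('a, ('b \<times> 'm \<Rightarrow>\<^sub>0 int) set) module"
  where "tensor_product R B ract M =
    (let T = free_Abelian_group (carrier B \<times> carrier M) Mod tensor_subgroup R B ract M in
    \<lparr>carrier = carrier T, monoid.mult = undefined, one = undefined,
     zero = one T, add = monoid.mult T,
     smult = (\<lambda>r C. \<Union>c\<in>C. tensor_class R B ract M
                              (frag_extend (\<lambda>(x, m). frag_of (r \<odot>\<^bsub>B\<^esub> x, m)) c))\<rparr>)"

text \<open>The map \<open>id \<otimes> \<phi>\<close> from \<open>B \<otimes> M\<close> to \<open>B \<otimes> N\<close>; the source \<open>M\<close> does not enter the formula.\<close>

definition tensor_map ::
    "('a, 'r) ring_scheme \<Rightarrow> ('a, 'b, 'c) module_scheme \<Rightarrow> ('b \<Rightarrow> 'a \<Rightarrow> 'b) \<Rightarrow>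
     ('a, 'n, 'd) module_scheme \<Rightarrow> ('m \<Rightarrow> 'n) \<Rightarrow>
     ('b \<times> 'm \<Rightarrow>\<^sub>0 int) set \<Rightarrow> ('b \<times> 'n \<Rightarrow>\<^sub>0 int) set"
  where "tensor_map R B ract N \<phi> C =
    (\<Union>c\<in>C. tensor_class R B ract N (frag_extend (\<lambda>(x, m). frag_of (x, \<phi> m)) c))"


section \<open>The Peskine--Szpiro functor\<close>

definition frob_ract :: "('a, 'r) ring_scheme \<Rightarrow> nat \<Rightarrow> 'a \<Rightarrow> 'a \<Rightarrow> 'a"
  where "frob_ract R p r' r = (r [^]\<^bsub>R\<^esub> p) \<otimes>\<^bsub>R\<^esub> r'"

definition PS ::
    "('a, 'r) ring_scheme \<Rightarrow> nat \<Rightarrow> ('a, 'm, 'c) module_scheme \<Rightarrow> ('a, ('a \<times> 'm \<Rightarrow>\<^sub>0 int) set) module"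
  where "PS R p M = tensor_product R (self_module R) (frob_ract R p) M"

definition PS_map ::
    "('a, 'r) ring_scheme \<Rightarrow> nat \<Rightarrow> ('a, 'n, 'c) module_scheme \<Rightarrow> ('m \<Rightarrow> 'n) \<Rightarrow>
     ('a \<times> 'm \<Rightarrow>\<^sub>0 int) set \<Rightarrow> ('a \<times> 'n \<Rightarrow>\<^sub>0 int) set"
  where "PS_map R p N \<phi> = tensor_map R (self_module R) (frob_ract R p) N \<phi>"

text \<open>
  Each application of \<^const>\<open>PS\<close> changes the type of the elements, so the iterates of \<^const>\<open>PS\<close>
  cannot be defined by recursion as they stand. The following type, whose elements are either
  elements of the original module or formal sums of pure tensors \<open>r \<otimes> x\<close>, accommodates all of
  them: an element of \<open>F(N)\<close> is renamed to a chosen formal sum representing it. Such a sum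
  always exists, without integer coefficients, since \<open>-(r \<otimes> x) = (-r) \<otimes> x\<close>; hence the
  renaming is injective on \<open>F(N)\<close>.
\<close>

datatype ('a, 'm) iterated = Base 'm | Formal_Sum "('a \<times> ('a, 'm) iterated) list"

definition PS_code ::
    "('a, 'r) ring_scheme \<Rightarrow> nat \<Rightarrow> ('a, ('a, 'm) iterated) module \<Rightarrow>
     ('a \<times> ('a, 'm) iterated \<Rightarrow>\<^sub>0 int) set \<Rightarrow> ('a, 'm) iterated"
  where "PS_code R p N C =
    Formal_Sum (SOME xs. set xs \<subseteq> carrier R \<times> carrier N \<and>
      C = tensor_class R (self_module R) (frob_ract R p) N (sum_list (map frag_of xs)))"

text \<open>\<open>PS_iter R p M e\<close> is \<open>F\<^sup>e(M)\<close>, and \<^const>\<open>PS_code\<close> is the renaming isomorphism from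
  \<open>F(F\<^sup>e(M))\<close> to \<open>F\<^sup>e\<^sup>+\<^sup>1(M)\<close>.\<close>

primrec PS_iter ::
    "('a, 'r) ring_scheme \<Rightarrow> nat \<Rightarrow> ('a, 'm) module \<Rightarrow> nat \<Rightarrow> ('a, ('a, 'm) iterated) module"
  where
    "PS_iter R p M 0 = transport_module Base M"
  | "PS_iter R p M (Suc e) =
       transport_module (PS_code R p (PS_iter R p M e)) (PS R p (PS_iter R p M e))"

definition PS_decode ::
    "('a, 'r) ring_scheme \<Rightarrow> nat \<Rightarrow> ('a, 'm) module \<Rightarrow> nat \<Rightarrow>
     ('a, 'm) iterated \<Rightarrow> ('a \<times> ('a, 'm) iterated \<Rightarrow>\<^sub>0 int) set"
  where "PS_decode R p M e =
    inv_into (carrier (PS R p (PS_iter R p M e))) (PS_code R p (PS_iter R p M e))"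

text \<open>\<open>PS_iter_map R p M \<beta> e\<close> is the map \<open>F\<^sup>e(\<beta>)\<close> from \<open>F\<^sup>e(M)\<close> to \<open>F\<^sup>e\<^sup>+\<^sup>1(M)\<close>.\<close>

primrec PS_iter_map ::
    "('a, 'r) ring_scheme \<Rightarrow> nat \<Rightarrow> ('a, 'm) module \<Rightarrow> ('m \<Rightarrow> ('a \<times> 'm \<Rightarrow>\<^sub>0 int) set) \<Rightarrow> nat \<Rightarrow>
     ('a, 'm) iterated \<Rightarrow> ('a, 'm) iterated"
  where
    "PS_iter_map R p M \<beta> 0 =
       PS_code R p (PS_iter R p M 0) \<circ> PS_map R p (PS_iter R p M 0) Base \<circ> \<beta>
         \<circ> inv_into (carrier M) Base"
  | "PS_iter_map R p M \<beta> (Suc e) =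
       PS_code R p (PS_iter R p M (Suc e))
         \<circ> PS_map R p (PS_iter R p M (Suc e)) (PS_iter_map R p M \<beta> e)
         \<circ> PS_decode R p M e"


section \<open>Direct limits of sequences\<close>

definition limit_class ::
    "(nat \<Rightarrow> ('a, 'm, 'c) module_scheme) \<Rightarrow> (nat \<Rightarrow> 'm \<Rightarrow> 'm) \<Rightarrow> nat \<Rightarrow> 'm \<Rightarrow> (nat \<times> 'm) set"
  where "limit_class N g d x =
    {(e, y). y \<in> carrier (N e) \<and>
             (\<exists>k. d \<le> k \<and> e \<le> k \<and> fold g [d..<k] x = fold g [e..<k] y)}"

definition direct_limit ::
    "(nat \<Rightarrow> ('a, 'm, 'c) module_scheme) \<Rightarrow> (nat \<Rightarrow> 'm \<Rightarrow> 'm) \<Rightarrow> ('a, (nat \<times> 'm) set) module"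
  where "direct_limit N g =
    \<lparr>carrier = {limit_class N g d x | d x. x \<in> carrier (N d)},
     monoid.mult = undefined, one = undefined,
     zero = limit_class N g 0 \<zero>\<^bsub>N 0\<^esub>,
     add = (\<lambda>X Y. \<Union>(d, x)\<in>X. \<Union>(e, y)\<in>Y. let k = max d e in
              limit_class N g k (fold g [d..<k] x \<oplus>\<^bsub>N k\<^esub> fold g [e..<k] y)),
     smult = (\<lambda>r X. \<Union>(d, x)\<in>X. limit_class N g d (r \<odot>\<^bsub>N d\<^esub> x))\<rparr>"


section \<open>F-modules\<close>

definition F_module ::
    "('a, 'r) ring_scheme \<Rightarrow> nat \<Rightarrow> ('a, 'm, 'c) module_scheme \<Rightarrow> ('m \<Rightarrow> ('a \<times> 'm \<Rightarrow>\<^sub>0 int) set) \<Rightarrow> bool"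
  where "F_module R p L \<theta> \<longleftrightarrow> module R L \<and> \<theta> \<in> module_iso R L (PS R p L)"

text \<open>
  \<open>\<beta>\<close> is a generating morphism of the F-module \<open>(L, \<theta>)\<close>. Write \<open>\<psi>\<^sub>e\<close> for the map
  from \<open>F\<^sup>e(M)\<close> to \<open>L\<close> given by \<open>\<psi>\<close>. As \<open>F\<close> commutes with the direct limit, \<open>F(L)\<close> is the
  limit of the modules \<open>F\<^sup>e\<^sup>+\<^sup>1(M)\<close> along the maps \<open>F(\<psi>\<^sub>e)\<close>, and the last conjunct states
  that \<open>\<theta> \<circ> \<psi>\<^sub>e = F(\<psi>\<^sub>e) \<circ> F\<^sup>e(\<beta>)\<close>, that is, that \<open>\<theta>\<close> is the map of limits induced
  by the maps \<open>F\<^sup>e(\<beta>)\<close>.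
\<close>

definition generating_morphism ::
    "('a, 'r) ring_scheme \<Rightarrow> nat \<Rightarrow> ('a, 'l, 'c) module_scheme \<Rightarrow> ('l \<Rightarrow> ('a \<times> 'l \<Rightarrow>\<^sub>0 int) set) \<Rightarrow>
     ('a, 'm) module \<Rightarrow> ('m \<Rightarrow> ('a \<times> 'm \<Rightarrow>\<^sub>0 int) set) \<Rightarrow> bool"
  where "generating_morphism R p L \<theta> M \<beta> \<longleftrightarrow>
    module R M \<and> \<beta> \<in> module_hom R M (PS R p M) \<and>
    (\<exists>\<psi> \<in> module_iso R (direct_limit (PS_iter R p M) (PS_iter_map R p M \<beta>)) L.
       let \<psi>' = (\<lambda>e x. \<psi> (limit_class (PS_iter R p M) (PS_iter_map R p M \<beta>) e x)) in
       \<forall>e. \<forall>x\<in>carrier (PS_iter R p M e).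
         \<theta> (\<psi>' e x) = PS_map R p L (\<psi>' e) (PS_decode R p M e (PS_iter_map R p M \<beta> e x)))"

text \<open>
  The type of the elements of \<open>M\<close> is a parameter because a HOL formula cannot quantify over
  types.
\<close>

definition F_finite ::
    "'m itself \<Rightarrow> ('a, 'r) ring_scheme \<Rightarrow> nat \<Rightarrow> ('a, 'l, 'c) module_scheme \<Rightarrow>
     ('l \<Rightarrow> ('a \<times> 'l \<Rightarrow>\<^sub>0 int) set) \<Rightarrow> bool"
  where "F_finite _ R p L \<theta> \<longleftrightarrow>
    (\<exists>(M :: ('a, 'm) module) \<beta>. finitely_generated_module R M \<and> generating_morphism R p L \<theta> M \<beta>)"

end

theory Submission imports Defs
begin

text \<open>
  Write \<open>\<phi>\<close> for the \<open>p\<close>-linear endomorphism of \<open>L\<close> that corresponds to \<open>\<theta>\<close>. A generating morphism exhibits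
  \<open>L\<close> as the increasing union of finitely generated submodules \<open>L\<^sub>0, L\<^sub>1, \<dots>\<close>, where \<open>L\<^sub>e\<^sub>+\<^sub>1\<close> is the span of
  \<open>\<phi>(L\<^sub>e)\<close>. The Frobenius of a regular ring is flat (Kunz), so the elements of \<open>L\<^sub>e\<^sub>+\<^sub>1\<close> killed by \<open>f\<^sup>p\<close> are
  spanned by the images of the elements of \<open>L\<^sub>e\<close> killed by \<open>f\<close>, and similarly for cocycles. This turns the
  vanishing of cohomology at a prime \<open>Q\<close> into finitely many conditions of the form ``some \<open>s \<notin> Q\<close>
  multiplies a given element into a given submodule'', which are open in \<open>Q\<close>.

  For \<open>H\<^sup>0\<close> and \<open>H\<^sup>2\<close> it suffices to test generators of the kernel in \<open>L\<^sub>0\<close> and of \<open>L\<^sub>0\<close>. For \<open>H\<^sup>1\<close> let \<open>T\<close> be the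
  submodule of elements killed by powers of both \<open>f\<^sub>1\<close> and \<open>f\<^sub>2\<close>, \<open>N\<close> the kernel of \<open>f\<^sub>1\<close> on \<open>T\<close>, and \<open>T\<^sub>e = T \<inter> L\<^sub>e\<close>.
  Locally at \<open>Q\<close>, the conditions are that cocycles in \<open>L\<^sub>0\<close> are coboundaries modulo \<open>T\<close>, that \<open>T\<^sub>0\<close> lies in \<open>f\<^sub>1 T\<^sub>c\<close>,
  and that \<open>N \<inter> L\<^sub>c\<close> lies in \<open>f\<^sub>2 N\<close>. Iterating the second with \<open>q = p\<^sup>e\<close>, an element of \<open>N \<inter> L\<^sub>e\<close> becomes
  \<open>f\<^sub>1\<^sup>q y\<close> with \<open>f\<^sub>1 y\<close> in the \<open>e\<close>-th iterate of \<open>N \<inter> L\<^sub>c\<close>, hence lies in \<open>f\<^sub>2 N\<close>, because \<open>f\<^sub>1\<^sup>p\<^sup>-\<^sup>1 \<phi>\<close> maps \<open>f\<^sub>2 N\<close> to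
  itself; so every cocycle is a coboundary. Conversely, all three conditions hold where \<open>H\<^sup>1\<close> vanishes once
  \<open>c\<close> is large.
\<close>

section \<open>Spans and linear combinations\<close>

text \<open>The obstacle is that cocycles of degree one do not climb the filtration. Flatness
  decomposes solutions of equations with coefficients \<open>F f1\<close> and \<open>F f2\<close>; a
  cocycle \<open>(x, y)\<close> in \<open>Lf (Suc e)\<close> gives such a solution only after
  \<open>x\<close> is multiplied by \<open>f1^(p-1)\<close> and \<open>y\<close> by
  \<open>f2^(p-1)\<close>. Undoing the multiplication determines the pair only up to elements killed
  by powers of both \<open>f1\<close> and \<open>f2\<close>. This is why that torsion is split off
  and gets an argument of its own, in which the factors \<open>f1^(p-1)\<close>, harmful before,
  bring images of \<open>\<phi>\<close> back into the kernel of \<open>f1\<close>. Degrees zero and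
  two meet no such difficulty, as \<open>F f1\<close> is a multiple of \<open>f1\<close>.

  Kunz's theorem is reached through relations. Local generators of a prime whose number is the
  dimension are sent by Frobenius to their p-th powers; locally these have only the Koszul
  relations, which are the Frobenius images of Koszul relations among the generators. Noetherian
  induction then carries the statement from this one family to all ideals. Working with relations
  and denominators keeps every statement inside \<open>R\<close> and \<open>M\<close>.\<close>

inductive_set lspan ::
    "('a, 'r) ring_scheme \<Rightarrow> ('a, 'm, 'c) module_scheme \<Rightarrow> 'm set \<Rightarrow> 'm set"
  for R :: "('a, 'r) ring_scheme" and M :: "('a, 'm, 'c) module_scheme" and X :: "'m set"
  where
    lspan_zero: "\<zero>\<^bsub>M\<^esub> \<in> lspan R M X"
  | lspan_step: "r \<in> carrier R \<Longrightarrow> x \<in> X \<Longrightarrow> y \<in> lspan R M X \<Longrightarrow> r \<odot>\<^bsub>M\<^esub> x \<oplus>\<^bsub>M\<^esub> y \<in> lspan R M X"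

text \<open>For a submodule \<open>X\<close> this is the preimage in \<open>M\<close> of the
  localization of \<open>X\<close> at \<open>P\<close>. Statements at a prime are phrased through
  it, so that they concern elements of \<open>M\<close> itself.\<close>

definition sat ::
    "('a, 'r) ring_scheme \<Rightarrow> 'a set \<Rightarrow> ('a, 'm, 'c) module_scheme \<Rightarrow> 'm set \<Rightarrow> 'm set"
  where "sat R P M X = {x \<in> carrier M. \<exists>s\<in>carrier R - P. s \<odot>\<^bsub>M\<^esub> x \<in> X}"

definition noetherian_module :: "('a, 'r) ring_scheme \<Rightarrow> ('a, 'm, 'c) module_scheme \<Rightarrow> bool"
  where "noetherian_module R M \<longleftrightarrow>
    (\<forall>N. submodule N R M \<longrightarrow> (\<exists>G. finite G \<and> G \<subseteq> N \<and> N = lspan R M G))"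

context module
begin

abbreviation scale (infixl "\<bullet>" 70) where "r \<bullet> x \<equiv> r \<odot>\<^bsub>M\<^esub> x"

lemma submodule_zero: "submodule H R M \<Longrightarrow> \<zero>\<^bsub>M\<^esub> \<in> H"
  using subgroup.one_closed[of H "add_monoid M"] by (simp add: submodule_def)

lemma submodule_add: "submodule H R M \<Longrightarrow> x \<in> H \<Longrightarrow> y \<in> H \<Longrightarrow> x \<oplus>\<^bsub>M\<^esub> y \<in> H"
  by (rule submoduleE)

lemma submodule_smult: "submodule H R M \<Longrightarrow> r \<in> carrier R \<Longrightarrow> x \<in> H \<Longrightarrow> r \<bullet> x \<in> H"
  by (rule submoduleE)

lemma submodule_neg: "submodule H R M \<Longrightarrow> x \<in> H \<Longrightarrow> \<ominus>\<^bsub>M\<^esub> x \<in> H"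
  by (rule submoduleE)

lemma submodule_diff: "submodule H R M \<Longrightarrow> x \<in> H \<Longrightarrow> y \<in> H \<Longrightarrow> x \<ominus>\<^bsub>M\<^esub> y \<in> H"
  unfolding a_minus_def by (intro submodule_add submodule_neg)

lemma submodule_carr: "submodule H R M \<Longrightarrow> x \<in> H \<Longrightarrow> x \<in> carrier M"
  using submoduleE(1) by blast

lemma submoduleI2:
  assumes "H \<subseteq> carrier M" "\<zero>\<^bsub>M\<^esub> \<in> H"
    and "\<And>a b. a \<in> H \<Longrightarrow> b \<in> H \<Longrightarrow> a \<oplus>\<^bsub>M\<^esub> b \<in> H"
    and "\<And>a x. a \<in> carrier R \<Longrightarrow> x \<in> H \<Longrightarrow> a \<bullet> x \<in> H"
  shows "submodule H R M"
proof (rule submoduleI)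
  fix a assume a: "a \<in> H"
  have "(\<ominus> \<one>) \<bullet> a \<in> H" using assms(4) a by simp
  moreover have "(\<ominus> \<one>) \<bullet> a = \<ominus>\<^bsub>M\<^esub> a" using a assms(1) by (subst smult_l_minus) auto
  ultimately show "\<ominus>\<^bsub>M\<^esub> a \<in> H" by simp
qed (use assms in auto)

lemma zero_submodule: "submodule {\<zero>\<^bsub>M\<^esub>} R M"
  by (rule submoduleI2) auto

lemma lspan_carr: "X \<subseteq> carrier M \<Longrightarrow> x \<in> lspan R M X \<Longrightarrow> x \<in> carrier M"
  by (rotate_tac 1, induction rule: lspan.induct) auto

lemma lspan_add:
  assumes "X \<subseteq> carrier M" "x \<in> lspan R M X" "y \<in> lspan R M X"
  shows "x \<oplus>\<^bsub>M\<^esub> y \<in> lspan R M X"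
  using assms(2)
proof (induction rule: lspan.induct)
  case lspan_zero then show ?case using assms lspan_carr by (simp)
next
  case (lspan_step r z w)
  have "r \<bullet> z \<oplus>\<^bsub>M\<^esub> w \<oplus>\<^bsub>M\<^esub> y = r \<bullet> z \<oplus>\<^bsub>M\<^esub> (w \<oplus>\<^bsub>M\<^esub> y)"
    using lspan_step assms lspan_carr[OF assms(1)] by (intro M.a_assoc) auto
  then show ?case using lspan_step by (auto intro: lspan.lspan_step)
qed

lemma lspan_smult:
  assumes "X \<subseteq> carrier M" "x \<in> lspan R M X" "r \<in> carrier R"
  shows "r \<bullet> x \<in> lspan R M X"
  using assms(2)
proof (induction rule: lspan.induct)
  case lspan_zero then show ?case using assms lspan.lspan_zero by simp
next
  case (lspan_step r' z w)
  have "r \<bullet> (r' \<bullet> z \<oplus>\<^bsub>M\<^esub> w) = (r \<otimes> r') \<bullet> z \<oplus>\<^bsub>M\<^esub> r \<bullet> w"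
    using lspan_step assms lspan_carr[OF assms(1)]
    by (subst smult_r_distr) (auto simp: smult_assoc1)
  then show ?case using lspan_step assms by (auto intro: lspan.lspan_step)
qed

lemma lspan_submodule: "X \<subseteq> carrier M \<Longrightarrow> submodule (lspan R M X) R M"
  by (intro submoduleI2) (auto intro: lspan_add lspan_smult lspan_carr lspan.lspan_zero)

lemma lspan_incl: "X \<subseteq> carrier M \<Longrightarrow> X \<subseteq> lspan R M X"
proof
  fix x assume "X \<subseteq> carrier M" "x \<in> X"
  then show "x \<in> lspan R M X"
    using lspan.lspan_step[of \<one> R x X "\<zero>\<^bsub>M\<^esub>" M] lspan.lspan_zero[of M R X] by auto
qed

lemma lspan_minimal: "submodule H R M \<Longrightarrow> X \<subseteq> H \<Longrightarrow> lspan R M X \<subseteq> H"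
proof
  fix x assume H: "submodule H R M" "X \<subseteq> H" and "x \<in> lspan R M X"
  from this(3) show "x \<in> H"
    by (induction rule: lspan.induct) (use H in \<open>auto intro!: submodule_add submodule_smult submodule_zero\<close>)
qed

lemma lspan_mono: "Y \<subseteq> carrier M \<Longrightarrow> X \<subseteq> Y \<Longrightarrow> lspan R M X \<subseteq> lspan R M Y"
  by (rule lspan_minimal) (auto intro: lspan_submodule dest: lspan_incl)

lemma lspan_of_submodule: "submodule H R M \<Longrightarrow> lspan R M H = H"
  using lspan_minimal[of H H] lspan_incl[of H] submoduleE(1)[of H] by blast

lemma lspan_insert:
  assumes "X \<subseteq> carrier M" "g \<in> carrier M" "x \<in> lspan R M (insert g X)"
  obtains r y where "r \<in> carrier R" "y \<in> lspan R M X" "x = r \<bullet> g \<oplus>\<^bsub>M\<^esub> y"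
proof -
  have "\<exists>r y. r \<in> carrier R \<and> y \<in> lspan R M X \<and> x = r \<bullet> g \<oplus>\<^bsub>M\<^esub> y"
    using assms(3)
  proof (induction rule: lspan.induct)
    case lspan_zero
    then show ?case using assms lspan.lspan_zero by (intro exI[of _ \<zero>] exI[of _ "\<zero>\<^bsub>M\<^esub>"]) auto
  next
    case (lspan_step r z w)
    then obtain r' y where w: "r' \<in> carrier R" "y \<in> lspan R M X" "w = r' \<bullet> g \<oplus>\<^bsub>M\<^esub> y" by auto
    note c = lspan_carr[OF assms(1) w(2)]
    show ?case
    proof (cases "z = g")
      case True
      have "r \<bullet> z \<oplus>\<^bsub>M\<^esub> w = (r \<oplus> r') \<bullet> g \<oplus>\<^bsub>M\<^esub> y"
        using True w lspan_step assms c by (simp add: smult_l_distr M.a_assoc)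
      then show ?thesis using w lspan_step by blast
    next
      case False
      have "r \<bullet> z \<oplus>\<^bsub>M\<^esub> w = r' \<bullet> g \<oplus>\<^bsub>M\<^esub> (r \<bullet> z \<oplus>\<^bsub>M\<^esub> y)"
        using False w lspan_step assms c by (intro M.a_lcomm[of "r \<bullet> z" "r' \<bullet> g" y, folded w(3)]) auto
      moreover have "r \<bullet> z \<oplus>\<^bsub>M\<^esub> y \<in> lspan R M X"
        using w lspan_step False by (intro lspan.lspan_step) auto
      ultimately show ?thesis using w lspan_step by blast
    qed
  qed
  then show ?thesis using that by blast
qed

section \<open>Saturation at a prime and Nakayama's lemma\<close>

lemma prime_one: "primeideal P R \<Longrightarrow> \<one> \<in> carrier R - P"
  using primeideal.I_notcarr ideal.one_imp_carrier primeideal.axioms(1) by blast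

lemma prime_mult: "primeideal P R \<Longrightarrow> s \<in> carrier R - P \<Longrightarrow> t \<in> carrier R - P \<Longrightarrow> s \<otimes> t \<in> carrier R - P"
  using primeideal.I_prime[of P R s t] by auto

lemma sat_submodule:
  assumes P: "primeideal P R" and N: "submodule N R M"
  shows "submodule (sat R P M N) R M"
proof (rule submoduleI2)
  have one: "\<one> \<in> carrier R - P" using P primeideal.I_notcarr ideal.one_imp_carrier primeideal.axioms(1) by blast
  show "\<zero>\<^bsub>M\<^esub> \<in> sat R P M N" using one submodule_zero[OF N] by (auto simp: sat_def intro!: bexI[of _ \<one>])
  fix a b assume "a \<in> sat R P M N" "b \<in> sat R P M N"
  then obtain s t where *: "a \<in> carrier M" "b \<in> carrier M" "s \<in> carrier R - P" "t \<in> carrier R - P"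
     "s \<bullet> a \<in> N" "t \<bullet> b \<in> N" by (auto simp: sat_def)
  have st: "s \<otimes> t \<in> carrier R - P" using * primeideal.I_prime[OF P, of s t] by auto
  have "(s \<otimes> t) \<bullet> (a \<oplus>\<^bsub>M\<^esub> b) = t \<bullet> (s \<bullet> a) \<oplus>\<^bsub>M\<^esub> s \<bullet> (t \<bullet> b)"
    using * by (simp add: smult_r_distr smult_assoc1[symmetric] R.m_comm)
  then have "(s \<otimes> t) \<bullet> (a \<oplus>\<^bsub>M\<^esub> b) \<in> N" using * N by (auto intro: submodule_add submodule_smult)
  then show "a \<oplus>\<^bsub>M\<^esub> b \<in> sat R P M N" using * st by (auto simp: sat_def)
next
  fix a x assume a: "a \<in> carrier R" and "x \<in> sat R P M N"
  then obtain s where *: "x \<in> carrier M" "s \<in> carrier R - P" "s \<bullet> x \<in> N" by (auto simp: sat_def)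
  have "s \<bullet> (a \<bullet> x) = a \<bullet> (s \<bullet> x)"
    using * a by (simp add: smult_assoc1[symmetric] R.m_comm)
  then show "a \<bullet> x \<in> sat R P M N" using * a submodule_smult[OF N a *(3)] by (auto simp: sat_def intro!: bexI[of _ s])
qed (auto simp: sat_def)

lemma sat_incl: "primeideal P R \<Longrightarrow> N \<subseteq> carrier M \<Longrightarrow> N \<subseteq> sat R P M N"
  using prime_one by (force simp: sat_def intro!: bexI[of _ \<one>])

lemma sat_mono: "N \<subseteq> N' \<Longrightarrow> sat R P M N \<subseteq> sat R P M N'"
  by (auto simp: sat_def)

lemma sat_cancel:
  assumes "primeideal P R" "s \<in> carrier R - P" "x \<in> carrier M" "s \<bullet> x \<in> sat R P M N"
  shows "x \<in> sat R P M N"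
proof -
  obtain t where t: "t \<in> carrier R - P" "t \<bullet> (s \<bullet> x) \<in> N" using assms by (auto simp: sat_def)
  then have "(t \<otimes> s) \<bullet> x \<in> N" using assms by (simp add: smult_assoc1)
  then show ?thesis using assms t prime_mult by (auto simp: sat_def)
qed

lemma sat_idem:
  assumes "primeideal P R" "x \<in> sat R P M (sat R P M N)" shows "x \<in> sat R P M N"
  using assms sat_cancel by (auto simp: sat_def[of R P M "sat R P M N"])

text \<open>Generators are eliminated one at a time. In the equation for \<open>g\<close> the
  coefficient of \<open>g\<close> on the right lies in \<open>P\<close>; moved to the left it leaves
  a coefficient outside \<open>P\<close>, a unit at \<open>P\<close>, so that \<open>g\<close> can
  be substituted into the other equations.\<close>

lemma nakayama:
  assumes P: "primeideal P R" and N: "submodule N R M" and "finite G" "G \<subseteq> carrier M"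
    and PG: "\<And>g. g \<in> G \<Longrightarrow>
      \<exists>s\<in>carrier R - P. \<exists>n\<in>N. \<exists>w\<in>lspan R M {r \<bullet> h |r h. r \<in> P \<and> h \<in> G}. s \<bullet> g = n \<oplus>\<^bsub>M\<^esub> w"
  shows "G \<subseteq> sat R P M N"
  using assms(3,4) PG
proof (induction G arbitrary: rule: finite_induct)
  case empty then show ?case by simp
next
  case (insert g G)
  have PR: "P \<subseteq> carrier R" using ideal.Icarr[OF primeideal.axioms(1)[OF P]] by blast
  have idP: "ideal P R" using P primeideal.axioms(1) by blast
  let ?S = "\<lambda>G. {r \<bullet> h |r h. r \<in> P \<and> h \<in> G}"
  have SG: "?S G \<subseteq> carrier M" "?S (insert g G) \<subseteq> carrier M" using insert.prems PR by auto
  \<comment> \<open>Collects the terms in \<open>g\<close>: every coefficient comes from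
    \<open>P\<close>, and so does their sum \<open>r\<close>.\<close>
  have split: "\<exists>r\<in>P. \<exists>v\<in>lspan R M (?S G). w = r \<bullet> g \<oplus>\<^bsub>M\<^esub> v"
    if "w \<in> lspan R M (?S (insert g G))" for w
    using that
  proof (induction rule: lspan.induct)
    case lspan_zero
    then show ?case using insert.prems additive_subgroup.zero_closed[OF ideal.axioms(1)[OF idP]] lspan.lspan_zero
      by (intro bexI[of _ \<zero>] bexI[of _ "\<zero>\<^bsub>M\<^esub>"]) auto
  next
    case (lspan_step r x y)
    then obtain a v where av: "a \<in> P" "v \<in> lspan R M (?S G)" "y = a \<bullet> g \<oplus>\<^bsub>M\<^esub> v" by auto
    obtain q h where qh: "x = q \<bullet> h" "q \<in> P" "h \<in> insert g G" using lspan_step by blast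
    note cc = lspan_carr[OF SG(1) av(2)] subsetD[OF PR av(1)] subsetD[OF PR qh(2)]
    have gM: "g \<in> carrier M" using insert.prems by auto
    show ?case
    proof (cases "h = g")
      case True
      have "r \<bullet> x \<oplus>\<^bsub>M\<^esub> y = (r \<otimes> q \<oplus> a) \<bullet> g \<oplus>\<^bsub>M\<^esub> v"
        using True qh av cc gM lspan_step by (simp add: smult_l_distr smult_assoc1 M.a_assoc)
      moreover have "r \<otimes> q \<oplus> a \<in> P" using idP qh av lspan_step
        by (simp add: additive_subgroup.a_closed ideal.I_l_closed ideal.axioms(1))
      ultimately show ?thesis using av by blast
    next
      case False
      have xM: "x \<in> carrier M" using qh cc insert.prems by auto
      have "r \<bullet> x \<oplus>\<^bsub>M\<^esub> y = a \<bullet> g \<oplus>\<^bsub>M\<^esub> (r \<bullet> x \<oplus>\<^bsub>M\<^esub> v)"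
        using av cc gM lspan_step xM by (simp add: M.a_lcomm)
      moreover have "r \<bullet> x \<oplus>\<^bsub>M\<^esub> v \<in> lspan R M (?S G)"
        using av lspan_step qh False by (intro lspan.lspan_step) auto
      ultimately show ?thesis using av by blast
    qed
  qed
  have NS: "submodule (lspan R M (N \<union> ?S G)) R M" 
    using SG submoduleE(1)[OF N] by (intro lspan_submodule) auto
  have gM: "g \<in> carrier M" "G \<subseteq> carrier M" using insert.prems by auto
  obtain s n w where s: "s \<in> carrier R - P" "n \<in> N" "w \<in> lspan R M (?S (insert g G))" "s \<bullet> g = n \<oplus>\<^bsub>M\<^esub> w"
    using insert.prems(2)[of g] by blast
  obtain r v where rv: "r \<in> P" "v \<in> lspan R M (?S G)" "w = r \<bullet> g \<oplus>\<^bsub>M\<^esub> v" using split[OF s(3)] by blast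
  have rR: "r \<in> carrier R" using rv PR by auto
  have nM: "n \<in> carrier M" using s submodule_carr[OF N] by auto
  have vM: "v \<in> carrier M" using rv lspan_carr[OF SG(1)] by auto
  \<comment> \<open>\<open>s\<close> is outside \<open>P\<close> and \<open>r\<close> inside, so
    \<open>e\<close> is outside \<open>P\<close> and serves as a denominator.\<close>
  define e where "e = s \<ominus> r"
  have eR: "e \<in> carrier R" using s rR by (simp add: e_def)
  have eP: "e \<notin> P"
  proof
    assume "e \<in> P"
    then have "e \<oplus> r \<in> P" using rv idP by (simp add: additive_subgroup.a_closed ideal.axioms(1))
    moreover have "e \<oplus> r = s" using s rR by (simp add: e_def a_minus_def R.a_assoc R.l_neg)
    ultimately show False using s by simp
  qed
  have ge: "e \<bullet> g = n \<oplus>\<^bsub>M\<^esub> v"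
  proof -
    have "e \<bullet> g = s \<bullet> g \<ominus>\<^bsub>M\<^esub> r \<bullet> g"
      using s rR gM by (simp add: e_def a_minus_def smult_l_distr smult_l_minus)
    also have "\<dots> = n \<oplus>\<^bsub>M\<^esub> v"
      unfolding s(4) rv(3) using nM vM gM rR
      by (simp add: a_minus_def M.a_ac M.r_neg M.r_neg1 M.r_neg2)
    finally show ?thesis .
  qed
  have IH: "G \<subseteq> sat R P M N"
  proof (rule insert.IH[OF gM(2)])
    fix h assume h: "h \<in> G"
    obtain s' n' w' where s': "s' \<in> carrier R - P" "n' \<in> N" "w' \<in> lspan R M (?S (insert g G))" "s' \<bullet> h = n' \<oplus>\<^bsub>M\<^esub> w'"
      using insert.prems(2)[of h] h by blast
    obtain r' v' where rv': "r' \<in> P" "v' \<in> lspan R M (?S G)" "w' = r' \<bullet> g \<oplus>\<^bsub>M\<^esub> v'" using split[OF s'(3)] by blast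
    have r'R: "r' \<in> carrier R" using rv' PR by auto
    have n'M: "n' \<in> carrier M" using s' submodule_carr[OF N] by auto
    have v'M: "v' \<in> carrier M" using rv' lspan_carr[OF SG(1)] by auto
    have hM: "h \<in> carrier M" using h gM by auto
    \<comment> \<open>After multiplication by \<open>e\<close> the term in \<open>g\<close> is
      replaced by means of \<open>ge\<close>, which leaves only elements of \<open>N\<close> and
      combinations of \<open>G\<close> with coefficients in \<open>P\<close>.\<close>
    have "(e \<otimes> s') \<bullet> h = e \<bullet> n' \<oplus>\<^bsub>M\<^esub> (r' \<bullet> (e \<bullet> g) \<oplus>\<^bsub>M\<^esub> e \<bullet> v')"
    proof -
      have "e \<bullet> (r' \<bullet> g) = r' \<bullet> (e \<bullet> g)"
        using eR r'R gM by (simp add: smult_assoc1[symmetric] R.m_comm)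
      moreover have "(e \<otimes> s') \<bullet> h = e \<bullet> (n' \<oplus>\<^bsub>M\<^esub> (r' \<bullet> g \<oplus>\<^bsub>M\<^esub> v'))"
        using eR s' hM by (simp add: smult_assoc1 rv'(3))
      ultimately show ?thesis using eR r'R n'M v'M gM by (simp add: smult_r_distr)
    qed
    also have "\<dots> = (e \<bullet> n' \<oplus>\<^bsub>M\<^esub> r' \<bullet> n) \<oplus>\<^bsub>M\<^esub> (r' \<bullet> v \<oplus>\<^bsub>M\<^esub> e \<bullet> v')"
      unfolding ge using eR r'R n'M v'M nM vM by (simp add: smult_r_distr M.a_assoc)
    finally have "(e \<otimes> s') \<bullet> h = (e \<bullet> n' \<oplus>\<^bsub>M\<^esub> r' \<bullet> n) \<oplus>\<^bsub>M\<^esub> (r' \<bullet> v \<oplus>\<^bsub>M\<^esub> e \<bullet> v')" .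
    moreover have "e \<bullet> n' \<oplus>\<^bsub>M\<^esub> r' \<bullet> n \<in> N"
      using s s' eR r'R N by (auto intro: submodule_add submodule_smult)
    moreover have "r' \<bullet> v \<oplus>\<^bsub>M\<^esub> e \<bullet> v' \<in> lspan R M (?S G)"
      using rv rv' eR r'R SG by (auto intro: lspan_add lspan_smult)
    moreover have "e \<otimes> s' \<in> carrier R - P" using eR eP s' prime_mult[OF P] by auto
    ultimately show "\<exists>s\<in>carrier R - P. \<exists>n\<in>N. \<exists>w\<in>lspan R M (?S G). s \<bullet> h = n \<oplus>\<^bsub>M\<^esub> w" by blast
  qed
  have satN: "submodule (sat R P M N) R M" by (rule sat_submodule[OF P N])
  have "lspan R M (?S G) \<subseteq> sat R P M N"
    using IH PR by (intro lspan_minimal satN) (auto intro!: submodule_smult[OF satN])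
  then have "e \<bullet> g \<in> sat R P M N"
    unfolding ge using rv s sat_incl[OF P submoduleE(1)[OF N]] by (intro submodule_add[OF satN]) auto
  then have "g \<in> sat R P M N" using sat_cancel[OF P, of e g] eR eP gM by auto
  then show ?case using IH by auto
qed

text \<open>This is the ideal of leading coefficients of \<open>N\<close>, where \<open>g\<close> is
  the leading term and \<open>K\<close> holds the lower ones. As in Hilbert's basis theorem, it
  reduces finite generation of submodules to that of ideals.\<close>

lemma coefficient_ideal:
  assumes N: "submodule N R M" and K: "submodule K R M" and g: "g \<in> carrier M"
  shows "ideal {r \<in> carrier R. \<exists>y\<in>K. r \<bullet> g \<oplus>\<^bsub>M\<^esub> y \<in> N} R" (is "ideal ?I R")
proof (rule idealI)
  show "ring R" by (rule R.ring_axioms)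
  note cl = submodule_carr[OF N] submodule_carr[OF K]
  show "subgroup ?I (add_monoid R)"
  proof (rule subgroup.intro)
    fix a b assume "a \<in> ?I" "b \<in> ?I"
    then obtain x y where *: "a \<in> carrier R" "b \<in> carrier R" "x \<in> K" "y \<in> K"
       "a \<bullet> g \<oplus>\<^bsub>M\<^esub> x \<in> N" "b \<bullet> g \<oplus>\<^bsub>M\<^esub> y \<in> N" by blast
    have "(a \<oplus> b) \<bullet> g \<oplus>\<^bsub>M\<^esub> (x \<oplus>\<^bsub>M\<^esub> y) = (a \<bullet> g \<oplus>\<^bsub>M\<^esub> x) \<oplus>\<^bsub>M\<^esub> (b \<bullet> g \<oplus>\<^bsub>M\<^esub> y)"
      using * g cl by (simp add: smult_l_distr M.a_ac)
    then show "a \<otimes>\<^bsub>add_monoid R\<^esub> b \<in> ?I"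
      using * submodule_add[OF N *(5,6)] submodule_add[OF K *(3,4)] by (auto intro!: bexI[of _ "x \<oplus>\<^bsub>M\<^esub> y"])
  next
    show "\<one>\<^bsub>add_monoid R\<^esub> \<in> ?I"
      using g submodule_zero[OF N] submodule_zero[OF K] by (auto intro!: bexI[of _ "\<zero>\<^bsub>M\<^esub>"])
  next
    fix a assume "a \<in> ?I"
    then obtain x where *: "a \<in> carrier R" "x \<in> K" "a \<bullet> g \<oplus>\<^bsub>M\<^esub> x \<in> N" by blast
    have "(\<ominus> a) \<bullet> g \<oplus>\<^bsub>M\<^esub> \<ominus>\<^bsub>M\<^esub> x = \<ominus>\<^bsub>M\<^esub> (a \<bullet> g \<oplus>\<^bsub>M\<^esub> x)"
      using * g cl by (simp add: smult_l_minus M.minus_add)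
    then show "inv\<^bsub>add_monoid R\<^esub> a \<in> ?I"
      using * submodule_neg[OF N *(3)] submodule_neg[OF K *(2)] by (auto simp: a_inv_def[symmetric] intro!: bexI[of _ "\<ominus>\<^bsub>M\<^esub> x"])
  qed auto
  fix a r assume "a \<in> ?I" and r: "r \<in> carrier R"
  then obtain x where *: "a \<in> carrier R" "x \<in> K" "a \<bullet> g \<oplus>\<^bsub>M\<^esub> x \<in> N" by blast
  have "(r \<otimes> a) \<bullet> g \<oplus>\<^bsub>M\<^esub> r \<bullet> x = r \<bullet> (a \<bullet> g \<oplus>\<^bsub>M\<^esub> x)"
    using * g cl r by (simp add: smult_r_distr smult_assoc1)
  then show "r \<otimes> a \<in> ?I"
    using * r submodule_smult[OF N r *(3)] submodule_smult[OF K r *(2)] by (auto intro!: bexI[of _ "r \<bullet> x"])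
  then show "a \<otimes> r \<in> ?I" using * r by (simp add: R.m_comm)
qed

lemma noetherian_module_fg:
  assumes R: "noetherian_ring R" and "finite G" "G \<subseteq> carrier M" and N: "submodule N R M" "N \<subseteq> lspan R M G"
  shows "\<exists>H. finite H \<and> H \<subseteq> N \<and> N = lspan R M H"
  using assms(2-5)
proof (induction G arbitrary: N rule: finite_induct)
  case empty
  have "lspan R M {} \<subseteq> {\<zero>\<^bsub>M\<^esub>}" by (rule lspan_minimal[OF zero_submodule]) auto
  then have "N = lspan R M {}" using empty lspan_submodule[of "{}"] submodule_zero[of N] submodule_zero[of "lspan R M {}"] by auto
  then show ?case by (intro exI[of _ "{}"]) auto
next
  case (insert g G)
  have gM: "g \<in> carrier M" "G \<subseteq> carrier M" using insert.prems by auto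
  have SG: "submodule (lspan R M G) R M" using gM lspan_submodule by auto
  define I where "I = {r \<in> carrier R. \<exists>y\<in>lspan R M G. r \<bullet> g \<oplus>\<^bsub>M\<^esub> y \<in> N}"
  have idI: "ideal I R" unfolding I_def using insert.prems gM by (intro coefficient_ideal[OF _ SG]) auto
  obtain A where A: "A \<subseteq> carrier R" "finite A" "I = Idl A"
    using noetherian_ring.finetely_gen[OF R idI] by blast
  have AI: "A \<subseteq> I" using A R.genideal_self by auto
  have "\<forall>r\<in>A. \<exists>y\<in>lspan R M G. r \<bullet> g \<oplus>\<^bsub>M\<^esub> y \<in> N" using AI by (auto simp: I_def)
  then obtain Y where Y: "\<And>r. r \<in> A \<Longrightarrow> Y r \<in> lspan R M G" "\<And>r. r \<in> A \<Longrightarrow> r \<bullet> g \<oplus>\<^bsub>M\<^esub> Y r \<in> N" by metis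
  let ?H1 = "(\<lambda>r. r \<bullet> g \<oplus>\<^bsub>M\<^esub> Y r) ` A"
  have sub2: "submodule (N \<inter> lspan R M G) R M"
    using insert.prems SG by (intro submoduleI2) (auto intro: submodule_add submodule_smult submodule_zero submodule_carr)
  obtain H2 where H2: "finite H2" "H2 \<subseteq> N \<inter> lspan R M G" "N \<inter> lspan R M G = lspan R M H2"
    using insert.IH[OF gM(2) sub2] by auto
  let ?H = "?H1 \<union> H2"
  have HN: "?H \<subseteq> N" using Y H2 by auto
  have HM: "?H \<subseteq> carrier M" using HN submoduleE(1)[OF insert.prems(2)] by auto
  have SH: "submodule (lspan R M ?H) R M" using HM lspan_submodule by auto
  \<comment> \<open>The same ideal formed for the span of the candidate generators. It contains the
    generators \<open>A\<close> of \<open>I\<close>, hence all of \<open>I\<close>, so every element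
    of \<open>N\<close> agrees with one of that span up to
    \<open>N \<inter> lspan R M G\<close>.\<close>
  define I' where "I' = {r \<in> carrier R. \<exists>y\<in>lspan R M G. r \<bullet> g \<oplus>\<^bsub>M\<^esub> y \<in> lspan R M ?H}"
  have idI': "ideal I' R" unfolding I'_def using gM by (intro coefficient_ideal[OF SH SG]) auto
  have "A \<subseteq> I'"
  proof
    fix r assume r: "r \<in> A"
    then have "r \<bullet> g \<oplus>\<^bsub>M\<^esub> Y r \<in> lspan R M ?H" using lspan_incl[OF HM] by blast
    then show "r \<in> I'" using r A(1) Y(1)[OF r] by (auto simp: I'_def)
  qed
  then have II': "I \<subseteq> I'" using A(3) R.genideal_minimal[OF idI'] by auto
  have "N \<subseteq> lspan R M ?H"
  proof
    fix x assume x: "x \<in> N"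
    then have "x \<in> lspan R M (insert g G)" using insert.prems by auto
    then obtain r y where ry: "r \<in> carrier R" "y \<in> lspan R M G" "x = r \<bullet> g \<oplus>\<^bsub>M\<^esub> y"
      using lspan_insert[OF gM(2,1)] by blast
    then have "r \<in> I'" using x II' by (auto simp: I_def)
    then obtain y' where y': "y' \<in> lspan R M G" "r \<bullet> g \<oplus>\<^bsub>M\<^esub> y' \<in> lspan R M ?H" by (auto simp: I'_def)
    have yM: "y \<in> carrier M" "y' \<in> carrier M" using ry y' lspan_carr gM by auto
    have xx: "x = (r \<bullet> g \<oplus>\<^bsub>M\<^esub> y') \<oplus>\<^bsub>M\<^esub> (y \<ominus>\<^bsub>M\<^esub> y')"
      using ry yM gM by (simp add: a_minus_def M.a_ac M.r_neg M.r_neg1 M.r_neg2 M.a_lcomm[of y' y])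
    have "y \<ominus>\<^bsub>M\<^esub> y' = x \<ominus>\<^bsub>M\<^esub> (r \<bullet> g \<oplus>\<^bsub>M\<^esub> y')"
      using ry yM gM by (simp add: a_minus_def M.minus_add M.a_ac M.r_neg M.r_neg1 M.r_neg2)
    moreover have "lspan R M ?H \<subseteq> N" using HN insert.prems by (intro lspan_minimal) auto
    ultimately have "y \<ominus>\<^bsub>M\<^esub> y' \<in> N" using x y' insert.prems by (auto intro: submodule_diff)
    moreover have "y \<ominus>\<^bsub>M\<^esub> y' \<in> lspan R M G" using ry y' SG submodule_diff by blast
    ultimately have "y \<ominus>\<^bsub>M\<^esub> y' \<in> lspan R M H2" using H2 by auto
    then have "y \<ominus>\<^bsub>M\<^esub> y' \<in> lspan R M ?H" using lspan_mono[OF HM, of H2] by auto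
    then show "x \<in> lspan R M ?H" using xx y' submodule_add[OF SH] by simp
  qed
  moreover have "lspan R M ?H \<subseteq> N" using HN insert.prems by (intro lspan_minimal) auto
  ultimately have "N = lspan R M ?H" by blast
  moreover have "finite ?H" using A H2 by auto
  ultimately show ?case using HN by blast
qed

end

section \<open>Finitely supported families and linear combinations\<close>

definition semilinear ::
    "('a, 'r) ring_scheme \<Rightarrow> ('a \<Rightarrow> 'a) \<Rightarrow> ('a, 'm, 'c) module_scheme \<Rightarrow> ('a, 'n, 'd) module_scheme \<Rightarrow> ('m \<Rightarrow> 'n) \<Rightarrow> bool"
  where "semilinear R F M N h \<longleftrightarrow> h \<in> carrier M \<rightarrow> carrier N \<and>
    (\<forall>x\<in>carrier M. \<forall>y\<in>carrier M. h (x \<oplus>\<^bsub>M\<^esub> y) = h x \<oplus>\<^bsub>N\<^esub> h y) \<and>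
    (\<forall>r\<in>carrier R. \<forall>x\<in>carrier M. h (r \<odot>\<^bsub>M\<^esub> x) = F r \<odot>\<^bsub>N\<^esub> h x)"

text \<open>The free module on \<open>A\<close>. Its elements are functions on the whole index type
  that vanish off \<open>A\<close>, so that passing to a larger index set leaves both the elements
  and the operations unchanged.\<close>

definition fs :: "('a, 'r) ring_scheme \<Rightarrow> 'i set \<Rightarrow> ('a, 'i \<Rightarrow> 'a) module"
  where "fs R A =
    \<lparr>carrier = {f. (\<forall>x. f x \<in> carrier R) \<and> finite {x. f x \<noteq> \<zero>\<^bsub>R\<^esub>} \<and> {x. f x \<noteq> \<zero>\<^bsub>R\<^esub>} \<subseteq> A},
     monoid.mult = undefined, one = undefined,
     zero = (\<lambda>x. \<zero>\<^bsub>R\<^esub>), add = (\<lambda>f g x. f x \<oplus>\<^bsub>R\<^esub> g x), smult = (\<lambda>r f x. r \<otimes>\<^bsub>R\<^esub> f x)\<rparr>"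

text \<open>Summing over the support of \<open>c\<close> makes the value independent of the index
  set in which \<open>c\<close> is considered.\<close>

definition lc :: "('a, 'r) ring_scheme \<Rightarrow> ('a, 'm, 'c) module_scheme \<Rightarrow> ('i \<Rightarrow> 'm) \<Rightarrow> ('i \<Rightarrow> 'a) \<Rightarrow> 'm"
  where "lc R M f c = finsum M (\<lambda>x. c x \<odot>\<^bsub>M\<^esub> f x) {x. c x \<noteq> \<zero>\<^bsub>R\<^esub>}"

definition single :: "('a, 'r) ring_scheme \<Rightarrow> 'i \<Rightarrow> 'a \<Rightarrow> 'i \<Rightarrow> 'a"
  where "single R i r = (\<lambda>j. if j = i then r else \<zero>\<^bsub>R\<^esub>)"

lemma semilinearD:
  assumes "semilinear R F M N h"
  shows "x \<in> carrier M \<Longrightarrow> h x \<in> carrier N"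
    and "x \<in> carrier M \<Longrightarrow> y \<in> carrier M \<Longrightarrow> h (x \<oplus>\<^bsub>M\<^esub> y) = h x \<oplus>\<^bsub>N\<^esub> h y"
    and "r \<in> carrier R \<Longrightarrow> x \<in> carrier M \<Longrightarrow> h (r \<odot>\<^bsub>M\<^esub> x) = F r \<odot>\<^bsub>N\<^esub> h x"
  using assms by (auto simp: semilinear_def)

lemma fs_simps:
  "\<zero>\<^bsub>fs R A\<^esub> = (\<lambda>x. \<zero>\<^bsub>R\<^esub>)" "f \<oplus>\<^bsub>fs R A\<^esub> g = (\<lambda>x. f x \<oplus>\<^bsub>R\<^esub> g x)" "r \<odot>\<^bsub>fs R A\<^esub> f = (\<lambda>x. r \<otimes>\<^bsub>R\<^esub> f x)"
  by (auto simp: fs_def)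

lemma fs_carrier:
  "f \<in> carrier (fs R A) \<longleftrightarrow> (\<forall>x. f x \<in> carrier R) \<and> finite {x. f x \<noteq> \<zero>\<^bsub>R\<^esub>} \<and> {x. f x \<noteq> \<zero>\<^bsub>R\<^esub>} \<subseteq> A"
  by (auto simp: fs_def)

lemma self_simps:
  "carrier (self_module R) = carrier R"
  "\<zero>\<^bsub>self_module R\<^esub> = \<zero>\<^bsub>R\<^esub>" "f \<oplus>\<^bsub>self_module R\<^esub> g = f \<oplus>\<^bsub>R\<^esub> g" "r \<odot>\<^bsub>self_module R\<^esub> f = r \<otimes>\<^bsub>R\<^esub> f"
  by (auto simp: self_module_def)

context cring
begin

lemma self_is_module: "module R (self_module R)"
proof (rule moduleI)
  show "abelian_group (self_module R)"
  proof (rule abelian_groupI)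
    fix x assume "x \<in> carrier (self_module R)"
    then show "\<exists>y\<in>carrier (self_module R). y \<oplus>\<^bsub>self_module R\<^esub> x = \<zero>\<^bsub>self_module R\<^esub>"
      by (auto simp: self_simps intro!: bexI[of _ "\<ominus> x"] l_neg)
  qed (auto simp: self_simps a_ac)
qed (auto simp: self_simps l_distr r_distr m_assoc is_cring)

lemma fs_add_supp:
  assumes "f \<in> carrier (fs R A)" "g \<in> carrier (fs R A)"
  shows "(\<lambda>x. f x \<oplus> g x) \<in> carrier (fs R A)"
proof -
  have "{x. f x \<oplus> g x \<noteq> \<zero>} \<subseteq> {x. f x \<noteq> \<zero>} \<union> {x. g x \<noteq> \<zero>}"
    using assms by (auto simp: fs_carrier)
  then show ?thesis using assms unfolding fs_carrier
    by (auto intro: finite_subset)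
qed

lemma fs_map:
  assumes "f \<in> carrier (fs R A)" "\<And>r. r \<in> carrier R \<Longrightarrow> h r \<in> carrier R" "h \<zero> = \<zero>"
  shows "(\<lambda>x. h (f x)) \<in> carrier (fs R A)"
proof -
  have "{x. h (f x) \<noteq> \<zero>} \<subseteq> {x. f x \<noteq> \<zero>}"
    using assms by (auto simp: fs_carrier)
  then show ?thesis using assms unfolding fs_carrier
    by (auto intro: finite_subset)
qed

lemma fs_is_module: "module R (fs R A)"
proof (rule moduleI)
  show "abelian_group (fs R A)"
  proof (rule abelian_groupI)
    fix x assume x: "x \<in> carrier (fs R A)"
    then have "(\<lambda>i. \<ominus> x i) \<in> carrier (fs R A)" using fs_map[of x A "\<lambda>r. \<ominus> r"] by simp
    moreover have "(\<lambda>i. \<ominus> x i) \<oplus>\<^bsub>fs R A\<^esub> x = \<zero>\<^bsub>fs R A\<^esub>" using x by (auto simp: fs_simps fs_carrier l_neg)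
    ultimately show "\<exists>y\<in>carrier (fs R A). y \<oplus>\<^bsub>fs R A\<^esub> x = \<zero>\<^bsub>fs R A\<^esub>" by blast
  qed (use fs_add_supp in \<open>auto simp: fs_simps fs_carrier a_ac\<close>)
  show "\<And>a x. \<lbrakk>a \<in> carrier R; x \<in> carrier (fs R A)\<rbrakk> \<Longrightarrow> a \<odot>\<^bsub>fs R A\<^esub> x \<in> carrier (fs R A)"
    unfolding fs_simps by (rule fs_map) auto
qed (auto simp: fs_simps fs_carrier l_distr r_distr m_assoc is_cring)

lemma single_fs: "i \<in> A \<Longrightarrow> r \<in> carrier R \<Longrightarrow> single R i r \<in> carrier (fs R A)"
  by (auto simp: fs_carrier single_def)

lemma fs_mono: "c \<in> carrier (fs R A) \<Longrightarrow> A \<subseteq> B \<Longrightarrow> c \<in> carrier (fs R B)"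
  by (auto simp: fs_carrier)

lemma fs_closed: "c \<in> carrier (fs R A) \<Longrightarrow> c x \<in> carrier R"
  by (auto simp: fs_carrier)

lemma fs_outside: "c \<in> carrier (fs R A) \<Longrightarrow> x \<notin> A \<Longrightarrow> c x = \<zero>"
  by (auto simp: fs_carrier)

end

context module
begin

lemma lc_eq_finsum:
  assumes c: "c \<in> carrier (fs R A)" and f: "\<And>x. x \<in> A \<Longrightarrow> f x \<in> carrier M"
    and B: "finite B" "{x. c x \<noteq> \<zero>} \<subseteq> B" "B \<subseteq> A"
  shows "lc R M f c = finsum M (\<lambda>x. c x \<bullet> f x) B"
  unfolding lc_def
  using f B R.fs_closed[OF c] by (intro M.add.finprod_mono_neutral_cong_left) auto

lemma lc_linear:
  assumes f: "\<And>x. x \<in> A \<Longrightarrow> f x \<in> carrier M"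
  shows "semilinear R (\<lambda>r. r) (fs R A) M (lc R M f)"
proof -
  have cl: "c x \<bullet> f x \<in> carrier M" if "c \<in> carrier (fs R A)" "x \<in> A" for c x
    using f[OF that(2)] R.fs_closed[OF that(1)] by auto
  have 1: "lc R M f c \<in> carrier M" if c: "c \<in> carrier (fs R A)" for c
    unfolding lc_def using cl[OF c] c by (intro M.finsum_closed) (auto simp: fs_carrier)
  have 2: "lc R M f (c \<oplus>\<^bsub>fs R A\<^esub> d) = lc R M f c \<oplus>\<^bsub>M\<^esub> lc R M f d"
    if c: "c \<in> carrier (fs R A)" and d: "d \<in> carrier (fs R A)" for c d
  proof -
    let ?B = "{x. c x \<noteq> \<zero>} \<union> {x. d x \<noteq> \<zero>}"
    have B: "finite ?B" "?B \<subseteq> A" using c d by (auto simp: fs_carrier)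
    have cd: "c \<oplus>\<^bsub>fs R A\<^esub> d \<in> carrier (fs R A)" using R.fs_add_supp[OF c d] by (simp add: fs_simps)
    have "lc R M f (c \<oplus>\<^bsub>fs R A\<^esub> d) = finsum M (\<lambda>x. (c \<oplus>\<^bsub>fs R A\<^esub> d) x \<bullet> f x) ?B"
      using c d by (intro lc_eq_finsum[OF cd f B(1) _ B(2)]) (auto simp: fs_simps)
    also have "\<dots> = finsum M (\<lambda>x. c x \<bullet> f x \<oplus>\<^bsub>M\<^esub> d x \<bullet> f x) ?B"
      using B f R.fs_closed[OF c] R.fs_closed[OF d]
      by (intro M.finsum_cong') (auto simp: fs_simps smult_l_distr)
    also have "\<dots> = finsum M (\<lambda>x. c x \<bullet> f x) ?B \<oplus>\<^bsub>M\<^esub> finsum M (\<lambda>x. d x \<bullet> f x) ?B"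
      using cl[OF c] cl[OF d] B by (intro M.finsum_addf) auto
    also have "\<dots> = lc R M f c \<oplus>\<^bsub>M\<^esub> lc R M f d"
      using lc_eq_finsum[OF c f B(1) _ B(2)] lc_eq_finsum[OF d f B(1) _ B(2)] by auto
    finally show ?thesis .
  qed
  have 3: "lc R M f (r \<odot>\<^bsub>fs R A\<^esub> c) = r \<bullet> lc R M f c"
    if c: "c \<in> carrier (fs R A)" and r: "r \<in> carrier R" for c r
  proof -
    let ?B = "{x. c x \<noteq> \<zero>}"
    have B: "finite ?B" "?B \<subseteq> A" using c by (auto simp: fs_carrier)
    have rc: "r \<odot>\<^bsub>fs R A\<^esub> c \<in> carrier (fs R A)" using module.smult_closed[OF R.fs_is_module r c] .
    have "lc R M f (r \<odot>\<^bsub>fs R A\<^esub> c) = finsum M (\<lambda>x. (r \<odot>\<^bsub>fs R A\<^esub> c) x \<bullet> f x) ?B"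
      using r c by (intro lc_eq_finsum[OF rc f B(1) _ B(2)]) (auto simp: fs_simps)
    also have "\<dots> = finsum M (\<lambda>x. r \<bullet> (c x \<bullet> f x)) ?B"
      using B f R.fs_closed[OF c] r
      by (intro M.finsum_cong') (auto simp: fs_simps smult_assoc1)
    also have "\<dots> = r \<bullet> lc R M f c"
      unfolding lc_def using cl[OF c] B r by (subst finsum_smult_ldistr) auto
    finally show ?thesis .
  qed
  show ?thesis unfolding semilinear_def using 1 2 3 by auto
qed

lemmas lc_closed = semilinearD(1)[OF lc_linear]
lemmas lc_add = semilinearD(2)[OF lc_linear]
lemmas lc_smult = semilinearD(3)[OF lc_linear]

lemma lc_single:
  assumes "r \<in> carrier R" "f i \<in> carrier M"
  shows "lc R M f (single R i r) = r \<bullet> f i"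
proof -
  have "lc R M f (single R i r) = finsum M (\<lambda>x. single R i r x \<bullet> f x) {i}"
    using assms by (intro lc_eq_finsum[of _ "{i}"] R.single_fs) (auto simp: single_def)
  then show ?thesis using assms by (simp add: single_def)
qed

lemma fs_induct [consumes 1, case_names zero step]:
  assumes c: "c \<in> carrier (fs R A)"
    and 0: "P (\<lambda>_. \<zero>)"
    and step: "\<And>i r c. i \<in> A \<Longrightarrow> r \<in> carrier R \<Longrightarrow> c \<in> carrier (fs R A) \<Longrightarrow> P c \<Longrightarrow>
      P (single R i r \<oplus>\<^bsub>fs R A\<^esub> c)"
  shows "P c"
proof -
  have "finite S \<Longrightarrow> c \<in> carrier (fs R A) \<Longrightarrow> {x. c x \<noteq> \<zero>} \<subseteq> S \<Longrightarrow> P c" for S c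
  proof (induction S arbitrary: c rule: finite_induct)
    case empty
    then have "c = (\<lambda>_. \<zero>)" by auto
    then show ?case using 0 by simp
  next
    case (insert i S)
    show ?case
    proof (cases "c i = \<zero>")
      case True then show ?thesis using insert by auto
    next
      case False
      let ?d = "\<lambda>x. if x = i then \<zero> else c x"
      have "{x. ?d x \<noteq> \<zero>} \<subseteq> {x. c x \<noteq> \<zero>}" by auto
      then have d: "?d \<in> carrier (fs R A)"
        using insert.prems unfolding fs_carrier by (auto intro: finite_subset)
      have "P ?d" using insert d by (intro insert.IH) auto
      then have "P (single R i (c i) \<oplus>\<^bsub>fs R A\<^esub> ?d)" using insert.prems d False
        by (intro step) (auto simp: fs_carrier)
      moreover have "single R i (c i) \<oplus>\<^bsub>fs R A\<^esub> ?d = c" using insert.prems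
        by (auto simp: fs_simps single_def fs_carrier)
      ultimately show ?thesis by simp
    qed
  qed
  from this[OF _ c order.refl] show ?thesis using c by (auto simp: fs_carrier)
qed

lemma lc_zero: "lc R M f (\<lambda>_. \<zero>) = \<zero>\<^bsub>M\<^esub>"
  by (simp add: lc_def)

end

lemma semilinear_zero:
  assumes "module R M" "module R N" "semilinear R F M N h"
  shows "h \<zero>\<^bsub>M\<^esub> = \<zero>\<^bsub>N\<^esub>"
proof -
  interpret M: module R M by fact
  interpret N: module R N by fact
  have "h (\<zero>\<^bsub>M\<^esub> \<oplus>\<^bsub>M\<^esub> \<zero>\<^bsub>M\<^esub>) = h \<zero>\<^bsub>M\<^esub> \<oplus>\<^bsub>N\<^esub> h \<zero>\<^bsub>M\<^esub>" by (intro semilinearD(2)[OF assms(3)]) auto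
  then show ?thesis using semilinearD(1)[OF assms(3), of "\<zero>\<^bsub>M\<^esub>"] by (auto simp: N.M.add.r_cancel_one')
qed

lemma semilinear_minus:
  assumes "module R M" "module R N" "semilinear R F M N h" "x \<in> carrier M"
  shows "h (\<ominus>\<^bsub>M\<^esub> x) = \<ominus>\<^bsub>N\<^esub> h x"
proof -
  interpret M: module R M by fact
  interpret N: module R N by fact
  have "h (\<ominus>\<^bsub>M\<^esub> x) \<oplus>\<^bsub>N\<^esub> h x = \<zero>\<^bsub>N\<^esub>"
    using semilinearD(2)[OF assms(3), of "\<ominus>\<^bsub>M\<^esub> x" x] assms by (simp add: M.M.l_neg semilinear_zero[OF assms(1-3)])
  then show ?thesis using semilinearD(1)[OF assms(3)] assms(4)
    by (simp add: N.M.minus_equality)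
qed

lemma semilinear_vimage:
  assumes "module R M" "module R N" "semilinear R F M N h" "submodule K R N" "F \<in> carrier R \<rightarrow> carrier R"
  shows "submodule {x \<in> carrier M. h x \<in> K} R M"
proof -
  interpret M: module R M by fact
  interpret N: module R N by fact
  note D = semilinearD[OF assms(3)]
  show ?thesis
    by (rule M.submoduleI2)
      (use assms D in \<open>auto simp: semilinear_zero[OF assms(1-3)] Pi_iff intro: N.submodule_zero N.submodule_add N.submodule_smult\<close>)
qed

lemma semilinear_kernel:
  assumes "module R M" "module R N" "semilinear R F M N h" "F \<in> carrier R \<rightarrow> carrier R"
  shows "submodule {x \<in> carrier M. h x = \<zero>\<^bsub>N\<^esub>} R M"
  using semilinear_vimage[OF assms(1-3) module.zero_submodule[OF assms(2)] assms(4)] by simp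

lemma semilinear_lspan:
  assumes "module R M" "module R N" "semilinear R F M N h" "submodule K R N" "F \<in> carrier R \<rightarrow> carrier R"
    and "X \<subseteq> carrier M" "h ` X \<subseteq> K" "x \<in> lspan R M X"
  shows "h x \<in> K"
proof -
  interpret M: module R M by fact
  have "lspan R M X \<subseteq> {x \<in> carrier M. h x \<in> K}"
    using assms by (intro M.lspan_minimal semilinear_vimage) auto
  then show ?thesis using assms by auto
qed

lemma semilinear_lc:
  assumes "module R M" "module R N" "semilinear R F M N h" "F \<in> ring_hom R R"
    and c: "c \<in> carrier (fs R A)" and f: "\<And>x. x \<in> A \<Longrightarrow> f x \<in> carrier M"
  shows "h (lc R M f c) = lc R N (\<lambda>x. h (f x)) (\<lambda>x. F (c x))"
proof -
  interpret M: module R M by fact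
  interpret N: module R N by fact
  note D = semilinearD[OF assms(3)]
  have F0: "F \<zero>\<^bsub>R\<^esub> = \<zero>\<^bsub>R\<^esub>" using ring_hom_zero[OF assms(4)] M.R.ring_axioms by blast
  have Fc: "r \<in> carrier R \<Longrightarrow> F r \<in> carrier R" for r using ring_hom_closed[OF assms(4)] .
  show ?thesis using c
  proof (induction rule: M.fs_induct)
    case zero
    show ?case using semilinear_zero[OF assms(1-3)] by (simp add: M.lc_zero N.lc_zero F0)
  next
    case (step i r c)
    have Fcc: "(\<lambda>x. F (c x)) \<in> carrier (fs R A)" using M.R.fs_map[OF step(3)] Fc F0 by blast
    have e: "(\<lambda>x. F ((single R i r \<oplus>\<^bsub>fs R A\<^esub> c) x)) = single R i (F r) \<oplus>\<^bsub>fs R A\<^esub> (\<lambda>x. F (c x))"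
      using step M.R.fs_closed[OF step(3)] ring_hom_add[OF assms(4)] F0
      by (auto simp: fs_simps single_def Fc)
    have "h (lc R M f (single R i r \<oplus>\<^bsub>fs R A\<^esub> c)) = h (r \<odot>\<^bsub>M\<^esub> f i \<oplus>\<^bsub>M\<^esub> lc R M f c)"
      using step f by (simp add: M.lc_add[OF f] M.R.single_fs M.lc_single)
    also have "\<dots> = F r \<odot>\<^bsub>N\<^esub> h (f i) \<oplus>\<^bsub>N\<^esub> h (lc R M f c)"
      using step f M.lc_closed[OF f step(3)] by (simp add: D)
    also have "\<dots> = lc R N (\<lambda>x. h (f x)) (single R i (F r) \<oplus>\<^bsub>fs R A\<^esub> (\<lambda>x. F (c x)))"
      using step f Fc D by (subst N.lc_add[where A=A]) (auto simp: M.R.single_fs N.lc_single Fcc)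
    finally show ?case by (simp add: e)
  qed
qed

lemma linear_lc:
  assumes "module R M" "module R N" "semilinear R (\<lambda>r. r) M N h"
    and c: "c \<in> carrier (fs R A)" and f: "\<And>x. x \<in> A \<Longrightarrow> f x \<in> carrier M"
  shows "h (lc R M f c) = lc R N (\<lambda>x. h (f x)) c"
  using semilinear_lc[OF assms(1-3) _ c f] by (simp add: ring_hom_def)

context cring
begin

lemma fs_proj: "semilinear R (\<lambda>r. r) (fs R A) (self_module R) (\<lambda>c. c x)"
  by (auto simp: semilinear_def fs_simps self_simps fs_carrier)

lemma lc_fs_apply:
  assumes "c \<in> carrier (fs R A)" "\<And>x. x \<in> A \<Longrightarrow> f x \<in> carrier (fs R B)"
  shows "lc R (fs R B) f c y = lc R (self_module R) (\<lambda>x. f x y) c"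
  by (rule linear_lc[OF fs_is_module self_is_module fs_proj assms])

lemma fs_eq_lc:
  assumes c: "c \<in> carrier (fs R A)"
  shows "lc R (fs R A) (\<lambda>i. single R i \<one>) c = c"
proof -
  interpret FS: module R "fs R A" by (rule fs_is_module)
  show ?thesis using c
  proof (induction rule: FS.fs_induct)
    case zero show ?case by (simp add: FS.lc_zero fs_simps)
  next
    case (step i r c)
    have "lc R (fs R A) (\<lambda>i. single R i \<one>) (single R i r \<oplus>\<^bsub>fs R A\<^esub> c)
       = r \<odot>\<^bsub>fs R A\<^esub> single R i \<one> \<oplus>\<^bsub>fs R A\<^esub> c"
      using step by (subst FS.lc_add[where A=A]) (auto simp: single_fs FS.lc_single)
    also have "r \<odot>\<^bsub>fs R A\<^esub> single R i \<one> = single R i r" using step by (auto simp: fs_simps single_def)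
    finally show ?case .
  qed
qed

end

context module
begin

lemma lc_in_submodule:
  assumes "c \<in> carrier (fs R A)" "submodule K R M" "\<And>x. x \<in> A \<Longrightarrow> f x \<in> K"
  shows "lc R M f c \<in> K"
  using assms(1)
proof (induction rule: fs_induct)
  case zero then show ?case using assms by (simp add: lc_zero submodule_zero)
next
  case (step i r c)
  then show ?case using assms submodule_carr[OF assms(2)]
    by (subst lc_add[where A=A]) (auto simp: R.single_fs lc_single intro!: submodule_add submodule_smult)
qed

lemma lspan_image_lc:
  assumes "x \<in> lspan R M (f ` A)" "\<And>x. x \<in> A \<Longrightarrow> f x \<in> carrier M"
  shows "\<exists>c\<in>carrier (fs R A). x = lc R M f c"
  using assms(1)
proof (induction rule: lspan.induct)
  case lspan_zero
  then show ?case by (intro bexI[of _ "\<lambda>_. \<zero>"]) (auto simp: lc_zero fs_carrier)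
next
  case (lspan_step r x y)
  then obtain c i where c: "c \<in> carrier (fs R A)" "y = lc R M f c" and i: "i \<in> A" "x = f i" by auto
  then have "r \<bullet> x \<oplus>\<^bsub>M\<^esub> y = lc R M f (single R i r \<oplus>\<^bsub>fs R A\<^esub> c)"
    using assms lspan_step by (subst lc_add[where A=A]) (auto simp: R.single_fs lc_single)
  moreover have "single R i r \<oplus>\<^bsub>fs R A\<^esub> c \<in> carrier (fs R A)"
    using R.fs_add_supp[OF R.single_fs[OF i(1) lspan_step(1)] c(1)] by (simp add: fs_simps(2))
  ultimately show ?case by blast
qed

text \<open>Numbering the elements that occur, with repetitions allowed, brings every combination to
  the index type \<open>nat\<close>, the one for which flatness is assumed later.\<close>

lemma lspan_lc:
  assumes "x \<in> lspan R M X" "X \<subseteq> carrier M"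
  obtains n :: nat and v c where "\<And>t. t < n \<Longrightarrow> c t \<in> X" "v \<in> carrier (fs R {..<n})" "x = lc R M c v"
proof -
  have "\<exists>n c. \<exists>v\<in>carrier (fs R {..<n::nat}). (\<forall>t<n. c t \<in> X) \<and> x = lc R M c v"
    using assms(1)
  proof (induction rule: lspan.induct)
    case lspan_zero
    then show ?case by (intro exI[of _ 0] bexI[of _ "\<lambda>_. \<zero>"]) (auto simp: lc_zero fs_carrier)
  next
    case (lspan_step r z y)
    then obtain n c v where v: "v \<in> carrier (fs R {..<n::nat})" "\<forall>t<n. c t \<in> X" "y = lc R M c v" by auto
    let ?c = "c(n := z)"
    let ?v = "single R n r \<oplus>\<^bsub>fs R {..<Suc n}\<^esub> v"
    have v': "v \<in> carrier (fs R {..<Suc n})" using R.fs_mono[OF v(1)] by auto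
    have cX: "\<forall>t<Suc n. ?c t \<in> X" using v lspan_step by (auto simp: less_Suc_eq)
    have cM: "\<And>t. t \<in> {..<Suc n} \<Longrightarrow> ?c t \<in> carrier M" using cX assms(2) by auto
    have "lc R M ?c v = lc R M c v"
      unfolding lc_def using v assms(2) by (intro M.add.finprod_cong') (auto simp: fs_carrier intro!: smult_closed)
    then have "r \<bullet> z \<oplus>\<^bsub>M\<^esub> y = lc R M ?c ?v"
      using lspan_step v v' cM[of n] by (subst lc_add[where A="{..<Suc n}"]) (use cM in \<open>auto simp: R.single_fs lc_single\<close>)
    moreover have "?v \<in> carrier (fs R {..<Suc n})"
      using v' lspan_step R.fs_add_supp[of "single R n r" "{..<Suc n}" v] R.single_fs[of n "{..<Suc n}" r] by (auto simp: fs_simps(2))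
    ultimately show ?case using cX by blast
  qed
  then show ?thesis using that by blast
qed

end

section \<open>Flatness of a ring endomorphism, locally at a prime\<close>

definition syz :: "('a, 'r) ring_scheme \<Rightarrow> 'i set \<Rightarrow> ('i \<Rightarrow> 'a) \<Rightarrow> ('i \<Rightarrow> 'a) set"
  where "syz R A b = {c \<in> carrier (fs R A). lc R (self_module R) b c = \<zero>\<^bsub>R\<^esub>}"

text \<open>For a submodule \<open>S\<close> this is the image in the free module on
  \<open>A\<close> of the base change of \<open>S\<close> along \<open>F\<close>.\<close>

definition frob_span :: "('a, 'r) ring_scheme \<Rightarrow> ('a \<Rightarrow> 'a) \<Rightarrow> 'i set \<Rightarrow> ('i \<Rightarrow> 'a) set \<Rightarrow> ('i \<Rightarrow> 'a) set"
  where "frob_span R F A S = lspan R (fs R A) ((\<lambda>c i. F (c i)) ` S)"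

text \<open>
  Flatness of \<open>F\<close> at \<open>P\<close>, tested on one family \<open>b\<close> by the equational criterion: up to denominators
  outside \<open>P\<close>, the relations among the \<open>F (b i)\<close> come from relations among the \<open>b i\<close>.
\<close>

definition flat_at ::
    "('a, 'r) ring_scheme \<Rightarrow> ('a \<Rightarrow> 'a) \<Rightarrow> 'a set \<Rightarrow> 'i set \<Rightarrow> ('i \<Rightarrow> 'a) \<Rightarrow> bool"
  where "flat_at R F P A b \<longleftrightarrow>
    syz R A (\<lambda>i. F (b i)) \<subseteq> sat R P (fs R A) (frob_span R F A (syz R A b))"

text \<open>Larger submodules count as smaller in this relation, so that induction along it is
  Noetherian induction. The union of a strictly increasing chain would be finitely generated, hence
  equal to one of its members.\<close>

lemma noetherian_module_wf:
  assumes "module R M" "noetherian_module R M"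
  shows "wf {(J', J). submodule J R M \<and> submodule J' R M \<and> J \<subset> J'}"
  unfolding wf_iff_no_infinite_down_chain
proof
  interpret module R M by fact
  assume "\<exists>f. \<forall>i. (f (Suc i), f i) \<in> {(J', J). submodule J R M \<and> submodule J' R M \<and> J \<subset> J'}"
  then obtain f :: "nat \<Rightarrow> 'c set" where f0: "\<forall>i. (f (Suc i), f i) \<in> {(J', J). submodule J R M \<and> submodule J' R M \<and> J \<subset> J'}"
    by blast
  then have f: "\<And>i. submodule (f i) R M" "\<And>i. f i \<subset> f (Suc i)" by auto
  have mono: "i \<le> j \<Longrightarrow> f i \<subseteq> f j" for i j using lift_Suc_mono_le[of f i j] f by blast
  let ?U = "\<Union>i. f i"
  have "submodule ?U R M"
  proof (rule submoduleI2)
    fix a b assume "a \<in> ?U" "b \<in> ?U"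
    then obtain i j where "a \<in> f i" "b \<in> f j" by auto
    then have "a \<in> f (max i j)" "b \<in> f (max i j)" using mono[of i "max i j"] mono[of j "max i j"] by auto
    then have "a \<oplus>\<^bsub>M\<^esub> b \<in> f (max i j)" using submodule_add[OF f(1)] by blast
    then show "a \<oplus>\<^bsub>M\<^esub> b \<in> ?U" by blast
  next
    show "?U \<subseteq> carrier M" using submoduleE(1)[OF f(1)] by blast
    show "\<zero>\<^bsub>M\<^esub> \<in> ?U" using submodule_zero[OF f(1)] by blast
    show "\<And>a x. a \<in> carrier R \<Longrightarrow> x \<in> ?U \<Longrightarrow> a \<odot>\<^bsub>M\<^esub> x \<in> ?U" using submodule_smult[OF f(1)] by blast
  qed
  then obtain G where G: "finite G" "G \<subseteq> ?U" "?U = lspan R M G"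
    using assms(2) by (auto simp: noetherian_module_def)
  have "\<exists>N. G \<subseteq> f N" using G(1,2)
  proof (induction G rule: finite_induct)
    case (insert x G)
    then obtain N i where "G \<subseteq> f N" "x \<in> f i" by auto
    then have "insert x G \<subseteq> f (max N i)" using mono[of N "max N i"] mono[of i "max N i"] by auto
    then show ?case by blast
  qed auto
  then obtain N where "G \<subseteq> f N" by blast
  then have "?U \<subseteq> f N" unfolding G(3) by (intro lspan_minimal f)
  then show False using f(2)[of N] by blast
qed

context module
begin

lemma lc_cong:
  assumes "c \<in> carrier (fs R A)" "\<And>x. x \<in> A \<Longrightarrow> f x = g x" "\<And>x. x \<in> A \<Longrightarrow> g x \<in> carrier M"
  shows "lc R M f c = lc R M g c"
  unfolding lc_def using assms by (intro M.add.finprod_cong') (auto simp: fs_carrier subset_iff)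

lemma lc_fun_add:
  assumes c: "c \<in> carrier (fs R A)" and f: "\<And>x. x \<in> A \<Longrightarrow> f x \<in> carrier M"
    and g: "\<And>x. x \<in> A \<Longrightarrow> g x \<in> carrier M" and r: "r \<in> carrier R"
  shows "lc R M (\<lambda>x. f x \<oplus>\<^bsub>M\<^esub> r \<bullet> g x) c = lc R M f c \<oplus>\<^bsub>M\<^esub> r \<bullet> lc R M g c"
proof -
  have fin: "finite {x. c x \<noteq> \<zero>}" and cR: "\<And>x. c x \<in> carrier R" and sub: "\<And>x. c x \<noteq> \<zero> \<Longrightarrow> x \<in> A"
    using c by (auto simp: fs_carrier)
  have sw: "c x \<bullet> (r \<bullet> g x) = r \<bullet> (c x \<bullet> g x)" if "x \<in> A" for x
    using cR[of x] r g[OF that] by (simp add: smult_assoc1[symmetric] R.m_comm)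
  have "lc R M (\<lambda>x. f x \<oplus>\<^bsub>M\<^esub> r \<bullet> g x) c
      = finsum M (\<lambda>x. c x \<bullet> f x \<oplus>\<^bsub>M\<^esub> r \<bullet> (c x \<bullet> g x)) {x. c x \<noteq> \<zero>}"
    unfolding lc_def using f g r cR sub by (intro M.finsum_cong') (auto simp: smult_r_distr sw)
  also have "\<dots> = lc R M f c \<oplus>\<^bsub>M\<^esub> finsum M (\<lambda>x. r \<bullet> (c x \<bullet> g x)) {x. c x \<noteq> \<zero>}"
    unfolding lc_def using f g r cR sub by (intro M.finsum_addf) auto
  also have "finsum M (\<lambda>x. r \<bullet> (c x \<bullet> g x)) {x. c x \<noteq> \<zero>} = r \<bullet> lc R M g c"
    unfolding lc_def using g r cR sub fin by (intro finsum_smult_ldistr[symmetric]) auto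
  finally show ?thesis .
qed

lemma submodule_inter:
  assumes "submodule H R M" "submodule K R M" shows "submodule (H \<inter> K) R M"
proof (rule submoduleI2)
  show "H \<inter> K \<subseteq> carrier M" using submoduleE(1)[OF assms(1)] by blast
  show "\<zero>\<^bsub>M\<^esub> \<in> H \<inter> K" using submodule_zero[OF assms(1)] submodule_zero[OF assms(2)] by blast
  show "\<And>a b. a \<in> H \<inter> K \<Longrightarrow> b \<in> H \<inter> K \<Longrightarrow> a \<oplus>\<^bsub>M\<^esub> b \<in> H \<inter> K"
    using submodule_add[OF assms(1)] submodule_add[OF assms(2)] by blast
  show "\<And>a x. a \<in> carrier R \<Longrightarrow> x \<in> H \<inter> K \<Longrightarrow> a \<bullet> x \<in> H \<inter> K"
    using submodule_smult[OF assms(1)] submodule_smult[OF assms(2)] by blast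
qed

lemma smult_linear: "r \<in> carrier R \<Longrightarrow> semilinear R (\<lambda>r. r) M M (\<lambda>x. r \<bullet> x)"
  by (auto simp: semilinear_def smult_r_distr smult_assoc1[symmetric] R.m_comm)

lemma fg_enumerate:
  assumes "noetherian_module R M" "submodule N R M"
  obtains K :: nat and D where "\<And>t. t < K \<Longrightarrow> D t \<in> N" "N = lspan R M (D ` {..<K})"
proof -
  obtain G where G: "finite G" "G \<subseteq> N" "N = lspan R M G" using assms by (auto simp: noetherian_module_def)
  then obtain K :: nat and D where "G = D ` {i. i < K}" using finite_imp_nat_seg_image_inj_on[of G] by blast
  then show ?thesis using that[of K D] G by (auto simp: lessThan_def)
qed

lemma common_denominator:
  assumes P: "primeideal P R" and "finite B" and K: "submodule K R M" and "\<And>i. i \<in> B \<Longrightarrow> y i \<in> sat R P M K"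
  shows "\<exists>s\<in>carrier R - P. \<forall>i\<in>B. s \<bullet> y i \<in> K"
  using assms(2,4)
proof (induction B rule: finite_induct)
  case empty then show ?case using prime_one[OF P] by auto
next
  case (insert i B)
  then obtain s where s: "s \<in> carrier R - P" "\<forall>i\<in>B. s \<bullet> y i \<in> K" by auto
  obtain t where t: "t \<in> carrier R - P" "t \<bullet> y i \<in> K" "y i \<in> carrier M"
    using insert.prems[of i] by (auto simp: sat_def)
  have "(s \<otimes> t) \<bullet> y j \<in> K" if "j \<in> insert i B" for j
  proof (cases "j = i")
    case True then show ?thesis using s t submodule_smult[OF K] by (simp add: smult_assoc1)
  next
    case False
    then have j: "j \<in> B" "y j \<in> carrier M" using that insert.prems[of j] by (auto simp: sat_def)
    then have "(s \<otimes> t) \<bullet> y j = t \<bullet> (s \<bullet> y j)" using s t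
      by (simp add: R.m_comm smult_assoc1[symmetric])
    then show ?thesis using s t j submodule_smult[OF K] by simp
  qed
  then show ?case using prime_mult[OF P s(1) t(1)] by blast
qed

end

lemma sat_linear:
  assumes "semilinear R (\<lambda>r. r) M N h" "\<And>x. x \<in> K \<Longrightarrow> h x \<in> K'" "x \<in> sat R P M K"
  shows "h x \<in> sat R P N K'"
  using assms(2,3) semilinearD[OF assms(1)] by (auto simp: sat_def) (metis DiffI)

context cring
begin

lemma noetherian_fs:
  assumes "noetherian_ring R" "finite A"
  shows "noetherian_module R (fs R A)"
proof -
  interpret V: module R "fs R A" by (rule fs_is_module)
  let ?G = "(\<lambda>i. single R i \<one>) ` A"
  have G: "?G \<subseteq> carrier (fs R A)" by (auto intro!: single_fs)
  have "carrier (fs R A) \<subseteq> lspan R (fs R A) ?G"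
  proof
    fix c assume c: "c \<in> carrier (fs R A)"
    have "lc R (fs R A) (\<lambda>i. single R i \<one>) c \<in> lspan R (fs R A) ?G"
      using V.lspan_incl[OF G] by (intro V.lc_in_submodule[OF c] V.lspan_submodule[OF G]) auto
    then show "c \<in> lspan R (fs R A) ?G" using fs_eq_lc[OF c] by simp
  qed
  then show ?thesis unfolding noetherian_module_def
    using V.noetherian_module_fg[OF assms(1) finite_imageI[OF assms(2)] G] V.submoduleE(1)
    by (meson order.trans)
qed

text \<open>Through this, ideals inherit the calculus of spans and saturations, and Nakayama's
  lemma.\<close>

lemma ideal_iff_submodule: "ideal I R \<longleftrightarrow> submodule I R (self_module R)"
proof -
  interpret V: module R "self_module R" by (rule self_is_module)
  show ?thesis
  proof
    assume I: "ideal I R"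
    note ad = ideal.axioms(1)[OF I]
    show "submodule I R (self_module R)"
    proof (rule V.submoduleI2)
      show "I \<subseteq> carrier (self_module R)" using additive_subgroup.a_subset[OF ad] by (simp add: self_simps)
      show "\<zero>\<^bsub>self_module R\<^esub> \<in> I" using additive_subgroup.zero_closed[OF ad] by (simp add: self_simps)
      show "\<And>a b. a \<in> I \<Longrightarrow> b \<in> I \<Longrightarrow> a \<oplus>\<^bsub>self_module R\<^esub> b \<in> I"
        using additive_subgroup.a_closed[OF ad] by (simp add: self_simps)
      show "\<And>a x. a \<in> carrier R \<Longrightarrow> x \<in> I \<Longrightarrow> a \<odot>\<^bsub>self_module R\<^esub> x \<in> I"
        using ideal.I_l_closed[OF I] by (simp add: self_simps)
    qed
  next
    assume S: "submodule I R (self_module R)"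
    have neg: "\<ominus> x \<in> I" if "x \<in> I" for x
    proof -
      have "x \<in> carrier R" using V.submodule_carr[OF S that] by (simp add: self_simps)
      then show ?thesis using V.submodule_smult[OF S _ that, of "\<ominus> \<one>"] by (simp add: self_simps l_minus)
    qed
    have sm: "r \<otimes> x \<in> I" "x \<otimes> r \<in> I" if "r \<in> carrier R" "x \<in> I" for r x
      using V.submodule_smult[OF S that] V.submodule_carr[OF S that(2)] m_comm[OF that(1)] that(1)
      by (simp_all add: self_simps)
    show "ideal I R"
    proof (rule idealI)
      show "subgroup I (add_monoid R)"
        using V.submodule_carr[OF S] V.submodule_zero[OF S] V.submodule_add[OF S] neg
        by (auto intro!: subgroup.intro simp: self_simps a_inv_def[symmetric])
    qed (use sm in \<open>auto simp: ring_axioms\<close>)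
  qed
qed

lemma Idl_eq_lspan:
  assumes "A \<subseteq> carrier R" shows "Idl A = lspan R (self_module R) A"
proof -
  interpret V: module R "self_module R" by (rule self_is_module)
  have A: "A \<subseteq> carrier (self_module R)" using assms by (simp add: self_simps)
  show ?thesis
  proof
    show "Idl A \<subseteq> lspan R (self_module R) A"
      using V.lspan_submodule[OF A] V.lspan_incl[OF A] by (intro genideal_minimal) (auto simp: ideal_iff_submodule)
    show "lspan R (self_module R) A \<subseteq> Idl A"
      using genideal_ideal[OF assms] genideal_self[OF assms] by (intro V.lspan_minimal) (auto simp: ideal_iff_submodule)
  qed
qed

lemma noetherian_self: "noetherian_ring R \<Longrightarrow> noetherian_module R (self_module R)"
  unfolding noetherian_module_def
proof (intro allI impI)
  fix N assume "noetherian_ring R" "submodule N R (self_module R)"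
  then obtain G where "G \<subseteq> carrier R" "finite G" "N = Idl G"
    using noetherian_ring.finetely_gen[of R N] ideal_iff_submodule[of N] by auto
  then show "\<exists>G. finite G \<and> G \<subseteq> N \<and> N = lspan R (self_module R) G"
    using Idl_eq_lspan[of G] genideal_self[of G] by (intro exI[of _ G]) auto
qed

end

section \<open>Ring endomorphisms acting on coefficients\<close>

locale cring_endo = cring R for R (structure) +
  fixes F
  assumes F: "F \<in> ring_hom R R"
begin

lemma F_closed [simp]: "r \<in> carrier R \<Longrightarrow> F r \<in> carrier R"
  using ring_hom_closed[OF F] .

lemma F_zero [simp]: "F \<zero> = \<zero>"
  using ring_hom_zero[OF F] ring_axioms by blast

lemma F_one [simp]: "F \<one> = \<one>"
  using ring_hom_one[OF F] .

lemma F_minus: "r \<in> carrier R \<Longrightarrow> F (\<ominus> r) = \<ominus> F r"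
proof -
  assume r: "r \<in> carrier R"
  have "F (\<ominus> r \<oplus> r) = F (\<ominus> r) \<oplus> F r" using r by (intro ring_hom_add[OF F]) auto
  then have "F (\<ominus> r) \<oplus> F r = \<zero>" using r by (simp add: l_neg)
  then show "F (\<ominus> r) = \<ominus> F r" using r by (simp add: minus_equality)
qed

lemma F_funcset: "F \<in> carrier R \<rightarrow> carrier R" by auto

lemma F_self: "semilinear R F (self_module R) (self_module R) F"
  using ring_hom_add[OF F] ring_hom_mult[OF F] by (auto simp: semilinear_def self_simps)

lemma F_fs: "semilinear R F (fs R A) (fs R A) (\<lambda>c i. F (c i))"
  unfolding semilinear_def
proof (intro conjI ballI)
  show "(\<lambda>c i. F (c i)) \<in> carrier (fs R A) \<rightarrow> carrier (fs R A)" using fs_map[of _ A F] by auto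
qed (auto simp: fs_simps fs_closed intro!: ext ring_hom_add[OF F] ring_hom_mult[OF F])

lemma F_lc_self:
  assumes "c \<in> carrier (fs R A)" "\<And>i. i \<in> A \<Longrightarrow> b i \<in> carrier R"
  shows "F (lc R (self_module R) b c) = lc R (self_module R) (\<lambda>i. F (b i)) (\<lambda>i. F (c i))"
  using assms by (intro semilinear_lc[OF self_is_module self_is_module F_self F]) (auto simp: self_simps)

lemma F_lc_fs:
  assumes "c \<in> carrier (fs R A)" "\<And>i. i \<in> A \<Longrightarrow> D i \<in> carrier (fs R B)"
  shows "(\<lambda>j. F (lc R (fs R B) D c j)) = lc R (fs R B) (\<lambda>i j. F (D i j)) (\<lambda>i. F (c i))"
  using semilinear_lc[OF fs_is_module fs_is_module F_fs F, of c A D B] assms by auto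

lemma ev_linear:
  assumes "\<And>i. i \<in> A \<Longrightarrow> b i \<in> carrier R"
  shows "semilinear R (\<lambda>r. r) (fs R A) (self_module R) (lc R (self_module R) b)"
  using assms by (intro module.lc_linear[OF self_is_module]) (auto simp: self_simps)

lemma syz_submodule:
  assumes "\<And>i. i \<in> A \<Longrightarrow> b i \<in> carrier R"
  shows "submodule (syz R A b) R (fs R A)"
  using semilinear_kernel[OF fs_is_module self_is_module ev_linear[of A b]] assms
  by (simp add: syz_def self_simps)

lemma ev_lc:
  assumes "c \<in> carrier (fs R A)" "\<And>i. i \<in> A \<Longrightarrow> D i \<in> carrier (fs R B)" "\<And>j. j \<in> B \<Longrightarrow> b j \<in> carrier R"
  shows "lc R (self_module R) b (lc R (fs R B) D c) = lc R (self_module R) (\<lambda>i. lc R (self_module R) b (D i)) c"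
  using assms by (intro linear_lc[OF fs_is_module self_is_module ev_linear]) auto

lemma F_image_fs: "S \<subseteq> carrier (fs R A) \<Longrightarrow> (\<lambda>c i. F (c i)) ` S \<subseteq> carrier (fs R A)"
  using semilinearD(1)[OF F_fs] by blast

lemma frob_span_submodule: "S \<subseteq> carrier (fs R A) \<Longrightarrow> submodule (frob_span R F A S) R (fs R A)"
  unfolding frob_span_def by (intro module.lspan_submodule[OF fs_is_module] F_image_fs)

text \<open>Base change along \<open>F\<close> is functorial. With the vectors \<open>D i\<close> as
  columns of a matrix, applying \<open>F\<close> to the entries gives a matrix that sends the image
  of \<open>e\<close> under \<open>F\<close> to the image of the vector that \<open>D\<close> makes
  of \<open>e\<close>.\<close>

lemma frob_span_map:
  assumes D: "\<And>i. i \<in> A \<Longrightarrow> D i \<in> carrier (fs R B)" and S: "S \<subseteq> carrier (fs R A)" "S' \<subseteq> carrier (fs R B)"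
    and SS: "\<And>e. e \<in> S \<Longrightarrow> lc R (fs R B) D e \<in> S'" and v: "v \<in> frob_span R F A S"
  shows "lc R (fs R B) (\<lambda>i j. F (D i j)) v \<in> frob_span R F B S'"
proof (rule semilinear_lspan[OF fs_is_module fs_is_module _ frob_span_submodule[OF S(2)] _ F_image_fs[OF S(1)]])
  show "semilinear R (\<lambda>r. r) (fs R A) (fs R B) (lc R (fs R B) (\<lambda>i j. F (D i j)))"
    using D semilinearD(1)[OF F_fs] by (intro module.lc_linear[OF fs_is_module]) auto
  show "v \<in> lspan R (fs R A) ((\<lambda>c i. F (c i)) ` S)" using v by (simp add: frob_span_def)
  show "lc R (fs R B) (\<lambda>i j. F (D i j)) ` (\<lambda>c i. F (c i)) ` S \<subseteq> frob_span R F B S'"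
  proof clarify
    fix e assume e: "e \<in> S"
    have "lc R (fs R B) (\<lambda>i j. F (D i j)) (\<lambda>i. F (e i)) = (\<lambda>j. F (lc R (fs R B) D e j))"
      using F_lc_fs[OF _ D, of e] e S by auto
    also have "\<dots> \<in> frob_span R F B S'"
      unfolding frob_span_def using SS[OF e] module.lspan_incl[OF fs_is_module F_image_fs[OF S(2)]] by blast
    finally show "lc R (fs R B) (\<lambda>i j. F (D i j)) (\<lambda>i. F (e i)) \<in> frob_span R F B S'" .
  qed
qed auto

text \<open>By semilinearity, the image of a combination of the \<open>D t\<close> is a combination
  of their images, so images of generators suffice.\<close>

lemma frob_span_lspan:
  assumes D: "\<And>t. t \<in> K \<Longrightarrow> D t \<in> carrier (fs R A)" and u: "u \<in> frob_span R F A (lspan R (fs R A) (D ` K))"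
  shows "\<exists>v\<in>carrier (fs R K). u = lc R (fs R A) (\<lambda>t i. F (D t i)) v"
proof -
  interpret V: module R "fs R A" by (rule fs_is_module)
  have DM: "D ` K \<subseteq> carrier (fs R A)" using D by auto
  have FD: "\<And>t. t \<in> K \<Longrightarrow> (\<lambda>i. F (D t i)) \<in> carrier (fs R A)" using D semilinearD(1)[OF F_fs] by blast
  let ?L = "lspan R (fs R A) ((\<lambda>t i. F (D t i)) ` K)"
  have LM: "(\<lambda>t i. F (D t i)) ` K \<subseteq> carrier (fs R A)" using FD by auto
  have sub: "(\<lambda>c i. F (c i)) ` lspan R (fs R A) (D ` K) \<subseteq> ?L"
    using V.lspan_incl[OF LM] semilinear_lspan[OF V.module_axioms V.module_axioms F_fs V.lspan_submodule[OF LM] F_funcset DM]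
    by blast
  have "u \<in> ?L"
    using u V.lspan_minimal[OF V.lspan_submodule[OF LM] sub] unfolding frob_span_def by auto
  then show ?thesis using V.lspan_image_lc[of u "\<lambda>t i. F (D t i)" K] FD by auto
qed

end

text \<open>The last two assumptions say that the preimage of \<open>P\<close> under
  \<open>F\<close> is \<open>P\<close>, so that \<open>F\<close> induces a local endomorphism of the
  local ring at \<open>P\<close>.\<close>

locale noeth_endo_prime = cring_endo R F for R (structure) and F +
  fixes P
  assumes noeth: "noetherian_ring R" and P: "primeideal P R"
    and F_in: "a \<in> P \<Longrightarrow> F a \<in> P"
    and F_notin: "s \<in> carrier R - P \<Longrightarrow> F s \<notin> P"
begin

lemma F_denominator: "s \<in> carrier R - P \<Longrightarrow> F s \<in> carrier R - P"
  using F_notin by auto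

text \<open>The condition depends only on the localization at \<open>P\<close> of the ideal
  generated by the family. Matrices \<open>H\<close> and \<open>G\<close> express the
  \<open>x i\<close> by the \<open>b i\<close> and, up to a denominator \<open>s\<close>, the
  \<open>b i\<close> by the \<open>x i\<close>. A relation among the \<open>F (b i)\<close> is moved
  by the image of \<open>G\<close> under \<open>F\<close> to the \<open>F (x i)\<close>, decomposed
  there, and moved back by the image of \<open>H\<close>.\<close>

lemma flat_at_change:
  assumes B: "finite B" and b: "\<And>i. i \<in> B \<Longrightarrow> b i \<in> carrier R" and x: "\<And>i. i \<in> A \<Longrightarrow> x i \<in> carrier R"
    and bx: "\<And>i. i \<in> B \<Longrightarrow> b i \<in> sat R P (self_module R) (lspan R (self_module R) (x ` A))"
    and xb: "\<And>i. i \<in> A \<Longrightarrow> x i \<in> lspan R (self_module R) (b ` B)"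
    and flat: "flat_at R F P A x"
  shows "flat_at R F P B b"
  unfolding flat_at_def
proof
  interpret S: module R "self_module R" by (rule self_is_module)
  interpret VA: module R "fs R A" by (rule fs_is_module)
  interpret VB: module R "fs R B" by (rule fs_is_module)
  let ?ev = "lc R (self_module R)"
  fix u assume u: "u \<in> syz R B (\<lambda>i. F (b i))"
  have uB: "u \<in> carrier (fs R B)" using u by (simp add: syz_def)
  have bS: "\<And>i. i \<in> B \<Longrightarrow> b i \<in> carrier (self_module R)" "\<And>i. i \<in> A \<Longrightarrow> x i \<in> carrier (self_module R)"
    using b x by (auto simp: self_simps)
  have "\<forall>i\<in>A. \<exists>h\<in>carrier (fs R B). x i = ?ev b h" using S.lspan_image_lc[OF xb bS(1)] by auto
  then obtain H where H: "\<And>i. i \<in> A \<Longrightarrow> H i \<in> carrier (fs R B)" "\<And>i. i \<in> A \<Longrightarrow> ?ev b (H i) = x i" by metis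
  have xA: "x ` A \<subseteq> carrier (self_module R)" using bS by auto
  obtain s where s: "s \<in> carrier R - P" "\<And>i. i \<in> B \<Longrightarrow> s \<otimes> b i \<in> lspan R (self_module R) (x ` A)"
    using S.common_denominator[where y=b, OF P B S.lspan_submodule[OF xA] bx] by (auto simp: self_simps)
  have "\<forall>i\<in>B. \<exists>g\<in>carrier (fs R A). s \<otimes> b i = ?ev x g" using S.lspan_image_lc[OF s(2) bS(2)] by auto
  then obtain G where G: "\<And>i. i \<in> B \<Longrightarrow> G i \<in> carrier (fs R A)" "\<And>i. i \<in> B \<Longrightarrow> ?ev x (G i) = s \<otimes> b i" by metis
  have FG: "\<And>i. i \<in> B \<Longrightarrow> (\<lambda>j. F (G i j)) \<in> carrier (fs R A)" using G(1) semilinearD(1)[OF F_fs] by blast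
  have FH: "\<And>i. i \<in> A \<Longrightarrow> (\<lambda>j. F (H i j)) \<in> carrier (fs R B)" using H(1) semilinearD(1)[OF F_fs] by blast
  define w where "w = lc R (fs R A) (\<lambda>i j. F (G i j)) u"
  have wA: "w \<in> carrier (fs R A)" unfolding w_def using FG uB by (rule VA.lc_closed)
  have "?ev (\<lambda>i. F (x i)) w = ?ev (\<lambda>i. ?ev (\<lambda>i. F (x i)) (\<lambda>j. F (G i j))) u"
    unfolding w_def using FG x by (intro ev_lc[OF uB]) auto
  also have "\<dots> = ?ev (\<lambda>i. F s \<otimes> F (b i)) u"
    unfolding lc_def
  proof (intro S.M.add.finprod_cong' refl)
    fix i assume "i \<in> {x. u x \<noteq> \<zero>}"
    then have i: "i \<in> B" using uB by (auto simp: fs_carrier)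
    have "lc R (self_module R) (\<lambda>i. F (x i)) (\<lambda>j. F (G i j)) = F (s \<otimes> b i)"
      using F_lc_self[where b=x, OF G(1)[OF i] x] G(2)[OF i] by simp
    then show "u i \<odot>\<^bsub>self_module R\<^esub> (\<Oplus>\<^bsub>self_module R\<^esub>xa\<in>{xa. F (G i xa) \<noteq> \<zero>}. F (G i xa) \<odot>\<^bsub>self_module R\<^esub> F (x xa))
      = u i \<odot>\<^bsub>self_module R\<^esub> (F s \<otimes> F (b i))"
      using ring_hom_mult[OF F, of s "b i"] s b[OF i] by (simp add: lc_def)
  qed (use uB s b in \<open>auto simp: fs_carrier self_simps\<close>)
  also have "\<dots> = ?ev (\<lambda>i. F (b i)) (F s \<odot>\<^bsub>fs R B\<^esub> u)"
  proof -
    have "?ev (\<lambda>i. F s \<odot>\<^bsub>self_module R\<^esub> F (b i)) u = F s \<odot>\<^bsub>self_module R\<^esub> ?ev (\<lambda>i. F (b i)) u"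
    proof (rule linear_lc[OF S.module_axioms S.module_axioms _ uB, symmetric])
      show "semilinear R (\<lambda>r. r) (self_module R) (self_module R) (\<lambda>x. F s \<odot>\<^bsub>self_module R\<^esub> x)"
        using s by (auto simp: semilinear_def self_simps r_distr m_lcomm)
    qed (use b in \<open>auto simp: self_simps\<close>)
    then show ?thesis using s b S.lc_smult[of B "\<lambda>i. F (b i)" "F s" u] uB by (simp add: self_simps)
  qed
  also have "\<dots> = F s \<otimes> ?ev (\<lambda>i. F (b i)) u"
    using s b S.lc_smult[of B "\<lambda>i. F (b i)" "F s" u] uB by (simp add: self_simps)
  also have "\<dots> = \<zero>" using u s by (simp add: syz_def)
  finally have "w \<in> syz R A (\<lambda>i. F (x i))" using wA by (simp add: syz_def)
  then have wsat: "w \<in> sat R P (fs R A) (frob_span R F A (syz R A x))" using flat by (auto simp: flat_at_def)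
  have syzb: "syz R B b \<subseteq> carrier (fs R B)" "syz R A x \<subseteq> carrier (fs R A)" by (auto simp: syz_def)
  let ?W = "frob_span R F B (syz R B b)"
  have Wsub: "submodule ?W R (fs R B)" by (rule frob_span_submodule[OF syzb(1)])
  have hw: "lc R (fs R B) (\<lambda>i j. F (H i j)) w \<in> sat R P (fs R B) ?W"
  proof (rule sat_linear[OF VB.lc_linear[OF FH] _ wsat])
    fix v assume v: "v \<in> frob_span R F A (syz R A x)"
    show "lc R (fs R B) (\<lambda>i j. F (H i j)) v \<in> ?W"
    proof (rule frob_span_map[OF H(1) syzb(2,1) _ v])
      fix e assume e: "e \<in> syz R A x"
      then have eA: "e \<in> carrier (fs R A)" by (simp add: syz_def)
      have "?ev b (lc R (fs R B) H e) = ?ev (\<lambda>i. ?ev b (H i)) e" using H b by (intro ev_lc[OF eA]) auto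
      also have "\<dots> = ?ev x e" unfolding lc_def[of R _ _ e]
        using H eA x by (intro S.M.add.finprod_cong') (auto simp: fs_carrier self_simps)
      also have "\<dots> = \<zero>" using e by (simp add: syz_def)
      finally show "lc R (fs R B) H e \<in> syz R B b" using VB.lc_closed[OF H(1) eA] by (simp add: syz_def)
    qed
  qed
  \<comment> \<open>The round trip through \<open>G\<close> and \<open>H\<close> differs from
    multiplication by \<open>s\<close> by these vectors. Both evaluate to
    \<open>s \<otimes> b i\<close>, so each \<open>k i\<close> is a relation among the
    \<open>b i\<close>.\<close>
  define k where "k i = single R i s \<ominus>\<^bsub>fs R B\<^esub> lc R (fs R B) H (G i)" for i
  have k1: "k i \<in> carrier (fs R B)" if "i \<in> B" for i
    unfolding k_def using that s VB.lc_closed[OF H(1) G(1)[OF that]] single_fs[OF that, of s] by simp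
  have evk: "k i \<in> syz R B b" if i: "i \<in> B" for i
  proof -
    have sp: "single R i s \<in> carrier (fs R B)" using single_fs[OF i] s by auto
    have lG: "lc R (fs R B) H (G i) \<in> carrier (fs R B)" using VB.lc_closed[OF H(1) G(1)[OF i]] .
    have "?ev b (lc R (fs R B) H (G i)) = ?ev (\<lambda>i. ?ev b (H i)) (G i)" using H b by (intro ev_lc[OF G(1)[OF i]]) auto
    also have "\<dots> = ?ev x (G i)" unfolding lc_def[of R _ _ "G i"]
      using H G(1)[OF i] x by (intro S.M.add.finprod_cong') (auto simp: fs_carrier self_simps)
    finally have e1: "?ev b (lc R (fs R B) H (G i)) = s \<otimes> b i" using G i by simp
    have e2: "?ev b (single R i s) = s \<otimes> b i" using S.lc_single[of s b i] b i s by (simp add: self_simps)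
    have "?ev b (k i) = ?ev b (single R i s) \<oplus> ?ev b (\<ominus>\<^bsub>fs R B\<^esub> lc R (fs R B) H (G i))"
      unfolding k_def a_minus_def using sp lG b
      by (subst semilinearD(2)[OF ev_linear[of B b]]) (auto simp: self_simps)
    also have "?ev b (\<ominus>\<^bsub>fs R B\<^esub> lc R (fs R B) H (G i)) = \<ominus>\<^bsub>self_module R\<^esub> (s \<otimes> b i)"
      using semilinear_minus[OF VB.module_axioms S.module_axioms ev_linear[of B b] lG] b e1 by simp
    also have "?ev b (single R i s) \<oplus> \<dots> = \<zero>"
      unfolding e2 using S.M.r_neg[of "s \<otimes> b i"] s b i by (simp add: self_simps)
    finally show ?thesis using k1[OF i] by (simp add: syz_def)
  qed
  have Fk: "(\<lambda>j. F (k i j)) \<in> ?W" if "i \<in> B" for i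
    unfolding frob_span_def using evk[OF that] VB.lspan_incl[OF F_image_fs[OF syzb(1)]] by blast
  have Fk1: "(\<lambda>j. F (k i j)) \<in> carrier (fs R B)" if "i \<in> B" for i
    using Fk[OF that] VB.submodule_carr[OF Wsub] by blast
  have kW: "lc R (fs R B) (\<lambda>i j. F (k i j)) u \<in> ?W"
    by (rule VB.lc_in_submodule[OF uB Wsub Fk])
  \<comment> \<open>Both summands are under control: the first is a combination of images of the
    relations \<open>k i\<close>, the second is the decomposition obtained for
    \<open>x\<close>.\<close>
  have "F s \<odot>\<^bsub>fs R B\<^esub> u = lc R (fs R B) (\<lambda>i j. F (k i j)) u \<oplus>\<^bsub>fs R B\<^esub> lc R (fs R B) (\<lambda>i j. F (H i j)) w"
  proof -
    have e1: "lc R (fs R B) (\<lambda>i j. F (H i j)) w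
       = lc R (fs R B) (\<lambda>i. lc R (fs R B) (\<lambda>i j. F (H i j)) (\<lambda>j. F (G i j))) u"
      unfolding w_def by (rule linear_lc[OF VA.module_axioms VB.module_axioms VB.lc_linear[OF FH] uB FG])
    have e2: "F s \<odot>\<^bsub>fs R B\<^esub> u = lc R (fs R B) (\<lambda>i. F s \<odot>\<^bsub>fs R B\<^esub> single R i \<one>) u"
    proof -
      have "F s \<odot>\<^bsub>fs R B\<^esub> u = F s \<odot>\<^bsub>fs R B\<^esub> lc R (fs R B) (\<lambda>i. single R i \<one>) u"
        using fs_eq_lc[OF uB] by simp
      also have "\<dots> = lc R (fs R B) (\<lambda>i. F s \<odot>\<^bsub>fs R B\<^esub> single R i \<one>) u"
      proof (rule linear_lc[OF VB.module_axioms VB.module_axioms _ uB])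
        show "semilinear R (\<lambda>r. r) (fs R B) (fs R B) ((\<odot>\<^bsub>fs R B\<^esub>) (F s))"
          using s by (auto simp: semilinear_def VB.smult_r_distr VB.smult_assoc1[symmetric] m_comm)
      qed (auto simp: single_fs)
      finally show ?thesis .
    qed
    have e3: "F s \<odot>\<^bsub>fs R B\<^esub> single R i \<one> = (\<lambda>j. F (k i j)) \<oplus>\<^bsub>fs R B\<^esub> lc R (fs R B) (\<lambda>i j. F (H i j)) (\<lambda>j. F (G i j))"
      if i: "i \<in> B" for i
    proof -
      have sp: "single R i s \<in> carrier (fs R B)" using single_fs[OF i] s by auto
      have lG: "lc R (fs R B) H (G i) \<in> carrier (fs R B)" using VB.lc_closed[OF H(1) G(1)[OF i]] .
      have "k i \<oplus>\<^bsub>fs R B\<^esub> lc R (fs R B) H (G i) = single R i s"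
        unfolding k_def a_minus_def using sp lG by (simp add: VB.M.a_assoc VB.M.l_neg)
      then have "(\<lambda>j. F (single R i s j)) = (\<lambda>j. F ((k i \<oplus>\<^bsub>fs R B\<^esub> lc R (fs R B) H (G i)) j))" by simp
      also have "\<dots> = (\<lambda>j. F (k i j)) \<oplus>\<^bsub>fs R B\<^esub> (\<lambda>j. F (lc R (fs R B) H (G i) j))"
        using semilinearD(2)[OF F_fs k1[OF i] lG] by simp
      also have "(\<lambda>j. F (lc R (fs R B) H (G i) j)) = lc R (fs R B) (\<lambda>i j. F (H i j)) (\<lambda>j. F (G i j))"
        by (rule F_lc_fs[OF G(1)[OF i] H(1)])
      also have "(\<lambda>j. F (single R i s j)) = F s \<odot>\<^bsub>fs R B\<^esub> single R i \<one>"
        using s by (auto simp: single_def fs_simps)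
      finally show ?thesis .
    qed
    have cl: "\<And>i. i \<in> B \<Longrightarrow> lc R (fs R B) (\<lambda>i j. F (H i j)) (\<lambda>j. F (G i j)) \<in> carrier (fs R B)"
      by (rule VB.lc_closed[OF FH FG])
    have uc: "\<And>i. u i \<in> carrier R" "finite {i. u i \<noteq> \<zero>}" "\<And>i. u i \<noteq> \<zero> \<Longrightarrow> i \<in> B"
      using uB by (auto simp: fs_carrier)
    have "(\<Oplus>\<^bsub>fs R B\<^esub>i\<in>{x. u x \<noteq> \<zero>}. u i \<odot>\<^bsub>fs R B\<^esub> (F s \<odot>\<^bsub>fs R B\<^esub> single R i \<one>))
      = (\<Oplus>\<^bsub>fs R B\<^esub>i\<in>{x. u x \<noteq> \<zero>}. u i \<odot>\<^bsub>fs R B\<^esub> (\<lambda>j. F (k i j)) \<oplus>\<^bsub>fs R B\<^esub>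
          u i \<odot>\<^bsub>fs R B\<^esub> lc R (fs R B) (\<lambda>i j. F (H i j)) (\<lambda>j. F (G i j)))"
      using uc Fk1 cl by (intro VB.M.finsum_cong') (auto simp: e3 VB.smult_r_distr)
    also have "\<dots> = lc R (fs R B) (\<lambda>i j. F (k i j)) u \<oplus>\<^bsub>fs R B\<^esub>
        lc R (fs R B) (\<lambda>i. lc R (fs R B) (\<lambda>i j. F (H i j)) (\<lambda>j. F (G i j))) u"
      unfolding lc_def[of R _ _ u] using uc Fk1 cl by (intro VB.M.finsum_addf) auto
    finally show ?thesis unfolding e1 e2 lc_def[of R _ "\<lambda>i. F s \<odot>\<^bsub>fs R B\<^esub> single R i \<one>" u] .
  qed
  then have "F s \<odot>\<^bsub>fs R B\<^esub> u \<in> sat R P (fs R B) ?W"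
    using VB.submodule_add[OF VB.sat_submodule[OF P Wsub]] kW hw VB.sat_incl[OF P VB.submoduleE(1)[OF Wsub]] by auto
  then show "u \<in> sat R P (fs R B) ?W" using VB.sat_cancel[OF P F_denominator[OF s(1)] uB] by blast
qed

lemma lspan_fs_indep_aux: "lspan R (fs R A) X \<subseteq> lspan R (fs R B) X"
proof
  fix x assume "x \<in> lspan R (fs R A) X"
  then show "x \<in> lspan R (fs R B) X"
  proof (induction rule: lspan.induct)
    case lspan_zero show ?case using lspan.lspan_zero[of "fs R B" R X] by (simp add: fs_simps)
  next
    case (lspan_step r x y)
    then show ?case using lspan.lspan_step[of r R x X y "fs R B"] by (simp add: fs_simps)
  qed
qed

lemma lspan_fs_indep: "lspan R (fs R A) X = lspan R (fs R B) X"
  using lspan_fs_indep_aux by blast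

text \<open>
  The \<open>c t\<close> generate the colon ideal \<open>(b) : a\<close>. If \<open>(b) : a\<close> is larger than \<open>(b)\<close>, the first conclusion reduces
  the flatness statement for \<open>(b)\<close> to those for \<open>(b) + (a)\<close> and \<open>(b) : a\<close>; if both ideals agree, the second
  one, an instance of Nakayama's lemma, needs only the one for \<open>(b) + (a)\<close>.
\<close>

lemma flat_at_step:
  fixes b :: "nat \<Rightarrow> 'a"
  assumes b: "\<And>i. i < n \<Longrightarrow> b i \<in> carrier R" and a: "a \<in> carrier R"
    and flat: "flat_at R F P {..<Suc n} (b(n := a))"
  obtains K :: nat and c where "\<And>t. t < K \<Longrightarrow> c t \<in> carrier R"
    "lspan R (self_module R) (c ` {..<K}) = {r \<in> carrier R. r \<otimes> a \<in> lspan R (self_module R) (b ` {..<n})}"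
    "flat_at R F P {..<K} c \<Longrightarrow> flat_at R F P {..<n} b"
    "a \<in> P \<Longrightarrow> (\<And>t. t < K \<Longrightarrow> c t \<in> lspan R (self_module R) (b ` {..<n})) \<Longrightarrow> flat_at R F P {..<n} b"
proof -
  interpret S: module R "self_module R" by (rule self_is_module)
  interpret V0: module R "fs R {..<n}" by (rule fs_is_module)
  interpret V1: module R "fs R {..<Suc n}" by (rule fs_is_module)
  let ?ev = "lc R (self_module R)"
  let ?b' = "b(n := a)"
  have b': "\<And>i. i \<in> {..<Suc n} \<Longrightarrow> ?b' i \<in> carrier R" using a b by (auto simp: less_Suc_eq)
  have evl: "semilinear R (\<lambda>r. r) (fs R {..<Suc n}) (self_module R) (?ev ?b')"
    by (rule ev_linear) (rule b')
  have bS: "b ` {..<n} \<subseteq> carrier (self_module R)" using b by (auto simp: self_simps)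
  have up: "c \<in> carrier (fs R {..<Suc n})" if "c \<in> carrier (fs R {..<n})" for c :: "nat \<Rightarrow> 'a"
    using fs_mono[OF that] by auto
  have down: "c \<in> carrier (fs R {..<n})" if "c \<in> carrier (fs R {..<Suc n})" "c n = \<zero>" for c :: "nat \<Rightarrow> 'a"
    using that by (auto simp: fs_carrier less_Suc_eq)
  have evb: "?ev ?b' c = ?ev b c" if "c \<in> carrier (fs R {..<n})" for c
    using b by (intro S.lc_cong[OF that]) (auto simp: self_simps)
  have evFb: "?ev (\<lambda>i. F (?b' i)) c = ?ev (\<lambda>i. F (b i)) c" if "c \<in> carrier (fs R {..<n})" for c
    using b by (intro S.lc_cong[OF that]) (auto simp: self_simps)
  let ?Z = "syz R {..<Suc n} ?b'"
  have Zsub: "submodule ?Z R (fs R {..<Suc n})" by (rule syz_submodule[OF b'])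
  obtain K :: nat and D where D: "\<And>t. t < K \<Longrightarrow> D t \<in> ?Z" "?Z = lspan R (fs R {..<Suc n}) (D ` {..<K})"
    using V1.fg_enumerate[OF noetherian_fs[OF noeth] Zsub] by auto
  have D1: "\<And>t. t \<in> {..<K} \<Longrightarrow> D t \<in> carrier (fs R {..<Suc n})" using D(1) by (auto simp: syz_def)
  have FD1: "\<And>t. t \<in> {..<K} \<Longrightarrow> (\<lambda>i. F (D t i)) \<in> carrier (fs R {..<Suc n})"
    using D1 semilinearD(1)[OF F_fs] by blast
  \<comment> \<open>A relation among \<open>b\<close> and \<open>a\<close> is a pair
    \<open>(d, c)\<close> in which \<open>c a\<close> is minus the value of \<open>d\<close>. Thus
    the last coordinates of all relations form the ideal \<open>(b) : a\<close>, and those of the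
    generators \<open>D t\<close> generate it.\<close>
  define c where "c t = D t n" for t
  have cR: "c t \<in> carrier R" if "t < K" for t unfolding c_def using fs_closed[OF D1[of t]] that by simp
  define d where "d t = (D t)(n := \<zero>)" for t
  have d0: "d t \<in> carrier (fs R {..<n})" if "t < K" for t
  proof (rule down)
    have "{x. ((D t)(n := \<zero>)) x \<noteq> \<zero>} \<subseteq> {x. D t x \<noteq> \<zero>}" by auto
    then show "d t \<in> carrier (fs R {..<Suc n})" unfolding d_def
      using D1[of t] that unfolding fs_carrier by (auto intro: finite_subset)
  qed (simp add: d_def)
  have evd: "?ev b (d t) = \<ominus> (c t \<otimes> a)" if t: "t < K" for t
  proof -
    have "D t = d t \<oplus>\<^bsub>fs R {..<Suc n}\<^esub> single R n (c t)"
      using D1[of t] t by (auto simp: fs_simps single_def d_def c_def fs_carrier)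
    then have "\<zero> = ?ev ?b' (d t) \<oplus> ?ev ?b' (single R n (c t))"
      using D(1)[OF t] semilinearD(2)[OF evl, of "d t" "single R n (c t)"]
        up[OF d0[OF t]] single_fs[of n "{..<Suc n}" "c t"] cR[OF t] by (simp add: syz_def self_simps)
    moreover have "?ev ?b' (single R n (c t)) = c t \<otimes> a"
      using S.lc_single[of "c t" ?b' n] cR[OF t] a by (simp add: self_simps)
    moreover have "?ev b (d t) \<in> carrier R" using semilinearD(1)[OF ev_linear[of "{..<n}" b]] b d0[OF t] by (auto simp: self_simps)
    ultimately show ?thesis using evb[OF d0[OF t]] cR[OF t] a by (simp add: minus_equality)
  qed
  have ev_in: "?ev b g \<in> lspan R (self_module R) (b ` {..<n})" if "g \<in> carrier (fs R {..<n})" for g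
    using S.lspan_incl[OF bS] by (intro S.lc_in_submodule[OF that S.lspan_submodule[OF bS]]) auto
  have ideal_eq: "lspan R (self_module R) (c ` {..<K}) = {r \<in> carrier R. r \<otimes> a \<in> lspan R (self_module R) (b ` {..<n})}"
    (is "?C = ?Q")
  proof
    have lin: "semilinear R (\<lambda>r. r) (self_module R) (self_module R) (\<lambda>r. r \<otimes> a)"
      using a by (auto simp: semilinear_def self_simps l_distr m_assoc)
    have Q: "submodule ?Q R (self_module R)"
      using semilinear_vimage[OF S.module_axioms S.module_axioms lin S.lspan_submodule[OF bS]] by (simp add: self_simps)
    have "c t \<in> ?Q" if t: "t < K" for t
    proof -
      have "\<ominus>\<^bsub>self_module R\<^esub> ?ev b (d t) \<in> lspan R (self_module R) (b ` {..<n})"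
        using S.submodule_neg[OF S.lspan_submodule[OF bS] ev_in[OF d0[OF t]]] .
      moreover have "\<ominus>\<^bsub>self_module R\<^esub> ?ev b (d t) = c t \<otimes> a"
        using evd[OF t] cR[OF t] a S.M.minus_equality[of "c t \<otimes> a" "\<ominus> (c t \<otimes> a)"] by (simp add: self_simps r_neg)
      ultimately show ?thesis using cR[OF t] by simp
    qed
    then show "?C \<subseteq> ?Q" by (intro S.lspan_minimal[OF Q]) auto
    show "?Q \<subseteq> ?C"
    proof
      fix r assume "r \<in> ?Q"
      then have r: "r \<in> carrier R" "r \<otimes> a \<in> lspan R (self_module R) (b ` {..<n})" by auto
      obtain g where g: "g \<in> carrier (fs R {..<n})" "r \<otimes> a = ?ev b g"
        using S.lspan_image_lc[OF r(2)] bS by auto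
      define e where "e = single R n r \<ominus>\<^bsub>fs R {..<Suc n}\<^esub> g"
      have sn: "single R n r \<in> carrier (fs R {..<Suc n})" using single_fs[of n "{..<Suc n}" r] r by auto
      have "?ev ?b' (\<ominus>\<^bsub>fs R {..<Suc n}\<^esub> g) = \<ominus>\<^bsub>self_module R\<^esub> (r \<otimes> a)"
        using semilinear_minus[OF V1.module_axioms S.module_axioms evl, of g] up[OF g(1)] evb[OF g(1)] g(2) by simp
      moreover have "?ev ?b' (single R n r) = r \<otimes> a"
        using S.lc_single[of r ?b' n] r a by (simp add: self_simps)
      moreover have "?ev ?b' e = ?ev ?b' (single R n r) \<oplus>\<^bsub>self_module R\<^esub> ?ev ?b' (\<ominus>\<^bsub>fs R {..<Suc n}\<^esub> g)"
        unfolding e_def a_minus_def using sn up[OF g(1)]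
        by (intro semilinearD(2)[OF evl]) auto
      ultimately have "?ev ?b' e = \<zero>" using S.M.r_neg[of "r \<otimes> a"] r a by (simp add: self_simps)
      moreover have "e \<in> carrier (fs R {..<Suc n})" unfolding e_def using sn up[OF g(1)] by simp
      ultimately have eZ: "e \<in> lspan R (fs R {..<Suc n}) (D ` {..<K})" using D(2) by (auto simp: syz_def)
      have cS: "c ` {..<K} \<subseteq> carrier (self_module R)" using cR by (auto simp: self_simps)
      have "e n \<in> ?C"
        using S.lspan_incl[OF cS] D1
        by (intro semilinear_lspan[OF V1.module_axioms S.module_axioms fs_proj S.lspan_submodule[OF cS] _ _ _ eZ])
          (auto simp: c_def)
      moreover have "(\<ominus>\<^bsub>fs R {..<Suc n}\<^esub> g) n = \<zero>"
      proof -
        have "(\<ominus>\<^bsub>fs R {..<Suc n}\<^esub> g) n = \<ominus>\<^bsub>self_module R\<^esub> (g n)"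
          by (rule semilinear_minus[OF V1.module_axioms S.module_axioms fs_proj up[OF g(1)]])
        also have "g n = \<zero>\<^bsub>self_module R\<^esub>" using fs_outside[OF g(1)] by (simp add: self_simps)
        finally show ?thesis
          using S.M.minus_equality[of "\<zero>\<^bsub>self_module R\<^esub>" "\<zero>\<^bsub>self_module R\<^esub>"] by (simp add: self_simps)
      qed
      ultimately show "r \<in> ?C" using r by (simp add: e_def a_minus_def fs_simps single_def)
    qed
  qed
  \<comment> \<open>Padded with a zero, \<open>u\<close> is a relation among the
    \<open>F (b i)\<close> and \<open>F a\<close>. The given flatness writes it, up to a
    denominator, through the images of the \<open>D t\<close> with coefficients \<open>v\<close>;
    that the last coordinate is zero says that \<open>v\<close> is a relation among the
    \<open>F (c t)\<close>.\<close>
  have dec: "\<exists>s\<in>carrier R - P. \<exists>v\<in>carrier (fs R {..<K}).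
      s \<odot>\<^bsub>fs R {..<n}\<^esub> u = lc R (fs R {..<Suc n}) (\<lambda>t i. F (D t i)) v \<and> v \<in> syz R {..<K} (\<lambda>t. F (c t))"
    if u: "u \<in> syz R {..<n} (\<lambda>i. F (b i))" for u
  proof -
    have u0: "u \<in> carrier (fs R {..<n})" using u by (simp add: syz_def)
    have "u \<in> syz R {..<Suc n} (\<lambda>i. F (?b' i))" using u evFb[OF u0] up[OF u0] by (simp add: syz_def)
    then have "u \<in> sat R P (fs R {..<Suc n}) (frob_span R F {..<Suc n} ?Z)" using flat unfolding flat_at_def by blast
    then obtain s where s: "s \<in> carrier R - P" "s \<odot>\<^bsub>fs R {..<Suc n}\<^esub> u \<in> frob_span R F {..<Suc n} ?Z"
      by (auto simp: sat_def)
    then obtain v where v: "v \<in> carrier (fs R {..<K})" "s \<odot>\<^bsub>fs R {..<Suc n}\<^esub> u = lc R (fs R {..<Suc n}) (\<lambda>t i. F (D t i)) v"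
      using frob_span_lspan[of "{..<K}" D "{..<Suc n}" "s \<odot>\<^bsub>fs R {..<Suc n}\<^esub> u"] D1 D(2) by auto
    have "?ev (\<lambda>t. F (c t)) v = lc R (fs R {..<Suc n}) (\<lambda>t i. F (D t i)) v n"
      unfolding c_def by (rule lc_fs_apply[OF v(1) FD1, symmetric])
    also have "\<dots> = \<zero>" unfolding v(2)[symmetric] using fs_outside[OF u0, of n] s by (simp add: fs_simps)
    finally have "v \<in> syz R {..<K} (\<lambda>t. F (c t))" using v(1) by (simp add: syz_def)
    then show ?thesis using v s by (auto simp: fs_simps)
  qed
  let ?Y = "syz R {..<n} b"
  have Z0: "?Y \<subseteq> carrier (fs R {..<n})" "?Y \<subseteq> carrier (fs R {..<Suc n})" using up by (auto simp: syz_def)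
  have W0: "submodule (frob_span R F {..<n} ?Y) R (fs R {..<n})" by (rule frob_span_submodule[OF Z0(1)])
  \<comment> \<open>By flatness for \<open>c\<close> it is enough to treat images of relations
    \<open>e\<close> among the \<open>c t\<close>. The combination of the \<open>D t\<close> with
    coefficients \<open>e\<close> has last coordinate zero, so it is a relation among the
    \<open>b i\<close> alone.\<close>
  have concl1: "flat_at R F P {..<n} b" if fl: "flat_at R F P {..<K} c"
    unfolding flat_at_def
  proof
    fix u assume u: "u \<in> syz R {..<n} (\<lambda>i. F (b i))"
    have u0: "u \<in> carrier (fs R {..<n})" using u by (simp add: syz_def)
    obtain s v where s: "s \<in> carrier R - P" and v: "v \<in> carrier (fs R {..<K})"
      "s \<odot>\<^bsub>fs R {..<n}\<^esub> u = lc R (fs R {..<Suc n}) (\<lambda>t i. F (D t i)) v" "v \<in> syz R {..<K} (\<lambda>t. F (c t))"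
      using dec[OF u] by blast
    have vsat: "v \<in> sat R P (fs R {..<K}) (frob_span R F {..<K} (syz R {..<K} c))"
      using fl v(3) by (auto simp: flat_at_def)
    have "lc R (fs R {..<Suc n}) (\<lambda>t i. F (D t i)) v \<in> sat R P (fs R {..<Suc n}) (frob_span R F {..<Suc n} ?Y)"
    proof (rule sat_linear[OF V1.lc_linear[OF FD1] _ vsat])
      fix w assume w: "w \<in> frob_span R F {..<K} (syz R {..<K} c)"
      show "lc R (fs R {..<Suc n}) (\<lambda>t i. F (D t i)) w \<in> frob_span R F {..<Suc n} ?Y"
      proof (rule frob_span_map[OF D1 _ Z0(2) _ w])
        fix e assume e: "e \<in> syz R {..<K} c"
        then have eK: "e \<in> carrier (fs R {..<K})" by (simp add: syz_def)
        have l: "lc R (fs R {..<Suc n}) D e \<in> ?Z"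
          using D(1) by (intro V1.lc_in_submodule[OF eK Zsub]) auto
        have "lc R (fs R {..<Suc n}) D e n = ?ev c e"
          unfolding c_def by (rule lc_fs_apply[OF eK D1])
        then have "lc R (fs R {..<Suc n}) D e n = \<zero>" using e by (simp add: syz_def)
        then have "lc R (fs R {..<Suc n}) D e \<in> carrier (fs R {..<n})" using l by (intro down) (auto simp: syz_def)
        then show "lc R (fs R {..<Suc n}) D e \<in> ?Y" using l evb by (simp add: syz_def)
      qed (auto simp: syz_def)
    qed
    then have "s \<odot>\<^bsub>fs R {..<n}\<^esub> u \<in> sat R P (fs R {..<Suc n}) (frob_span R F {..<n} ?Y)"
      unfolding v(2)[symmetric] frob_span_def using lspan_fs_indep[of "{..<n}" _ "{..<Suc n}"] by simp
    then have "s \<odot>\<^bsub>fs R {..<n}\<^esub> u \<in> sat R P (fs R {..<n}) (frob_span R F {..<n} ?Y)"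
      using V0.smult_closed[of s u] u0 s unfolding sat_def by (simp add: fs_simps(3))
    then show "u \<in> sat R P (fs R {..<n}) (frob_span R F {..<n} ?Y)"
      by (rule V0.sat_cancel[OF P s u0])
  qed
  have concl2: "flat_at R F P {..<n} b" if aP: "a \<in> P"
    and cb: "\<And>t. t < K \<Longrightarrow> c t \<in> lspan R (self_module R) (b ` {..<n})"
  proof -
    have "\<forall>t\<in>{..<K}. \<exists>g\<in>carrier (fs R {..<n}). c t = ?ev b g" using S.lspan_image_lc[OF cb] bS by auto
    then obtain g where g: "\<And>t. t \<in> {..<K} \<Longrightarrow> g t \<in> carrier (fs R {..<n})" "\<And>t. t \<in> {..<K} \<Longrightarrow> ?ev b (g t) = c t" by metis
    have Fg: "\<And>t. t \<in> {..<K} \<Longrightarrow> (\<lambda>i. F (g t i)) \<in> carrier (fs R {..<n})" using g(1) semilinearD(1)[OF F_fs] by blast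
    have d0': "\<And>t. t \<in> {..<K} \<Longrightarrow> d t \<in> carrier (fs R {..<n})" using d0 by auto
    have Fd: "\<And>t. t \<in> {..<K} \<Longrightarrow> (\<lambda>i. F (d t i)) \<in> carrier (fs R {..<n})" using d0' semilinearD(1)[OF F_fs] by blast
    \<comment> \<open>Since \<open>c t\<close> is the value of \<open>g t\<close>, adding
      \<open>a\<close> times \<open>g t\<close> to \<open>d t\<close> gives a relation among the
      \<open>b i\<close>. Replacing the \<open>d t\<close> by the \<open>\<sigma> t\<close> costs a
      term with factor \<open>F a\<close>, which lies in \<open>P\<close>, times another relation
      \<open>u'\<close> among the \<open>F (b i)\<close>; Nakayama's lemma absorbs it.\<close>
    define \<sigma> where "\<sigma> t = d t \<oplus>\<^bsub>fs R {..<n}\<^esub> a \<odot>\<^bsub>fs R {..<n}\<^esub> g t" for t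
    have evl0: "semilinear R (\<lambda>r. r) (fs R {..<n}) (self_module R) (?ev b)"
      by (rule ev_linear) (use b in auto)
    have \<sigma>: "\<sigma> t \<in> ?Y" if t: "t < K" for t
    proof -
      have tK: "t \<in> {..<K}" using t by simp
      have "?ev b (\<sigma> t) = ?ev b (d t) \<oplus> a \<otimes> ?ev b (g t)"
        unfolding \<sigma>_def using semilinearD(2)[OF evl0, of "d t" "a \<odot>\<^bsub>fs R {..<n}\<^esub> g t"]
          semilinearD(3)[OF evl0, of a "g t"] a g(1)[OF tK] d0[OF t] by (simp add: self_simps)
      also have "\<dots> = \<zero>" using evd[OF t] g(2)[OF tK] a cR[OF t] by (simp add: m_comm l_neg)
      finally show ?thesis using d0[OF t] g(1)[OF tK] a by (simp add: syz_def \<sigma>_def)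
    qed
    have F\<sigma>: "(\<lambda>i. F (\<sigma> t i)) = (\<lambda>i. F (d t i)) \<oplus>\<^bsub>fs R {..<n}\<^esub> F a \<odot>\<^bsub>fs R {..<n}\<^esub> (\<lambda>i. F (g t i))" if t: "t \<in> {..<K}" for t
      unfolding \<sigma>_def using semilinearD(2)[OF F_fs, of "d t" "{..<n}" "a \<odot>\<^bsub>fs R {..<n}\<^esub> g t"]
        semilinearD(3)[OF F_fs, of a "g t" "{..<n}"] a g(1)[OF t] d0'[OF t] by simp
    let ?S = "syz R {..<n} (\<lambda>i. F (b i))"
    have Ssub: "submodule ?S R (fs R {..<n})" using b by (intro syz_submodule) auto
    obtain G where G: "finite G" "G \<subseteq> ?S" "?S = lspan R (fs R {..<n}) G"
      using noetherian_fs[OF noeth, of "{..<n}"] Ssub by (auto simp: noetherian_module_def)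
    have GM: "G \<subseteq> carrier (fs R {..<n})" using G(2) by (auto simp: syz_def)
    have PR: "P \<subseteq> carrier R" using ideal.Icarr[OF primeideal.axioms(1)[OF P]] by blast
    let ?PG = "{r \<odot>\<^bsub>fs R {..<n}\<^esub> h |r h. r \<in> P \<and> h \<in> G}"
    have PGM: "?PG \<subseteq> carrier (fs R {..<n})" using GM PR by auto
    have "G \<subseteq> sat R P (fs R {..<n}) (frob_span R F {..<n} ?Y)"
    proof (rule V0.nakayama[OF P W0 G(1) GM])
      fix u assume uG: "u \<in> G"
      then have u: "u \<in> ?S" using G by blast
      have u0: "u \<in> carrier (fs R {..<n})" using u by (simp add: syz_def)
      obtain s v where s: "s \<in> carrier R - P" and v: "v \<in> carrier (fs R {..<K})"
        "s \<odot>\<^bsub>fs R {..<n}\<^esub> u = lc R (fs R {..<Suc n}) (\<lambda>t i. F (D t i)) v" "v \<in> syz R {..<K} (\<lambda>t. F (c t))"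
        using dec[OF u] by blast
      define u' where "u' = lc R (fs R {..<n}) (\<lambda>t i. F (g t i)) v"
      have u'0: "u' \<in> carrier (fs R {..<n})" unfolding u'_def by (rule V0.lc_closed[OF Fg v(1)])
      have su: "s \<odot>\<^bsub>fs R {..<n}\<^esub> u = lc R (fs R {..<n}) (\<lambda>t i. F (d t i)) v" (is "?l = ?r")
      proof
        fix y
        have r0: "?r \<in> carrier (fs R {..<n})" by (rule V0.lc_closed[OF Fd v(1)])
        have l0: "?l \<in> carrier (fs R {..<n})" using u0 s by simp
        show "?l y = ?r y"
        proof (cases "y < n")
          case False
          then show ?thesis using fs_outside[OF r0, of y] fs_outside[OF l0, of y] by simp
        next
          case True
          have "?l y = ?ev (\<lambda>t. F (D t y)) v" unfolding v(2) by (rule lc_fs_apply[OF v(1) FD1])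
          also have "(\<lambda>t. F (D t y)) = (\<lambda>t. F (d t y))" using True by (auto simp: d_def)
          also have "?ev (\<lambda>t. F (d t y)) v = ?r y" by (rule lc_fs_apply[OF v(1) Fd, symmetric])
          finally show ?thesis .
        qed
      qed
      have sig: "lc R (fs R {..<n}) (\<lambda>t i. F (\<sigma> t i)) v = s \<odot>\<^bsub>fs R {..<n}\<^esub> u \<oplus>\<^bsub>fs R {..<n}\<^esub> F a \<odot>\<^bsub>fs R {..<n}\<^esub> u'"
      proof -
        have "lc R (fs R {..<n}) (\<lambda>t i. F (\<sigma> t i)) v
          = lc R (fs R {..<n}) (\<lambda>t. (\<lambda>i. F (d t i)) \<oplus>\<^bsub>fs R {..<n}\<^esub> F a \<odot>\<^bsub>fs R {..<n}\<^esub> (\<lambda>i. F (g t i))) v"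
          using F\<sigma> Fd Fg a by (intro V0.lc_cong[OF v(1)]) auto
        also have "\<dots> = lc R (fs R {..<n}) (\<lambda>t i. F (d t i)) v \<oplus>\<^bsub>fs R {..<n}\<^esub> F a \<odot>\<^bsub>fs R {..<n}\<^esub> u'"
          unfolding u'_def using a by (intro V0.lc_fun_add[OF v(1) Fd Fg]) auto
        finally show ?thesis unfolding su .
      qed
      have F\<sigma>W: "(\<lambda>i. F (\<sigma> t i)) \<in> frob_span R F {..<n} ?Y" if "t < K" for t
        unfolding frob_span_def using \<sigma>[OF that] V0.lspan_incl[OF F_image_fs[OF Z0(1)]] by blast
      have sigW: "lc R (fs R {..<n}) (\<lambda>t i. F (\<sigma> t i)) v \<in> frob_span R F {..<n} ?Y"
        using F\<sigma>W by (intro V0.lc_in_submodule[OF v(1) W0]) auto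
      have "?ev (\<lambda>i. F (b i)) u' = ?ev (\<lambda>t. ?ev (\<lambda>i. F (b i)) (\<lambda>i. F (g t i))) v"
        unfolding u'_def using b by (intro ev_lc[OF v(1) Fg]) auto
      also have "\<dots> = ?ev (\<lambda>t. F (c t)) v"
      proof (rule S.lc_cong[OF v(1)])
        fix t assume t: "t \<in> {..<K}"
        show "?ev (\<lambda>i. F (b i)) (\<lambda>i. F (g t i)) = F (c t)"
          using F_lc_self[where b=b, OF g(1)[OF t]] g(2)[OF t] b by simp
        show "F (c t) \<in> carrier (self_module R)" using cR t by (simp add: self_simps)
      qed
      also have "\<dots> = \<zero>" using v(3) by (simp add: syz_def)
      finally have u'S: "u' \<in> ?S" using u'0 by (simp add: syz_def)
      have "(\<ominus> F a) \<odot>\<^bsub>fs R {..<n}\<^esub> u' \<in> lspan R (fs R {..<n}) ?PG"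
      proof (rule semilinear_lspan[OF V0.module_axioms V0.module_axioms V0.smult_linear V0.lspan_submodule[OF PGM] _ GM])
        have "\<ominus> F a \<in> P" using F_in[OF aP] additive_subgroup.a_inv_closed[OF ideal.axioms(1)[OF primeideal.axioms(1)[OF P]]] by blast
        then show "(\<odot>\<^bsub>fs R {..<n}\<^esub>) (\<ominus> F a) ` G \<subseteq> lspan R (fs R {..<n}) ?PG"
          using V0.lspan_incl[OF PGM] by blast
        show "u' \<in> lspan R (fs R {..<n}) G" using u'S G by simp
      qed (use a in auto)
      moreover have "s \<odot>\<^bsub>fs R {..<n}\<^esub> u = lc R (fs R {..<n}) (\<lambda>t i. F (\<sigma> t i)) v \<oplus>\<^bsub>fs R {..<n}\<^esub> (\<ominus> F a) \<odot>\<^bsub>fs R {..<n}\<^esub> u'"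
        unfolding sig using s u0 u'0 a by (simp add: V0.smult_l_minus V0.M.a_assoc V0.M.r_neg)
      ultimately show "\<exists>s\<in>carrier R - P. \<exists>n'\<in>frob_span R F {..<n} ?Y. \<exists>w\<in>lspan R (fs R {..<n}) ?PG.
          s \<odot>\<^bsub>fs R {..<n}\<^esub> u = n' \<oplus>\<^bsub>fs R {..<n}\<^esub> w"
        using sigW s by blast
    qed
    then have "lspan R (fs R {..<n}) G \<subseteq> sat R P (fs R {..<n}) (frob_span R F {..<n} ?Y)"
      by (rule V0.lspan_minimal[OF V0.sat_submodule[OF P W0]])
    then show ?thesis using G(3) by (simp add: flat_at_def)
  qed
  show ?thesis using that[of K c] cR ideal_eq concl1 concl2 by blast
qed

text \<open>
  Noetherian induction on the ideal \<open>(b)\<close>; the ideal \<open>P\<close> itself is the only base case that matters,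
  and \<open>x\<close> generates it locally.
\<close>

lemma flat_at_all:
  assumes x: "\<And>i. i < d \<Longrightarrow> x i \<in> P"
    and Px: "P \<subseteq> sat R P (self_module R) (lspan R (self_module R) (x ` {..<d::nat}))"
    and fl: "flat_at R F P {..<d} x"
    and b: "\<And>i. i < n \<Longrightarrow> b i \<in> carrier R"
  shows "flat_at R F P {..<n::nat} b"
proof -
  interpret S: module R "self_module R" by (rule self_is_module)
  let ?sp = "lspan R (self_module R)"
  have PR: "P \<subseteq> carrier R" using ideal.Icarr[OF primeideal.axioms(1)[OF P]] by blast
  have subP: "submodule P R (self_module R)" using primeideal.axioms(1)[OF P] ideal_iff_submodule by blast
  have "\<forall>n b. (\<forall>i<n. b i \<in> carrier R) \<longrightarrow> ?sp (b ` {..<n::nat}) = J \<longrightarrow> flat_at R F P {..<n} b" for J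
  proof (induction J rule: wf_induct_rule[OF noetherian_module_wf[OF self_is_module noetherian_self[OF noeth]]])
    case (1 J)
    show ?case
    proof (intro allI impI)
      fix n :: nat and b assume b: "\<forall>i<n. b i \<in> carrier R" and J: "?sp (b ` {..<n}) = J"
      have bS: "b ` {..<n} \<subseteq> carrier (self_module R)" using b by (auto simp: self_simps)
      have subJ: "submodule J R (self_module R)" using S.lspan_submodule[OF bS] J by simp
      have bJ: "b i \<in> J" if "i < n" for i using S.lspan_incl[OF bS] J that by auto
      show "flat_at R F P {..<n} b"
      proof (cases "J \<subseteq> P")
        case False
        \<comment> \<open>Here the ideal becomes the unit ideal at \<open>P\<close>. It is generated
          there by \<open>s\<close> alone, and a relation on \<open>F s\<close> is killed by
          \<open>F s\<close>, which lies outside \<open>P\<close>.\<close>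
        then obtain s where s: "s \<in> J" "s \<notin> P" by blast
        have sR: "s \<in> carrier R" using S.submodule_carr[OF subJ s(1)] by (simp add: self_simps)
        have sS: "{s} \<subseteq> carrier (self_module R)" using sR by (simp add: self_simps)
        show ?thesis
        proof (rule flat_at_change[of "{..<n}" b "{0::nat}" "\<lambda>_. s"])
          fix i assume i: "i \<in> {..<n}"
          have "b i \<odot>\<^bsub>self_module R\<^esub> s \<in> ?sp {s}"
            using S.lspan_incl[OF sS] b i by (intro S.submodule_smult[OF S.lspan_submodule[OF sS]]) auto
          moreover have "b i \<odot>\<^bsub>self_module R\<^esub> s = s \<otimes> b i" using b i sR by (simp add: self_simps m_comm)
          ultimately show "b i \<in> sat R P (self_module R) (?sp ((\<lambda>_. s) ` {0::nat}))"
            using b i s sR by (auto simp: sat_def self_simps intro!: bexI[of _ s])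
        next
          show "flat_at R F P {0::nat} (\<lambda>_. s)"
            unfolding flat_at_def
          proof
            interpret V: module R "fs R {0::nat}" by (rule fs_is_module)
            fix u assume u: "u \<in> syz R {0::nat} (\<lambda>i. F s)"
            then have u0: "u \<in> carrier (fs R {0})" by (simp add: syz_def)
            have ueq: "u = single R 0 (u 0)" using fs_outside[OF u0] by (auto simp: single_def fun_eq_iff)
            have "lc R (self_module R) (\<lambda>i. F s) (single R (0::nat) (u 0)) = u 0 \<otimes> F s"
              using S.lc_single[of "u 0" "\<lambda>_. F s" "0::nat"] sR fs_closed[OF u0] by (simp add: self_simps)
            then have "u 0 \<otimes> F s = \<zero>" using u ueq by (simp add: syz_def)
            then have "F s \<odot>\<^bsub>fs R {0::nat}\<^esub> u = \<zero>\<^bsub>fs R {0}\<^esub>"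
              using u0 sR by (auto simp: fs_simps fs_carrier m_comm) (metis fs_closed fs_outside l_null m_comm F_closed r_null singletonD u0)
            then show "u \<in> sat R P (fs R {0}) (frob_span R F {0} (syz R {0} (\<lambda>_. s)))"
              using F_denominator[of s] s sR u0 V.submodule_zero[OF frob_span_submodule[of "syz R {0} (\<lambda>_. s)"]]
              by (auto simp: sat_def syz_def intro!: bexI[of _ "F s"])
          qed
        qed (use b s sR J in auto)
      next
        case sub: True
        show ?thesis
        proof (cases "J = P")
          case True
          show ?thesis
          proof (rule flat_at_change[of "{..<n}" b "{..<d}" x])
            show "\<And>i. i \<in> {..<n} \<Longrightarrow> b i \<in> sat R P (self_module R) (?sp (x ` {..<d}))"
              using Px bJ True by auto
          qed (use b x PR J True fl in auto)
        next
          case False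
          then obtain a where a: "a \<in> P" "a \<notin> J" using sub by blast
          have aR: "a \<in> carrier R" using a PR by auto
          let ?b' = "b(n := a)"
          have b'R: "\<forall>i<Suc n. ?b' i \<in> carrier R" using b aR by (auto simp: less_Suc_eq)
          have b'S: "?b' ` {..<Suc n} \<subseteq> carrier (self_module R)" using b'R by (auto simp: self_simps)
          have sub': "submodule (?sp (?b' ` {..<Suc n})) R (self_module R)" by (rule S.lspan_submodule[OF b'S])
          have "b ` {..<n} \<subseteq> ?b' ` {..<Suc n}" by force
          then have "J \<subseteq> ?sp (?b' ` {..<Suc n})" using S.lspan_mono[OF b'S] J by blast
          moreover have "a \<in> ?sp (?b' ` {..<Suc n})" using S.lspan_incl[OF b'S] by force
          ultimately have "(?sp (?b' ` {..<Suc n}), J) \<in> {(J', J). submodule J R (self_module R) \<and> submodule J' R (self_module R) \<and> J \<subset> J'}"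
            using sub' subJ a by auto
          from "1.IH"[OF this] have fl': "flat_at R F P {..<Suc n} ?b'" using b'R by blast
          obtain K :: nat and c where c: "\<And>t. t < K \<Longrightarrow> c t \<in> carrier R"
            "?sp (c ` {..<K}) = {r \<in> carrier R. r \<otimes> a \<in> ?sp (b ` {..<n})}"
            "flat_at R F P {..<K} c \<Longrightarrow> flat_at R F P {..<n} b"
            "a \<in> P \<Longrightarrow> (\<And>t. t < K \<Longrightarrow> c t \<in> ?sp (b ` {..<n})) \<Longrightarrow> flat_at R F P {..<n} b"
            using flat_at_step[OF _ aR fl'] b by (metis (no_types, lifting))
          have cS: "c ` {..<K} \<subseteq> carrier (self_module R)" using c(1) by (auto simp: self_simps)
          have JC: "J \<subseteq> ?sp (c ` {..<K})"
          proof
            fix r assume r: "r \<in> J"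
            have rR: "r \<in> carrier R" using S.submodule_carr[OF subJ r] by (simp add: self_simps)
            have "a \<odot>\<^bsub>self_module R\<^esub> r \<in> J" by (rule S.submodule_smult[OF subJ aR r])
            then show "r \<in> ?sp (c ` {..<K})" unfolding c(2) J using rR aR by (simp add: self_simps m_comm)
          qed
          show ?thesis
          proof (cases "?sp (c ` {..<K}) = J")
            case True
            then show ?thesis using c(4)[OF a(1)] S.lspan_incl[OF cS] J by auto
          next
            case False
            then have "(?sp (c ` {..<K}), J) \<in> {(J', J). submodule J R (self_module R) \<and> submodule J' R (self_module R) \<and> J \<subset> J'}"
              using JC S.lspan_submodule[OF cS] subJ by auto
            from "1.IH"[OF this] have "flat_at R F P {..<K} c" using c(1) by blast
            then show ?thesis by (rule c(3))
          qed
        qed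
      qed
    qed
  qed
  then show ?thesis using b by blast
qed

end

section \<open>From flatness at primes to flatness\<close>

locale flat_endo = cring_endo R F for R (structure) and F +
  assumes noeth: "noetherian_ring R"
    and flat: "\<And>P n b. primeideal P R \<Longrightarrow> (\<And>i. i < n \<Longrightarrow> b i \<in> carrier R) \<Longrightarrow> flat_at R F P {..<n::nat} b"
begin

text \<open>The elements \<open>r\<close> that multiply \<open>u\<close> into the span form an
  ideal. Flatness at a maximal ideal \<open>m\<close> gives such an element outside
  \<open>m\<close>, so the ideal lies in no maximal ideal and contains
  \<open>\<one>\<close>.\<close>

lemma syz_flat:
  assumes b: "\<And>i. i < n \<Longrightarrow> b i \<in> carrier R"
  shows "syz R {..<n::nat} (\<lambda>i. F (b i)) \<subseteq> frob_span R F {..<n} (syz R {..<n} b)"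
proof
  interpret S: module R "self_module R" by (rule self_is_module)
  interpret V: module R "fs R {..<n}" by (rule fs_is_module)
  let ?W = "frob_span R F {..<n} (syz R {..<n} b)"
  have W: "submodule ?W R (fs R {..<n})" by (rule frob_span_submodule) (auto simp: syz_def)
  fix u assume u: "u \<in> syz R {..<n} (\<lambda>i. F (b i))"
  then have u0: "u \<in> carrier (fs R {..<n})" by (simp add: syz_def)
  let ?I = "{r \<in> carrier R. r \<odot>\<^bsub>fs R {..<n}\<^esub> u \<in> ?W}"
  have "semilinear R (\<lambda>r. r) (self_module R) (fs R {..<n}) (\<lambda>r. r \<odot>\<^bsub>fs R {..<n}\<^esub> u)"
    using u0 by (auto simp: semilinear_def self_simps V.smult_l_distr V.smult_assoc1)
  from semilinear_vimage[OF S.module_axioms V.module_axioms this W]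
  have I: "ideal ?I R" by (simp add: ideal_iff_submodule self_simps)
  have "\<one> \<in> ?I"
  proof (rule ccontr)
    assume n1: "\<one> \<notin> ?I"
    let ?Q = "{J. ideal J R \<and> ?I \<subseteq> J \<and> \<one> \<notin> J}"
    obtain m where m: "m \<in> ?Q" and
      max: "\<And>J. (J, m) \<in> {(J', J). submodule J R (self_module R) \<and> submodule J' R (self_module R) \<and> J \<subset> J'} \<Longrightarrow> J \<notin> ?Q"
      using wfE_min[OF noetherian_module_wf[OF self_is_module noetherian_self[OF noeth]], of ?I ?Q] I n1 by blast
    have "maximalideal m R"
    proof (rule maximalidealI)
      show "ideal m R" using m by blast
      show "carrier R \<noteq> m" using m by auto
      fix J assume J: "ideal J R" "m \<subseteq> J" "J \<subseteq> carrier R"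
      show "J = m \<or> J = carrier R"
      proof (cases "\<one> \<in> J")
        case True then show ?thesis using ideal.one_imp_carrier[OF J(1)] by blast
      next
        case False
        then have "J \<in> ?Q" using m J by blast
        then show ?thesis using max[of J] J m by (auto simp: ideal_iff_submodule[symmetric])
      qed
    qed
    then have mp: "primeideal m R" by (rule maximalideal_prime)
    have "u \<in> sat R m (fs R {..<n}) ?W" using flat[where b=b, OF mp b] u by (auto simp: flat_at_def)
    then obtain s where "s \<in> carrier R" "s \<notin> m" "s \<in> ?I" by (auto simp: sat_def)
    then show False using m by blast
  qed
  then show "u \<in> ?W" using u0 by simp
qed

text \<open>Several equations are solved one after another. The solutions of the earlier ones are
  spanned by vectors \<open>D t\<close>; the next equation becomes a single relation among the
  values \<open>c t\<close> of these vectors, to which \<open>syz_flat\<close> applies. With no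
  equation the unit vectors suffice, being fixed by \<open>F\<close>.\<close>

lemma syz_flat_finite:
  assumes "finite Y" and fam: "\<And>t y. t < N \<Longrightarrow> fam t y \<in> carrier R"
    and w: "w \<in> carrier (fs R {..<N::nat})"
    and "\<And>y. y \<in> Y \<Longrightarrow> lc R (self_module R) (\<lambda>t. F (fam t y)) w = \<zero>"
  shows "w \<in> frob_span R F {..<N} {d \<in> carrier (fs R {..<N}). \<forall>y\<in>Y. lc R (self_module R) (\<lambda>t. fam t y) d = \<zero>}"
  using assms(1,4)
proof (induction Y rule: finite_induct)
  case empty
  interpret V: module R "fs R {..<N}" by (rule fs_is_module)
  have s1: "single R i \<one> \<in> carrier (fs R {..<N})" if "i \<in> {..<N}" for i using single_fs[OF that] by auto
  have "single R i \<one> \<in> frob_span R F {..<N} (carrier (fs R {..<N}))" if i: "i \<in> {..<N}" for i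
  proof -
    have "single R i \<one> = (\<lambda>j. F (single R i \<one> j))" by (auto simp: single_def)
    then have "single R i \<one> \<in> (\<lambda>c j. F (c j)) ` carrier (fs R {..<N})"
      using image_eqI[where f="\<lambda>c j. F (c j)" and x="single R i \<one>", OF _ s1[OF i]] by blast
    then show ?thesis unfolding frob_span_def by (rule subsetD[OF V.lspan_incl[OF F_image_fs[OF order.refl]]])
  qed
  then have "lc R (fs R {..<N}) (\<lambda>i. single R i \<one>) w \<in> frob_span R F {..<N} (carrier (fs R {..<N}))"
    by (intro V.lc_in_submodule[OF w frob_span_submodule]) auto
  then show ?case using fs_eq_lc[OF w] by simp
next
  case (insert z Y)
  interpret S: module R "self_module R" by (rule self_is_module)
  interpret V: module R "fs R {..<N}" by (rule fs_is_module)
  let ?ev = "\<lambda>y. lc R (self_module R) (\<lambda>t. fam t y)"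
  let ?S = "\<lambda>Y. {d \<in> carrier (fs R {..<N}). \<forall>y\<in>Y. ?ev y d = \<zero>}"
  have ev: "semilinear R (\<lambda>r. r) (fs R {..<N}) (self_module R) (?ev y)" for y
    using fam by (intro ev_linear) auto
  have "finite Y \<Longrightarrow> submodule (?S Y) R (fs R {..<N})" for Y
  proof (induction Y rule: finite_induct)
    case empty then show ?case using V.carrier_is_submodule by simp
  next
    case (insert y Y)
    have "submodule {x \<in> carrier (fs R {..<N}). ?ev y x = \<zero>} R (fs R {..<N})"
      using semilinear_kernel[OF V.module_axioms S.module_axioms ev] by (simp add: self_simps)
    with insert.IH have "submodule (?S Y \<inter> {x \<in> carrier (fs R {..<N}). ?ev y x = \<zero>}) R (fs R {..<N})"
      by (intro V.submodule_inter)
    moreover have "?S Y \<inter> {x \<in> carrier (fs R {..<N}). ?ev y x = \<zero>} = ?S (insert y Y)" by auto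
    ultimately show ?case by simp
  qed
  note Sg = this
  have Ssub: "submodule (?S Y) R (fs R {..<N})" "submodule (?S (insert z Y)) R (fs R {..<N})"
    by (rule Sg, simp add: insert.hyps)+
  obtain K :: nat and D where D: "\<And>t. t < K \<Longrightarrow> D t \<in> ?S Y" "?S Y = lspan R (fs R {..<N}) (D ` {..<K})"
    using V.fg_enumerate[OF noetherian_fs[OF noeth] Ssub(1)] by auto
  have D1: "\<And>t. t \<in> {..<K} \<Longrightarrow> D t \<in> carrier (fs R {..<N})" using D(1) by auto
  have FD1: "\<And>t. t \<in> {..<K} \<Longrightarrow> (\<lambda>i. F (D t i)) \<in> carrier (fs R {..<N})"
    using D1 semilinearD(1)[OF F_fs] by blast
  obtain v where v: "v \<in> carrier (fs R {..<K})" "w = lc R (fs R {..<N}) (\<lambda>t i. F (D t i)) v"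
    using frob_span_lspan[of "{..<K}" D "{..<N}" w] D1 insert.IH insert.prems D(2) by auto
  define c where "c t = ?ev z (D t)" for t
  have cR: "c t \<in> carrier R" if "t < K" for t
    unfolding c_def using semilinearD(1)[OF ev D1[of t]] that by (simp add: self_simps)
  have "lc R (self_module R) (\<lambda>t. F (c t)) v = lc R (self_module R) (\<lambda>t. lc R (self_module R) (\<lambda>t. F (fam t z)) (\<lambda>i. F (D t i))) v"
  proof (rule S.lc_cong[OF v(1)])
    fix t assume t: "t \<in> {..<K}"
    show e: "F (c t) = lc R (self_module R) (\<lambda>t. F (fam t z)) (\<lambda>i. F (D t i))"
      unfolding c_def using F_lc_self[where b="\<lambda>t. fam t z", OF D1[OF t]] fam by simp
    show "lc R (self_module R) (\<lambda>t. F (fam t z)) (\<lambda>i. F (D t i)) \<in> carrier (self_module R)"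
      unfolding e[symmetric] using cR t by (simp add: self_simps)
  qed
  also have "\<dots> = lc R (self_module R) (\<lambda>t. F (fam t z)) w"
    unfolding v(2) using fam by (intro ev_lc[OF v(1) FD1, symmetric]) auto
  also have "\<dots> = \<zero>" using insert.prems by simp
  finally have "v \<in> syz R {..<K} (\<lambda>t. F (c t))" using v(1) by (simp add: syz_def)
  then have vW: "v \<in> frob_span R F {..<K} (syz R {..<K} c)" using syz_flat[of K c] cR by blast
  show ?case unfolding v(2)
  proof (rule frob_span_map[OF D1 _ _ _ vW])
    fix e assume e: "e \<in> syz R {..<K} c"
    then have eK: "e \<in> carrier (fs R {..<K})" by (simp add: syz_def)
    have l: "lc R (fs R {..<N}) D e \<in> ?S Y"
      using D(1) by (intro V.lc_in_submodule[OF eK Ssub(1)]) auto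
    have "?ev z (lc R (fs R {..<N}) D e) = lc R (self_module R) c e"
      unfolding c_def using fam by (intro ev_lc[OF eK D1]) auto
    then show "lc R (fs R {..<N}) D e \<in> ?S (insert z Y)" using e l by (auto simp: syz_def)
  qed (auto simp: syz_def)
qed

end

section \<open>Krull's principal ideal theorem and regular systems of parameters\<close>

context module
begin

lemma lspan_union_submodules:
  assumes A: "submodule A R M" and B: "submodule B R M" and x: "x \<in> lspan R M (A \<union> B)"
  shows "\<exists>a\<in>A. \<exists>b\<in>B. x = a \<oplus>\<^bsub>M\<^esub> b"
  using x
proof (induction rule: lspan.induct)
  case lspan_zero
  then show ?case using submodule_zero[OF A] submodule_zero[OF B] by (metis M.l_zero M.zero_closed)
next
  case (lspan_step r x y)
  then obtain a b where ab: "a \<in> A" "b \<in> B" "y = a \<oplus>\<^bsub>M\<^esub> b" by auto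
  note c = submodule_carr[OF A ab(1)] submodule_carr[OF B ab(2)]
  from lspan_step(2) show ?case
  proof
    assume xA: "x \<in> A"
    have "r \<bullet> x \<oplus>\<^bsub>M\<^esub> y = (r \<bullet> x \<oplus>\<^bsub>M\<^esub> a) \<oplus>\<^bsub>M\<^esub> b"
      using c submodule_carr[OF A xA] lspan_step(1) ab by (simp add: M.a_assoc)
    moreover have "r \<bullet> x \<oplus>\<^bsub>M\<^esub> a \<in> A"
      using submodule_add[OF A submodule_smult[OF A lspan_step(1) xA] ab(1)] .
    ultimately show ?thesis using ab by blast
  next
    assume xB: "x \<in> B"
    have "r \<bullet> x \<oplus>\<^bsub>M\<^esub> y = a \<oplus>\<^bsub>M\<^esub> (r \<bullet> x \<oplus>\<^bsub>M\<^esub> b)"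
      using c submodule_carr[OF B xB] lspan_step(1) ab by (simp add: M.a_lcomm)
    moreover have "r \<bullet> x \<oplus>\<^bsub>M\<^esub> b \<in> B"
      using submodule_add[OF B submodule_smult[OF B lspan_step(1) xB] ab(2)] .
    ultimately show ?thesis using ab by blast
  qed
qed

end

section \<open>Ideals as submodules of the ring\<close>

context cring
begin

abbreviation Sm where "Sm \<equiv> self_module R"

lemma sm_carr: "submodule I R Sm \<Longrightarrow> x \<in> I \<Longrightarrow> x \<in> carrier R"
  using module.submodule_carr[OF self_is_module] by (simp add: self_simps)

lemma sm_zero: "submodule I R Sm \<Longrightarrow> \<zero> \<in> I"
  using module.submodule_zero[OF self_is_module] by (simp add: self_simps)

lemma sm_add: "submodule I R Sm \<Longrightarrow> x \<in> I \<Longrightarrow> y \<in> I \<Longrightarrow> x \<oplus> y \<in> I"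
  using module.submodule_add[OF self_is_module] by (simp add: self_simps)

lemma sm_mult: "submodule I R Sm \<Longrightarrow> r \<in> carrier R \<Longrightarrow> y \<in> I \<Longrightarrow> r \<otimes> y \<in> I"
  using module.submodule_smult[OF self_is_module] by (simp add: self_simps)

lemma sm_mult2: "submodule I R Sm \<Longrightarrow> r \<in> carrier R \<Longrightarrow> y \<in> I \<Longrightarrow> y \<otimes> r \<in> I"
  using sm_mult sm_carr m_comm by metis

lemma sm_neg: "submodule I R Sm \<Longrightarrow> y \<in> I \<Longrightarrow> \<ominus> y \<in> I"
  using sm_mult[of I "\<ominus> \<one>" y] sm_carr by (simp add: l_minus)

lemma sm_diff: "submodule I R Sm \<Longrightarrow> x \<in> I \<Longrightarrow> y \<in> I \<Longrightarrow> x \<ominus> y \<in> I"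
  unfolding a_minus_def by (intro sm_add sm_neg)

lemma sm_add_cancel:
  assumes "submodule I R Sm" "x \<oplus> y \<in> I" "y \<in> I" "x \<in> carrier R" shows "x \<in> I"
proof -
  have "x = (x \<oplus> y) \<ominus> y" using sm_carr[OF assms(1,3)] assms(4) by (simp add: a_minus_def a_assoc r_neg)
  then show ?thesis using sm_diff[OF assms(1-3)] by simp
qed

lemma sm_one: "submodule I R Sm \<Longrightarrow> \<one> \<in> I \<Longrightarrow> I = carrier R"
  using ideal_iff_submodule ideal.one_imp_carrier by blast

lemma sm_prime: "primeideal P R \<Longrightarrow> submodule P R Sm"
  using primeideal.axioms(1) ideal_iff_submodule by blast

lemma sm_lspan: "X \<subseteq> carrier R \<Longrightarrow> submodule (lspan R Sm X) R Sm"
  using module.lspan_submodule[OF self_is_module, of X] by (simp add: self_simps)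

lemma sm_lspan_incl: "X \<subseteq> carrier R \<Longrightarrow> X \<subseteq> lspan R Sm X"
  using module.lspan_incl[OF self_is_module, of X] by (simp add: self_simps)

lemma sm_lspan_insert:
  assumes "submodule I R Sm" "g \<in> carrier R" "x \<in> lspan R Sm (insert g I)"
  obtains r y where "r \<in> carrier R" "y \<in> I" "x = r \<otimes> g \<oplus> y"
proof -
  interpret S: module R Sm by (rule self_is_module)
  show ?thesis
    using S.lspan_insert[OF S.submoduleE(1)[OF assms(1)] _ assms(3)] assms(2) that
    unfolding S.lspan_of_submodule[OF assms(1)] by (metis self_simps(1,3,4))
qed

lemma sat_self: "x \<in> sat R P Sm X \<longleftrightarrow> x \<in> carrier R \<and> (\<exists>s\<in>carrier R - P. s \<otimes> x \<in> X)"
  by (auto simp: sat_def self_simps)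

lemma sm_sat: "primeideal P R \<Longrightarrow> submodule I R Sm \<Longrightarrow> submodule (sat R P Sm I) R Sm"
  by (rule module.sat_submodule[OF self_is_module])

lemma sm_sat_incl: "primeideal P R \<Longrightarrow> I \<subseteq> carrier R \<Longrightarrow> I \<subseteq> sat R P Sm I"
  using module.sat_incl[OF self_is_module, of P I] by (simp add: self_simps)

lemma sm_subset: "submodule I R Sm \<Longrightarrow> I \<subseteq> carrier R"
  using sm_carr by blast

lemma sm_sat_cancel:
  assumes "primeideal P R" "s \<in> carrier R - P" "x \<in> carrier R" "s \<otimes> x \<in> sat R P Sm N"
  shows "x \<in> sat R P Sm N"
  using module.sat_cancel[OF self_is_module, of P s x N] assms by (simp add: self_simps)

lemma sat_prime:
  assumes Q: "primeideal Q R" and "Q \<subseteq> P" shows "sat R P Sm Q \<subseteq> Q"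
proof
  fix x assume "x \<in> sat R P Sm Q"
  then obtain s where "x \<in> carrier R" "s \<in> carrier R" "s \<notin> P" "s \<otimes> x \<in> Q" by (auto simp: sat_self)
  then show "x \<in> Q" using primeideal.I_prime[OF Q, of s x] assms(2) by blast
qed

lemma prime_pow:
  assumes P: "primeideal P R" and "x \<in> carrier R" "x [^] (n::nat) \<in> P" shows "x \<in> P"
  using assms(3)
proof (induction n)
  case 0 then show ?case using sm_one[OF sm_prime[OF P]] assms(2) by simp
next
  case (Suc n) then show ?case using primeideal.I_prime[OF P, of "x [^] n" x] assms(2) by auto
qed

text \<open>The form used in arguments about ideals: locally, \<open>C\<close> is contained in
  \<open>N\<close> plus \<open>x C\<close> with \<open>x \<in> P\<close>. The Noetherian hypothesis
  provides the finite generating set that \<open>nakayama\<close> asks for.\<close>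

lemma nakayama_ideal:
  assumes noeth: "noetherian_ring R" and P: "primeideal P R" and C: "submodule C R Sm" and N: "submodule N R Sm"
    and x: "x \<in> P"
    and *: "\<And>a. a \<in> C \<Longrightarrow> \<exists>s\<in>carrier R - P. \<exists>b\<in>N. \<exists>r\<in>C. s \<otimes> a = b \<oplus> x \<otimes> r"
  shows "C \<subseteq> sat R P Sm N"
proof -
  interpret S: module R Sm by (rule self_is_module)
  have xR: "x \<in> carrier R" using sm_carr[OF sm_prime[OF P] x] .
  obtain G where G: "finite G" "G \<subseteq> C" "C = lspan R Sm G"
    using noetherian_self[OF noeth] C by (auto simp: noetherian_module_def)
  have GM: "G \<subseteq> carrier Sm" using G(2) S.submoduleE(1)[OF C] by blast
  let ?PG = "{r \<odot>\<^bsub>Sm\<^esub> h |r h. r \<in> P \<and> h \<in> G}"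
  have PG: "?PG \<subseteq> carrier Sm" using GM sm_subset[OF sm_prime[OF P]] by auto
  have "G \<subseteq> sat R P Sm N"
  proof (rule S.nakayama[OF P N G(1) GM])
    fix g assume "g \<in> G"
    then obtain s b r where s: "s \<in> carrier R - P" "b \<in> N" "r \<in> C" "s \<otimes> g = b \<oplus> x \<otimes> r"
      using *[of g] G(2) by blast
    have "x \<odot>\<^bsub>Sm\<^esub> r \<in> lspan R Sm ?PG"
      using x S.lspan_incl[OF PG] s(3) G(3)
      by (intro semilinear_lspan[OF S.module_axioms S.module_axioms S.smult_linear[OF xR] S.lspan_submodule[OF PG] _ GM]) auto
    then show "\<exists>s\<in>carrier R - P. \<exists>n\<in>N. \<exists>w\<in>lspan R Sm ?PG. s \<odot>\<^bsub>Sm\<^esub> g = n \<oplus>\<^bsub>Sm\<^esub> w"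
      using s by (auto simp: self_simps)
  qed
  then show ?thesis unfolding G(3) by (rule S.lspan_minimal[OF S.sat_submodule[OF P N]])
qed

text \<open>
  The localization at \<open>P\<close> of \<open>R\<close> modulo \<open>I\<close> has a single prime ideal, so that it is Artinian.
\<close>

lemma sat_dcc:
  assumes noeth: "noetherian_ring R" and P: "primeideal P R"
    and "submodule I R Sm" "sat R P Sm I \<subseteq> I"
    and "\<And>Q. primeideal Q R \<Longrightarrow> I \<subseteq> Q \<Longrightarrow> Q \<subseteq> P \<Longrightarrow> Q = P"
    and "\<And>n::nat. submodule (D n) R Sm" "\<And>n. sat R P Sm (D n) \<subseteq> D n" "\<And>n. I \<subseteq> D n" "\<And>n. D (Suc n) \<subseteq> D n"
  shows "\<exists>N. \<forall>n\<ge>N. D n = D N"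
  using assms(3-)
proof (induction I arbitrary: D rule: wf_induct_rule[OF noetherian_module_wf[OF self_is_module noetherian_self[OF noeth]]])
  case (1 I)
  note I = "1.prems"(1) and satI = "1.prems"(2) and primes = "1.prems"(3)
    and D = "1.prems"(4) and satD = "1.prems"(5) and ID = "1.prems"(6) and dec = "1.prems"(7)
  interpret S: module R Sm by (rule self_is_module)
  have anti: "D m \<subseteq> D n" if "n \<le> m" for m n using lift_Suc_antimono_le[of D, OF dec that] .
  show ?case
  proof (cases "I \<subseteq> P")
    case False
    then obtain s where s: "s \<in> I" "s \<notin> P" by blast
    have "\<one> \<in> sat R P Sm I" using s sm_carr[OF I s(1)] by (auto simp: sat_self intro!: bexI[of _ s])
    then have "I = carrier R" using satI sm_one[OF I] by blast
    then have "D n = carrier R" for n using ID[of n] sm_subset[OF D[of n]] by blast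
    then show ?thesis by auto
  next
    case IP: True
    have n1: "\<one> \<notin> I" using IP S.prime_one[OF P] by blast
    \<comment> \<open>An ideal maximal among the \<open>I : z\<close> with
      \<open>z \<notin> I\<close> is prime, an associated prime of \<open>R\<close> modulo
      \<open>I\<close>. Because \<open>I\<close> is saturated it lies in \<open>P\<close>, so by
      hypothesis it is \<open>P\<close>.\<close>
    let ?col = "\<lambda>z. {r \<in> carrier R. r \<otimes> z \<in> I}"
    have colsub: "submodule (?col z) R Sm" if "z \<in> carrier R" for z
    proof -
      have "semilinear R (\<lambda>r. r) Sm Sm (\<lambda>r. r \<otimes> z)" using that by (auto simp: semilinear_def self_simps l_distr m_assoc)
      from semilinear_vimage[OF S.module_axioms S.module_axioms this I] show ?thesis by (simp add: self_simps)
    qed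
    let ?Q = "{?col z |z. z \<in> carrier R \<and> z \<notin> I}"
    have "?col \<one> \<in> ?Q" using n1 by blast
    then have "\<exists>K\<in>?Q. \<forall>J. (J, K) \<in> {(J', J). submodule J R Sm \<and> submodule J' R Sm \<and> J \<subset> J'} \<longrightarrow> J \<notin> ?Q"
      using noetherian_module_wf[OF self_is_module noetherian_self[OF noeth]] unfolding wf_eq_minimal by (elim allE[of _ ?Q] allE[of _ "?col \<one>"] impE)
    then obtain K where K: "K \<in> ?Q" and
      max: "\<And>J. (J, K) \<in> {(J', J). submodule J R Sm \<and> submodule J' R Sm \<and> J \<subset> J'} \<Longrightarrow> J \<notin> ?Q"
      by blast
    obtain z where z: "K = ?col z" "z \<in> carrier R" "z \<notin> I" using K by blast
    have Ksub: "submodule K R Sm" using colsub z by simp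
    have IK: "I \<subseteq> K" using z sm_mult2[OF I z(2)] sm_subset[OF I] by auto
    have Kprime: "primeideal K R"
    proof (rule primeidealI)
      show "ideal K R" using Ksub ideal_iff_submodule by blast
      show "cring R" by (rule is_cring)
      have "\<one> \<notin> K" using z by simp
      then show "carrier R \<noteq> K" using one_closed by blast
      fix a b assume ab: "a \<in> carrier R" "b \<in> carrier R" "a \<otimes> b \<in> K"
      show "a \<in> K \<or> b \<in> K"
      proof (rule disjCI)
        assume "b \<notin> K"
        then have bz: "b \<otimes> z \<notin> I" using ab z by simp
        have "K \<subseteq> ?col (b \<otimes> z)"
        proof
          fix r assume "r \<in> K"
          then have "r \<in> carrier R" "b \<otimes> (r \<otimes> z) \<in> I" using z sm_mult[OF I ab(2)] by auto
          then show "r \<in> ?col (b \<otimes> z)" using ab z by (simp add: m_lcomm)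
        qed
        moreover have "?col (b \<otimes> z) \<in> ?Q" using bz ab z by blast
        ultimately have "?col (b \<otimes> z) = K" using max[of "?col (b \<otimes> z)"] Ksub colsub[of "b \<otimes> z"] ab z by auto
        moreover have "a \<in> ?col (b \<otimes> z)" using ab z by (simp add: m_assoc)
        ultimately show "a \<in> K" by simp
      qed
    qed
    have "K \<subseteq> P"
    proof
      fix t assume t: "t \<in> K"
      show "t \<in> P"
      proof (rule ccontr)
        assume "t \<notin> P"
        then have "z \<in> sat R P Sm I" using t z by (auto simp: sat_self)
        then show False using satI z by blast
      qed
    qed
    then have KP: "K = P" using primes[OF Kprime IK] by blast
    let ?I' = "sat R P Sm (lspan R Sm (insert z I))"
    have zI: "insert z I \<subseteq> carrier R" using z sm_subset[OF I] by blast
    have I'sub: "submodule ?I' R Sm" by (rule sm_sat[OF P sm_lspan[OF zI]])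
    have ins: "insert z I \<subseteq> ?I'" using sm_lspan_incl[OF zI] sm_sat_incl[OF P sm_subset[OF sm_lspan[OF zI]]] by blast
    have I'sat: "sat R P Sm ?I' \<subseteq> ?I'" using S.sat_idem[OF P] by blast
    have rel: "(?I', I) \<in> {(J', J). submodule J R Sm \<and> submodule J' R Sm \<and> J \<subset> J'}"
      using I I'sub ins z by auto
    \<comment> \<open>\<open>P\<close> annihilates \<open>z\<close> modulo \<open>I\<close>, so
      \<open>?I'\<close> modulo \<open>I\<close> becomes one-dimensional over the residue field at
      \<open>P\<close>. A saturated ideal above \<open>I\<close> therefore contains
      \<open>?I'\<close> or meets it in \<open>I\<close>.\<close>
    have big: "?I' \<subseteq> C" if C: "submodule C R Sm" "sat R P Sm C \<subseteq> C" "I \<subseteq> C" "z \<in> C" for C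
      using S.sat_mono[OF S.lspan_minimal[OF C(1), of "insert z I"]] C by blast
    have small: "C \<inter> ?I' \<subseteq> I" if C: "submodule C R Sm" "sat R P Sm C \<subseteq> C" "I \<subseteq> C" "z \<notin> C" for C
    proof
      fix w assume w: "w \<in> C \<inter> ?I'"
      then obtain s where s: "s \<in> carrier R - P" "s \<otimes> w \<in> lspan R Sm (insert z I)" "w \<in> carrier R" by (auto simp: sat_self)
      obtain r i where ri: "r \<in> carrier R" "i \<in> I" "s \<otimes> w = r \<otimes> z \<oplus> i" using sm_lspan_insert[OF I z(2) s(2)] by blast
      have "r \<otimes> z \<oplus> i \<in> C" unfolding ri(3)[symmetric] using sm_mult[OF C(1)] s w by blast
      then have rz: "r \<otimes> z \<in> C" using sm_add_cancel[OF C(1)] C(3) ri z by auto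
      have "r \<in> P"
      proof (rule ccontr)
        assume "r \<notin> P"
        then have "z \<in> sat R P Sm C" using ri rz z by (auto simp: sat_self)
        then show False using C by blast
      qed
      then have "r \<otimes> z \<in> I" using z KP by blast
      then have "s \<otimes> w \<in> I" using ri sm_add[OF I] by simp
      then have "w \<in> sat R P Sm I" using s unfolding sat_self by blast
      then show "w \<in> I" using satI by blast
    qed
    \<comment> \<open>The chain modulo \<open>?I'\<close>, stationary by induction. Since the
      intersections with \<open>?I'\<close> are stationary as well, the modular law makes
      \<open>D\<close> itself stationary.\<close>
    define D' where "D' n = sat R P Sm (lspan R Sm (D n \<union> ?I'))" for n
    have un: "D n \<union> ?I' \<subseteq> carrier R" for n using sm_subset[OF D] sm_subset[OF I'sub] by blast
    have "\<exists>N. \<forall>n\<ge>N. D' n = D' N"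
    proof (rule "1.IH"[OF rel I'sub I'sat])
      show "\<And>Q. primeideal Q R \<Longrightarrow> ?I' \<subseteq> Q \<Longrightarrow> Q \<subseteq> P \<Longrightarrow> Q = P" using primes ins by blast
      show "\<And>n. submodule (D' n) R Sm" unfolding D'_def by (rule sm_sat[OF P sm_lspan[OF un]])
      show "\<And>n. sat R P Sm (D' n) \<subseteq> D' n" unfolding D'_def using S.sat_idem[OF P] by blast
      show "?I' \<subseteq> D' n" for n
        unfolding D'_def using sm_lspan_incl[OF un] sm_sat_incl[OF P sm_subset[OF sm_lspan[OF un]]] by blast
      show "D' (Suc n) \<subseteq> D' n" for n
        unfolding D'_def
      proof (rule S.sat_mono, rule S.lspan_mono)
        show "D n \<union> ?I' \<subseteq> carrier Sm" using un by (simp add: self_simps)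
      qed (use dec in blast)
    qed
    then obtain N1 where N1: "\<And>n. n \<ge> N1 \<Longrightarrow> D' n = D' N1" by blast
    have "\<exists>N2. \<forall>n\<ge>N2. D n \<inter> ?I' = D N2 \<inter> ?I'"
    proof (cases "\<forall>n. z \<in> D n")
      case True
      then have "D n \<inter> ?I' = ?I'" for n using big[OF D satD ID] by blast
      then show ?thesis by auto
    next
      case False
      then obtain N2 where N2: "z \<notin> D N2" by blast
      have "D n \<inter> ?I' = I" if "n \<ge> N2" for n
        using small[OF D satD ID, of n] anti[OF that] N2 ID[of n] ins by blast
      then show ?thesis by (intro exI[of _ N2]) auto
    qed
    then obtain N2 where N2: "\<And>n. n \<ge> N2 \<Longrightarrow> D n \<inter> ?I' = D N2 \<inter> ?I'" by blast
    let ?N = "max N1 N2"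
    have "D n = D ?N" if n: "n \<ge> ?N" for n
    proof
      show "D n \<subseteq> D ?N" using anti[OF n] .
      show "D ?N \<subseteq> D n"
      proof
        fix c assume c: "c \<in> D ?N"
        have "c \<in> D' ?N" unfolding D'_def
          using c sm_lspan_incl[OF un] sm_sat_incl[OF P sm_subset[OF sm_lspan[OF un]]] by blast
        then have "c \<in> D' n" using N1[of ?N] N1[of n] n by auto
        then obtain s where s: "s \<in> carrier R - P" "s \<otimes> c \<in> lspan R Sm (D n \<union> ?I')" by (auto simp: D'_def sat_self)
        obtain c' i where ci: "c' \<in> D n" "i \<in> ?I'" "s \<otimes> c = c' \<oplus> i"
          using S.lspan_union_submodules[OF D I'sub s(2)] by (auto simp: self_simps)
        have iR: "i \<in> carrier R" "c' \<in> carrier R" using sm_carr[OF I'sub ci(2)] sm_carr[OF D ci(1)] by auto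
        have "s \<otimes> c \<in> D ?N" using sm_mult[OF D _ c] s by blast
        then have "i \<oplus> c' \<in> D ?N" using ci(3) a_comm[OF iR] by simp
        then have "i \<in> D ?N" using sm_add_cancel[OF D, of i c' ?N] anti[OF n] ci(1) iR by blast
        then have "i \<in> D n" using ci(2) N2[of n] N2[of ?N] n by auto
        then have "s \<otimes> c \<in> D n" using ci sm_add[OF D] by simp
        then have "c \<in> sat R P Sm (D n)" using s sm_carr[OF D c] unfolding sat_self by blast
        then show "c \<in> D n" using satD[of n] by blast
      qed
    qed
    then show ?thesis by blast
  qed
qed

text \<open>
  Otherwise \<open>P2\<close> is minimal over \<open>P0 + (x)\<close>. As in the usual proof of Krull's theorem, the symbolic powers
  \<open>C n\<close> at \<open>P1\<close> of some \<open>y \<in> P1 - P0\<close> become stationary modulo \<open>x\<close>, hence also before reduction.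
\<close>

lemma principal_ideal_theorem:
  assumes noeth: "noetherian_ring R" and P0: "primeideal P0 R" and P1: "primeideal P1 R" and P2: "primeideal P2 R"
    and "P0 \<subset> P1" "P1 \<subset> P2" and x: "x \<in> P2" "x \<notin> P0"
  shows "\<exists>Q. primeideal Q R \<and> x \<in> Q \<and> P0 \<subset> Q \<and> Q \<subset> P2"
proof (rule ccontr)
  assume contra: "\<not> ?thesis"
  interpret S: module R Sm by (rule self_is_module)
  have xR: "x \<in> carrier R" using sm_carr[OF sm_prime[OF P2] x(1)] .
  have x1: "x \<notin> P1" using contra assms by blast
  obtain y where y: "y \<in> P1" "y \<notin> P0" using assms by blast
  have yR: "y \<in> carrier R" using sm_carr[OF sm_prime[OF P1] y(1)] .
  have P0R: "P0 \<subseteq> carrier R" using sm_subset[OF sm_prime[OF P0]] .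
  define B where "B n = lspan R Sm (insert (y [^] (n::nat)) P0)" for n
  have Bin: "insert (y [^] (n::nat)) P0 \<subseteq> carrier R" for n using yR P0R by simp
  have B: "submodule (B n) R Sm" for n unfolding B_def by (rule sm_lspan[OF Bin])
  have BP0: "P0 \<subseteq> B n" "y [^] n \<in> B n" for n unfolding B_def using sm_lspan_incl[OF Bin[of n]] by auto
  have Bdec: "B (Suc n) \<subseteq> B n" for n
    unfolding B_def[of "Suc n"]
  proof (rule S.lspan_minimal[OF B])
    have "y [^] n \<otimes> y \<in> B n" using sm_mult2[OF B yR BP0(2)] .
    then show "insert (y [^] Suc n) P0 \<subseteq> B n" using BP0 by auto
  qed
  define C where "C n = sat R P1 Sm (B n)" for n
  have C: "submodule (C n) R Sm" for n unfolding C_def by (rule sm_sat[OF P1 B])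
  have BC: "B n \<subseteq> C n" for n unfolding C_def by (rule sm_sat_incl[OF P1 sm_subset[OF B]])
  have Cdec: "C (Suc n) \<subseteq> C n" for n unfolding C_def by (rule S.sat_mono[OF Bdec])
  have Ccan: "r \<in> C n" if "s \<in> carrier R - P1" "r \<in> carrier R" "s \<otimes> r \<in> C n" for s r n
    using sm_sat_cancel[OF P1 that(1,2)] that(3) by (simp add: C_def)
  define E where "E n = lspan R Sm (insert x (C n))" for n
  have Ein: "insert x (C n) \<subseteq> carrier R" for n using xR sm_subset[OF C] by blast
  have E: "submodule (E n) R Sm" for n unfolding E_def by (rule sm_lspan[OF Ein])
  have CE: "insert x (C n) \<subseteq> E n" for n unfolding E_def by (rule sm_lspan_incl[OF Ein])
  \<comment> \<open>These saturated ideals contain \<open>P0\<close> and \<open>x\<close>. By the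
    contradiction hypothesis no prime other than \<open>P2\<close> lies between
    \<open>P0 + (x)\<close> and \<open>P2\<close>, so the descending chain becomes
    stationary.\<close>
  define D where "D n = sat R P2 Sm (E n)" for n
  have ED: "E n \<subseteq> D n" for n unfolding D_def by (rule sm_sat_incl[OF P2 sm_subset[OF E]])
  have xP: "insert x P0 \<subseteq> carrier R" using xR P0R by blast
  let ?I = "sat R P2 Sm (lspan R Sm (insert x P0))"
  have insI: "insert x P0 \<subseteq> ?I" using sm_lspan_incl[OF xP] sm_sat_incl[OF P2 sm_subset[OF sm_lspan[OF xP]]] by blast
  have "\<exists>N. \<forall>n\<ge>N. D n = D N"
  proof (rule sat_dcc[OF noeth P2, of ?I])
    show "submodule ?I R Sm" by (rule sm_sat[OF P2 sm_lspan[OF xP]])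
    show "sat R P2 Sm ?I \<subseteq> ?I" using S.sat_idem[OF P2] by blast
    show "Q = P2" if "primeideal Q R" "?I \<subseteq> Q" "Q \<subseteq> P2" for Q
    proof (rule ccontr)
      assume "Q \<noteq> P2"
      then show False using contra that insI x by blast
    qed
    show "\<And>n. submodule (D n) R Sm" unfolding D_def by (rule sm_sat[OF P2 E])
    show "\<And>n. sat R P2 Sm (D n) \<subseteq> D n" unfolding D_def using S.sat_idem[OF P2] by blast
    show "?I \<subseteq> D n" for n unfolding D_def
      using CE[of n] BP0(1)[of n] BC[of n] by (intro S.sat_mono S.lspan_minimal[OF E]) auto
    show "D (Suc n) \<subseteq> D n" for n unfolding D_def
    proof (rule S.sat_mono)
      show "E (Suc n) \<subseteq> E n" unfolding E_def[of "Suc n"]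
        using CE[of n] Cdec[of n] by (intro S.lspan_minimal[OF E]) auto
    qed
  qed
  then obtain N where N0: "\<forall>n\<ge>N. D n = D N" by blast
  have N: "D (Suc N) = D N" by (rule N0[rule_format]) simp
  \<comment> \<open>An element of \<open>C N\<close> is locally \<open>r x\<close> plus an element
    of \<open>C (Suc N)\<close>. Then \<open>r x\<close> lies in \<open>C N\<close>, and so does
    \<open>r\<close>, because \<open>x\<close> is outside \<open>P1\<close> and \<open>C N\<close>
    is saturated at \<open>P1\<close>. Hence \<open>C N\<close> is \<open>C (Suc N)\<close> plus
    \<open>x C N\<close> at \<open>P2\<close>, and Nakayama's lemma removes the last term.\<close>
  have "C N \<subseteq> sat R P2 Sm (C (Suc N))"
  proof (rule nakayama_ideal[OF noeth P2 C C x(1)])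
    fix a assume a: "a \<in> C N"
    then have "a \<in> D (Suc N)" using CE ED N by blast
    then obtain s where s: "s \<in> carrier R - P2" "s \<otimes> a \<in> E (Suc N)" by (auto simp: D_def sat_self)
    obtain r b where rb: "r \<in> carrier R" "b \<in> C (Suc N)" "s \<otimes> a = r \<otimes> x \<oplus> b"
      using sm_lspan_insert[OF C xR s(2)[unfolded E_def]] by blast
    have bR: "b \<in> carrier R" using sm_carr[OF C rb(2)] .
    have "r \<otimes> x \<oplus> b \<in> C N" unfolding rb(3)[symmetric] using sm_mult[OF C _ a] s by blast
    then have "r \<otimes> x \<in> C N" using sm_add_cancel[OF C, of "r \<otimes> x" b N] rb Cdec[of N] xR by blast
    then have "r \<in> C N" using Ccan[of x r N] x1 xR rb by (simp add: m_comm)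
    moreover have "s \<otimes> a = b \<oplus> x \<otimes> r" using rb bR xR by (simp add: m_comm a_comm)
    ultimately show "\<exists>s\<in>carrier R - P2. \<exists>b\<in>C (Suc N). \<exists>r\<in>C N. s \<otimes> a = b \<oplus> x \<otimes> r" using s rb by blast
  qed
  then have "y [^] N \<in> sat R P2 Sm (C (Suc N))" using BP0 BC by blast
  then obtain t where t: "t \<in> carrier R - P2" "t \<otimes> y [^] N \<in> C (Suc N)" by (auto simp: sat_self)
  then have "y [^] N \<in> C (Suc N)" using Ccan[of t "y [^] N" "Suc N"] assms yR by auto
  then obtain s where s: "s \<in> carrier R - P1" "s \<otimes> y [^] N \<in> B (Suc N)" by (auto simp: C_def sat_self)
  obtain r q where rq: "r \<in> carrier R" "q \<in> P0" "s \<otimes> y [^] N = r \<otimes> y [^] Suc N \<oplus> q"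
    using sm_lspan_insert[OF sm_prime[OF P0] _ s(2)[unfolded B_def]] yR by blast
  have qR: "q \<in> carrier R" using rq P0R by blast
  have yN: "y [^] N \<in> carrier R" using yR by simp
  \<comment> \<open>The product \<open>y^N (s - r y)\<close> lies in \<open>P0\<close> while
    \<open>y\<close> does not, so \<open>s - r y\<close> lies in \<open>P0\<close> and hence in
    \<open>P1\<close>. As \<open>y \<in> P1\<close>, this puts \<open>s\<close> into
    \<open>P1\<close>, against its choice.\<close>
  have "y [^] N \<otimes> (s \<ominus> r \<otimes> y) = s \<otimes> y [^] N \<ominus> r \<otimes> (y [^] N \<otimes> y)"
    using s rq(1) yR yN by (simp add: a_minus_def r_distr r_minus m_ac)
  also have "\<dots> = q"
    unfolding rq(3) using rq(1) yR yN qR by (simp add: a_minus_def a_ac r_neg r_neg1 r_neg2)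
  finally have "y [^] N \<otimes> (s \<ominus> r \<otimes> y) \<in> P0" using rq by simp
  then have "y [^] N \<in> P0 \<or> s \<ominus> r \<otimes> y \<in> P0"
    using primeideal.I_prime[OF P0 yN, of "s \<ominus> r \<otimes> y"] s rq yR by simp
  then have "s \<ominus> r \<otimes> y \<in> P0" using prime_pow[OF P0 yR] y by blast
  then have "s \<ominus> r \<otimes> y \<in> P1" using assms by blast
  moreover have "r \<otimes> y \<in> P1" using sm_mult[OF sm_prime[OF P1] rq(1) y(1)] .
  ultimately have "(s \<ominus> r \<otimes> y) \<oplus> r \<otimes> y \<in> P1" using sm_add[OF sm_prime[OF P1]] by blast
  moreover have "(s \<ominus> r \<otimes> y) \<oplus> r \<otimes> y = s" using s rq yR by (simp add: a_minus_def a_assoc l_neg)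
  ultimately show False using s by simp
qed

end

section \<open>Chains of primes and heights\<close>

definition prime_chain :: "('a, 'r) ring_scheme \<Rightarrow> nat \<Rightarrow> (nat \<Rightarrow> 'a set) \<Rightarrow> bool"
  where "prime_chain R n Q \<longleftrightarrow> (\<forall>i\<le>n. primeideal (Q i) R) \<and> (\<forall>i<n. Q i \<subset> Q (Suc i))"

context cring
begin

lemma prime_chain_mono:
  assumes "prime_chain R n Q" "i \<le> j" "j \<le> n" shows "Q i \<subseteq> Q j"
  using assms(2,3)
proof (induction j rule: dec_induct)
  case (step m)
  then have "Q m \<subset> Q (Suc m)" using assms(1) by (simp add: prime_chain_def)
  then show ?case using step by auto
qed simp

lemma prime_chain_snoc:
  assumes "prime_chain R n Q" "primeideal P R" "Q n \<subset> P"
  shows "prime_chain R (Suc n) (Q(Suc n := P))"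
  using assms by (auto simp: prime_chain_def less_Suc_eq le_Suc_eq)

text \<open>The element \<open>x\<close> is pushed down from the top. If the prime just below the
  top misses \<open>x\<close>, the principal ideal theorem replaces it by one between its neighbours
  that contains \<open>x\<close>; both ends of the chain stay.\<close>

lemma prime_chain_modify:
  assumes noeth: "noetherian_ring R" and "prime_chain R n Q" "n \<ge> 1" "x \<in> Q n" "x \<notin> Q 0"
  shows "\<exists>Q'. prime_chain R n Q' \<and> Q' 0 = Q 0 \<and> Q' n = Q n \<and> x \<in> Q' 1"
  using assms(2-)
proof (induction n arbitrary: Q)
  case 0 then show ?case by simp
next
  case (Suc m)
  show ?case
  proof (cases "m = 0")
    case True then show ?thesis using Suc.prems by auto
  next
    case m: False
    have ext: ?thesis if Q2: "prime_chain R m Q2" "Q2 0 = Q 0" "x \<in> Q2 m" "Q2 m \<subset> Q (Suc m)" for Q2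
    proof -
      obtain Q' where Q': "prime_chain R m Q'" "Q' 0 = Q2 0" "Q' m = Q2 m" "x \<in> Q' 1"
        using Suc.IH[OF Q2(1)] m Q2 Suc.prems by auto
      have pr: "primeideal (Q (Suc m)) R" using Suc.prems by (auto simp: prime_chain_def)
      have "Q' m \<subset> Q (Suc m)" using Q'(3) Q2(4) by simp
      then have "prime_chain R (Suc m) (Q'(Suc m := Q (Suc m)))" by (rule prime_chain_snoc[OF Q'(1) pr])
      moreover have "(Q'(Suc m := Q (Suc m))) 0 = Q 0" "(Q'(Suc m := Q (Suc m))) (Suc m) = Q (Suc m)"
        "x \<in> (Q'(Suc m := Q (Suc m))) 1" using Q' Q2(2) m by simp_all
      ultimately show ?thesis by blast
    qed
    have ch: "prime_chain R m Q" using Suc.prems by (auto simp: prime_chain_def)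
    show ?thesis
    proof (cases "x \<in> Q m")
      case True
      then show ?thesis using ext[OF ch] Suc.prems by (auto simp: prime_chain_def)
    next
      case False
      obtain k where k: "m = Suc k" using m by (cases m) auto
      have xk: "x \<notin> Q k" using False prime_chain_mono[OF ch, of k m] k by auto
      obtain P' where P': "primeideal P' R" "x \<in> P'" "Q k \<subset> P'" "P' \<subset> Q (Suc m)"
        using principal_ideal_theorem[OF noeth, of "Q k" "Q m" "Q (Suc m)" x] Suc.prems xk k
        by (auto simp: prime_chain_def)
      have chk: "prime_chain R k Q" using ch k by (auto simp: prime_chain_def)
      show ?thesis
        using ext[of "Q(m := P')"] prime_chain_snoc[OF chk P'(1,3)] k P' by auto
    qed
  qed
qed

text \<open>Krull's height theorem relative to an ideal \<open>J\<close>: each step moves one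
  generator into \<open>J\<close> and drops the lowest prime. In the equality case, locally at
  \<open>P\<close>, the induction hypothesis puts \<open>Q 0\<close> into \<open>J + (x t)\<close>;
  as \<open>Q 0\<close> is a prime without \<open>x t\<close>, it even lies in
  \<open>J + x t Q 0\<close>, and Nakayama's lemma puts it into \<open>J\<close>. This case is what
  makes a regular local ring a domain.\<close>

lemma height_bound:
  assumes noeth: "noetherian_ring R" and P: "primeideal P R"
    and "finite T" "x ` T \<subseteq> P" "prime_chain R n Q" "Q n = P" "submodule J R Sm" "J \<subseteq> Q 0"
    and "P \<subseteq> sat R P Sm (lspan R Sm (J \<union> x ` T))"
  shows "n \<le> card T \<and> (n = card T \<longrightarrow> Q 0 \<subseteq> sat R P Sm J)"
  using assms(3-)
proof (induction "card T" arbitrary: T J Q n)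
  case k0: 0
  then have T: "T = {}" by simp
  interpret S: module R Sm by (rule self_is_module)
  have "lspan R Sm (J \<union> x ` T) = J" using S.lspan_of_submodule[OF k0.prems(5)] T by simp
  then have PJ: "P \<subseteq> sat R P Sm J" using k0.prems(7) by simp
  have pQ: "primeideal (Q 0) R" using k0.prems(3) by (auto simp: prime_chain_def)
  have Q0P: "Q 0 \<subseteq> P" using prime_chain_mono[OF k0.prems(3), of 0 n] k0.prems(4) by simp
  have "P \<subseteq> Q 0" using PJ S.sat_mono[OF k0.prems(6)] sat_prime[OF pQ Q0P] by blast
  have "n = 0"
  proof (rule ccontr)
    assume "n \<noteq> 0"
    then have "Q 0 \<subset> Q 1" "Q 1 \<subseteq> Q n" using k0.prems(3) prime_chain_mono[OF k0.prems(3), of 1 n] by (auto simp: prime_chain_def)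
    then show False using \<open>P \<subseteq> Q 0\<close> k0.prems(4) by blast
  qed
  then show ?case using T PJ k0.prems(4) by simp
next
  case (Suc k)
  note fT = Suc.prems(1) and xT = Suc.prems(2) and ch = Suc.prems(3) and Qn = Suc.prems(4)
    and J = Suc.prems(5) and JQ = Suc.prems(6) and PS = Suc.prems(7)
  interpret S: module R Sm by (rule self_is_module)
  have pQ: "primeideal (Q 0) R" using ch by (auto simp: prime_chain_def)
  have Q0P: "Q 0 \<subseteq> P" using prime_chain_mono[OF ch, of 0 n] Qn by simp
  show ?case
  proof (cases "n = 0")
    case True then show ?thesis using Suc.hyps(2) by simp
  next
    case n0: False
    have "Q 0 \<subset> Q 1" "Q 1 \<subseteq> Q n" using n0 ch prime_chain_mono[OF ch, of 1 n] by (auto simp: prime_chain_def)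
    then have ne: "\<not> P \<subseteq> Q 0" using Qn by blast
    \<comment> \<open>Otherwise \<open>Q 0\<close> would contain all the generators and hence
      \<open>P\<close>, although the chain has positive length.\<close>
    have "\<exists>t\<in>T. x t \<notin> Q 0"
    proof (rule ccontr)
      assume "\<not> ?thesis"
      then have "lspan R Sm (J \<union> x ` T) \<subseteq> Q 0" using JQ by (intro S.lspan_minimal[OF sm_prime[OF pQ]]) auto
      then show False using ne PS S.sat_mono[of _ "Q 0"] sat_prime[OF pQ Q0P] by blast
    qed
    then obtain t where t: "t \<in> T" "x t \<notin> Q 0" by blast
    have xt: "x t \<in> P" "x t \<in> carrier R" using t xT sm_subset[OF sm_prime[OF P]] by auto
    obtain Q' where Q': "prime_chain R n Q'" "Q' 0 = Q 0" "Q' n = P" "x t \<in> Q' 1"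
      using prime_chain_modify[OF noeth ch, of "x t"] n0 t xt Qn by auto
    have JR: "insert (x t) J \<subseteq> carrier R" using xt sm_subset[OF J] by blast
    let ?J' = "lspan R Sm (insert (x t) J)"
    have J': "submodule ?J' R Sm" by (rule sm_lspan[OF JR])
    have pQ1: "primeideal (Q' 1) R" using Q'(1) n0 by (auto simp: prime_chain_def)
    have Q01: "Q 0 \<subseteq> Q' 1" using prime_chain_mono[OF Q'(1), of 0 1] Q'(2) n0 by auto
    have J'Q: "?J' \<subseteq> Q' 1" using Q'(4) JQ Q01 by (intro S.lspan_minimal[OF sm_prime[OF pQ1]]) auto
    have ch': "prime_chain R (n - 1) (\<lambda>i. Q' (Suc i))" using Q'(1) n0 by (auto simp: prime_chain_def)
    have TR: "x ` T \<subseteq> carrier R" using xT sm_subset[OF sm_prime[OF P]] by blast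
    have UR: "?J' \<union> x ` (T - {t}) \<subseteq> carrier R" using sm_subset[OF J'] TR by blast
    have PS': "P \<subseteq> sat R P Sm (lspan R Sm (?J' \<union> x ` (T - {t})))"
    proof -
      have "J \<union> x ` T \<subseteq> insert (x t) J \<union> x ` (T - {t})" by blast
      also have "\<dots> \<subseteq> lspan R Sm (?J' \<union> x ` (T - {t}))" using sm_lspan_incl[OF UR] sm_lspan_incl[OF JR] by blast
      finally have "lspan R Sm (J \<union> x ` T) \<subseteq> lspan R Sm (?J' \<union> x ` (T - {t}))"
        by (rule S.lspan_minimal[OF sm_lspan[OF UR]])
      then show ?thesis using PS S.sat_mono by blast
    qed
    have cT: "card (T - {t}) = k" using Suc.hyps(2) t fT by simp
    have IH: "n - 1 \<le> card (T - {t}) \<and> (n - 1 = card (T - {t}) \<longrightarrow> Q' (Suc 0) \<subseteq> sat R P Sm ?J')"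
      using Suc.hyps(1)[OF cT[symmetric] _ _ ch' _ J' _ PS'] fT xT Q'(3) n0 J'Q by auto
    have "Q 0 \<subseteq> sat R P Sm J" if "n = card T"
    proof (rule nakayama_ideal[OF noeth P sm_prime[OF pQ] J xt(1)])
      fix q assume q: "q \<in> Q 0"
      have "Q' 1 \<subseteq> sat R P Sm ?J'" using IH that cT Suc.hyps(2) n0 by auto
      then have "q \<in> sat R P Sm ?J'" using q Q01 by blast
      then obtain s where s: "s \<in> carrier R - P" "s \<otimes> q \<in> ?J'" by (auto simp: sat_self)
      obtain r j where rj: "r \<in> carrier R" "j \<in> J" "s \<otimes> q = r \<otimes> x t \<oplus> j"
        using sm_lspan_insert[OF J xt(2) s(2)] by blast
      have "r \<otimes> x t \<oplus> j \<in> Q 0" unfolding rj(3)[symmetric] using sm_mult[OF sm_prime[OF pQ] _ q] s by blast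
      then have "r \<otimes> x t \<in> Q 0" using sm_add_cancel[OF sm_prime[OF pQ]] rj JQ xt by blast
      then have "r \<in> Q 0" using primeideal.I_prime[OF pQ rj(1) xt(2)] t by blast
      moreover have "s \<otimes> q = j \<oplus> x t \<otimes> r" using rj xt sm_carr[OF J rj(2)] by (simp add: m_comm a_comm)
      ultimately show "\<exists>s\<in>carrier R - P. \<exists>b\<in>J. \<exists>r\<in>Q 0. s \<otimes> q = b \<oplus> x t \<otimes> r" using s rj by blast
    qed
    then show ?thesis using IH cT Suc.hyps(2) n0 by auto
  qed
qed

lemma sat_span_lower:
  assumes "primeideal Q R" "Q \<subseteq> P" "X \<subseteq> Q" shows "sat R P Sm (lspan R Sm X) \<subseteq> Q"
proof -
  interpret S: module R Sm by (rule self_is_module)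
  show ?thesis using S.sat_mono[OF S.lspan_minimal[OF sm_prime[OF assms(1)] assms(3)]] sat_prime[OF assms(1,2)] by blast
qed

text \<open>Induction over \<open>T\<close> produces a chain of length \<open>d - card T\<close>
  that starts at the ideal of \<open>T\<close> itself: its bottom is a prime containing this ideal,
  and the equality case of \<open>height_bound\<close> identifies the two. So the local ring modulo
  some of its parameters is a domain.\<close>

lemma regular_parameters:
  assumes noeth: "noetherian_ring R" and P: "primeideal P R"
    and ch: "prime_chain R d Q" "Q d = P" and xP: "x ` {..<d} \<subseteq> P"
    and PS: "P \<subseteq> sat R P Sm (lspan R Sm (x ` {..<d}))"
    and T: "T \<subseteq> {..<d}"
  shows "primeideal (sat R P Sm (lspan R Sm (x ` T))) R"
    and "j < d \<Longrightarrow> j \<notin> T \<Longrightarrow> x j \<notin> sat R P Sm (lspan R Sm (x ` T))"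
proof -
  interpret S: module R Sm by (rule self_is_module)
  let ?J = "\<lambda>T. sat R P Sm (lspan R Sm (x ` T))"
  have xR: "x ` T \<subseteq> carrier R" if "T \<subseteq> {..<d}" for T using xP that sm_subset[OF sm_prime[OF P]] by blast
  have J: "submodule (?J T) R Sm" if "T \<subseteq> {..<d}" for T by (rule sm_sat[OF P sm_lspan[OF xR[OF that]]])
  have xJ: "x ` T \<subseteq> ?J T" if "T \<subseteq> {..<d}" for T
    using sm_lspan_incl[OF xR[OF that]] sm_sat_incl[OF P sm_subset[OF sm_lspan[OF xR[OF that]]]] by blast
  have finT: "finite T" if "T \<subseteq> {..<d}" for T using that finite_subset by blast
  \<comment> \<open>If \<open>x j\<close> were in the ideal of \<open>T\<close>, the
    \<open>d - card T - 1\<close> other parameters would generate \<open>P\<close> above it, too few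
    for a chain of length \<open>d - card T\<close>.\<close>
  have notin: "x j \<notin> ?J T" if T: "T \<subseteq> {..<d}" and j: "j < d" "j \<notin> T"
    and Q: "prime_chain R (d - card T) Q" "Q 0 = ?J T" "Q (d - card T) = P" for T j Q
  proof
    assume xj: "x j \<in> ?J T"
    let ?U = "{..<d} - T - {j}"
    have UR: "?J T \<union> x ` ?U \<subseteq> carrier R" using sm_subset[OF J[OF T]] xR[of ?U] by blast
    have "x ` {..<d} \<subseteq> ?J T \<union> x ` ?U" using xj xJ[OF T] by blast
    then have "lspan R Sm (x ` {..<d}) \<subseteq> lspan R Sm (?J T \<union> x ` ?U)"
      using UR by (intro S.lspan_mono) (simp_all add: self_simps)
    from S.sat_mono[OF this] have PU: "P \<subseteq> sat R P Sm (lspan R Sm (?J T \<union> x ` ?U))" using PS by blast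
    have U: "finite ?U" "x ` ?U \<subseteq> P" "?J T \<subseteq> Q 0" using xP Q(2) by auto
    have "d - card T \<le> card ?U"
      by (rule conjunct1[OF height_bound[OF noeth P U(1,2) Q(1,3) J[OF T] U(3) PU]])
    moreover have "card T < d"
    proof -
      have "T \<subset> {..<d}" using T j by auto
      then show "card T < d" using psubset_card_mono[of "{..<d}" T] by simp
    qed
    moreover have "card ?U = d - card T - 1"
    proof -
      have "card ({..<d} - T) = d - card T" using card_Diff_subset[OF finT[OF T] T] by simp
      moreover have "card ?U = card ({..<d} - T) - 1" using j by (intro card_Diff_singleton) auto
      ultimately show ?thesis by simp
    qed
    ultimately show False by linarith
  qed
  have "\<exists>Q. prime_chain R (d - card T) Q \<and> Q 0 = ?J T \<and> Q (d - card T) = P" if "T \<subseteq> {..<d}" for T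
    using finT[OF that] that
  proof (induction T rule: finite_induct)
    case empty
    have z: "lspan R Sm {} = {\<zero>}"
      using S.lspan_minimal[OF S.zero_submodule, of "{}"] sm_zero[OF sm_lspan[of "{}"]] by (auto simp: self_simps)
    have pQ: "primeideal (Q 0) R" using ch by (auto simp: prime_chain_def)
    have "Q 0 \<subseteq> P" using prime_chain_mono[OF ch(1), of 0 d] ch by simp
    then have lower: "?J {} \<subseteq> Q 0" by (intro sat_span_lower[OF pQ]) auto
    have zs: "submodule {\<zero>} R Sm" using sm_lspan[of "{}"] z by simp
    have "insert \<zero> (x ` {..<d}) \<subseteq> carrier R" using xR[of "{..<d}"] by auto
    then have "lspan R Sm (x ` {..<d}) \<subseteq> lspan R Sm ({\<zero>} \<union> x ` {..<d})"
      by (intro S.lspan_mono) (auto simp: self_simps)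
    then have "P \<subseteq> sat R P Sm (lspan R Sm ({\<zero>} \<union> x ` {..<d}))"
      using PS S.sat_mono by blast
    then have "Q 0 \<subseteq> sat R P Sm {\<zero>}"
      using height_bound[OF noeth P _ xP ch zs] sm_zero[OF sm_prime[OF pQ]] by auto
    then show ?case using lower ch z by (intro exI[of _ Q]) auto
  next
    case (insert t T)
    then obtain Q where Q: "prime_chain R (d - card T) Q" "Q 0 = ?J T" "Q (d - card T) = P" by auto
    have T: "T \<subseteq> {..<d}" "t < d" "t \<notin> T" "insert t T \<subseteq> {..<d}" using insert by auto
    have "T \<subset> {..<d}" using T by auto
    then have cT: "card T < d" using psubset_card_mono[of "{..<d}" T] by simp
    define m where "m = d - card T - 1"
    have m: "d - card T = Suc m" "d - card (insert t T) = m" using cT T finT[OF T(1)] by (auto simp: m_def)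
    have "x t \<notin> Q 0" using notin[OF T(1,2,3) Q] Q(2) by simp
    moreover have "x t \<in> Q (Suc m)" using Q(3) m xP T by auto
    ultimately obtain Q' where Q': "prime_chain R (Suc m) Q'" "Q' 0 = Q 0" "Q' (Suc m) = P" "x t \<in> Q' 1"
      using prime_chain_modify[OF noeth, of "Suc m" Q "x t"] Q m by auto
    have pQ1: "primeideal (Q' 1) R" using Q'(1) by (auto simp: prime_chain_def)
    have Q01: "?J T \<subseteq> Q' 1" using prime_chain_mono[OF Q'(1), of 0 1] Q'(2) Q(2) by auto
    have Q1P: "Q' 1 \<subseteq> P" using prime_chain_mono[OF Q'(1), of 1 "Suc m"] Q'(3) by auto
    have ins: "x ` insert t T \<subseteq> Q' 1" using Q'(4) Q01 xJ[OF T(1)] by auto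
    have lower: "?J (insert t T) \<subseteq> Q' 1" by (rule sat_span_lower[OF pQ1 Q1P ins])
    let ?L = "lspan R Sm (x ` insert t T)" and ?U = "{..<d} - insert t T"
    have L: "submodule ?L R Sm" by (rule sm_lspan[OF xR[OF T(4)]])
    have LQ: "?L \<subseteq> Q' 1" by (rule S.lspan_minimal[OF sm_prime[OF pQ1] ins])
    have ch': "prime_chain R m (\<lambda>i. Q' (Suc i))" using Q'(1) by (auto simp: prime_chain_def)
    have cU: "card ?U = m" using T finT[OF T(1)] cT by (subst card_Diff_subset) (auto simp: m_def)
    have UR: "?L \<union> x ` ?U \<subseteq> carrier R" using sm_subset[OF L] xR[of ?U] by blast
    have "x ` {..<d} \<subseteq> ?L \<union> x ` ?U" using sm_lspan_incl[OF xR[OF T(4)]] by blast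
    then have "lspan R Sm (x ` {..<d}) \<subseteq> lspan R Sm (?L \<union> x ` ?U)"
      using UR by (intro S.lspan_mono) (simp_all add: self_simps)
    from S.sat_mono[OF this] have PU: "P \<subseteq> sat R P Sm (lspan R Sm (?L \<union> x ` ?U))" using PS by blast
    have U: "finite ?U" "x ` ?U \<subseteq> P" "?L \<subseteq> Q' (Suc 0)" using xP LQ by auto
    have "Q' (Suc 0) \<subseteq> ?J (insert t T)"
      using conjunct2[OF height_bound[OF noeth P U(1,2) ch' Q'(3) L U(3) PU]] cU by simp
    then have "Q' (Suc 0) = ?J (insert t T)" using lower by auto
    then show ?case using ch' Q'(3) m by (intro exI[of _ "\<lambda>i. Q' (Suc i)"]) auto
  qed
  note chain = this
  from chain[OF T] obtain Q' where Q': "prime_chain R (d - card T) Q'" "Q' 0 = ?J T" "Q' (d - card T) = P" by blast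
  show "primeideal (?J T) R" using Q' by (auto simp: prime_chain_def)
  show "j < d \<Longrightarrow> j \<notin> T \<Longrightarrow> x j \<notin> ?J T" using notin[OF T _ _ Q'] by blast
qed

text \<open>Powers of parameters are still regular. The induction is on the sum of the exponents;
  when all are one, the ideal is prime. Otherwise an exponent \<open>k + 1\<close> at
  \<open>t\<close> is reduced to three smaller cases: exponent \<open>k\<close> at \<open>t\<close>,
  exponent one at \<open>t\<close>, and \<open>t\<close> left out.\<close>

lemma powers_regular:
  fixes a :: "'i \<Rightarrow> nat"
  assumes P: "primeideal P R" and xR: "\<And>i. i \<in> A \<Longrightarrow> x i \<in> carrier R"
    and pr: "\<And>T. T \<subseteq> A \<Longrightarrow> primeideal (sat R P Sm (lspan R Sm (x ` T))) R"
    and ni: "\<And>T j. T \<subseteq> A \<Longrightarrow> j \<in> A \<Longrightarrow> j \<notin> T \<Longrightarrow> x j \<notin> sat R P Sm (lspan R Sm (x ` T))"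
    and "finite T" "T \<subseteq> A" "\<And>t. t \<in> T \<Longrightarrow> a t \<ge> 1"
    and "z \<in> carrier R" "z \<notin> sat R P Sm (lspan R Sm (x ` T))" "u \<in> carrier R"
    and "z \<otimes> u \<in> sat R P Sm (lspan R Sm ((\<lambda>t. x t [^] a t) ` T))"
  shows "u \<in> sat R P Sm (lspan R Sm ((\<lambda>t. x t [^] a t) ` T))"
  using assms(5-)
proof (induction "sum a T" arbitrary: a T z u rule: less_induct)
  case less
  interpret S: module R Sm by (rule self_is_module)
  let ?J = "\<lambda>T. sat R P Sm (lspan R Sm (x ` T))"
  let ?X = "\<lambda>a T. lspan R Sm ((\<lambda>t. x t [^] (a t :: nat)) ` T)"
  note fT = less.prems(1) and TA = less.prems(2) and a1 = less.prems(3) and z = less.prems(4,5) and u = less.prems(6,7)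
  show ?case
  proof (cases "\<forall>t\<in>T. a t = 1")
    case True
    then have "(\<lambda>t. x t [^] a t) ` T = x ` T" using xR TA by (intro image_cong) auto
    then show ?thesis using u z primeideal.I_prime[OF pr[OF TA], of z u] by auto
  next
    case False
    then obtain t where t: "t \<in> T" "a t \<noteq> 1" by blast
    then have at: "a t \<ge> 2" using a1[OF t(1)] by auto
    define k where "k = a t - 1"
    have k: "a t = Suc k" "k \<ge> 1" using at by (auto simp: k_def)
    have xt: "x t \<in> carrier R" using t TA xR by auto
    let ?a' = "a(t := k)" and ?a1 = "a(t := 1)" and ?T' = "T - {t}"
    have T'A: "?T' \<subseteq> A" using TA by blast
    have s0: "sum a T = a t + sum a ?T'" using fT t by (simp add: sum.remove)
    have s1: "sum ?a' T = k + sum a ?T'" using fT t by (simp add: sum.remove[of T t])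
    have s2: "sum ?a1 T = 1 + sum a ?T'" using fT t by (simp add: sum.remove[of T t])
    have X'R: "(\<lambda>t. x t [^] a t) ` ?T' \<subseteq> carrier R" using T'A xR by auto
    have X': "submodule (?X a ?T') R Sm" by (rule sm_lspan[OF X'R])
    have TR: "(\<lambda>t. x t [^] b t) ` T \<subseteq> carrier R" for b :: "'i \<Rightarrow> nat" using TA xR by auto
    have im: "(\<lambda>s. x s [^] (a(t := m)) s) ` T = insert (x t [^] m) ((\<lambda>t. x t [^] a t) ` ?T')" for m
    proof -
      have "(\<lambda>s. x s [^] (a(t := m)) s) ` ?T' = (\<lambda>t. x t [^] a t) ` ?T'" by (intro image_cong) auto
      moreover have "(\<lambda>s. x s [^] (a(t := m)) s) ` T = (\<lambda>s. x s [^] (a(t := m)) s) ` insert t ?T'"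
        using insert_Diff[OF t(1)] by (simp only:)
      ultimately show ?thesis unfolding image_insert by simp
    qed
    have Xin: "r \<otimes> x t [^] m \<oplus> w \<in> ?X (a(t := m)) T" if "r \<in> carrier R" "w \<in> ?X a ?T'" for r w m
    proof -
      have X: "submodule (?X (a(t := m)) T) R Sm" by (rule sm_lspan[OF TR])
      have "x t [^] m \<in> ?X (a(t := m)) T" using sm_lspan_incl[OF TR, of "a(t := m)"] im[of m] by blast
      moreover have "?X a ?T' \<subseteq> ?X (a(t := m)) T" unfolding im using TR[of "a(t := m)"] im[of m]
        by (intro S.lspan_mono) (auto simp: self_simps)
      ultimately show ?thesis using that sm_add[OF X sm_mult[OF X]] by blast
    qed
    have Xout: "\<exists>r\<in>carrier R. \<exists>w\<in>?X a ?T'. y = r \<otimes> x t [^] m \<oplus> w" if y: "y \<in> ?X (a(t := m)) T" for y m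
    proof -
      obtain r w where "r \<in> carrier R" "w \<in> ?X a ?T'" "y = r \<odot>\<^bsub>Sm\<^esub> x t [^] m \<oplus>\<^bsub>Sm\<^esub> w"
        by (rule S.lspan_insert[of "(\<lambda>t. x t [^] a t) ` ?T'" "x t [^] m" y])
          (use y[unfolded im] X'R xt in \<open>auto simp: self_simps\<close>)
      then show ?thesis by (auto simp: self_simps)
    qed
    have aeq: "a(t := Suc k) = a" using k by auto
    have X'M: "\<And>w. w \<in> ?X a ?T' \<Longrightarrow> w \<in> carrier R" using sm_carr[OF X'] .
    have "?X a T \<subseteq> ?X ?a' T"
    proof
      fix y assume "y \<in> ?X a T"
      then obtain r w where rw: "r \<in> carrier R" "w \<in> ?X a ?T'" "y = r \<otimes> x t [^] Suc k \<oplus> w" using Xout[of y "Suc k"] aeq by auto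
      have "y = (r \<otimes> x t) \<otimes> x t [^] k \<oplus> w" using rw xt X'M by (simp add: m_ac)
      then show "y \<in> ?X ?a' T" using Xin[of "r \<otimes> x t" w k] rw xt by simp
    qed
    then have "z \<otimes> u \<in> sat R P Sm (?X ?a' T)" using u S.sat_mono by blast
    then have "u \<in> sat R P Sm (?X ?a' T)"
      using less.hyps[of ?a' T z u] s0 s1 k fT TA a1 z u by simp
    then obtain s where s: "s \<in> carrier R - P" "s \<otimes> u \<in> ?X ?a' T" by (auto simp: sat_self)
    obtain c w where c: "c \<in> carrier R" "w \<in> ?X a ?T'" "s \<otimes> u = c \<otimes> x t [^] k \<oplus> w" using Xout[OF s(2)] by blast
    obtain s' where s': "s' \<in> carrier R - P" "s' \<otimes> (z \<otimes> u) \<in> ?X a T" using u by (auto simp: sat_self)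
    obtain r w' where r: "r \<in> carrier R" "w' \<in> ?X a ?T'" "s' \<otimes> (z \<otimes> u) = r \<otimes> x t [^] Suc k \<oplus> w'"
      using Xout[of "s' \<otimes> (z \<otimes> u)" "Suc k"] s'(2) aeq by auto
    \<comment> \<open>\<open>s u\<close> is \<open>c x^k + w\<close> by the case of exponent
      \<open>k\<close>, and \<open>s' z u\<close> is \<open>r x^(k+1) + w'\<close> by assumption.
      Comparing them, \<open>x^k e\<close> lies in the ideal without \<open>t\<close>, and locally
      so does \<open>e\<close>, by the case in which \<open>t\<close> is left out. Then
      \<open>z c\<close>, and by the case of exponent one also \<open>c\<close>, is locally a
      multiple of \<open>x\<close> modulo that ideal, which raises \<open>x^k\<close> to
      \<open>x^(k+1)\<close> in the formula for \<open>s u\<close>.\<close>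
    define e where "e = s' \<otimes> z \<otimes> c \<ominus> s \<otimes> r \<otimes> x t"
    note cl = s(1) s'(1) c(1) r(1) xt z(1) u(1) X'M[OF c(2)] X'M[OF r(2)]
    have eR: "e \<in> carrier R" using cl by (simp add: e_def)
    have xk: "x t [^] k \<in> carrier R" using xt by simp
    have "x t [^] k \<otimes> e = s \<otimes> w' \<ominus> (s' \<otimes> z) \<otimes> w"
    proof -
      have "(s' \<otimes> z) \<otimes> (s \<otimes> u) = s \<otimes> (s' \<otimes> (z \<otimes> u))" using cl by (simp add: m_ac)
      then have "(s' \<otimes> z) \<otimes> (c \<otimes> x t [^] k \<oplus> w) = s \<otimes> (r \<otimes> (x t [^] k \<otimes> x t) \<oplus> w')"
        unfolding c(3) r(3) by simp
      then have eq: "(s' \<otimes> z) \<otimes> (c \<otimes> x t [^] k) \<oplus> (s' \<otimes> z) \<otimes> w = s \<otimes> (r \<otimes> (x t [^] k \<otimes> x t)) \<oplus> s \<otimes> w'"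
        using cl by (simp add: r_distr)
      have cancel: "p \<ominus> q = v \<ominus> o'" if "p \<oplus> o' = q \<oplus> v" "p \<in> carrier R" "q \<in> carrier R" "o' \<in> carrier R" "v \<in> carrier R" for p q o' v
      proof -
        have "p \<ominus> q = (p \<oplus> o') \<ominus> q \<ominus> o'" using that(2-) by algebra
        also have "\<dots> = v \<ominus> o'" unfolding that(1) using that(2-) by algebra
        finally show ?thesis .
      qed
      have "x t [^] k \<otimes> e = (s' \<otimes> z) \<otimes> (c \<otimes> x t [^] k) \<ominus> s \<otimes> (r \<otimes> (x t [^] k \<otimes> x t))"
        unfolding e_def using cl xk by (simp add: a_minus_def r_distr r_minus m_ac)
      also have "\<dots> = s \<otimes> w' \<ominus> (s' \<otimes> z) \<otimes> w"
        using cl xk by (intro cancel[OF eq]) auto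
      finally show ?thesis .
    qed
    moreover have "s \<otimes> w' \<ominus> (s' \<otimes> z) \<otimes> w \<in> ?X a ?T'"
      using cl by (intro sm_diff[OF X'] sm_mult[OF X'] c r) auto
    ultimately have "x t [^] k \<otimes> e \<in> sat R P Sm (?X a ?T')" using sm_sat_incl[OF P sm_subset[OF X']] by auto
    moreover have "x t [^] k \<notin> ?J ?T'" using prime_pow[OF pr[OF T'A] xt] ni[OF T'A, of t] t TA by blast
    ultimately have "e \<in> sat R P Sm (?X a ?T')"
      using less.hyps[of a ?T' "x t [^] k" e] s0 k fT T'A a1 xk eR by auto
    then obtain q where q: "q \<in> carrier R - P" "q \<otimes> e \<in> ?X a ?T'" by (auto simp: sat_self)
    have "q \<otimes> (s' \<otimes> z \<otimes> c) = (q \<otimes> s \<otimes> r) \<otimes> x t [^] (1::nat) \<oplus> q \<otimes> e"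
      unfolding e_def using q cl by (simp add: a_minus_def r_distr r_minus m_ac a_ac r_neg r_neg1 r_neg2)
    then have "q \<otimes> (s' \<otimes> z \<otimes> c) \<in> ?X ?a1 T" using Xin[of "q \<otimes> s \<otimes> r" "q \<otimes> e" 1] q cl by simp
    then have "(q \<otimes> s') \<otimes> (z \<otimes> c) \<in> ?X ?a1 T" using q cl by (simp add: m_ac)
    then have "z \<otimes> c \<in> sat R P Sm (?X ?a1 T)"
      using S.prime_mult[OF P q(1) s'(1)] cl by (auto simp: sat_self)
    then have "c \<in> sat R P Sm (?X ?a1 T)"
      using less.hyps[of ?a1 T z c] s0 s2 k fT TA a1 z c(1) by simp
    then obtain q' where q': "q' \<in> carrier R - P" "q' \<otimes> c \<in> ?X ?a1 T" by (auto simp: sat_self)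
    obtain r' w'' where r': "r' \<in> carrier R" "w'' \<in> ?X a ?T'" "q' \<otimes> c = r' \<otimes> x t [^] (1::nat) \<oplus> w''" using Xout[OF q'(2)] by blast
    have w''R: "w'' \<in> carrier R" using X'M[OF r'(2)] .
    have "(q' \<otimes> s) \<otimes> u = q' \<otimes> (s \<otimes> u)" using q' cl by (simp add: m_assoc)
    also have "\<dots> = (q' \<otimes> c) \<otimes> x t [^] k \<oplus> q' \<otimes> w" unfolding c(3) using q' cl xk by (simp add: r_distr m_ac)
    also have "\<dots> = r' \<otimes> x t [^] Suc k \<oplus> (x t [^] k \<otimes> w'' \<oplus> q' \<otimes> w)"
      unfolding r'(3) using r' q' cl xk w''R by (simp add: l_distr r_distr m_ac a_ac)
    finally have "(q' \<otimes> s) \<otimes> u = r' \<otimes> x t [^] Suc k \<oplus> (x t [^] k \<otimes> w'' \<oplus> q' \<otimes> w)" .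
    moreover have "x t [^] k \<otimes> w'' \<oplus> q' \<otimes> w \<in> ?X a ?T'"
      using q' c(2) r'(2) xk by (intro sm_add[OF X'] sm_mult[OF X']) auto
    ultimately have "(q' \<otimes> s) \<otimes> u \<in> ?X a T" using Xin[OF r'(1), of _ "Suc k"] aeq by simp
    then show ?thesis using S.prime_mult[OF P q'(1) s(1)] u(1) unfolding sat_self by blast
  qed
qed

end

section \<open>Flatness at a regular system of parameters\<close>

context noeth_endo_prime
begin

text \<open>The values of \<open>F\<close> are powers of parameters, so each is regular modulo the
  preceding ones. The last coefficient of a relation is then locally a combination of the preceding
  values, and subtracting Koszul relations with the coefficients of this combination shortens the
  relation.\<close>

lemma flat_at_parameters:
  assumes xP: "\<And>i. i < d \<Longrightarrow> x i \<in> P"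
    and pr: "\<And>T. T \<subseteq> {..<d::nat} \<Longrightarrow> primeideal (sat R P Sm (lspan R Sm (x ` T))) R"
    and ni: "\<And>T j. T \<subseteq> {..<d} \<Longrightarrow> j \<in> {..<d} \<Longrightarrow> j \<notin> T \<Longrightarrow> x j \<notin> sat R P Sm (lspan R Sm (x ` T))"
    and Fx: "\<And>i. i < d \<Longrightarrow> F (x i) = x i [^] (p::nat)" and p: "p \<ge> 1"
  shows "flat_at R F P {..<d} x"
proof -
  interpret S: module R Sm by (rule self_is_module)
  interpret V: module R "fs R {..<d}" by (rule fs_is_module)
  let ?V = "fs R {..<d}"
  let ?ev = "lc R Sm"
  have xR: "x i \<in> carrier R" if "i < d" for i using sm_carr[OF sm_prime[OF P] xP[OF that]] .
  have Z: "syz R {..<d} x \<subseteq> carrier ?V" by (auto simp: syz_def)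
  let ?W = "frob_span R F {..<d} (syz R {..<d} x)"
  have W: "submodule ?W R ?V" by (rule frob_span_submodule[OF Z])
  have satW: "submodule (sat R P ?V ?W) R ?V" by (rule V.sat_submodule[OF P W])
  have evF: "semilinear R (\<lambda>r. r) ?V Sm (?ev (\<lambda>i. F (x i)))" by (rule ev_linear) (simp add: xR)
  have evx: "semilinear R (\<lambda>r. r) ?V Sm (?ev x)" by (rule ev_linear) (simp add: xR)
  have syzF: "submodule (syz R {..<d} (\<lambda>i. F (x i))) R ?V" by (rule syz_submodule) (simp add: xR)
  have Wsyz: "w \<in> syz R {..<d} (\<lambda>i. F (x i))" if "w \<in> ?W" for w
  proof -
    have "?W \<subseteq> syz R {..<d} (\<lambda>i. F (x i))" unfolding frob_span_def
    proof (rule V.lspan_minimal[OF syzF], clarify)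
      fix c assume c: "c \<in> syz R {..<d} x"
      then have cV: "c \<in> carrier ?V" by (simp add: syz_def)
      have "F (?ev x c) = ?ev (\<lambda>i. F (x i)) (\<lambda>i. F (c i))" by (rule F_lc_self[OF cV]) (simp add: xR)
      then show "(\<lambda>i. F (c i)) \<in> syz R {..<d} (\<lambda>i. F (x i))"
        using c semilinearD(1)[OF F_fs cV] by (simp add: syz_def)
    qed
    then show ?thesis using that by blast
  qed
  have "k \<le> d \<Longrightarrow> u \<in> syz R {..<d} (\<lambda>i. F (x i)) \<Longrightarrow> (\<forall>i\<ge>k. u i = \<zero>) \<Longrightarrow> u \<in> sat R P ?V ?W" for k u
  proof (induction k arbitrary: u)
    case 0
    then have "u = \<zero>\<^bsub>?V\<^esub>" by (auto simp: fs_simps)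
    then show ?case using V.submodule_zero[OF satW] by simp
  next
    case (Suc k)
    then have kd: "k < d" by simp
    have uV: "u \<in> carrier ?V" using Suc.prems by (simp add: syz_def)
    have ukR: "u k \<in> carrier R" using fs_closed[OF uV] .
    let ?A = "{..<k}"
    define u0 where "u0 = u(k := \<zero>)"
    have u0A: "u0 \<in> carrier (fs R ?A)"
    proof -
      have "{i. u0 i \<noteq> \<zero>} \<subseteq> {i. u i \<noteq> \<zero>}" by (auto simp: u0_def)
      moreover have "{i. u0 i \<noteq> \<zero>} \<subseteq> ?A" using Suc.prems(3) by (auto simp: u0_def not_less_eq_eq[symmetric] le_less_linear) (metis Suc_leI le_neq_implies_less not_less)
      ultimately show ?thesis using uV by (auto simp: fs_carrier u0_def intro: finite_subset)
    qed
    have u0V: "u0 \<in> carrier ?V" using fs_mono[OF u0A] kd by auto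
    have sk: "single R k (u k) \<in> carrier ?V" using single_fs[of k "{..<d}" "u k"] kd ukR by simp
    have "u = u0 \<oplus>\<^bsub>?V\<^esub> single R k (u k)" using fs_closed[OF uV] by (auto simp: fs_simps u0_def single_def)
    then have "\<zero> = ?ev (\<lambda>i. F (x i)) u0 \<oplus> ?ev (\<lambda>i. F (x i)) (single R k (u k))"
      using Suc.prems(2) semilinearD(2)[OF evF u0V sk] by (simp add: syz_def self_simps)
    moreover have "?ev (\<lambda>i. F (x i)) (single R k (u k)) = u k \<otimes> F (x k)"
      using S.lc_single[of "u k" "\<lambda>i. F (x i)" k] ukR xR[OF kd] by (simp add: self_simps)
    moreover have e0R: "?ev (\<lambda>i. F (x i)) u0 \<in> carrier R" using semilinearD(1)[OF evF u0V] by (simp add: self_simps)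
    ultimately have uk: "F (x k) \<otimes> u k = \<ominus> ?ev (\<lambda>i. F (x i)) u0"
      using ukR xR[OF kd] by (simp add: m_comm minus_equality a_comm)
    have Ad: "?A \<subseteq> {..<d}" using kd by auto
    have im: "(\<lambda>t. x t [^] p) ` ?A = (\<lambda>t. F (x t)) ` ?A" using Fx kd by (intro image_cong) auto
    have FR: "(\<lambda>t. F (x t)) ` ?A \<subseteq> carrier R" using xR kd by auto
    have L: "submodule (lspan R Sm ((\<lambda>t. F (x t)) ` ?A)) R Sm" by (rule sm_lspan[OF FR])
    have "?ev (\<lambda>i. F (x i)) u0 \<in> lspan R Sm ((\<lambda>t. F (x t)) ` ?A)"
      using sm_lspan_incl[OF FR] by (intro S.lc_in_submodule[OF u0A L]) auto
    then have "F (x k) \<otimes> u k \<in> lspan R Sm ((\<lambda>t. F (x t)) ` ?A)" unfolding uk by (rule sm_neg[OF L])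
    then have mem: "x k [^] p \<otimes> u k \<in> sat R P Sm (lspan R Sm ((\<lambda>t. x t [^] p) ` ?A))"
      unfolding im using Fx[OF kd] sm_sat_incl[OF P sm_subset[OF L]] by auto
    have nin: "x k [^] p \<notin> sat R P Sm (lspan R Sm (x ` ?A))"
      using prime_pow[OF pr[OF Ad] xR[OF kd]] ni[OF Ad, of k] kd by auto
    have "u k \<in> sat R P Sm (lspan R Sm ((\<lambda>t. x t [^] p) ` ?A))"
      by (rule powers_regular[OF P _ pr ni _ Ad _ _ nin ukR mem]) (use xR p kd in auto)
    then obtain s where s: "s \<in> carrier R - P" "s \<otimes> u k \<in> lspan R Sm ((\<lambda>t. F (x t)) ` ?A)"
      unfolding im by (auto simp: sat_self)
    obtain g where g: "g \<in> carrier (fs R ?A)" "s \<otimes> u k = ?ev (\<lambda>t. F (x t)) g"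
      using S.lspan_image_lc[OF s(2)] FR by (auto simp: self_simps)
    \<comment> \<open>The Koszul relation between \<open>x i\<close> and \<open>x k\<close>; its
      image under \<open>F\<close> is the Koszul relation between their powers.\<close>
    define \<kappa> where "\<kappa> i = single R k (x i) \<ominus>\<^bsub>?V\<^esub> single R i (x k)" for i
    have s1: "single R k (x i) \<in> carrier ?V" "single R i (x k) \<in> carrier ?V" if "i < k" for i
      using that kd xR by (auto intro!: single_fs)
    have \<kappa>V: "\<kappa> i \<in> carrier ?V" if "i < k" for i unfolding \<kappa>_def using s1[OF that] by simp
    have \<kappa>val: "\<kappa> i j = single R k (x i) j \<oplus> \<ominus> (single R i (x k) j)" if "i < k" for i j
      using semilinear_minus[OF V.module_axioms S.module_axioms fs_proj s1(2)[OF that]] s1(2)[OF that]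
        S.M.minus_equality[of "\<ominus> (single R i (x k) j)" "single R i (x k) j"] fs_closed[OF s1(2)[OF that]]
      by (simp add: \<kappa>_def a_minus_def fs_simps self_simps l_neg)
    have \<kappa>Z: "\<kappa> i \<in> syz R {..<d} x" if i: "i < k" for i
    proof -
      have i': "i < d" using i kd by simp
      have "?ev x (\<kappa> i) = ?ev x (single R k (x i)) \<oplus>\<^bsub>Sm\<^esub> ?ev x (\<ominus>\<^bsub>?V\<^esub> single R i (x k))"
        unfolding \<kappa>_def a_minus_def using s1[OF i] by (intro semilinearD(2)[OF evx]) auto
      also have "?ev x (\<ominus>\<^bsub>?V\<^esub> single R i (x k)) = \<ominus>\<^bsub>Sm\<^esub> ?ev x (single R i (x k))"
        using s1[OF i] by (intro semilinear_minus[OF V.module_axioms S.module_axioms evx]) auto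
      also have "?ev x (single R i (x k)) = ?ev x (single R k (x i))"
        using S.lc_single[of "x i" x k] S.lc_single[of "x k" x i] xR[OF i'] xR[OF kd] by (simp add: self_simps m_comm)
      also have "?ev x (single R k (x i)) \<oplus>\<^bsub>Sm\<^esub> \<ominus>\<^bsub>Sm\<^esub> ?ev x (single R k (x i)) = \<zero>\<^bsub>Sm\<^esub>"
        using semilinearD(1)[OF evx s1(1)[OF i]] by (rule S.M.r_neg)
      finally show ?thesis using \<kappa>V[OF i] by (simp add: syz_def self_simps)
    qed
    have F\<kappa>W: "(\<lambda>j. F (\<kappa> i j)) \<in> ?W" if "i < k" for i
      unfolding frob_span_def using \<kappa>Z[OF that] V.lspan_incl[OF F_image_fs[OF Z]] by blast
    have F\<kappa>V: "\<And>i. i \<in> ?A \<Longrightarrow> (\<lambda>j. F (\<kappa> i j)) \<in> carrier ?V" using F\<kappa>W V.submodule_carr[OF W] by auto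
    define w where "w = lc R ?V (\<lambda>i j. F (\<kappa> i j)) g"
    have wW: "w \<in> ?W" unfolding w_def using F\<kappa>W by (intro V.lc_in_submodule[OF g(1) W]) auto
    have wV: "w \<in> carrier ?V" using V.submodule_carr[OF W wW] .
    have wj: "w j = ?ev (\<lambda>i. F (\<kappa> i j)) g" for j unfolding w_def by (rule lc_fs_apply[OF g(1) F\<kappa>V])
    have wk: "w k = s \<otimes> u k"
    proof -
      have "w k = ?ev (\<lambda>t. F (x t)) g" unfolding wj
        using xR kd by (intro S.lc_cong[OF g(1)]) (auto simp: \<kappa>val single_def self_simps)
      then show ?thesis using g by simp
    qed
    have wz: "w j = \<zero>" if "j > k" for j
    proof -
      have "w j = ?ev (\<lambda>t. \<zero>) g" unfolding wj
        using xR kd that by (intro S.lc_cong[OF g(1)]) (auto simp: \<kappa>val single_def self_simps)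
      also have "\<dots> = \<zero>"
        using S.lc_in_submodule[OF g(1) S.zero_submodule, of "\<lambda>t. \<zero>"] by (simp add: self_simps)
      finally show ?thesis .
    qed
    \<comment> \<open>\<open>w\<close> agrees with \<open>s u\<close> at \<open>k\<close> and
      vanishes beyond, so \<open>v\<close> vanishes from \<open>k\<close> on.\<close>
    define v where "v = s \<odot>\<^bsub>?V\<^esub> u \<ominus>\<^bsub>?V\<^esub> w"
    have suV: "s \<odot>\<^bsub>?V\<^esub> u \<in> carrier ?V" using s uV by simp
    have vval: "v j = s \<otimes> u j \<oplus> \<ominus> (w j)" for j
      using semilinear_minus[OF V.module_axioms S.module_axioms fs_proj wV]
        S.M.minus_equality[of "\<ominus> (w j)" "w j"] fs_closed[OF wV]
      by (simp add: v_def a_minus_def fs_simps self_simps l_neg)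
    have "v \<in> syz R {..<d} (\<lambda>i. F (x i))" unfolding v_def
      using V.submodule_diff[OF syzF V.submodule_smult[OF syzF _ Suc.prems(2)] Wsyz[OF wW]] s by blast
    moreover have "\<forall>j\<ge>k. v j = \<zero>"
    proof (intro allI impI)
      fix j assume j: "j \<ge> k"
      show "v j = \<zero>"
      proof (cases "j = k")
        case True then show ?thesis using vval wk s ukR by (simp add: r_neg)
      next
        case False
        then have "j > k" using j by simp
        then have "u j = \<zero>" "w j = \<zero>" using Suc.prems(3) wz by auto
        then show ?thesis using vval s by simp
      qed
    qed
    ultimately have "v \<in> sat R P ?V ?W" using Suc.IH[of v] kd by auto
    moreover have "w \<in> sat R P ?V ?W" using V.sat_incl[OF P V.submoduleE(1)[OF W]] wW by blast
    ultimately have "v \<oplus>\<^bsub>?V\<^esub> w \<in> sat R P ?V ?W" by (rule V.submodule_add[OF satW])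
    moreover have "v \<oplus>\<^bsub>?V\<^esub> w = s \<odot>\<^bsub>?V\<^esub> u"
      unfolding v_def a_minus_def using suV wV by (simp add: V.M.a_assoc V.M.l_neg)
    ultimately show ?case using V.sat_cancel[OF P s(1) uV] by simp
  qed
  note main = this
  show ?thesis unfolding flat_at_def
  proof
    fix u assume u: "u \<in> syz R {..<d} (\<lambda>i. F (x i))"
    then have "\<forall>i\<ge>d. u i = \<zero>" using fs_outside[of u "{..<d}"] by (auto simp: syz_def)
    then show "u \<in> sat R P ?V ?W" using main[of d u] u by blast
  qed
qed

lemma flat_at_regular:
  assumes ch: "prime_chain R d Q" "Q d = P" and xP: "x ` {..<d} \<subseteq> P"
    and PS: "P \<subseteq> sat R P Sm (lspan R Sm (x ` {..<d}))"
    and Fx: "\<And>r. r \<in> carrier R \<Longrightarrow> F r = r [^] (p::nat)" and p: "p \<ge> 1"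
    and b: "\<And>i. i < n \<Longrightarrow> b i \<in> carrier R"
  shows "flat_at R F P {..<n::nat} b"
proof (rule flat_at_all[OF _ PS _ b])
  show xi: "\<And>i. i < d \<Longrightarrow> x i \<in> P" using xP by auto
  show "flat_at R F P {..<d} x"
  proof (rule flat_at_parameters[OF xi _ _ _ p])
    show "F (x i) = x i [^] p" if "i < d" for i
      using Fx sm_carr[OF sm_prime[OF P] xi[OF that]] by blast
  qed (use regular_parameters[OF noeth P ch xP PS] in auto)
qed

end

text \<open>Operations on fractions and limit classes are unions over representatives; this
  evaluates them once the result is known to be independent of the representative.\<close>

lemma UN_pair_const:
  assumes "p \<in> X" "\<And>x s. (x, s) \<in> X \<Longrightarrow> f x s = c" shows "(\<Union>(x, s)\<in>X. f x s) = c"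
proof
  show "(\<Union>(x, s)\<in>X. f x s) \<subseteq> c" using assms(2) by auto
  obtain x s where "p = (x, s)" by (cases p)
  then show "c \<subseteq> (\<Union>(x, s)\<in>X. f x s)" using assms(1) assms(2)[of x s] by blast
qed

section \<open>Contraction of primes from the localization\<close>

locale prime_localization = cring R for R (structure) +
  fixes P
  assumes P: "primeideal P R"
begin

abbreviation S where "S \<equiv> carrier R - P"
abbreviation A where "A \<equiv> localized_ring R S"
definition fr where "fr x s = fraction S Sm x s"

lemma one_S: "\<one> \<in> S" using module.prime_one[OF self_is_module P] .

lemma mult_S: "s \<in> S \<Longrightarrow> t \<in> S \<Longrightarrow> s \<otimes> t \<in> S"
  by (rule module.prime_mult[OF self_is_module P])

lemma mem_fr: "(y, t) \<in> fr x s \<longleftrightarrow> y \<in> carrier R \<and> t \<in> S \<and> (\<exists>u\<in>S. u \<otimes> (t \<otimes> x) = u \<otimes> (s \<otimes> y))"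
  by (auto simp: fr_def fraction_def self_simps)

lemma fr_trans:
  assumes "x \<in> carrier R" "y \<in> carrier R" "z \<in> carrier R" "s \<in> S" "t \<in> S" "w \<in> S"
    and "(y, t) \<in> fr x s" "(z, w) \<in> fr y t"
  shows "(z, w) \<in> fr x s"
proof -
  obtain u v where u: "u \<in> S" "u \<otimes> (t \<otimes> x) = u \<otimes> (s \<otimes> y)" and v: "v \<in> S" "v \<otimes> (w \<otimes> y) = v \<otimes> (t \<otimes> z)"
    using assms by (auto simp: mem_fr)
  have "(u \<otimes> v \<otimes> t) \<otimes> (w \<otimes> x) = (v \<otimes> w) \<otimes> (u \<otimes> (t \<otimes> x))" using assms(1-6) u(1) v(1) by (simp add: m_ac)
  also have "\<dots> = (u \<otimes> s) \<otimes> (v \<otimes> (w \<otimes> y))" unfolding u(2) using assms(1-6) u(1) v(1) by (simp add: m_ac)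
  also have "\<dots> = (u \<otimes> v \<otimes> t) \<otimes> (s \<otimes> z)" unfolding v(2) using assms(1-6) u(1) v(1) by (simp add: m_ac)
  finally show ?thesis using assms mult_S u v by (auto simp: mem_fr intro!: bexI[of _ "u \<otimes> v \<otimes> t"])
qed

lemma fr_sym:
  assumes "x \<in> carrier R" "s \<in> S" "(y, t) \<in> fr x s" shows "(x, s) \<in> fr y t"
  using assms by (force simp: mem_fr)

lemma fr_refl: "x \<in> carrier R \<Longrightarrow> s \<in> S \<Longrightarrow> (x, s) \<in> fr x s"
  using one_S by (auto simp: mem_fr)

lemma fr_eq_iff:
  assumes "x \<in> carrier R" "y \<in> carrier R" "s \<in> S" "t \<in> S"
  shows "fr x s = fr y t \<longleftrightarrow> (\<exists>u\<in>S. u \<otimes> (t \<otimes> x) = u \<otimes> (s \<otimes> y))"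
proof
  assume "fr x s = fr y t"
  then have "(y, t) \<in> fr x s" using fr_refl assms by simp
  then show "\<exists>u\<in>S. u \<otimes> (t \<otimes> x) = u \<otimes> (s \<otimes> y)" by (simp add: mem_fr)
next
  assume "\<exists>u\<in>S. u \<otimes> (t \<otimes> x) = u \<otimes> (s \<otimes> y)"
  then have xy: "(y, t) \<in> fr x s" using assms by (simp add: mem_fr)
  then have yx: "(x, s) \<in> fr y t" using fr_sym assms by blast
  have mem: "a \<in> carrier R \<and> b \<in> S" if "(a, b) \<in> fr x s \<or> (a, b) \<in> fr y t" for a b using that by (auto simp: mem_fr)
  show "fr x s = fr y t"
  proof (rule Set.set_eqI)
    fix p :: "'a \<times> 'a"
    obtain a b where p: "p = (a, b)" by (cases p)
    show "p \<in> fr x s \<longleftrightarrow> p \<in> fr y t"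
      unfolding p using fr_trans[OF assms(1,2) _ assms(3,4) _ xy, of a b] fr_trans[OF assms(2,1) _ assms(4,3) _ yx, of a b] mem[of a b] by blast
  qed
qed

lemma A_carrier: "carrier A = {fr x s |x s. x \<in> carrier R \<and> s \<in> S}"
  by (simp add: localized_ring_def localized_module_def fr_def self_simps)

lemma A_one: "\<one>\<^bsub>A\<^esub> = fr \<one> \<one>"
  by (simp add: localized_ring_def fr_def)

lemma A_zero: "\<zero>\<^bsub>A\<^esub> = fr \<zero> \<one>"
  by (simp add: localized_ring_def localized_module_def fr_def self_simps)

lemma A_mult:
  assumes "x \<in> carrier R" "y \<in> carrier R" "s \<in> S" "t \<in> S"
  shows "fr x s \<otimes>\<^bsub>A\<^esub> fr y t = fr (x \<otimes> y) (s \<otimes> t)"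
proof -
  have eq: "fr (x' \<otimes> y') (s' \<otimes> t') = fr (x \<otimes> y) (s \<otimes> t)" if m: "(x', s') \<in> fr x s" "(y', t') \<in> fr y t" for x' s' y' t'
  proof -
    obtain u v where u: "u \<in> S" "u \<otimes> (s' \<otimes> x) = u \<otimes> (s \<otimes> x')" and v: "v \<in> S" "v \<otimes> (t' \<otimes> y) = v \<otimes> (t \<otimes> y')"
      and c: "x' \<in> carrier R" "y' \<in> carrier R" "s' \<in> S" "t' \<in> S" using m by (auto simp: mem_fr)
    have "(u \<otimes> v) \<otimes> ((s' \<otimes> t') \<otimes> (x \<otimes> y)) = (u \<otimes> (s' \<otimes> x)) \<otimes> (v \<otimes> (t' \<otimes> y))"
      using assms u(1) v(1) c by (simp add: m_ac)
    also have "\<dots> = (u \<otimes> v) \<otimes> ((s \<otimes> t) \<otimes> (x' \<otimes> y'))" unfolding u(2) v(2)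
      using assms u(1) v(1) c by (simp add: m_ac)
    finally have "\<exists>u\<in>S. u \<otimes> ((s' \<otimes> t') \<otimes> (x \<otimes> y)) = u \<otimes> ((s \<otimes> t) \<otimes> (x' \<otimes> y'))"
      using mult_S[OF u(1) v(1)] by blast
    then show ?thesis
      by (rule fr_eq_iff[THEN iffD2, symmetric, rotated 4]) (use assms c mult_S[OF c(3,4)] mult_S[OF assms(3,4)] in simp_all)
  qed
  have "fr x s \<otimes>\<^bsub>A\<^esub> fr y t = (\<Union>(x', s')\<in>fr x s. \<Union>(y', t')\<in>fr y t. fr (x' \<otimes> y') (s' \<otimes> t'))"
    by (simp add: localized_ring_def fr_def)
  also have "\<dots> = fr (x \<otimes> y) (s \<otimes> t)"
    by (rule UN_pair_const[OF fr_refl[OF assms(1,3)]], rule UN_pair_const[OF fr_refl[OF assms(2,4)]]) (rule eq)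
  finally show ?thesis .
qed

lemma A_add:
  assumes "x \<in> carrier R" "y \<in> carrier R" "s \<in> S" "t \<in> S"
  shows "fr x s \<oplus>\<^bsub>A\<^esub> fr y t = fr (t \<otimes> x \<oplus> s \<otimes> y) (s \<otimes> t)"
proof -
  have eq: "fr (t' \<otimes> x' \<oplus> s' \<otimes> y') (s' \<otimes> t') = fr (t \<otimes> x \<oplus> s \<otimes> y) (s \<otimes> t)"
    if m: "(x', s') \<in> fr x s" "(y', t') \<in> fr y t" for x' s' y' t'
  proof -
    obtain u v where u: "u \<in> S" "u \<otimes> (s' \<otimes> x) = u \<otimes> (s \<otimes> x')" and v: "v \<in> S" "v \<otimes> (t' \<otimes> y) = v \<otimes> (t \<otimes> y')"
      and c: "x' \<in> carrier R" "y' \<in> carrier R" "s' \<in> S" "t' \<in> S" using m by (auto simp: mem_fr)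
    have "(u \<otimes> v) \<otimes> ((s' \<otimes> t') \<otimes> (t \<otimes> x \<oplus> s \<otimes> y))
      = (v \<otimes> t' \<otimes> t) \<otimes> (u \<otimes> (s' \<otimes> x)) \<oplus> (u \<otimes> s' \<otimes> s) \<otimes> (v \<otimes> (t' \<otimes> y))"
      using assms u(1) v(1) c by (simp add: m_ac r_distr)
    also have "\<dots> = (u \<otimes> v) \<otimes> ((s \<otimes> t) \<otimes> (t' \<otimes> x' \<oplus> s' \<otimes> y'))" unfolding u(2) v(2)
      using assms u(1) v(1) c by (simp add: m_ac r_distr)
    finally have "\<exists>u\<in>S. u \<otimes> ((s' \<otimes> t') \<otimes> (t \<otimes> x \<oplus> s \<otimes> y)) = u \<otimes> ((s \<otimes> t) \<otimes> (t' \<otimes> x' \<oplus> s' \<otimes> y'))"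
      using mult_S[OF u(1) v(1)] by blast
    then show ?thesis
      by (rule fr_eq_iff[THEN iffD2, symmetric, rotated 4]) (use assms c mult_S[OF c(3,4)] mult_S[OF assms(3,4)] in simp_all)
  qed
  have "fr x s \<oplus>\<^bsub>A\<^esub> fr y t = (\<Union>(x', s')\<in>fr x s. \<Union>(y', t')\<in>fr y t. fr (t' \<otimes> x' \<oplus> s' \<otimes> y') (s' \<otimes> t'))"
    by (simp add: localized_ring_def localized_module_def fr_def self_simps)
  also have "\<dots> = fr (t \<otimes> x \<oplus> s \<otimes> y) (s \<otimes> t)"
    by (rule UN_pair_const[OF fr_refl[OF assms(1,3)]], rule UN_pair_const[OF fr_refl[OF assms(2,4)]]) (rule eq)
  finally show ?thesis .
qed

lemma fr_A: "x \<in> carrier R \<Longrightarrow> s \<in> S \<Longrightarrow> fr x s \<in> carrier A"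
  by (auto simp: A_carrier)

lemma fr_unit:
  assumes "x \<in> S" "s \<in> S" shows "fr x s \<otimes>\<^bsub>A\<^esub> fr s x = \<one>\<^bsub>A\<^esub>"
  using assms one_S mult_S by (subst A_mult, simp_all add: A_one, subst fr_eq_iff) (auto simp: m_comm intro!: bexI[of _ \<one>])

lemma fr_factor:
  assumes "x \<in> carrier R" "s \<in> S"
  shows "fr s \<one> \<otimes>\<^bsub>A\<^esub> fr x s = fr x \<one>" "fr \<one> s \<otimes>\<^bsub>A\<^esub> fr x \<one> = fr x s"
proof -
  have "fr s \<one> \<otimes>\<^bsub>A\<^esub> fr x s = fr (s \<otimes> x) (\<one> \<otimes> s)" using assms one_S by (intro A_mult) auto
  also have "\<dots> = fr x \<one>" using assms one_S by (subst fr_eq_iff) (auto intro!: bexI[of _ \<one>])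
  finally show "fr s \<one> \<otimes>\<^bsub>A\<^esub> fr x s = fr x \<one>" .
  have "fr \<one> s \<otimes>\<^bsub>A\<^esub> fr x \<one> = fr (\<one> \<otimes> x) (s \<otimes> \<one>)" using assms one_S by (intro A_mult) auto
  also have "\<dots> = fr x s" using assms by simp
  finally show "fr \<one> s \<otimes>\<^bsub>A\<^esub> fr x \<one> = fr x s" .
qed

text \<open>That \<open>A\<close> is a commutative ring is a premise because it comes with
  \<open>regular_local_ring A\<close>; only the formulas for sums and products of fractions have to
  be computed.\<close>

lemma preimage_prime:
  assumes "cring A" and Q: "primeideal Q A"
  shows "primeideal {r \<in> carrier R. fr r \<one> \<in> Q} R" "{r \<in> carrier R. fr r \<one> \<in> Q} \<subseteq> P"
proof -
  interpret A: cring A by fact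
  have Qs: "submodule Q A (self_module A)" by (rule A.sm_prime[OF Q])
  let ?I = "{r \<in> carrier R. fr r \<one> \<in> Q}"
  have n1: "\<one>\<^bsub>A\<^esub> \<notin> Q" using module.prime_one[OF A.self_is_module Q] by blast
  show sub: "?I \<subseteq> P"
  proof clarify
    fix r assume r: "r \<in> carrier R" "fr r \<one> \<in> Q"
    show "r \<in> P"
    proof (rule ccontr)
      assume "r \<notin> P"
      then have rS: "r \<in> S" using r by simp
      have "fr r \<one> \<otimes>\<^bsub>A\<^esub> fr \<one> r \<in> Q" using A.sm_mult2[OF Qs _ r(2)] fr_A[of \<one> r] rS by simp
      then show False using fr_unit[OF rS one_S] n1 by simp
    qed
  qed
  show "primeideal ?I R"
  proof (rule primeidealI)
    show "ideal ?I R" unfolding ideal_iff_submodule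
    proof (rule module.submoduleI2[OF self_is_module])
      show "?I \<subseteq> carrier Sm" by (auto simp: self_simps)
      show "\<zero>\<^bsub>Sm\<^esub> \<in> ?I" using A.sm_zero[OF Qs] by (simp add: self_simps A_zero)
      show "a \<oplus>\<^bsub>Sm\<^esub> b \<in> ?I" if "a \<in> ?I" "b \<in> ?I" for a b
        using that A_add[of a b \<one> \<one>] one_S A.sm_add[OF Qs, of "fr a \<one>" "fr b \<one>"] by (simp add: self_simps)
      show "a \<odot>\<^bsub>Sm\<^esub> x \<in> ?I" if "a \<in> carrier R" "x \<in> ?I" for a x
        using that A_mult[of a x \<one> \<one>] one_S A.sm_mult[OF Qs, of "fr a \<one>" "fr x \<one>"] fr_A[of a \<one>] by (simp add: self_simps)
    qed
    show "cring R" by (rule is_cring)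
    show "carrier R \<noteq> ?I" using sub one_S by blast
    fix a b assume ab: "a \<in> carrier R" "b \<in> carrier R" "a \<otimes> b \<in> ?I"
    then have "fr a \<one> \<otimes>\<^bsub>A\<^esub> fr b \<one> \<in> Q" using A_mult[of a b \<one> \<one>] one_S by simp
    then show "a \<in> ?I \<or> b \<in> ?I" using primeideal.I_prime[OF Q fr_A fr_A, of a \<one> b \<one>] ab one_S by auto
  qed
qed

lemma preimage_strict:
  assumes "cring A" "primeideal Q A" "primeideal Q' A" "Q \<subset> Q'"
  shows "{r \<in> carrier R. fr r \<one> \<in> Q} \<subset> {r \<in> carrier R. fr r \<one> \<in> Q'}"
proof -
  interpret A: cring A by fact
  obtain a where a: "a \<in> Q'" "a \<notin> Q" using assms by blast
  have "a \<in> carrier A" using A.sm_carr[OF A.sm_prime[OF assms(3)] a(1)] .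
  then obtain x s where x: "x \<in> carrier R" "s \<in> S" "a = fr x s" by (auto simp: A_carrier)
  have "fr x \<one> \<in> Q'" using A.sm_mult[OF A.sm_prime[OF assms(3)] _ a(1), of "fr s \<one>"] fr_factor(1)[OF x(1,2)] fr_A[of s \<one>] x one_S by simp
  moreover have "fr x \<one> \<notin> Q"
    using A.sm_mult[OF A.sm_prime[OF assms(2)], of "fr \<one> s" "fr x \<one>"] fr_factor(2)[OF x(1,2)] fr_A[of \<one> s] x a one_S by auto
  ultimately show ?thesis using assms x by blast
qed

text \<open>If some \<open>x \<in> P\<close> had its fraction outside \<open>m\<close>, then
  \<open>\<one>\<close> would be a multiple of that fraction plus some \<open>\<mu> \<in> m\<close>.
  Clearing denominators shows that the numerator of \<open>\<mu>\<close> is not in \<open>P\<close>,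
  so \<open>\<mu>\<close> would be a unit in \<open>m\<close>.\<close>

lemma preimage_maximal:
  assumes "cring A" and m: "maximalideal m A"
  shows "{r \<in> carrier R. fr r \<one> \<in> m} = P"
proof
  interpret A: cring A by fact
  have pm: "primeideal m A" by (rule A.maximalideal_prime[OF m])
  have ms: "submodule m A (self_module A)" by (rule A.sm_prime[OF pm])
  show "{r \<in> carrier R. fr r \<one> \<in> m} \<subseteq> P" by (rule preimage_prime(2)[OF assms(1) pm])
  show "P \<subseteq> {r \<in> carrier R. fr r \<one> \<in> m}"
  proof
    fix x assume x: "x \<in> P"
    have xR: "x \<in> carrier R" using sm_carr[OF sm_prime[OF P] x] .
    have xA: "fr x \<one> \<in> carrier A" using fr_A xR one_S by blast
    have "fr x \<one> \<in> m"
    proof (rule ccontr)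
      assume nm: "fr x \<one> \<notin> m"
      let ?L = "lspan A (self_module A) (insert (fr x \<one>) m)"
      have sub: "insert (fr x \<one>) m \<subseteq> carrier A" using xA A.sm_subset[OF ms] by blast
      have L: "ideal ?L A" using A.sm_lspan[OF sub] A.ideal_iff_submodule by blast
      have "?L = carrier A"
        using maximalideal.I_maximal[OF m L] A.sm_lspan_incl[OF sub] A.sm_subset[OF A.sm_lspan[OF sub]] nm by blast
      then have "\<one>\<^bsub>A\<^esub> \<in> ?L" by simp
      then obtain r \<mu> where r: "r \<in> carrier A" "\<mu> \<in> m" "\<one>\<^bsub>A\<^esub> = r \<otimes>\<^bsub>A\<^esub> fr x \<one> \<oplus>\<^bsub>A\<^esub> \<mu>"
        using A.sm_lspan_insert[OF ms xA] by blast
      obtain a s where a: "a \<in> carrier R" "s \<in> S" "r = fr a s" using r by (auto simp: A_carrier)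
      have "\<mu> \<in> carrier A" using A.sm_carr[OF ms r(2)] .
      then obtain y t where y: "y \<in> carrier R" "t \<in> S" "\<mu> = fr y t" by (auto simp: A_carrier)
      have "fr \<one> \<one> = fr (t \<otimes> (a \<otimes> x) \<oplus> s \<otimes> y) (s \<otimes> t)"
        using r(3) A_mult[OF a(1) xR a(2) one_S] A_add[of "a \<otimes> x" y s t] a y xR by (simp add: A_one)
      then obtain u where u: "u \<in> S" "u \<otimes> ((s \<otimes> t) \<otimes> \<one>) = u \<otimes> (\<one> \<otimes> (t \<otimes> (a \<otimes> x) \<oplus> s \<otimes> y))"
        using fr_eq_iff[of \<one> "t \<otimes> (a \<otimes> x) \<oplus> s \<otimes> y" \<one> "s \<otimes> t"] a y xR one_S mult_S by auto
      have yP: "y \<notin> P"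
      proof
        assume yP: "y \<in> P"
        have "u \<otimes> (t \<otimes> (a \<otimes> x) \<oplus> s \<otimes> y) \<in> P"
          using u(1) a y x yP by (intro sm_mult[OF sm_prime[OF P]] sm_add[OF sm_prime[OF P]]) auto
        then have "u \<otimes> (s \<otimes> t) \<in> P" using u a y xR by simp
        then show False using mult_S[OF u(1) mult_S[OF a(2) y(2)]] by blast
      qed
      then have "fr y t \<otimes>\<^bsub>A\<^esub> fr t y \<in> m" using A.sm_mult2[OF ms _ r(2), of "fr t y"] y fr_A[of t y] by simp
      then have "\<one>\<^bsub>A\<^esub> \<in> m" using fr_unit[of y t] y yP by simp
      then show False using module.prime_one[OF A.self_is_module pm] by blast
    qed
    then show "x \<in> {r \<in> carrier R. fr r \<one> \<in> m}" using xR by simp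
  qed
qed

lemma regular_local_parameters:
  assumes reg: "regular_local_ring A"
  obtains d :: nat and Q x where "prime_chain R d Q" "Q d = P" "x ` {..<d} \<subseteq> P"
    "P \<subseteq> sat R P Sm (lspan R Sm (x ` {..<d}))"
proof -
  interpret A: cring A using reg by (simp add: regular_local_ring_def)
  obtain m G where m: "{J. maximalideal J A} = {m}" and G: "G \<subseteq> carrier A" "finite G" "m = Idl\<^bsub>A\<^esub> G" "enat (card G) = krull_dim A"
    using reg by (auto simp: regular_local_ring_def)
  have mm: "maximalideal m A" using m by blast
  have pm: "primeideal m A" by (rule A.maximalideal_prime[OF mm])
  note pre = preimage_maximal[OF A.is_cring mm]
  \<comment> \<open>The dimension is a supremum in the extended natural numbers. Being finite and
    taken over a nonempty set, it is attained, so there is a chain whose length is exactly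
    \<open>card G\<close>.\<close>
  let ?X = "{enat n |n. \<exists>Q. (\<forall>i\<le>n. Q i \<in> Spec A) \<and> (\<forall>i<n. Q i \<subset> Q (Suc i))}"
  have sup: "Sup ?X = enat (card G)" using G(4) by (simp add: krull_dim_def)
  have "enat 0 \<in> ?X" using pm by (auto simp: Spec_def intro!: exI[of _ "\<lambda>_. m"])
  then have ne: "?X \<noteq> {}" by blast
  then have "finite ?X" using sup by (auto simp: Sup_enat_def split: if_splits)
  then have "Sup ?X \<in> ?X" using ne by (simp only: Sup_enat_def if_False if_True) (rule Max_in)
  then have "enat (card G) \<in> ?X" using sup by simp
  then obtain Q where Q: "\<And>i. i \<le> card G \<Longrightarrow> primeideal (Q i) A" "\<And>i. i < card G \<Longrightarrow> Q i \<subset> Q (Suc i)"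
    by (auto simp: Spec_def)
  define Q' where "Q' i = {r \<in> carrier R. fr r \<one> \<in> Q i}" for i
  have Q'p: "primeideal (Q' i) R" "Q' i \<subseteq> P" if "i \<le> card G" for i
    unfolding Q'_def using preimage_prime[OF A.is_cring Q(1)[OF that]] by auto
  have Q's: "Q' i \<subset> Q' (Suc i)" if "i < card G" for i
    unfolding Q'_def using preimage_strict[OF A.is_cring Q(1) Q(1) Q(2)] that by auto
  \<comment> \<open>The top of the contracted chain is so far only known to be contained in
    \<open>P\<close>; putting \<open>P\<close> in its place keeps the chain strict.\<close>
  have ch: "prime_chain R (card G) (Q'(card G := P))"
    unfolding prime_chain_def
  proof (intro conjI allI impI)
    fix i assume "i \<le> card G"
    then show "primeideal ((Q'(card G := P)) i) R" using Q'p P by auto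
  next
    fix i assume i: "i < card G"
    then show "(Q'(card G := P)) i \<subset> (Q'(card G := P)) (Suc i)"
      using Q's[OF i] Q'p(2)[of "Suc i"] by auto
  qed
  obtain g where g: "bij_betw g {..<card G} G"
    using ex_bij_betw_nat_finite[OF G(2)] by (auto simp: atLeast0LessThan)
  have gm: "g i \<in> m" "g i \<in> carrier A" if "i < card G" for i
    using that g G A.genideal_self[OF G(1)] by (auto simp: bij_betw_def)
  have "\<forall>i\<in>{..<card G}. \<exists>x s. x \<in> carrier R \<and> s \<in> S \<and> g i = fr x s"
    using gm(2) unfolding A_carrier by blast
  then obtain x s where x: "\<And>i. i < card G \<Longrightarrow> x i \<in> carrier R \<and> s i \<in> S \<and> g i = fr (x i) (s i)" by (metis lessThan_iff)
  have xP: "x i \<in> P" if i: "i < card G" for i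
  proof -
    have "fr (x i) \<one> \<in> m"
      using A.sm_mult[OF A.sm_prime[OF pm] _ gm(1)[OF i], of "fr (s i) \<one>"] fr_factor(1)[of "x i" "s i"] fr_A[of "s i" \<one>] x[OF i] one_S by simp
    then show ?thesis using pre x[OF i] by blast
  qed
  let ?L = "lspan R Sm (x ` {..<card G})"
  have xR: "x ` {..<card G} \<subseteq> carrier R" using x by auto
  have L: "submodule ?L R Sm" by (rule sm_lspan[OF xR])
  let ?LS = "sat R P Sm ?L"
  have LS: "submodule ?LS R Sm" by (rule sm_sat[OF P L])
  have LSR: "y \<in> carrier R" if "y \<in> ?LS" for y using sm_carr[OF LS that] .
  \<comment> \<open>The fractions with numerator in the saturated ideal form an ideal containing
    \<open>G\<close>, hence \<open>m\<close>. This transfers generation from \<open>A\<close> back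
    to \<open>R\<close>.\<close>
  let ?K = "{fr y t |y t. y \<in> ?LS \<and> t \<in> S}"
  have "submodule ?K A (self_module A)"
  proof (rule module.submoduleI2[OF A.self_is_module])
    show "?K \<subseteq> carrier (self_module A)" using LSR fr_A by (auto simp: self_simps)
    show "\<zero>\<^bsub>self_module A\<^esub> \<in> ?K" using sm_zero[OF LS] one_S by (auto simp: self_simps A_zero)
  next
    fix a b assume "a \<in> ?K" "b \<in> ?K"
    then obtain y t z w where yt: "y \<in> ?LS" "t \<in> S" "a = fr y t" "z \<in> ?LS" "w \<in> S" "b = fr z w" by blast
    have "a \<oplus>\<^bsub>A\<^esub> b = fr (w \<otimes> y \<oplus> t \<otimes> z) (t \<otimes> w)" using yt A_add LSR by simp
    moreover have "w \<otimes> y \<oplus> t \<otimes> z \<in> ?LS" using yt by (intro sm_add[OF LS] sm_mult[OF LS]) auto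
    ultimately show "a \<oplus>\<^bsub>self_module A\<^esub> b \<in> ?K" using mult_S[OF yt(2,5)] by (auto simp: self_simps)
  next
    fix a b assume "a \<in> carrier A" "b \<in> ?K"
    then obtain y t z w where yt: "y \<in> carrier R" "t \<in> S" "a = fr y t" "z \<in> ?LS" "w \<in> S" "b = fr z w"
      by (auto simp: A_carrier)
    have "a \<otimes>\<^bsub>A\<^esub> b = fr (y \<otimes> z) (t \<otimes> w)" using yt A_mult LSR by simp
    moreover have "y \<otimes> z \<in> ?LS" using yt by (intro sm_mult[OF LS]) auto
    ultimately show "a \<odot>\<^bsub>self_module A\<^esub> b \<in> ?K" using mult_S[OF yt(2,5)] by (auto simp: self_simps)
  qed
  moreover have "G \<subseteq> ?K"
  proof
    fix \<gamma> assume "\<gamma> \<in> G"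
    then obtain i where i: "i < card G" "\<gamma> = g i" using g by (auto simp: bij_betw_def)
    then show "\<gamma> \<in> ?K" using x[OF i(1)] sm_lspan_incl[OF xR] sm_sat_incl[OF P sm_subset[OF L]] by blast
  qed
  ultimately have mK: "m \<subseteq> ?K" unfolding G(3)
    using A.genideal_minimal A.ideal_iff_submodule by blast
  have "P \<subseteq> ?LS"
  proof
    fix y assume y: "y \<in> P"
    have yR: "y \<in> carrier R" using sm_carr[OF sm_prime[OF P] y] .
    have "fr y \<one> \<in> m" using pre y by blast
    then obtain z t where z: "z \<in> ?LS" "t \<in> S" "fr y \<one> = fr z t" using mK by blast
    then obtain u where u: "u \<in> S" "u \<otimes> (t \<otimes> y) = u \<otimes> (\<one> \<otimes> z)"
      using fr_eq_iff[OF yR LSR[OF z(1)] one_S z(2)] by blast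
    have "u \<otimes> z \<in> ?LS" using sm_mult[OF LS _ z(1)] u(1) by blast
    then have "(u \<otimes> t) \<otimes> y \<in> ?LS" using u z yR LSR[OF z(1)] by (simp add: m_assoc)
    then show "y \<in> ?LS" by (rule sm_sat_cancel[OF P mult_S[OF u(1) z(2)] yR])
  qed
  then show ?thesis using that[OF ch, of x] xP by auto
qed

end

section \<open>Flatness of the Frobenius endomorphism\<close>

context cring
begin

lemma binomial:
  assumes a: "a \<in> carrier R" and b: "b \<in> carrier R"
  shows "(a \<oplus> b) [^] (n::nat) = (\<Oplus>k\<in>{..n}. [(n choose k)] \<cdot> (a [^] k \<otimes> b [^] (n - k)))"
proof (induction n)
  case 0 then show ?case using a b by simp
next
  case (Suc n)
  let ?t = "\<lambda>n k. [(n choose k)] \<cdot> (a [^] k \<otimes> b [^] (n - k))"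
  have tR: "?t n k \<in> carrier R" for n k using a b by simp
  have sa: "?t n k \<otimes> a = [(n choose k)] \<cdot> (a [^] Suc k \<otimes> b [^] (n - k))" for k
    using a b add_pow_ldistr[of "a [^] k \<otimes> b [^] (n - k)" a "n choose k"] by (simp add: m_ac)
  have sb: "?t n k \<otimes> b = [(n choose k)] \<cdot> (a [^] k \<otimes> b [^] (Suc n - k))" if "k \<le> n" for k
    using a b that add_pow_ldistr[of "a [^] k \<otimes> b [^] (n - k)" b "n choose k"] by (simp add: m_ac Suc_diff_le)
  have "(a \<oplus> b) [^] Suc n = (\<Oplus>k\<in>{..n}. ?t n k) \<otimes> a \<oplus> (\<Oplus>k\<in>{..n}. ?t n k) \<otimes> b"
    using Suc a b tR by (simp add: r_distr)
  also have "(\<Oplus>k\<in>{..n}. ?t n k) \<otimes> a = (\<Oplus>k\<in>{..n}. [(n choose k)] \<cdot> (a [^] Suc k \<otimes> b [^] (n - k)))"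
    using a b tR by (subst finsum_ldistr) (auto simp del: nat_pow_Suc simp: sa intro!: add.finprod_cong')
  also have "(\<Oplus>k\<in>{..n}. ?t n k) \<otimes> b = (\<Oplus>k\<in>{..n}. [(n choose k)] \<cdot> (a [^] k \<otimes> b [^] (Suc n - k)))"
    using a b tR by (subst finsum_ldistr) (auto simp: sb intro!: add.finprod_cong')
  also have "\<dots> = (\<Oplus>k\<in>{..Suc n}. [(n choose k)] \<cdot> (a [^] k \<otimes> b [^] (Suc n - k)))"
    using a b by (subst finsum_Suc) (auto simp: binomial_eq_0)
  also have "\<dots> = (\<Oplus>k\<in>{..n}. [(n choose Suc k)] \<cdot> (a [^] Suc k \<otimes> b [^] (n - k))) \<oplus> b [^] Suc n"
    using a b by (subst finsum_Suc2) auto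
  also have "(\<Oplus>k\<in>{..n}. [(n choose k)] \<cdot> (a [^] Suc k \<otimes> b [^] (n - k))) \<oplus> \<dots>
     = ((\<Oplus>k\<in>{..n}. [(n choose k)] \<cdot> (a [^] Suc k \<otimes> b [^] (n - k))) \<oplus>
        (\<Oplus>k\<in>{..n}. [(n choose Suc k)] \<cdot> (a [^] Suc k \<otimes> b [^] (n - k)))) \<oplus> b [^] Suc n"
    using a b by (intro a_assoc[symmetric]) auto
  also have "((\<Oplus>k\<in>{..n}. [(n choose k)] \<cdot> (a [^] Suc k \<otimes> b [^] (n - k))) \<oplus>
        (\<Oplus>k\<in>{..n}. [(n choose Suc k)] \<cdot> (a [^] Suc k \<otimes> b [^] (n - k))))
     = (\<Oplus>k\<in>{..n}. [(Suc n choose Suc k)] \<cdot> (a [^] Suc k \<otimes> b [^] (n - k)))"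
    using a b by (subst finsum_addf[symmetric]) (auto simp del: nat_pow_Suc simp: add.nat_pow_mult intro!: add.finprod_cong')
  also have "\<dots> \<oplus> b [^] Suc n = (\<Oplus>k\<in>{..Suc n}. ?t (Suc n) k)"
    using a b by (subst finsum_Suc2) auto
  finally show ?case .
qed

lemma frobenius_add:
  assumes p: "Factorial_Ring.prime p" and ch: "has_characteristic R p" and a: "a \<in> carrier R" and b: "b \<in> carrier R"
  shows "(a \<oplus> b) [^] (p::nat) = a [^] p \<oplus> b [^] p"
proof -
  have z: "[m] \<cdot> x = \<zero>" if "p dvd m" "x \<in> carrier R" for m :: nat and x
  proof -
    have "[m] \<cdot> \<one> = \<zero>" using ch that by (simp add: has_characteristic_def)
    then show ?thesis using add_pow_ldistr[of \<one> x m] that by simp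
  qed
  have p0: "p > 0" using p prime_gt_0_nat by blast
  have "(\<Oplus>k\<in>{0, p}. [(p choose k)] \<cdot> (a [^] k \<otimes> b [^] (p - k))) = (\<Oplus>k\<in>{..p}. [(p choose k)] \<cdot> (a [^] k \<otimes> b [^] (p - k)))"
  proof (rule add.finprod_mono_neutral_cong_left)
    fix k assume "k \<in> {..p} - {0, p}"
    then have "p dvd (p choose k)" using p by (intro dvd_choose_prime) auto
    then show "[(p choose k)] \<cdot> (a [^] k \<otimes> b [^] (p - k)) = \<zero>" using a b by (intro z) auto
  qed (use a b in auto)
  then show ?thesis using binomial[OF a b, of p] p0 a b by (simp add: a_comm)
qed

end

text \<open>The direction of Kunz's theorem that is used. Regularity supplies parameters at each
  prime, and a prime contains \<open>r^p\<close> exactly if it contains \<open>r\<close>, so that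
  Frobenius is local at every prime.\<close>

lemma frobenius_flat:
  fixes R :: "('a, 'r) ring_scheme" (structure) and p :: nat
  assumes reg: "noetherian_regular_ring R" and p: "Factorial_Ring.prime p" and ch: "has_characteristic R p"
  shows "flat_endo R (\<lambda>r. r [^]\<^bsub>R\<^esub> p)"
proof -
  interpret cring R using reg by (simp add: noetherian_regular_ring_def)
  have p1: "p \<ge> 1" using p prime_ge_1_nat by blast
  have noeth: "noetherian_ring R" using reg by (simp add: noetherian_regular_ring_def)
  interpret cring_endo R "\<lambda>r. r [^] p"
  proof unfold_locales
    show "(\<lambda>r. r [^] p) \<in> ring_hom R R"
      by (rule ring_hom_memI) (auto simp: frobenius_add[OF p ch] nat_pow_distrib)
  qed
  show ?thesis
  proof (intro flat_endo.intro flat_endo_axioms.intro)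
    show "cring_endo R (\<lambda>r. r [^] p)" by (rule cring_endo_axioms)
    show "noetherian_ring R" by (rule noeth)
    fix P and n :: nat and b assume P: "primeideal P R" and b: "\<And>i. i < n \<Longrightarrow> b i \<in> carrier R"
    interpret E: noeth_endo_prime R "\<lambda>r. r [^] p" P
    proof (intro noeth_endo_prime.intro noeth_endo_prime_axioms.intro)
      show "cring_endo R (\<lambda>r. r [^] p)" by (rule cring_endo_axioms)
      show "noetherian_ring R" by (rule noeth)
      show "primeideal P R" by (rule P)
      show "s [^] p \<notin> P" if "s \<in> carrier R - P" for s using prime_pow[OF P, of s p] that by blast
      show "a [^] p \<in> P" if "a \<in> P" for a
      proof -
        have aR: "a \<in> carrier R" using sm_carr[OF sm_prime[OF P] that] .
        have "a [^] (p - 1) \<otimes> a \<in> P" using sm_mult[OF sm_prime[OF P] _ that] aR by simp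
        then show ?thesis using p1 nat_pow_Suc[of a "p - 1"] by simp
      qed
    qed
    interpret prime_localization R P by (intro prime_localization.intro prime_localization_axioms.intro is_cring P)
    have "regular_local_ring (localized_ring R (carrier R - P))"
      using reg P by (simp add: noetherian_regular_ring_def Spec_def)
    then obtain d :: nat and Q x where "prime_chain R d Q" "Q d = P" "x ` {..<d} \<subseteq> P"
      "P \<subseteq> sat R P Sm (lspan R Sm (x ` {..<d}))"
      by (rule regular_local_parameters)
    then show "flat_at R (\<lambda>r. r [^] p) P {..<n} b"
      by (rule E.flat_at_regular[where p=p and b=b]) (use p1 b in auto)
  qed
qed

section \<open>Relations with semilinear values\<close>

text \<open>Concatenation of coefficient vectors, with \<open>w\<close> moved to the indices
  \<open>n, ..., n + k - 1\<close>. Writing the shift as a combination of unit vectors gives its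
  linearity at once.\<close>

definition join :: "('a, 'r) ring_scheme \<Rightarrow> nat \<Rightarrow> nat \<Rightarrow> (nat \<Rightarrow> 'a) \<Rightarrow> (nat \<Rightarrow> 'a) \<Rightarrow> nat \<Rightarrow> 'a"
  where "join R n k u w = u \<oplus>\<^bsub>fs R {..<n + k}\<^esub> lc R (fs R {..<n + k}) (\<lambda>t. single R (n + t) \<one>\<^bsub>R\<^esub>) w"

context module
begin

lemma join_fs:
  assumes u: "u \<in> carrier (fs R {..<n})" and w: "w \<in> carrier (fs R {..<k})"
  shows "join R n k u w \<in> carrier (fs R {..<n + k})"
proof -
  interpret V: module R "fs R {..<n + k}" by (rule R.fs_is_module)
  have "u \<in> carrier (fs R {..<n + k})" by (rule R.fs_mono[OF u]) auto
  moreover have "lc R (fs R {..<n + k}) (\<lambda>t. single R (n + t) \<one>) w \<in> carrier (fs R {..<n + k})"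
    by (rule V.lc_closed[OF _ w]) (auto intro!: R.single_fs)
  ultimately show ?thesis unfolding join_def by simp
qed

lemma lc_join:
  assumes u: "u \<in> carrier (fs R {..<n})" and w: "w \<in> carrier (fs R {..<k})"
    and f: "\<And>i. i < n + k \<Longrightarrow> f i \<in> carrier M"
  shows "lc R M f (join R n k u w) = lc R M f u \<oplus>\<^bsub>M\<^esub> lc R M (\<lambda>t. f (n + t)) w"
proof -
  interpret V: module R "fs R {..<n + k}" by (rule R.fs_is_module)
  have u': "u \<in> carrier (fs R {..<n + k})" by (rule R.fs_mono[OF u]) auto
  have f': "\<And>i. i \<in> {..<n + k} \<Longrightarrow> f i \<in> carrier M" using f by auto
  have s: "\<And>t. t \<in> {..<k} \<Longrightarrow> single R (n + t) \<one> \<in> carrier (fs R {..<n + k})" by (auto intro!: R.single_fs)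
  have "lc R M f (lc R (fs R {..<n + k}) (\<lambda>t. single R (n + t) \<one>) w)
    = lc R M (\<lambda>t. lc R M f (single R (n + t) \<one>)) w"
    by (rule linear_lc[OF V.module_axioms module_axioms lc_linear[OF f'] w s])
  also have "\<dots> = lc R M (\<lambda>t. f (n + t)) w"
    using f by (intro lc_cong[OF w]) (auto simp: lc_single)
  finally show ?thesis unfolding join_def
    using lc_add[OF f' u' V.lc_closed[OF s w]] by simp
qed

lemma join_low:
  assumes u: "u \<in> carrier (fs R {..<n})" and w: "w \<in> carrier (fs R {..<k})" and "i < n"
  shows "join R n k u w i = u i"
proof -
  interpret S: module R "self_module R" by (rule R.self_is_module)
  have "lc R (fs R {..<n + k}) (\<lambda>t. single R (n + t) \<one>) w i = lc R (self_module R) (\<lambda>t. single R (n + t) \<one> i) w"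
    by (rule R.lc_fs_apply[OF w]) (auto intro!: R.single_fs)
  also have "\<dots> = lc R (self_module R) (\<lambda>t. \<zero>) w"
    using \<open>i < n\<close> by (intro S.lc_cong[OF w]) (auto simp: single_def self_simps)
  also have "\<dots> = \<zero>"
    using S.lc_in_submodule[OF w S.zero_submodule, of "\<lambda>t. \<zero>"] by (simp add: self_simps)
  finally show ?thesis using R.fs_closed[OF u] by (simp add: join_def fs_simps)
qed

lemma lc_restrict:
  assumes d: "d \<in> carrier (fs R A)" and z: "\<And>i. i \<in> B \<Longrightarrow> z i \<in> carrier M"
  shows "lc R M z (\<lambda>i. if i \<in> B then d i else \<zero>) = lc R M (\<lambda>i. if i \<in> B then z i else \<zero>\<^bsub>M\<^esub>) d"
  unfolding lc_def using d z
  by (intro M.add.finprod_mono_neutral_cong_left) (auto simp: fs_carrier)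

end

text \<open>
  The assumption \<open>relations\<close> says that the \<open>R\<close>-linear map from \<open>F(M)\<close> to \<open>M\<close> induced by \<open>\<phi>\<close> is injective:
  in the free module on the set \<open>carrier M\<close>, a relation among the values of \<open>\<phi>\<close> lies in the span of
  the Frobenius images of the relations that define \<open>M\<close>.
\<close>

locale semilinear_endo = flat_endo R F + module R M for R (structure) and F and M (structure) +
  fixes \<phi>
  assumes \<phi>: "semilinear R F M M \<phi>"
    and relations: "\<And>n z u. (\<And>i. i < n \<Longrightarrow> z i \<in> carrier M) \<Longrightarrow> u \<in> carrier (fs R {..<n::nat}) \<Longrightarrow>
      lc R M (\<lambda>i. \<phi> (z i)) u = \<zero>\<^bsub>M\<^esub> \<Longrightarrow>
      lc R (fs R (carrier M)) (\<lambda>i. single R (z i) \<one>\<^bsub>R\<^esub>) u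
        \<in> frob_span R F (carrier M) {c \<in> carrier (fs R (carrier M)). lc R M (\<lambda>x. x) c = \<zero>\<^bsub>M\<^esub>}"
begin

lemma \<phi>_closed: "x \<in> carrier M \<Longrightarrow> \<phi> x \<in> carrier M" by (rule semilinearD(1)[OF \<phi>])
lemma \<phi>_add: "x \<in> carrier M \<Longrightarrow> y \<in> carrier M \<Longrightarrow> \<phi> (x \<oplus>\<^bsub>M\<^esub> y) = \<phi> x \<oplus>\<^bsub>M\<^esub> \<phi> y" by (rule semilinearD(2)[OF \<phi>])
lemma \<phi>_smult: "r \<in> carrier R \<Longrightarrow> x \<in> carrier M \<Longrightarrow> \<phi> (r \<bullet> x) = F r \<bullet> \<phi> x" by (rule semilinearD(3)[OF \<phi>])
lemma \<phi>_zero: "\<phi> \<zero>\<^bsub>M\<^esub> = \<zero>\<^bsub>M\<^esub>" by (rule semilinear_zero[OF module_axioms module_axioms \<phi>])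
lemma \<phi>_minus: "x \<in> carrier M \<Longrightarrow> \<phi> (\<ominus>\<^bsub>M\<^esub> x) = \<ominus>\<^bsub>M\<^esub> \<phi> x"
  by (rule semilinear_minus[OF module_axioms module_axioms \<phi>])

text \<open>This extends the equational criterion from \<open>R\<close> to \<open>M\<close>. By
  \<open>relations\<close>, the combination of the basis vectors at the \<open>z i\<close> with
  coefficients \<open>u\<close> equals a combination, with coefficients \<open>v\<close>, of images
  of relations \<open>C t\<close> of \<open>M\<close>. That is a finite system of equations over
  \<open>R\<close> for \<open>u\<close> and \<open>v\<close>, to which
  \<open>syz_flat_finite\<close> applies.\<close>

lemma flat_relations:
  assumes z: "\<And>i. i < n \<Longrightarrow> z i \<in> carrier M" and u: "u \<in> carrier (fs R {..<n::nat})"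
    and eq: "lc R M (\<lambda>i. \<phi> (z i)) u = \<zero>\<^bsub>M\<^esub>"
  shows "u \<in> frob_span R F {..<n} {c \<in> carrier (fs R {..<n}). lc R M z c = \<zero>\<^bsub>M\<^esub>}"
proof -
  let ?L = "carrier M"
  interpret FL: module R "fs R ?L" by (rule fs_is_module)
  interpret S: module R Sm by (rule self_is_module)
  interpret Vn: module R "fs R {..<n}" by (rule fs_is_module)
  let ?Rel = "{c \<in> carrier (fs R ?L). lc R M (\<lambda>x. x) c = \<zero>\<^bsub>M\<^esub>}"
  have RelL: "?Rel \<subseteq> carrier (fs R ?L)" by blast
  let ?\<delta> = "\<lambda>i. single R (z i) \<one>"
  have \<delta>: "?\<delta> i \<in> carrier (fs R ?L)" if "i < n" for i using z[OF that] by (auto intro!: single_fs)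
  let ?u = "lc R (fs R ?L) ?\<delta> u"
  have "?u \<in> lspan R (fs R ?L) ((\<lambda>c i. F (c i)) ` ?Rel)"
    using relations[OF z u eq] by (simp add: frob_span_def)
  then obtain k :: nat and v c where c: "\<And>t. t < k \<Longrightarrow> c t \<in> (\<lambda>c i. F (c i)) ` ?Rel"
    and v: "v \<in> carrier (fs R {..<k})" and uv: "?u = lc R (fs R ?L) c v"
    by (rule FL.lspan_lc[OF _ F_image_fs[OF RelL]]) blast
  have "\<forall>t\<in>{..<k}. \<exists>C. C \<in> ?Rel \<and> c t = (\<lambda>i. F (C i))" using c by blast
  from bchoice[OF this] obtain C where C0: "\<forall>t\<in>{..<k}. C t \<in> ?Rel \<and> c t = (\<lambda>i. F (C t i))" ..
  have C: "C t \<in> ?Rel" "c t = (\<lambda>i. F (C t i))" if "t < k" for t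
    using bspec[OF C0, of t] that by (simp_all only: lessThan_iff)
  have CL: "C t \<in> carrier (fs R ?L)" if "t < k" for t using C(1)[OF that] by blast
  have cL: "c t \<in> carrier (fs R ?L)" if "t < k" for t using semilinearD(1)[OF F_fs CL[OF that]] C(2)[OF that] by simp
  let ?N = "n + k"
  interpret VN: module R "fs R {..<?N}" by (rule fs_is_module)
  interpret Vk: module R "fs R {..<k}" by (rule fs_is_module)
  define fam where "fam t = (if t < n then ?\<delta> t else C (t - n))" for t
  have famL: "fam t \<in> carrier (fs R ?L)" if "t < ?N" for t using that \<delta> CL by (auto simp: fam_def)
  have FfamL: "(\<lambda>y. F (fam t y)) \<in> carrier (fs R ?L)" if "t < ?N" for t using semilinearD(1)[OF F_fs famL[OF that]] .
  let ?v' = "\<ominus>\<^bsub>fs R {..<k}\<^esub> v"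
  have v': "?v' \<in> carrier (fs R {..<k})" using v by simp
  \<comment> \<open>\<open>u\<close> followed by minus \<open>v\<close> solves the system whose
    columns are the images of the \<open>fam t\<close>.\<close>
  define w where "w = join R n k u ?v'"
  have wN: "w \<in> carrier (fs R {..<?N})" unfolding w_def by (rule join_fs[OF u v'])
  have "lc R (fs R ?L) (\<lambda>t y. F (fam t y)) w
    = lc R (fs R ?L) (\<lambda>t y. F (fam t y)) u \<oplus>\<^bsub>fs R ?L\<^esub> lc R (fs R ?L) (\<lambda>t y. F (fam (n + t) y)) ?v'"
    unfolding w_def by (rule FL.lc_join[OF u v' FfamL])
  also have "lc R (fs R ?L) (\<lambda>t y. F (fam t y)) u = ?u"
    using \<delta> by (intro FL.lc_cong[OF u]) (auto simp: fam_def single_def)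
  also have "lc R (fs R ?L) (\<lambda>t y. F (fam (n + t) y)) ?v' = lc R (fs R ?L) c ?v'"
    using cL C(2) by (intro FL.lc_cong[OF v']) (auto simp: fam_def)
  also have "lc R (fs R ?L) c ?v' = \<ominus>\<^bsub>fs R ?L\<^esub> lc R (fs R ?L) c v"
    using cL by (intro semilinear_minus[OF Vk.module_axioms FL.module_axioms FL.lc_linear v]) auto
  also have "?u \<oplus>\<^bsub>fs R ?L\<^esub> \<dots> = \<zero>\<^bsub>fs R ?L\<^esub>" unfolding uv[symmetric]
    using FL.lc_closed[OF _ u, of ?\<delta>] \<delta> by (intro FL.M.r_neg) auto
  finally have w0: "lc R (fs R ?L) (\<lambda>t y. F (fam t y)) w = \<zero>\<^bsub>fs R ?L\<^esub>" .
  \<comment> \<open>Only coordinates in the finitely many supports give nontrivial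
    equations.\<close>
  define Y where "Y = (\<Union>t\<in>{..<?N}. {y. fam t y \<noteq> \<zero>})"
  have "finite {y. fam t y \<noteq> \<zero>}" if "t < ?N" for t using famL[OF that] by (simp add: fs_carrier)
  then have finY: "finite Y" by (auto simp: Y_def)
  let ?D = "{d \<in> carrier (fs R {..<?N}). \<forall>y\<in>Y. lc R Sm (\<lambda>t. fam t y) d = \<zero>}"
  have "w \<in> frob_span R F {..<?N} ?D"
  proof (rule syz_flat_finite[OF finY _ wN])
    show "fam t y \<in> carrier R" if "t < ?N" for t y using fs_closed[OF famL[OF that]] .
    fix y
    have "lc R Sm (\<lambda>t. F (fam t y)) w = lc R (fs R ?L) (\<lambda>t y. F (fam t y)) w y"
      using FfamL by (intro lc_fs_apply[OF wN, symmetric]) auto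
    then show "lc R Sm (\<lambda>t. F (fam t y)) w = \<zero>" using w0 by (simp add: fs_simps)
  qed
  \<comment> \<open>A solution \<open>d\<close> of the system for \<open>fam\<close> expresses the
    combination of the basis vectors at the \<open>z i\<close>, with the first \<open>n\<close>
    entries as coefficients, by the relations \<open>C t\<close>. In \<open>M\<close> this
    combination vanishes, so the first \<open>n\<close> entries form a relation among the
    \<open>z i\<close>.\<close>
  define pr where "pr d = (\<lambda>i. if i \<in> {..<n} then d i else \<zero>)" for d :: "nat \<Rightarrow> 'a"
  have pr_fs: "pr d \<in> carrier (fs R {..<n})" if "d \<in> carrier (fs R {..<?N})" for d
    using that by (auto simp: fs_carrier pr_def)
  have pr_lin: "semilinear R (\<lambda>r. r) (fs R {..<?N}) (fs R {..<n}) pr"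
    unfolding semilinear_def using pr_fs by (auto simp: fs_simps pr_def)
  have "pr w = u" using join_low[OF u v'] fs_outside[OF u] by (auto simp: pr_def w_def)
  moreover have "pr w \<in> frob_span R F {..<n} {c \<in> carrier (fs R {..<n}). lc R M z c = \<zero>\<^bsub>M\<^esub>}" (is "_ \<in> frob_span R F _ ?T")
  proof (rule semilinear_lspan[OF VN.module_axioms Vn.module_axioms pr_lin frob_span_submodule])
    show "w \<in> lspan R (fs R {..<?N}) ((\<lambda>c i. F (c i)) ` ?D)"
      using \<open>w \<in> frob_span R F {..<?N} ?D\<close> by (simp add: frob_span_def)
    show "(\<lambda>c i. F (c i)) ` ?D \<subseteq> carrier (fs R {..<?N})" by (rule F_image_fs) blast
    show "pr ` (\<lambda>c i. F (c i)) ` ?D \<subseteq> frob_span R F {..<n} ?T"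
    proof clarify
      fix d assume dN: "d \<in> carrier (fs R {..<?N})" and d: "\<forall>y\<in>Y. lc R Sm (\<lambda>t. fam t y) d = \<zero>"
      have "lc R (fs R ?L) fam d y = \<zero>" for y
      proof -
        have e: "lc R (fs R ?L) fam d y = lc R Sm (\<lambda>t. fam t y) d"
          using famL by (intro lc_fs_apply[OF dN]) auto
        show ?thesis
        proof (cases "y \<in> Y")
          case True then show ?thesis using e d by simp
        next
          case False
          have "lc R Sm (\<lambda>t. fam t y) d = lc R Sm (\<lambda>t. \<zero>) d"
            using False by (intro S.lc_cong[OF dN]) (auto simp: Y_def self_simps)
          also have "\<dots> = \<zero>"
            using S.lc_in_submodule[OF dN S.zero_submodule, of "\<lambda>t. \<zero>"] by (simp add: self_simps)
          finally show ?thesis using e by simp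
        qed
      qed
      then have l0: "lc R (fs R ?L) fam d = \<zero>\<^bsub>fs R ?L\<^esub>" by (auto simp: fs_simps)
      have evL: "semilinear R (\<lambda>r. r) (fs R ?L) M (lc R M (\<lambda>x. x))" by (rule lc_linear) auto
      have "\<zero>\<^bsub>M\<^esub> = lc R M (\<lambda>x. x) (lc R (fs R ?L) fam d)"
        unfolding l0 by (rule semilinear_zero[OF FL.module_axioms module_axioms evL, symmetric])
      also have "\<dots> = lc R M (\<lambda>t. lc R M (\<lambda>x. x) (fam t)) d"
        using famL by (intro linear_lc[OF FL.module_axioms module_axioms evL dN]) auto
      also have "\<dots> = lc R M (\<lambda>t. if t \<in> {..<n} then z t else \<zero>\<^bsub>M\<^esub>) d"
      proof (rule lc_cong[OF dN])
        fix t assume t: "t \<in> {..<?N}"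
        show "lc R M (\<lambda>x. x) (fam t) = (if t \<in> {..<n} then z t else \<zero>\<^bsub>M\<^esub>)"
          using t C(1)[of "t - n"] lc_single[of \<one> "\<lambda>x. x" "z t"] z[of t] by (auto simp: fam_def)
      qed (use z in auto)
      also have "\<dots> = lc R M z (pr d)" unfolding pr_def
        using z by (intro lc_restrict[OF dN, symmetric]) auto
      finally have "pr d \<in> ?T" using pr_fs[OF dN] by simp
      then have "(\<lambda>i. F (pr d i)) \<in> frob_span R F {..<n} ?T"
        unfolding frob_span_def by (intro subsetD[OF Vn.lspan_incl[OF F_image_fs]] imageI) auto
      moreover have "(\<lambda>i. F (pr d i)) = pr (\<lambda>i. F (d i))" by (auto simp: pr_def)
      ultimately show "pr (\<lambda>i. F (d i)) \<in> frob_span R F {..<n} ?T" by simp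
    qed
  qed auto
  ultimately show ?thesis by simp
qed

text \<open>For a submodule \<open>X\<close> this is the image in \<open>M\<close> of the base
  change of \<open>X\<close> along \<open>F\<close>.\<close>

definition \<Phi> where "\<Phi> X = lspan R M (\<phi> ` X)"

lemma \<Phi>_sub: "X \<subseteq> carrier M \<Longrightarrow> \<phi> ` X \<subseteq> carrier M" using \<phi>_closed by blast

lemma \<Phi>_submodule: "X \<subseteq> carrier M \<Longrightarrow> submodule (\<Phi> X) R M"
  unfolding \<Phi>_def by (rule lspan_submodule[OF \<Phi>_sub])

lemma \<Phi>_incl: "X \<subseteq> carrier M \<Longrightarrow> x \<in> X \<Longrightarrow> \<phi> x \<in> \<Phi> X"
  unfolding \<Phi>_def using lspan_incl[OF \<Phi>_sub] by blast

lemma \<Phi>_minimal: "submodule K R M \<Longrightarrow> (\<And>x. x \<in> X \<Longrightarrow> \<phi> x \<in> K) \<Longrightarrow> \<Phi> X \<subseteq> K"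
  unfolding \<Phi>_def by (rule lspan_minimal) auto

lemma \<Phi>_mono: "Y \<subseteq> carrier M \<Longrightarrow> X \<subseteq> Y \<Longrightarrow> \<Phi> X \<subseteq> \<Phi> Y"
  unfolding \<Phi>_def using \<Phi>_sub by (intro lspan_mono) auto

lemma \<Phi>_lc:
  assumes "x \<in> \<Phi> X" "X \<subseteq> carrier M"
  obtains n :: nat and v y where "\<And>t. t < n \<Longrightarrow> y t \<in> X" "v \<in> carrier (fs R {..<n})" "x = lc R M (\<lambda>t. \<phi> (y t)) v"
proof -
  obtain n :: nat and v c where c: "\<And>t. t < n \<Longrightarrow> c t \<in> \<phi> ` X" "v \<in> carrier (fs R {..<n})" "x = lc R M c v"
    by (rule lspan_lc[OF assms(1)[unfolded \<Phi>_def] \<Phi>_sub[OF assms(2)]]) blast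
  have "\<forall>t\<in>{..<n}. \<exists>y\<in>X. c t = \<phi> y" using c(1) by blast
  then obtain y where y: "\<And>t. t < n \<Longrightarrow> y t \<in> X" "\<And>t. t < n \<Longrightarrow> c t = \<phi> (y t)" by (metis lessThan_iff)
  have "lc R M c v = lc R M (\<lambda>t. \<phi> (y t)) v"
    using y assms(2) \<phi>_closed by (intro lc_cong[OF c(2)]) auto
  then show ?thesis using that[OF y(1) c(2)] c(3) by simp
qed

text \<open>Flat base change commutes with the kernel of multiplication by \<open>a\<close>. If a
  combination of values \<open>\<phi> (y t)\<close> is killed by \<open>F a\<close>, its
  coefficients form a relation among the \<open>\<phi> (a \<bullet> y t)\<close>. This comes from
  relations among the \<open>a \<bullet> y t\<close>, and with such coefficients the
  \<open>y t\<close> combine to elements of \<open>X\<close> killed by \<open>a\<close>.\<close>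

lemma annihilator_flat:
  assumes X: "submodule X R M" and x: "x \<in> \<Phi> X" and a: "a \<in> carrier R" and ax: "F a \<bullet> x = \<zero>\<^bsub>M\<^esub>"
  shows "x \<in> \<Phi> {y \<in> X. a \<bullet> y = \<zero>\<^bsub>M\<^esub>}"
proof -
  let ?T = "{y \<in> X. a \<bullet> y = \<zero>\<^bsub>M\<^esub>}"
  have XM: "X \<subseteq> carrier M" by (rule submoduleE(1)[OF X])
  have TM: "?T \<subseteq> carrier M" using XM by blast
  obtain n :: nat and v y where y: "\<And>t. t < n \<Longrightarrow> y t \<in> X" "v \<in> carrier (fs R {..<n})" "x = lc R M (\<lambda>t. \<phi> (y t)) v"
    using \<Phi>_lc[OF x XM] by blast
  interpret V: module R "fs R {..<n}" by (rule fs_is_module)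
  have yM: "\<And>t. t \<in> {..<n} \<Longrightarrow> y t \<in> carrier M" using y(1) XM by auto
  have \<phi>M: "\<And>t. t \<in> {..<n} \<Longrightarrow> \<phi> (y t) \<in> carrier M" using \<phi>_closed yM by blast
  have Fa: "F a \<in> carrier R" using a by simp
  let ?z = "\<lambda>t. a \<bullet> y t"
  let ?C = "{c \<in> carrier (fs R {..<n}). lc R M ?z c = \<zero>\<^bsub>M\<^esub>}"
  have "lc R M (\<lambda>t. \<phi> (?z t)) v = lc R M (\<lambda>t. F a \<bullet> \<phi> (y t)) v"
    using yM \<phi>M a by (intro lc_cong[OF y(2)]) (auto simp: \<phi>_smult)
  also have "\<dots> = F a \<bullet> x"
    unfolding y(3) by (rule linear_lc[OF module_axioms module_axioms smult_linear[OF Fa] y(2) \<phi>M, symmetric])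
  finally have "v \<in> frob_span R F {..<n} ?C"
    using yM a ax by (intro flat_relations[OF _ y(2)]) auto
  then have vC: "v \<in> lspan R (fs R {..<n}) ((\<lambda>c i. F (c i)) ` ?C)" by (simp add: frob_span_def)
  show ?thesis unfolding y(3)
  proof (rule semilinear_lspan[OF V.module_axioms module_axioms lc_linear[OF \<phi>M] \<Phi>_submodule[OF TM] _ _ _ vC])
    show "(\<lambda>c i. F (c i)) ` ?C \<subseteq> carrier (fs R {..<n})" by (rule F_image_fs) blast
    show "lc R M (\<lambda>t. \<phi> (y t)) ` (\<lambda>c i. F (c i)) ` ?C \<subseteq> \<Phi> ?T"
    proof clarify
      fix c assume c: "c \<in> carrier (fs R {..<n})" "lc R M ?z c = \<zero>\<^bsub>M\<^esub>"
      have "lc R M y c \<in> X" using y(1) by (intro lc_in_submodule[OF c(1) X]) auto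
      moreover have "a \<bullet> lc R M y c = lc R M ?z c"
        by (rule linear_lc[OF module_axioms module_axioms smult_linear[OF a] c(1) yM])
      ultimately have "\<phi> (lc R M y c) \<in> \<Phi> ?T" using c(2) by (intro \<Phi>_incl[OF TM]) auto
      moreover have "\<phi> (lc R M y c) = lc R M (\<lambda>t. \<phi> (y t)) (\<lambda>i. F (c i))"
        by (rule semilinear_lc[OF module_axioms module_axioms \<phi> F c(1) yM])
      ultimately show "lc R M (\<lambda>t. \<phi> (y t)) (\<lambda>i. F (c i)) \<in> \<Phi> ?T" by simp
    qed
  qed auto
qed

text \<open>
  \<open>K\<close> stands for any property that holds on the submodule of pairs generated by the
  \<open>(\<phi> u, \<phi> v)\<close> with \<open>(u, v)\<close> a cocycle in \<open>X\<close>.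
\<close>

lemma cocycle_flat:
  assumes X: "submodule X R M" and x: "x \<in> \<Phi> X" and y: "y \<in> \<Phi> X"
    and ab: "a \<in> carrier R" "b \<in> carrier R" and eq: "F a \<bullet> y = F b \<bullet> x"
    and K0: "K \<zero>\<^bsub>M\<^esub> \<zero>\<^bsub>M\<^esub>"
    and Kadd: "\<And>x y x' y'. K x y \<Longrightarrow> K x' y' \<Longrightarrow> K (x \<oplus>\<^bsub>M\<^esub> x') (y \<oplus>\<^bsub>M\<^esub> y')"
    and Ksmult: "\<And>r x y. r \<in> carrier R \<Longrightarrow> K x y \<Longrightarrow> K (r \<bullet> x) (r \<bullet> y)"
    and K\<phi>: "\<And>x y. x \<in> X \<Longrightarrow> y \<in> X \<Longrightarrow> a \<bullet> y = b \<bullet> x \<Longrightarrow> K (\<phi> x) (\<phi> y)"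
  shows "K x y"
proof -
  have XM: "X \<subseteq> carrier M" by (rule submoduleE(1)[OF X])
  obtain n :: nat and u f where f: "\<And>t. t < n \<Longrightarrow> f t \<in> X" and u: "u \<in> carrier (fs R {..<n})" and xf: "x = lc R M (\<lambda>t. \<phi> (f t)) u"
    using \<Phi>_lc[OF x XM] by blast
  obtain k :: nat and w g where g: "\<And>t. t < k \<Longrightarrow> g t \<in> X" and w: "w \<in> carrier (fs R {..<k})" and yg: "y = lc R M (\<lambda>t. \<phi> (g t)) w"
    using \<Phi>_lc[OF y XM] by blast
  let ?N = "n + k"
  interpret V: module R "fs R {..<?N}" by (rule fs_is_module)
  define v where "v = join R n k u w"
  have v: "v \<in> carrier (fs R {..<?N})" unfolding v_def by (rule join_fs[OF u w])
  \<comment> \<open>Padding with zeros lets \<open>x\<close> and \<open>y\<close> be combinations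
    with one common coefficient vector \<open>v\<close>, taken over the pairs
    \<open>(f t, 0)\<close> followed by the pairs \<open>(0, g t)\<close>.\<close>
  define f' where "f' t = (if t < n then f t else \<zero>\<^bsub>M\<^esub>)" for t
  define g' where "g' t = (if t < n then \<zero>\<^bsub>M\<^esub> else g (t - n))" for t
  have zX: "\<zero>\<^bsub>M\<^esub> \<in> X" by (rule submodule_zero[OF X])
  have f'X: "f' t \<in> X" and g'X: "g' t \<in> X" if "t < ?N" for t
    using that f g zX by (auto simp: f'_def g'_def)
  have f'M: "\<And>t. t \<in> {..<?N} \<Longrightarrow> f' t \<in> carrier M" and g'M: "\<And>t. t \<in> {..<?N} \<Longrightarrow> g' t \<in> carrier M"
    using f'X g'X XM by auto
  have \<phi>f': "\<And>t. t \<in> {..<?N} \<Longrightarrow> \<phi> (f' t) \<in> carrier M" and \<phi>g': "\<And>t. t \<in> {..<?N} \<Longrightarrow> \<phi> (g' t) \<in> carrier M"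
    using f'M g'M \<phi>_closed by blast+
  have lz: "lc R M (\<lambda>t. \<zero>\<^bsub>M\<^esub>) c = \<zero>\<^bsub>M\<^esub>" if "c \<in> carrier (fs R {..<m})" for c :: "nat \<Rightarrow> 'a" and m
    using lc_in_submodule[OF that zero_submodule, of "\<lambda>t. \<zero>\<^bsub>M\<^esub>"] by simp
  have fM: "f t \<in> carrier M" if "t < n" for t using f[OF that] XM by blast
  have gM: "g t \<in> carrier M" if "t < k" for t using g[OF that] XM by blast
  have xv: "x = lc R M (\<lambda>t. \<phi> (f' t)) v"
  proof -
    have "lc R M (\<lambda>t. \<phi> (f' t)) v = lc R M (\<lambda>t. \<phi> (f' t)) u \<oplus>\<^bsub>M\<^esub> lc R M (\<lambda>t. \<phi> (f' (n + t))) w"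
      unfolding v_def using \<phi>f' by (intro lc_join[OF u w]) auto
    also have "lc R M (\<lambda>t. \<phi> (f' t)) u = x" unfolding xf
      using fM \<phi>_closed by (intro lc_cong[OF u]) (auto simp: f'_def)
    also have "lc R M (\<lambda>t. \<phi> (f' (n + t))) w = \<zero>\<^bsub>M\<^esub>" using lz[OF w] by (simp add: f'_def \<phi>_zero)
    finally show ?thesis using submodule_carr[OF \<Phi>_submodule[OF XM] x] by simp
  qed
  have yv: "y = lc R M (\<lambda>t. \<phi> (g' t)) v"
  proof -
    have "lc R M (\<lambda>t. \<phi> (g' t)) v = lc R M (\<lambda>t. \<phi> (g' t)) u \<oplus>\<^bsub>M\<^esub> lc R M (\<lambda>t. \<phi> (g' (n + t))) w"
      unfolding v_def using \<phi>g' by (intro lc_join[OF u w]) auto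
    also have "lc R M (\<lambda>t. \<phi> (g' (n + t))) w = y" unfolding yg by (simp add: g'_def)
    also have "lc R M (\<lambda>t. \<phi> (g' t)) u = lc R M (\<lambda>t. \<zero>\<^bsub>M\<^esub>) u"
      by (intro lc_cong[OF u]) (auto simp: g'_def \<phi>_zero)
    finally show ?thesis using submodule_carr[OF \<Phi>_submodule[OF XM] y] lz[OF u] by simp
  qed
  \<comment> \<open>The equation between \<open>x\<close> and \<open>y\<close> says that
    \<open>v\<close> is a relation among the \<open>\<phi> (?z t)\<close>; a relation among the
    \<open>?z t\<close> in turn yields a cocycle in \<open>X\<close>.\<close>
  let ?z = "\<lambda>t. a \<bullet> g' t \<oplus>\<^bsub>M\<^esub> (\<ominus> b) \<bullet> f' t"
  have zM: "\<And>t. t \<in> {..<?N} \<Longrightarrow> ?z t \<in> carrier M" using f'M g'M ab by auto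
  have nb: "\<ominus> b \<in> carrier R" "F (\<ominus> b) \<in> carrier R" "F a \<in> carrier R" using ab by auto
  have sm: "lc R M (\<lambda>t. r \<bullet> h t) c = r \<bullet> lc R M h c"
    if "c \<in> carrier (fs R {..<?N})" "r \<in> carrier R" "\<And>t. t \<in> {..<?N} \<Longrightarrow> h t \<in> carrier M" for c r h
    by (rule linear_lc[OF module_axioms module_axioms smult_linear[OF that(2)] that(1,3), symmetric])
  let ?C = "{c \<in> carrier (fs R {..<?N}). lc R M ?z c = \<zero>\<^bsub>M\<^esub>}"
  have "lc R M (\<lambda>t. \<phi> (?z t)) v = lc R M (\<lambda>t. F a \<bullet> \<phi> (g' t) \<oplus>\<^bsub>M\<^esub> F (\<ominus> b) \<bullet> \<phi> (f' t)) v"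
    using f'M g'M \<phi>f' \<phi>g' ab by (intro lc_cong[OF v]) (auto simp: \<phi>_smult \<phi>_add)
  also have "\<dots> = lc R M (\<lambda>t. F a \<bullet> \<phi> (g' t)) v \<oplus>\<^bsub>M\<^esub> F (\<ominus> b) \<bullet> lc R M (\<lambda>t. \<phi> (f' t)) v"
    using \<phi>f' \<phi>g' nb by (intro lc_fun_add[OF v]) auto
  also have "\<dots> = F a \<bullet> y \<oplus>\<^bsub>M\<^esub> F (\<ominus> b) \<bullet> x"
    unfolding xv[symmetric] yv by (subst sm[OF v nb(3) \<phi>g']) auto
  also have "\<dots> = \<zero>\<^bsub>M\<^esub>"
    unfolding eq using submodule_carr[OF \<Phi>_submodule[OF XM] x] ab by (simp add: F_minus smult_l_minus M.r_neg)
  finally have "v \<in> frob_span R F {..<?N} ?C" using zM by (intro flat_relations[OF _ v]) auto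
  then have "v \<in> lspan R (fs R {..<?N}) ((\<lambda>c i. F (c i)) ` ?C)" by (simp add: frob_span_def)
  then have "v \<in> carrier (fs R {..<?N}) \<and> K (lc R M (\<lambda>t. \<phi> (f' t)) v) (lc R M (\<lambda>t. \<phi> (g' t)) v)"
  proof (induction rule: lspan.induct)
    case lspan_zero
    show ?case using K0 V.M.zero_closed by (simp add: fs_simps lc_zero)
  next
    case (lspan_step r d e)
    then obtain c where c: "c \<in> carrier (fs R {..<?N})" "lc R M ?z c = \<zero>\<^bsub>M\<^esub>" "d = (\<lambda>i. F (c i))" by blast
    have d: "d \<in> carrier (fs R {..<?N})" unfolding c(3) by (rule semilinearD(1)[OF F_fs c(1)])
    have fX: "lc R M f' c \<in> X" and gX: "lc R M g' c \<in> X"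
      using f'X g'X by (auto intro!: lc_in_submodule[OF c(1) X])
    have "\<zero>\<^bsub>M\<^esub> = a \<bullet> lc R M g' c \<oplus>\<^bsub>M\<^esub> (\<ominus> b) \<bullet> lc R M f' c"
      using c(2) lc_fun_add[OF c(1) _ f'M nb(1), of "\<lambda>t. a \<bullet> g' t"] sm[OF c(1) ab(1) g'M] g'M ab by auto
    moreover have "(\<ominus> b) \<bullet> lc R M f' c = \<ominus>\<^bsub>M\<^esub> (b \<bullet> lc R M f' c)"
      using fX XM ab by (intro smult_l_minus) auto
    ultimately have "a \<bullet> lc R M g' c = b \<bullet> lc R M f' c"
      using fX gX XM ab M.minus_equality[of "a \<bullet> lc R M g' c" "\<ominus>\<^bsub>M\<^esub> (b \<bullet> lc R M f' c)"] by (auto simp: subset_iff)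
    then have "K (\<phi> (lc R M f' c)) (\<phi> (lc R M g' c))" by (rule K\<phi>[OF fX gX])
    then have Kd: "K (lc R M (\<lambda>t. \<phi> (f' t)) d) (lc R M (\<lambda>t. \<phi> (g' t)) d)"
      using semilinear_lc[OF module_axioms module_axioms \<phi> F c(1) f'M] semilinear_lc[OF module_axioms module_axioms \<phi> F c(1) g'M]
      unfolding c(3) by simp
    have rd: "r \<odot>\<^bsub>fs R {..<?N}\<^esub> d \<in> carrier (fs R {..<?N})" using d lspan_step(1) by simp
    have lin: "lc R M h (r \<odot>\<^bsub>fs R {..<?N}\<^esub> d \<oplus>\<^bsub>fs R {..<?N}\<^esub> e) = r \<bullet> lc R M h d \<oplus>\<^bsub>M\<^esub> lc R M h e"
      if h: "\<And>t. t \<in> {..<?N} \<Longrightarrow> h t \<in> carrier M" for h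
      using lc_add[where y=e, OF h rd] lc_smult[OF h lspan_step(1) d] lspan_step by simp
    have l1: "lc R M (\<lambda>t. \<phi> (f' t)) (r \<odot>\<^bsub>fs R {..<?N}\<^esub> d \<oplus>\<^bsub>fs R {..<?N}\<^esub> e)
        = r \<bullet> lc R M (\<lambda>t. \<phi> (f' t)) d \<oplus>\<^bsub>M\<^esub> lc R M (\<lambda>t. \<phi> (f' t)) e"
      by (rule lin) (rule \<phi>f')
    have l2: "lc R M (\<lambda>t. \<phi> (g' t)) (r \<odot>\<^bsub>fs R {..<?N}\<^esub> d \<oplus>\<^bsub>fs R {..<?N}\<^esub> e)
        = r \<bullet> lc R M (\<lambda>t. \<phi> (g' t)) d \<oplus>\<^bsub>M\<^esub> lc R M (\<lambda>t. \<phi> (g' t)) e"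
      by (rule lin) (rule \<phi>g')
    show ?case unfolding l1 l2 using Kadd[OF Ksmult[OF lspan_step(1) Kd]] lspan_step rd by simp
  qed
  then show ?thesis unfolding xv[symmetric] yv[symmetric] by blast
qed

end

section \<open>The Peskine--Szpiro functor\<close>

text \<open>The iterates of the functor are not shown to be modules. Closure of the carrier under
  both operations is enough for the calculations with classes, and it passes easily to tensor
  products and renamed copies.\<close>

definition op_closed :: "('a, 'r) ring_scheme \<Rightarrow> ('a, 'm, 'c) module_scheme \<Rightarrow> bool"
  where "op_closed R N \<longleftrightarrow>
    (\<forall>x\<in>carrier N. \<forall>y\<in>carrier N. x \<oplus>\<^bsub>N\<^esub> y \<in> carrier N) \<and>
    (\<forall>r\<in>carrier R. \<forall>x\<in>carrier N. r \<odot>\<^bsub>N\<^esub> x \<in> carrier N)"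

lemma op_closedD:
  assumes "op_closed R N"
  shows "x \<in> carrier N \<Longrightarrow> y \<in> carrier N \<Longrightarrow> x \<oplus>\<^bsub>N\<^esub> y \<in> carrier N"
    and "r \<in> carrier R \<Longrightarrow> x \<in> carrier N \<Longrightarrow> r \<odot>\<^bsub>N\<^esub> x \<in> carrier N"
  using assms by (auto simp: op_closed_def)

lemma module_homD:
  assumes "h \<in> module_hom R M N"
  shows "x \<in> carrier M \<Longrightarrow> h x \<in> carrier N"
    and "x \<in> carrier M \<Longrightarrow> y \<in> carrier M \<Longrightarrow> h (x \<oplus>\<^bsub>M\<^esub> y) = h x \<oplus>\<^bsub>N\<^esub> h y"
    and "r \<in> carrier R \<Longrightarrow> x \<in> carrier M \<Longrightarrow> h (r \<odot>\<^bsub>M\<^esub> x) = r \<odot>\<^bsub>N\<^esub> h x"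
  using assms by (auto simp: module_hom_def)

lemma module_homI:
  assumes "\<And>x. x \<in> carrier M \<Longrightarrow> h x \<in> carrier N"
    and "\<And>x y. x \<in> carrier M \<Longrightarrow> y \<in> carrier M \<Longrightarrow> h (x \<oplus>\<^bsub>M\<^esub> y) = h x \<oplus>\<^bsub>N\<^esub> h y"
    and "\<And>r x. r \<in> carrier R \<Longrightarrow> x \<in> carrier M \<Longrightarrow> h (r \<odot>\<^bsub>M\<^esub> x) = r \<odot>\<^bsub>N\<^esub> h x"
  shows "h \<in> module_hom R M N"
  using assms by (auto simp: module_hom_def)

lemma module_hom_comp:
  assumes "h \<in> module_hom R M N" "k \<in> module_hom R N L" shows "k \<circ> h \<in> module_hom R M L"
  using assms by (auto simp: module_hom_def Pi_iff)

context
  fixes h :: "'m \<Rightarrow> 'n" and M :: "('a, 'm, 'c) module_scheme" and R :: "('a, 'r) ring_scheme"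
  assumes inj: "inj_on h (carrier M)" and cl: "op_closed R M"
begin

lemma transport_carrier: "carrier (transport_module h M) = h ` carrier M"
  by (simp add: transport_module_def Let_def)

lemma transport_hom: "h \<in> module_hom R M (transport_module h M)"
  by (rule module_homI) (auto simp: transport_module_def Let_def inv_into_f_f[OF inj])

lemma transport_inv_hom: "inv_into (carrier M) h \<in> module_hom R (transport_module h M) M"
proof (rule module_homI)
  fix x assume "x \<in> carrier (transport_module h M)"
  then show "inv_into (carrier M) h x \<in> carrier M" by (auto simp: transport_carrier intro: inv_into_into)
next
  fix x y assume "x \<in> carrier (transport_module h M)" "y \<in> carrier (transport_module h M)"
  then show "inv_into (carrier M) h (x \<oplus>\<^bsub>transport_module h M\<^esub> y) = inv_into (carrier M) h x \<oplus>\<^bsub>M\<^esub> inv_into (carrier M) h y"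
    using op_closedD[OF cl] by (auto simp: transport_module_def Let_def inv_into_f_f[OF inj])
next
  fix r x assume "r \<in> carrier R" "x \<in> carrier (transport_module h M)"
  then show "inv_into (carrier M) h (r \<odot>\<^bsub>transport_module h M\<^esub> x) = r \<odot>\<^bsub>M\<^esub> inv_into (carrier M) h x"
    using op_closedD[OF cl] by (auto simp: transport_module_def Let_def inv_into_f_f[OF inj])
qed

lemma transport_op_closed: "op_closed R (transport_module h M)"
  using op_closedD[OF cl] unfolding op_closed_def
  by (auto simp: transport_module_def Let_def inv_into_f_f[OF inj])

end

locale peskine_szpiro = cring R for R (structure) +
  fixes p :: nat
begin

abbreviation ract where "ract \<equiv> frob_ract R p"
abbreviation rel where "rel N \<equiv> tensor_relators R Sm ract N"
abbreviation T where "T N \<equiv> tensor_subgroup R Sm ract N"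
abbreviation cls where "cls N \<equiv> tensor_class R Sm ract N"
abbreviation gens where "gens N \<equiv> carrier R \<times> carrier N"

lemma ract_closed: "x \<in> carrier R \<Longrightarrow> r \<in> carrier R \<Longrightarrow> ract x r \<in> carrier R"
  by (simp add: frob_ract_def)

lemma rel_cases [consumes 1]:
  assumes "c \<in> rel N"
  obtains (add1) x y m where "c = frag_of (x \<oplus> y, m) - frag_of (x, m) - frag_of (y, m)"
      "x \<in> carrier R" "y \<in> carrier R" "m \<in> carrier N"
  | (add2) x m n where "c = frag_of (x, m \<oplus>\<^bsub>N\<^esub> n) - frag_of (x, m) - frag_of (x, n)"
      "x \<in> carrier R" "m \<in> carrier N" "n \<in> carrier N"
  | (scalar) x r m where "c = frag_of (ract x r, m) - frag_of (x, r \<odot>\<^bsub>N\<^esub> m)"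
      "x \<in> carrier R" "r \<in> carrier R" "m \<in> carrier N"
  using assms unfolding tensor_relators_def self_simps by blast

lemma rel_intros:
  "x \<in> carrier R \<Longrightarrow> y \<in> carrier R \<Longrightarrow> m \<in> carrier N \<Longrightarrow> frag_of (x \<oplus> y, m) - frag_of (x, m) - frag_of (y, m) \<in> rel N"
  "x \<in> carrier R \<Longrightarrow> m \<in> carrier N \<Longrightarrow> n \<in> carrier N \<Longrightarrow> frag_of (x, m \<oplus>\<^bsub>N\<^esub> n) - frag_of (x, m) - frag_of (x, n) \<in> rel N"
  "x \<in> carrier R \<Longrightarrow> r \<in> carrier R \<Longrightarrow> m \<in> carrier N \<Longrightarrow> frag_of (ract x r, m) - frag_of (x, r \<odot>\<^bsub>N\<^esub> m) \<in> rel N"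
  unfolding tensor_relators_def self_simps by blast+

lemma keys_diff_sub: "Poly_Mapping.keys a \<subseteq> X \<Longrightarrow> Poly_Mapping.keys b \<subseteq> X \<Longrightarrow> Poly_Mapping.keys (a - b) \<subseteq> X"
  for a b :: "'x \<Rightarrow>\<^sub>0 int"
  using keys_diff[of a b] by blast

lemma keys_of_sub: "i \<in> X \<Longrightarrow> Poly_Mapping.keys (frag_of i) \<subseteq> X"
  by simp

lemma rel_gens:
  assumes "op_closed R N" "c \<in> rel N" shows "Poly_Mapping.keys c \<subseteq> gens N"
  using assms(2)
proof (cases rule: rel_cases)
  case (add1 x y m)
  show ?thesis unfolding add1(1) using add1(2-) by (intro keys_diff_sub keys_of_sub) auto
next
  case (add2 x m n)
  show ?thesis unfolding add2(1) using add2(2-) op_closedD[OF assms(1)] by (intro keys_diff_sub keys_of_sub) auto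
next
  case (scalar x r m)
  show ?thesis unfolding scalar(1) using scalar(2-) op_closedD[OF assms(1)] ract_closed
    by (intro keys_diff_sub keys_of_sub) auto
qed

lemma T_subgroup:
  assumes "op_closed R N" shows "subgroup (T N) (free_Abelian_group (gens N))"
proof -
  interpret G: group "free_Abelian_group (gens N)" by simp
  show ?thesis unfolding tensor_subgroup_def self_simps
    by (rule G.generate_is_subgroup) (use rel_gens[OF assms] in \<open>auto simp: carrier_free_Abelian_group_iff\<close>)
qed

lemma T_gens: "op_closed R N \<Longrightarrow> c \<in> T N \<Longrightarrow> Poly_Mapping.keys c \<subseteq> gens N"
  using subsetD[OF subgroup.subset[OF T_subgroup], of N c] by (simp only: carrier_free_Abelian_group_iff)

lemma T_zero: "op_closed R N \<Longrightarrow> 0 \<in> T N"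
  using subgroup.one_closed[OF T_subgroup] by simp

lemma T_add: "op_closed R N \<Longrightarrow> a \<in> T N \<Longrightarrow> b \<in> T N \<Longrightarrow> a + b \<in> T N"
  using subgroup.m_closed[OF T_subgroup] by simp

lemma T_minus: "op_closed R N \<Longrightarrow> a \<in> T N \<Longrightarrow> - a \<in> T N"
  using subgroup.m_inv_closed[OF T_subgroup, of N a] T_gens[of N a] by simp

lemma T_diff: "op_closed R N \<Longrightarrow> a \<in> T N \<Longrightarrow> b \<in> T N \<Longrightarrow> a - b \<in> T N"
  using T_add[of N a "- b"] T_minus[of N b] by simp

lemma T_rel: "c \<in> rel N \<Longrightarrow> c \<in> T N"
  unfolding tensor_subgroup_def self_simps by (rule generate.incl)

lemma T_induct [consumes 2, case_names zero rel add minus]: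
  assumes "op_closed R N" "c \<in> T N" "P 0" "\<And>c. c \<in> rel N \<Longrightarrow> P c"
    and "\<And>a b. a \<in> T N \<Longrightarrow> b \<in> T N \<Longrightarrow> P a \<Longrightarrow> P b \<Longrightarrow> P (a + b)"
    and "\<And>a. a \<in> T N \<Longrightarrow> P a \<Longrightarrow> P (- a)"
  shows "P c"
proof -
  have "c \<in> generate (free_Abelian_group (gens N)) (rel N)"
    using assms(2) by (simp add: tensor_subgroup_def self_simps)
  then have "c \<in> T N \<and> P c"
  proof (induction rule: generate.induct)
    case one then show ?case using assms T_zero by simp
  next
    case (incl h) then show ?case using assms T_rel by simp
  next
    case (inv h)
    have "- h \<in> T N \<and> P (- h)"
      using T_minus[OF assms(1) T_rel[OF inv]] assms(6)[OF T_rel[OF inv] assms(4)[OF inv]] ..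
    then show ?case using rel_gens[OF assms(1) inv] by simp
  next
    case (eng a b) then show ?case using assms(5)[of a b] T_add[OF assms(1), of a b] by simp
  qed
  then show ?thesis ..
qed

lemma mem_cls: "d \<in> cls N c \<longleftrightarrow> d - c \<in> T N"
  unfolding tensor_class_def r_coset_def by (auto simp: image_iff) (metis diff_add_cancel)

lemma cls_eq:
  assumes "op_closed R N" shows "cls N c = cls N d \<longleftrightarrow> c - d \<in> T N"
proof
  assume "cls N c = cls N d"
  moreover have "c \<in> cls N c" using T_zero[OF assms] by (simp add: mem_cls)
  ultimately show "c - d \<in> T N" by (simp add: mem_cls)
next
  assume cd: "c - d \<in> T N"
  have "a - c \<in> T N \<longleftrightarrow> a - d \<in> T N" for a
    using T_add[OF assms _ cd, of "a - c"] T_diff[OF assms _ cd, of "a - d"] by auto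
  then show "cls N c = cls N d" by (auto simp: mem_cls)
qed

lemma cls_self: "op_closed R N \<Longrightarrow> c \<in> cls N c"
  using T_zero by (simp add: mem_cls)

lemma PS_carrier: "carrier (PS R p N) = {cls N c |c. Poly_Mapping.keys c \<subseteq> gens N}"
  unfolding PS_def tensor_product_def Let_def
  by (auto simp: FactGroup_def RCOSETS_def tensor_class_def self_simps carrier_free_Abelian_group_iff)

lemma PS_add:
  assumes "op_closed R N" shows "cls N c \<oplus>\<^bsub>PS R p N\<^esub> cls N d = cls N (c + d)"
proof -
  have "cls N c \<oplus>\<^bsub>PS R p N\<^esub> cls N d = {a + b |a b. a \<in> cls N c \<and> b \<in> cls N d}"
    unfolding PS_def tensor_product_def Let_def
    by (auto simp: FactGroup_def set_mult_def self_simps)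
  also have "\<dots> = cls N (c + d)"
  proof safe
    fix a b assume "a \<in> cls N c" "b \<in> cls N d"
    then have "(a - c) + (b - d) \<in> T N" using T_add[OF assms] by (simp add: mem_cls)
    then show "a + b \<in> cls N (c + d)" by (simp add: mem_cls algebra_simps)
  next
    fix a assume "a \<in> cls N (c + d)"
    then have "a - d \<in> cls N c" by (simp add: mem_cls algebra_simps)
    moreover have "a = (a - d) + d" by simp
    ultimately show "\<exists>x b. a = x + b \<and> x \<in> cls N c \<and> b \<in> cls N d" using cls_self[OF assms] by blast
  qed
  finally show ?thesis .
qed

definition act :: "'a \<Rightarrow> ('a \<times> 'm \<Rightarrow>\<^sub>0 int) \<Rightarrow> ('a \<times> 'm \<Rightarrow>\<^sub>0 int)"
  where "act r = frag_extend (\<lambda>(x, m). frag_of (r \<otimes> x, m))"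

definition fmap :: "('m \<Rightarrow> 'n) \<Rightarrow> ('a \<times> 'm \<Rightarrow>\<^sub>0 int) \<Rightarrow> ('a \<times> 'n \<Rightarrow>\<^sub>0 int)"
  where "fmap \<phi> = frag_extend (\<lambda>(x, m). frag_of (x, \<phi> m))"

lemma act_simps: "act r (a + b) = act r a + act r b" "act r (a - b) = act r a - act r b"
  "act r (- a) = - act r a" "act r 0 = 0" "act r (frag_of (x, m)) = frag_of (r \<otimes> x, m)"
  by (simp_all add: act_def frag_extend_add frag_extend_diff frag_extend_minus)

lemma fmap_simps: "fmap \<phi> (a + b) = fmap \<phi> a + fmap \<phi> b" "fmap \<phi> (a - b) = fmap \<phi> a - fmap \<phi> b"
  "fmap \<phi> (- a) = - fmap \<phi> a" "fmap \<phi> 0 = 0" "fmap \<phi> (frag_of (x, m)) = frag_of (x, \<phi> m)"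
  by (simp_all add: fmap_def frag_extend_add frag_extend_diff frag_extend_minus)

lemma act_keys: "r \<in> carrier R \<Longrightarrow> Poly_Mapping.keys c \<subseteq> gens N \<Longrightarrow> Poly_Mapping.keys (act r c) \<subseteq> gens N"
  unfolding act_def using keys_frag_extend[of "\<lambda>(x, m). frag_of (r \<otimes> x, m)" c] by fastforce

lemma fmap_keys: "(\<And>m. m \<in> carrier N \<Longrightarrow> \<phi> m \<in> carrier N') \<Longrightarrow> Poly_Mapping.keys c \<subseteq> gens N \<Longrightarrow> Poly_Mapping.keys (fmap \<phi> c) \<subseteq> gens N'"
  unfolding fmap_def using keys_frag_extend[of "\<lambda>(x, m). frag_of (x, \<phi> m)" c] by fastforce

lemma act_T:
  assumes N: "op_closed R N" and c: "c \<in> T N" and r: "r \<in> carrier R" shows "act r c \<in> T N"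
  using N c
proof (induction rule: T_induct)
  case zero then show ?case using T_zero[OF N] by (simp add: act_simps)
next
  case (rel c)
  then show ?case
  proof (cases rule: rel_cases)
    case (add1 x y m)
    then show ?thesis using rel_intros(1)[of "r \<otimes> x" "r \<otimes> y" m N] r T_rel by (simp add: act_simps r_distr)
  next
    case (add2 x m n)
    then show ?thesis using rel_intros(2)[of "r \<otimes> x" m N n] r T_rel by (simp add: act_simps)
  next
    case (scalar x s m)
    then have "r \<otimes> ract x s = ract (r \<otimes> x) s" using r by (simp add: frob_ract_def m_lcomm)
    then show ?thesis using scalar rel_intros(3)[of "r \<otimes> x" s m N] r T_rel by (simp add: act_simps)
  qed
next
  case (add a b) then show ?case using T_add[OF N] by (simp add: act_simps)
next
  case (minus a) then show ?case using T_minus[OF N] by (simp add: act_simps)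
qed

lemma fmap_T:
  assumes N: "op_closed R N" and N': "op_closed R N'" and \<phi>: "\<phi> \<in> module_hom R N N'" and c: "c \<in> T N"
  shows "fmap \<phi> c \<in> T N'"
  using N c
proof (induction rule: T_induct)
  case zero then show ?case using T_zero[OF N'] by (simp add: fmap_simps)
next
  case (rel c)
  then show ?case
  proof (cases rule: rel_cases)
    case (add1 x y m)
    then show ?thesis using rel_intros(1)[of x y "\<phi> m" N'] module_homD[OF \<phi>] T_rel by (simp add: fmap_simps)
  next
    case (add2 x m n)
    then show ?thesis using rel_intros(2)[of x "\<phi> m" N' "\<phi> n"] module_homD[OF \<phi>] T_rel by (simp add: fmap_simps)
  next
    case (scalar x s m)
    then show ?thesis using rel_intros(3)[of x s "\<phi> m" N'] module_homD[OF \<phi>] T_rel by (simp add: fmap_simps)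
  qed
next
  case (add a b) then show ?case using T_add[OF N'] by (simp add: fmap_simps)
next
  case (minus a) then show ?case using T_minus[OF N'] by (simp add: fmap_simps)
qed

lemma PS_smult:
  assumes N: "op_closed R N" and r: "r \<in> carrier R"
  shows "r \<odot>\<^bsub>PS R p N\<^esub> cls N c = cls N (act r c)"
proof -
  have "r \<odot>\<^bsub>PS R p N\<^esub> cls N c = (\<Union>d\<in>cls N c. cls N (act r d))"
    by (simp add: PS_def tensor_product_def Let_def act_def self_simps)
  moreover have "cls N (act r d) = cls N (act r c)" if "d \<in> cls N c" for d
    using act_T[OF N _ r, of "d - c"] that by (simp add: cls_eq[OF N] mem_cls act_simps)
  ultimately show ?thesis using cls_self[OF N, of c] by blast
qed

lemma PS_map_cls:
  assumes N: "op_closed R N" and N': "op_closed R N'" and \<phi>: "\<phi> \<in> module_hom R N N'"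
  shows "PS_map R p N' \<phi> (cls N c) = cls N' (fmap \<phi> c)"
proof -
  have "PS_map R p N' \<phi> (cls N c) = (\<Union>d\<in>cls N c. cls N' (fmap \<phi> d))"
    by (simp add: PS_map_def tensor_map_def fmap_def)
  moreover have "cls N' (fmap \<phi> d) = cls N' (fmap \<phi> c)" if "d \<in> cls N c" for d
    using fmap_T[OF N N' \<phi>, of "d - c"] that by (simp add: cls_eq[OF N'] mem_cls fmap_simps)
  ultimately show ?thesis using cls_self[OF N, of c] by blast
qed

lemma PS_cases:
  assumes "C \<in> carrier (PS R p N)"
  obtains c where "C = cls N c" "Poly_Mapping.keys c \<subseteq> gens N"
  using assms by (auto simp: PS_carrier)

lemma PS_op_closed:
  assumes N: "op_closed R N" shows "op_closed R (PS R p N)"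
  unfolding op_closed_def
proof (intro conjI ballI)
  fix C D assume "C \<in> carrier (PS R p N)" "D \<in> carrier (PS R p N)"
  then obtain c d where "C = cls N c" "Poly_Mapping.keys c \<subseteq> gens N" "D = cls N d" "Poly_Mapping.keys d \<subseteq> gens N"
    unfolding PS_carrier by blast
  moreover from this have "Poly_Mapping.keys (c + d) \<subseteq> gens N" using keys_add[of c d] by blast
  ultimately show "C \<oplus>\<^bsub>PS R p N\<^esub> D \<in> carrier (PS R p N)" by (auto simp: PS_add[OF N] PS_carrier)
next
  fix r C assume r: "r \<in> carrier R" and "C \<in> carrier (PS R p N)"
  then obtain c where c: "C = cls N c" "Poly_Mapping.keys c \<subseteq> gens N" unfolding PS_carrier by blast
  show "r \<odot>\<^bsub>PS R p N\<^esub> C \<in> carrier (PS R p N)"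
    unfolding c(1) PS_smult[OF N r] PS_carrier using act_keys[OF r c(2)] by blast
qed

lemma PS_map_hom:
  assumes N: "op_closed R N" and N': "op_closed R N'" and \<phi>: "\<phi> \<in> module_hom R N N'"
  shows "PS_map R p N' \<phi> \<in> module_hom R (PS R p N) (PS R p N')"
proof (rule module_homI)
  note mp = PS_map_cls[OF N N' \<phi>]
  fix C assume "C \<in> carrier (PS R p N)"
  then obtain c where c: "C = cls N c" "Poly_Mapping.keys c \<subseteq> gens N" by (rule PS_cases)
  then show "PS_map R p N' \<phi> C \<in> carrier (PS R p N')"
    using fmap_keys[of N \<phi> N' c] module_homD(1)[OF \<phi>] by (auto simp: mp PS_carrier)
  show "PS_map R p N' \<phi> (C \<oplus>\<^bsub>PS R p N\<^esub> D) = PS_map R p N' \<phi> C \<oplus>\<^bsub>PS R p N'\<^esub> PS_map R p N' \<phi> D"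
    if "D \<in> carrier (PS R p N)" for D
    using that c by (auto elim!: PS_cases simp: mp PS_add[OF N] PS_add[OF N'] fmap_simps)
  have "act r (fmap \<phi> d) = fmap \<phi> (act r d)" if "Poly_Mapping.keys d \<subseteq> gens N" for r d
    using that by (induction d rule: frag_induction) (auto simp: act_simps fmap_simps)
  then show "PS_map R p N' \<phi> (r \<odot>\<^bsub>PS R p N\<^esub> C) = r \<odot>\<^bsub>PS R p N'\<^esub> PS_map R p N' \<phi> C" if "r \<in> carrier R" for r
    using c that by (simp add: mp PS_smult[OF N] PS_smult[OF N'])
qed

lemma cls_neg_pure:
  assumes N: "op_closed R N" and x: "x \<in> carrier R" "m \<in> carrier N"
  shows "frag_of (x, m) + frag_of (\<ominus> x, m) \<in> T N"
proof -
  \<comment> \<open>The additivity relator for \<open>\<zero> \<oplus> \<zero>\<close> is minus this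
    generator.\<close>
  have 0: "frag_of (\<zero>, m) \<in> T N"
    using T_minus[OF N T_rel[OF rel_intros(1)[of \<zero> \<zero> m N]]] x by simp
  have "frag_of (x \<oplus> \<ominus> x, m) - frag_of (x, m) - frag_of (\<ominus> x, m) \<in> T N"
    using x by (intro T_rel rel_intros) auto
  then have "frag_of (\<zero>, m) - frag_of (x, m) - frag_of (\<ominus> x, m) \<in> T N" using x by (simp add: r_neg)
  from T_diff[OF N 0 this] show ?thesis by (simp add: algebra_simps)
qed

lemma cls_formal_sum:
  assumes N: "op_closed R N" and c: "Poly_Mapping.keys c \<subseteq> gens N"
  shows "\<exists>xs. set xs \<subseteq> gens N \<and> cls N c = cls N (sum_list (map frag_of xs))"
  using c
proof (induction c rule: frag_induction)
  case zero show ?case by (intro exI[of _ "[]"]) simp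
next
  case (one x) then show ?case by (intro exI[of _ "[x]"]) simp
next
  case (diff a b)
  then obtain xs ys where xs: "set xs \<subseteq> gens N" "a - sum_list (map frag_of xs) \<in> T N"
    and ys: "set ys \<subseteq> gens N" "b - sum_list (map frag_of ys) \<in> T N"
    by (auto simp: cls_eq[OF N])
  let ?n = "map (\<lambda>(r, m). (\<ominus> r, m))"
  have "sum_list (map frag_of ys) + sum_list (map frag_of (?n ys)) \<in> T N"
    using ys(1)
  proof (induction ys)
    case Nil then show ?case using T_zero[OF N] by simp
  next
    case (Cons y ys)
    obtain r m where y: "y = (r, m)" by (cases y)
    have "frag_of (r, m) + frag_of (\<ominus> r, m) \<in> T N" using Cons.prems y by (intro cls_neg_pure[OF N]) auto
    from T_add[OF N this Cons.IH] show ?case using Cons.prems y by (simp add: algebra_simps)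
  qed
  from T_diff[OF N T_diff[OF N xs(2) ys(2)] this]
  have "a - b - (sum_list (map frag_of xs) + sum_list (map frag_of (?n ys))) \<in> T N"
    by (simp add: algebra_simps)
  moreover have "set (xs @ ?n ys) \<subseteq> gens N" using xs(1) ys(1) by auto
  ultimately show ?case by (intro exI[of _ "xs @ ?n ys"]) (simp add: cls_eq[OF N])
qed

lemma PS_code_inj:
  assumes N: "op_closed R N" shows "inj_on (PS_code R p N) (carrier (PS R p N))"
proof (rule inj_onI)
  fix C D assume C: "C \<in> carrier (PS R p N)" and D: "D \<in> carrier (PS R p N)" and eq: "PS_code R p N C = PS_code R p N D"
  let ?P = "\<lambda>C xs. set xs \<subseteq> gens N \<and> C = cls N (sum_list (map frag_of xs))"
  have "?P C (SOME xs. ?P C xs)" if "C \<in> carrier (PS R p N)" for C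
    using that by (elim PS_cases) (rule someI_ex, use cls_formal_sum[OF N] in blast)
  from this[OF C] this[OF D] eq show "C = D" by (simp add: PS_code_def)
qed

section \<open>Iterates of the functor\<close>

lemma iter_op_closed:
  assumes "module R M" shows "op_closed R (PS_iter R p M e)"
proof (induction e)
  case 0
  interpret M: module R M by fact
  show ?case by (simp, rule transport_op_closed) (auto simp: op_closed_def inj_on_def)
next
  case (Suc e)
  show ?case by (simp, rule transport_op_closed[OF PS_code_inj[OF Suc] PS_op_closed[OF Suc]])
qed

lemma code_hom:
  assumes "module R M"
  shows "PS_code R p (PS_iter R p M e) \<in> module_hom R (PS R p (PS_iter R p M e)) (PS_iter R p M (Suc e))"
  using transport_hom[OF PS_code_inj PS_op_closed, OF iter_op_closed iter_op_closed, OF assms assms] by simp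

lemma decode_hom:
  assumes "module R M"
  shows "PS_decode R p M e \<in> module_hom R (PS_iter R p M (Suc e)) (PS R p (PS_iter R p M e))"
  using transport_inv_hom[OF PS_code_inj PS_op_closed, OF iter_op_closed iter_op_closed, OF assms assms]
  by (simp add: PS_decode_def)

lemma decode_code:
  assumes "module R M" "C \<in> carrier (PS R p (PS_iter R p M e))"
  shows "PS_decode R p M e (PS_code R p (PS_iter R p M e) C) = C"
  unfolding PS_decode_def by (rule inv_into_f_f[OF PS_code_inj[OF iter_op_closed[OF assms(1)]] assms(2)])

lemma iter_Suc_carrier:
  "carrier (PS_iter R p M (Suc e)) = PS_code R p (PS_iter R p M e) ` carrier (PS R p (PS_iter R p M e))"
  by (simp add: transport_module_def Let_def)

lemma iter_map_hom:
  assumes M: "module R M" and \<beta>: "\<beta> \<in> module_hom R M (PS R p M)"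
  shows "PS_iter_map R p M \<beta> e \<in> module_hom R (PS_iter R p M e) (PS_iter R p M (Suc e))"
proof (induction e)
  case 0
  interpret M: module R M by fact
  have cl: "op_closed R M" by (auto simp: op_closed_def)
  have inj: "inj_on Base (carrier M)" by (auto simp: inj_on_def)
  have b: "Base \<in> module_hom R M (PS_iter R p M 0)" using transport_hom[OF inj cl] by simp
  have i: "inv_into (carrier M) Base \<in> module_hom R (PS_iter R p M 0) M" using transport_inv_hom[OF inj cl] by simp
  show ?case unfolding PS_iter_map.simps(1)
    by (intro module_hom_comp[OF i] module_hom_comp[OF \<beta>] module_hom_comp[OF PS_map_hom[OF cl iter_op_closed[OF M] b]] code_hom[OF M])
next
  case (Suc e)
  show ?case unfolding PS_iter_map.simps(2)
    by (intro module_hom_comp[OF decode_hom[OF M]] module_hom_comp[OF PS_map_hom[OF iter_op_closed[OF M] iter_op_closed[OF M] Suc]] code_hom[OF M])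
qed

end

section \<open>Direct limits\<close>

lemma fold_upt_split: "d \<le> k \<Longrightarrow> k \<le> m \<Longrightarrow> fold g [d..<m] x = fold g [k..<m] (fold g [d..<k] x)"
  for d k m :: nat
  by (metis fold_append comp_apply le_add_diff_inverse upt_add_eq_append)

text \<open>Agreement at one stage persists at every later one, so two comparisons can be made at a
  common stage.\<close>

lemma limit_class_eq:
  assumes "fold g [d..<k] x = fold g [e..<k] y" "d \<le> k" "e \<le> k"
  shows "limit_class N g d x = limit_class N g e y"
proof -
  have main: "(a, z) \<in> limit_class N g e y"
    if eq: "fold g [d..<k] x = fold g [e..<k] y" "d \<le> k" "e \<le> k" and m: "(a, z) \<in> limit_class N g d x" for d e x y a z
  proof -
    obtain l where l: "z \<in> carrier (N a)" "d \<le> l" "a \<le> l" "fold g [d..<l] x = fold g [a..<l] z"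
      using m by (auto simp: limit_class_def)
    let ?m = "max k l"
    have "fold g [e..<?m] y = fold g [k..<?m] (fold g [e..<k] y)" using eq by (intro fold_upt_split) auto
    also have "\<dots> = fold g [d..<?m] x" unfolding eq(1)[symmetric] using eq by (intro fold_upt_split[symmetric]) auto
    also have "\<dots> = fold g [l..<?m] (fold g [d..<l] x)" using l by (intro fold_upt_split) auto
    also have "\<dots> = fold g [a..<?m] z" unfolding l(4) using l by (intro fold_upt_split[symmetric]) auto
    finally show ?thesis using l eq by (auto simp: limit_class_def intro!: exI[of _ ?m])
  qed
  show ?thesis using main[OF assms] main[OF assms(1)[symmetric] assms(3,2)] by auto
qed

locale direct_system = cring R for R (structure) +
  fixes N :: "nat \<Rightarrow> ('a, 'm, 'c) module_scheme" and g :: "nat \<Rightarrow> 'm \<Rightarrow> 'm"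
  assumes N: "\<And>e. op_closed R (N e)" and g: "\<And>e. g e \<in> module_hom R (N e) (N (Suc e))"
begin

lemma fold_hom: "fold g [d..<d + k] \<in> module_hom R (N d) (N (d + k))"
proof (induction k)
  case 0 show ?case by (auto simp: module_hom_def)
next
  case (Suc k)
  have "fold g [d..<d + Suc k] = g (d + k) \<circ> fold g [d..<d + k]" by simp
  then show ?case using module_hom_comp[OF Suc g[of "d + k"]] by (simp add: comp_def)
qed

lemma fold_hom': "d \<le> k \<Longrightarrow> fold g [d..<k] \<in> module_hom R (N d) (N k)"
  using fold_hom[of d "k - d"] by simp

abbreviation cl where "cl \<equiv> limit_class N g"

lemma cl_step: "cl e x = cl (Suc e) (g e x)"
  by (rule limit_class_eq[of _ _ "Suc e"]) auto

lemma mem_cl_self: "x \<in> carrier (N e) \<Longrightarrow> (e, x) \<in> cl e x"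
  by (auto simp: limit_class_def)

lemma cl_add:
  assumes x: "x \<in> carrier (N e)" and y: "y \<in> carrier (N e)"
  shows "cl e x \<oplus>\<^bsub>direct_limit N g\<^esub> cl e y = cl e (x \<oplus>\<^bsub>N e\<^esub> y)"
proof -
  have "cl (max a b) (fold g [a..<max a b] x' \<oplus>\<^bsub>N (max a b)\<^esub> fold g [b..<max a b] y') = cl e (x \<oplus>\<^bsub>N e\<^esub> y)"
    if x': "(a, x') \<in> cl e x" and y': "(b, y') \<in> cl e y" for a b x' y'
  proof -
    let ?k = "max a b"
    obtain k1 where k1: "x' \<in> carrier (N a)" "e \<le> k1" "a \<le> k1" "fold g [e..<k1] x = fold g [a..<k1] x'"
      using x' by (auto simp: limit_class_def)
    obtain k2 where k2: "y' \<in> carrier (N b)" "e \<le> k2" "b \<le> k2" "fold g [e..<k2] y = fold g [b..<k2] y'"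
      using y' by (auto simp: limit_class_def)
    let ?K = "max k1 k2"
    have xk: "fold g [a..<?k] x' \<in> carrier (N ?k)" using module_homD(1)[OF fold_hom'[of a ?k]] k1 by simp
    have yk: "fold g [b..<?k] y' \<in> carrier (N ?k)" using module_homD(1)[OF fold_hom'[of b ?k]] k2 by simp
    have kK: "?k \<le> ?K" using k1 k2 by auto
    have eK: "e \<le> ?K" using k1 by auto
    have "fold g [?k..<?K] (fold g [a..<?k] x' \<oplus>\<^bsub>N ?k\<^esub> fold g [b..<?k] y')
      = fold g [?k..<?K] (fold g [a..<?k] x') \<oplus>\<^bsub>N ?K\<^esub> fold g [?k..<?K] (fold g [b..<?k] y')"
      by (rule module_homD(2)[OF fold_hom'[OF kK] xk yk])
    also have "fold g [?k..<?K] (fold g [a..<?k] x') = fold g [k1..<?K] (fold g [a..<k1] x')"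
      using fold_upt_split[of a ?k ?K g x'] fold_upt_split[of a k1 ?K g x'] kK k1 by simp
    also have "\<dots> = fold g [e..<?K] x" unfolding k1(4)[symmetric] using k1 by (intro fold_upt_split[symmetric]) auto
    also have "fold g [?k..<?K] (fold g [b..<?k] y') = fold g [k2..<?K] (fold g [b..<k2] y')"
      using fold_upt_split[of b ?k ?K g y'] fold_upt_split[of b k2 ?K g y'] kK k2 by simp
    also have "\<dots> = fold g [e..<?K] y" unfolding k2(4)[symmetric] using k2 by (intro fold_upt_split[symmetric]) auto
    also have "fold g [e..<?K] x \<oplus>\<^bsub>N ?K\<^esub> fold g [e..<?K] y = fold g [e..<?K] (x \<oplus>\<^bsub>N e\<^esub> y)"
      by (rule module_homD(2)[OF fold_hom'[OF eK] x y, symmetric])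
    finally show ?thesis by (rule limit_class_eq[OF _ kK eK])
  qed
  then show ?thesis
    unfolding direct_limit_def Let_def
    by (simp, intro UN_pair_const[OF mem_cl_self[OF x]] UN_pair_const[OF mem_cl_self[OF y]])
qed

lemma cl_smult:
  assumes r: "r \<in> carrier R" and x: "x \<in> carrier (N e)"
  shows "r \<odot>\<^bsub>direct_limit N g\<^esub> cl e x = cl e (r \<odot>\<^bsub>N e\<^esub> x)"
proof -
  have "cl a (r \<odot>\<^bsub>N a\<^esub> x') = cl e (r \<odot>\<^bsub>N e\<^esub> x)" if x': "(a, x') \<in> cl e x" for a x'
  proof -
    obtain k where k: "x' \<in> carrier (N a)" "e \<le> k" "a \<le> k" "fold g [e..<k] x = fold g [a..<k] x'"
      using x' by (auto simp: limit_class_def)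
    show ?thesis
      by (rule limit_class_eq[OF _ k(3,2)])
        (simp add: module_homD(3)[OF fold_hom'[OF k(3)] r k(1)] module_homD(3)[OF fold_hom'[OF k(2)] r x] k(4))
  qed
  then show ?thesis
    unfolding direct_limit_def by (simp, intro UN_pair_const[OF mem_cl_self[OF x]])
qed

lemma cl_hom: "cl e \<in> module_hom R (N e) (direct_limit N g)"
  by (rule module_homI) (auto simp: cl_add cl_smult, auto simp: direct_limit_def)

lemma direct_limit_carrier: "carrier (direct_limit N g) = (\<Union>e. cl e ` carrier (N e))"
  by (auto simp: direct_limit_def)

end

section \<open>F-modules as modules with a Frobenius action\<close>

lemma module_hom_semilinear: "h \<in> module_hom R M N \<longleftrightarrow> semilinear R (\<lambda>r. r) M N h"
  by (auto simp: module_hom_def semilinear_def)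

locale frobenius_module = flat_endo R F + peskine_szpiro R p + module R M
  for R :: "('a, 'r) ring_scheme" (structure) and F and p and M :: "('a, 'm, 'c) module_scheme" (structure) +
  fixes \<theta> :: "'m \<Rightarrow> ('a \<times> 'm \<Rightarrow>\<^sub>0 int) set"
  assumes F_pow: "F = (\<lambda>r. r [^] p)" and \<theta>: "\<theta> \<in> module_iso R M (PS R p M)"
begin

lemma M_op_closed: "op_closed R M" by (auto simp: op_closed_def)

lemma \<theta>_hom: "\<theta> \<in> module_hom R M (PS R p M)" and \<theta>_bij: "bij_betw \<theta> (carrier M) (carrier (PS R p M))"
  using \<theta> by (auto simp: module_iso_def)

lemma \<theta>_inj: "x \<in> carrier M \<Longrightarrow> y \<in> carrier M \<Longrightarrow> \<theta> x = \<theta> y \<Longrightarrow> x = y"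
  using \<theta>_bij by (auto simp: bij_betw_def inj_on_def)

text \<open>The inverse of \<open>\<theta>\<close> sends the class of \<open>(r, x)\<close> to
  \<open>r \<bullet> \<phi> x\<close>. By adjunction this linear map is determined by
  \<open>\<phi>\<close>, which is linear only over Frobenius.\<close>

definition \<phi> where "\<phi> x = inv_into (carrier M) \<theta> (cls M (frag_of (\<one>, x)))"

lemma pure_PS: "r \<in> carrier R \<Longrightarrow> x \<in> carrier M \<Longrightarrow> cls M (frag_of (r, x)) \<in> carrier (PS R p M)"
  unfolding PS_carrier by (auto intro!: exI[of _ "frag_of (r, x)"])

lemma \<phi>_carr: "x \<in> carrier M \<Longrightarrow> \<phi> x \<in> carrier M"
  unfolding \<phi>_def using pure_PS[of \<one> x] \<theta>_bij by (auto simp: bij_betw_def intro!: inv_into_into)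

lemma \<theta>_\<phi>: "x \<in> carrier M \<Longrightarrow> \<theta> (\<phi> x) = cls M (frag_of (\<one>, x))"
  unfolding \<phi>_def using pure_PS[of \<one> x] \<theta>_bij by (auto simp: bij_betw_def intro!: f_inv_into_f)

lemma \<theta>_smult_\<phi>: "r \<in> carrier R \<Longrightarrow> x \<in> carrier M \<Longrightarrow> \<theta> (r \<bullet> \<phi> x) = cls M (frag_of (r, x))"
  using module_homD(3)[OF \<theta>_hom, of r "\<phi> x"] \<phi>_carr by (simp add: \<theta>_\<phi> PS_smult[OF M_op_closed] act_simps)

lemma \<phi>_semilinear: "semilinear R F M M \<phi>"
  unfolding semilinear_def
proof (intro conjI ballI)
  show "\<phi> \<in> carrier M \<rightarrow> carrier M" using \<phi>_carr by auto
  fix x assume x: "x \<in> carrier M"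
  show "\<phi> (x \<oplus>\<^bsub>M\<^esub> y) = \<phi> x \<oplus>\<^bsub>M\<^esub> \<phi> y" if y: "y \<in> carrier M" for y
  proof (rule \<theta>_inj)
    have "\<theta> (\<phi> x \<oplus>\<^bsub>M\<^esub> \<phi> y) = cls M (frag_of (\<one>, x) + frag_of (\<one>, y))"
      using module_homD(2)[OF \<theta>_hom, of "\<phi> x" "\<phi> y"] x y \<phi>_carr by (simp add: \<theta>_\<phi> PS_add[OF M_op_closed])
    moreover have "frag_of (\<one>, x \<oplus>\<^bsub>M\<^esub> y) - (frag_of (\<one>, x) + frag_of (\<one>, y)) \<in> T M"
      using T_rel[OF rel_intros(2)[of \<one> x M y]] x y by (simp add: algebra_simps)
    ultimately show "\<theta> (\<phi> (x \<oplus>\<^bsub>M\<^esub> y)) = \<theta> (\<phi> x \<oplus>\<^bsub>M\<^esub> \<phi> y)"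
      using x y by (simp add: \<theta>_\<phi> cls_eq[OF M_op_closed])
  qed (use x y \<phi>_carr in auto)
  show "\<phi> (r \<bullet> x) = F r \<bullet> \<phi> x" if r: "r \<in> carrier R" for r
  proof (rule \<theta>_inj)
    have "frag_of (ract \<one> r, x) - frag_of (\<one>, r \<bullet> x) \<in> T M"
      using T_rel[OF rel_intros(3)[of \<one> r x M]] x r by simp
    then have "cls M (frag_of (ract \<one> r, x)) = cls M (frag_of (\<one>, r \<bullet> x))" by (simp add: cls_eq[OF M_op_closed])
    then show "\<theta> (\<phi> (r \<bullet> x)) = \<theta> (F r \<bullet> \<phi> x)"
      using x r \<theta>_smult_\<phi>[of "F r" x] by (simp add: \<theta>_\<phi> frob_ract_def F_pow)
  qed (use x r \<phi>_carr in auto)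
qed

lemma \<theta>_zero: "\<theta> \<zero>\<^bsub>M\<^esub> = cls M 0"
proof -
  obtain c where c: "\<theta> \<zero>\<^bsub>M\<^esub> = cls M c" using module_homD(1)[OF \<theta>_hom, of "\<zero>\<^bsub>M\<^esub>"] PS_cases by blast
  have "cls M c = cls M (c + c)" using module_homD(2)[OF \<theta>_hom, of "\<zero>\<^bsub>M\<^esub>" "\<zero>\<^bsub>M\<^esub>"] c by (simp add: PS_add[OF M_op_closed])
  then have "- c \<in> T M" by (simp add: cls_eq[OF M_op_closed])
  then have "c \<in> T M" using T_minus[OF M_op_closed, of "- c"] by simp
  then show ?thesis unfolding c by (simp add: cls_eq[OF M_op_closed])
qed

text \<open>Applied to the relation, \<open>\<theta>\<close> makes the tensor with entries
  \<open>u i\<close> and \<open>z i\<close> vanish, so a formal sum representing it lies in the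
  subgroup generated by the relators. A homomorphism \<open>h\<close> into the free module on
  \<open>carrier M\<close> carries the relators into the span of the Frobenius images of the
  relations of \<open>M\<close>.\<close>

lemma tensor_relations:
  assumes z: "\<And>i. i < n \<Longrightarrow> z i \<in> carrier M" and u: "u \<in> carrier (fs R {..<n::nat})"
    and eq: "lc R M (\<lambda>i. \<phi> (z i)) u = \<zero>\<^bsub>M\<^esub>"
  shows "lc R (fs R (carrier M)) (\<lambda>i. single R (z i) \<one>) u
        \<in> frob_span R F (carrier M) {c \<in> carrier (fs R (carrier M)). lc R M (\<lambda>x. x) c = \<zero>\<^bsub>M\<^esub>}" (is "_ \<in> frob_span R F _ ?Rel")
proof -
  let ?FL = "fs R (carrier M)"
  interpret FL: module R ?FL by (rule fs_is_module)
  let ?W = "frob_span R F (carrier M) ?Rel"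
  have RelL: "?Rel \<subseteq> carrier ?FL" by blast
  have W: "submodule ?W R ?FL" by (rule frob_span_submodule[OF RelL])
  have FW: "(\<lambda>i. F (c i)) \<in> ?W" if "c \<in> ?Rel" for c
    unfolding frob_span_def using that FL.lspan_incl[OF F_image_fs[OF RelL]] by blast
  have s: "single R m r \<in> carrier ?FL" if "m \<in> carrier M" "r \<in> carrier R" for m r
    using that by (intro single_fs) auto
  have im: "(\<lambda>(r, m). single R m r) ` gens M \<subseteq> carrier (add_monoid ?FL)" using s by auto
  \<comment> \<open>Formal sums of pairs are compared with vectors by sending \<open>(r, m)\<close>
    to \<open>r\<close> times the basis vector at \<open>m\<close>.\<close>
  obtain h where h: "h \<in> hom (free_Abelian_group (gens M)) (add_monoid ?FL)"
    and hs0: "\<And>x. x \<in> gens M \<Longrightarrow> h (frag_of x) = (\<lambda>(r, m). single R m r) x"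
    by (rule comm_group.free_Abelian_group_universal[OF FL.a_comm_group im]) (rule that)
  have hs: "h (frag_of (r, m)) = single R m r" if "r \<in> carrier R" "m \<in> carrier M" for r m
    using hs0[of "(r, m)"] that by simp
  have hc: "h c \<in> carrier ?FL" if "Poly_Mapping.keys c \<subseteq> gens M" for c
    using h that by (auto simp: hom_def Pi_iff carrier_free_Abelian_group_iff)
  have hadd: "h (a + b) = h a \<oplus>\<^bsub>?FL\<^esub> h b" if "Poly_Mapping.keys a \<subseteq> gens M" "Poly_Mapping.keys b \<subseteq> gens M" for a b
    using h that by (simp add: hom_def carrier_free_Abelian_group_iff)
  have hdiff: "h (a - b) = h a \<ominus>\<^bsub>?FL\<^esub> h b" if ab: "Poly_Mapping.keys a \<subseteq> gens M" "Poly_Mapping.keys b \<subseteq> gens M" for a b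
  proof -
    have d: "Poly_Mapping.keys (a - b) \<subseteq> gens M" by (rule keys_diff_sub[OF ab])
    have "h a = h (a - b) \<oplus>\<^bsub>?FL\<^esub> h b" using hadd[OF d ab(2)] by simp
    then show ?thesis using hc[OF d] hc[OF ab(2)] by (simp add: a_minus_def FL.M.a_assoc FL.M.r_neg)
  qed
  have h0: "h 0 = \<zero>\<^bsub>?FL\<^esub>" using hdiff[of 0 0] hc[of 0] by (simp add: a_minus_def FL.M.r_neg)
  have ev: "semilinear R (\<lambda>r. r) ?FL M (lc R M (\<lambda>x. x))" by (rule lc_linear) auto
  have evs: "lc R M (\<lambda>x. x) (single R m r) = r \<bullet> m" if "m \<in> carrier M" "r \<in> carrier R" for m r
    using lc_single[of r "\<lambda>x. x" m] that by simp
  have evd: "lc R M (\<lambda>x. x) (f \<ominus>\<^bsub>?FL\<^esub> g) = lc R M (\<lambda>x. x) f \<ominus>\<^bsub>M\<^esub> lc R M (\<lambda>x. x) g"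
    if "f \<in> carrier ?FL" "g \<in> carrier ?FL" for f g
    using semilinearD(2)[OF ev that(1), of "\<ominus>\<^bsub>?FL\<^esub> g"] semilinear_minus[OF FL.module_axioms module_axioms ev that(2)] that
    by (simp add: a_minus_def)
  have Fd: "(\<lambda>i. F ((f \<ominus>\<^bsub>?FL\<^esub> g) i)) = (\<lambda>i. F (f i)) \<ominus>\<^bsub>?FL\<^esub> (\<lambda>i. F (g i))"
    if "f \<in> carrier ?FL" "g \<in> carrier ?FL" for f g
    using semilinearD(2)[OF F_fs that(1), of "\<ominus>\<^bsub>?FL\<^esub> g"] semilinear_minus[OF FL.module_axioms FL.module_axioms F_fs that(2)] that
    by (simp add: a_minus_def)
  have Fs: "(\<lambda>i. F (single R m r i)) = single R m (F r)" for m r by (auto simp: single_def)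
  have sm: "x \<odot>\<^bsub>?FL\<^esub> single R m r = single R m (x \<otimes> r)" if "x \<in> carrier R" for x m r
    using that by (auto simp: single_def fs_simps)
  have smd: "x \<odot>\<^bsub>?FL\<^esub> (f \<ominus>\<^bsub>?FL\<^esub> g) = x \<odot>\<^bsub>?FL\<^esub> f \<ominus>\<^bsub>?FL\<^esub> x \<odot>\<^bsub>?FL\<^esub> g"
    if "x \<in> carrier R" "f \<in> carrier ?FL" "g \<in> carrier ?FL" for x f g
    using that by (simp add: a_minus_def FL.smult_r_distr FL.smult_r_minus)
  have hT: "h c \<in> ?W" if "c \<in> T M" for c
    using M_op_closed that
  proof (induction rule: T_induct)
    case zero then show ?case using h0 FL.submodule_zero[OF W] by simp
  next
    case (rel c)
    then show ?case
    proof (cases rule: rel_cases)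
      case (add1 x y m)
      have k: "Poly_Mapping.keys (frag_of (r, m)) \<subseteq> gens M" if "r \<in> carrier R" for r using that add1 by auto
      have "h c = single R m (x \<oplus> y) \<ominus>\<^bsub>?FL\<^esub> single R m x \<ominus>\<^bsub>?FL\<^esub> single R m y"
        unfolding add1(1) using add1(2-) hs
        by (subst hdiff[OF keys_diff_sub[OF k k] k]) (auto simp: hdiff[OF k k])
      also have "single R m (x \<oplus> y) = single R m x \<oplus>\<^bsub>?FL\<^esub> single R m y" by (auto simp: fs_simps single_def)
      also have "single R m x \<oplus>\<^bsub>?FL\<^esub> single R m y \<ominus>\<^bsub>?FL\<^esub> single R m x \<ominus>\<^bsub>?FL\<^esub> single R m y = \<zero>\<^bsub>?FL\<^esub>"
        using s[of m x] s[of m y] add1 FL.M.r_neg[of "single R m x \<oplus>\<^bsub>?FL\<^esub> single R m y"]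
        by (simp add: a_minus_def FL.M.minus_add FL.M.a_assoc)
      finally show ?thesis using FL.submodule_zero[OF W] by simp
    next
      case (add2 x m n)
      have mn: "m \<oplus>\<^bsub>M\<^esub> n \<in> carrier M" using add2 by simp
      have k: "Poly_Mapping.keys (frag_of (x, m)) \<subseteq> gens M" if "m \<in> carrier M" for m using that add2 by auto
      \<comment> \<open>The relation expressing additivity in \<open>M\<close>. Its coefficients are
        fixed by Frobenius, so \<open>x\<close> times it is the image of the relator under
        \<open>h\<close>.\<close>
      let ?C = "single R (m \<oplus>\<^bsub>M\<^esub> n) \<one> \<ominus>\<^bsub>?FL\<^esub> single R m \<one> \<ominus>\<^bsub>?FL\<^esub> single R n \<one>"
      have s1: "single R (m \<oplus>\<^bsub>M\<^esub> n) \<one> \<in> carrier ?FL" "single R m \<one> \<in> carrier ?FL" "single R n \<one> \<in> carrier ?FL"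
        using s mn add2 by auto
      have "lc R M (\<lambda>x. x) ?C = \<zero>\<^bsub>M\<^esub>"
        using s1 add2 mn M.r_neg[of "m \<oplus>\<^bsub>M\<^esub> n"]
        by (simp add: evd evs) (simp add: a_minus_def M.minus_add M.a_assoc)
      then have "?C \<in> ?Rel" using s1 by simp
      then have "x \<odot>\<^bsub>?FL\<^esub> (\<lambda>i. F (?C i)) \<in> ?W" using add2 by (intro FL.submodule_smult[OF W] FW)
      also have "(\<lambda>i. F (?C i)) = ?C" using s1 by (simp add: Fd Fs)
      also have "x \<odot>\<^bsub>?FL\<^esub> ?C = single R (m \<oplus>\<^bsub>M\<^esub> n) x \<ominus>\<^bsub>?FL\<^esub> single R m x \<ominus>\<^bsub>?FL\<^esub> single R n x"
        using s1 add2 by (simp add: smd sm)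
      also have "\<dots> = h c"
        unfolding add2(1) using add2(2-) mn hs
        by (subst hdiff[OF keys_diff_sub[OF k k] k]) (auto simp: hdiff[OF k k])
      finally show ?thesis .
    next
      case (scalar x r m)
      have rm: "r \<bullet> m \<in> carrier M" using scalar by simp
      \<comment> \<open>Here the coefficient \<open>r\<close> of the relation becomes
        \<open>F r\<close>, which matches the right action of \<open>r\<close> built into the
        bimodule.\<close>
      let ?C = "single R m r \<ominus>\<^bsub>?FL\<^esub> single R (r \<bullet> m) \<one>"
      have s1: "single R m r \<in> carrier ?FL" "single R m (F r) \<in> carrier ?FL" "single R (r \<bullet> m) \<one> \<in> carrier ?FL"
        using s rm scalar by auto
      have "lc R M (\<lambda>x. x) ?C = \<zero>\<^bsub>M\<^esub>"
        using s1 scalar rm by (simp add: evd evs) (simp add: a_minus_def M.r_neg)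
      then have "?C \<in> ?Rel" using s1 by simp
      then have "x \<odot>\<^bsub>?FL\<^esub> (\<lambda>i. F (?C i)) \<in> ?W" using scalar by (intro FL.submodule_smult[OF W] FW)
      also have "(\<lambda>i. F (?C i)) = single R m (F r) \<ominus>\<^bsub>?FL\<^esub> single R (r \<bullet> m) \<one>" using s1 by (simp add: Fd Fs)
      also have "x \<odot>\<^bsub>?FL\<^esub> \<dots> = single R m (ract x r) \<ominus>\<^bsub>?FL\<^esub> single R (r \<bullet> m) x"
        using s1 scalar by (simp add: smd sm frob_ract_def F_pow m_comm)
      also have "\<dots> = h c"
        unfolding scalar(1) using scalar(2-) rm hs ract_closed
        by (subst hdiff) auto
      finally show ?thesis .
    qed
  next
    case (add a b)
    then show ?case using hadd[of a b] T_gens[OF M_op_closed] FL.submodule_add[OF W] by simp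
  next
    case (minus a)
    then have "h (- a) = h 0 \<ominus>\<^bsub>?FL\<^esub> h a" using hdiff[of 0 a] T_gens[OF M_op_closed] by simp
    then show ?case using minus h0 FL.submodule_diff[OF W FL.submodule_zero[OF W]] by simp
  qed
  have \<phi>z: "\<And>i. i \<in> {..<n} \<Longrightarrow> \<phi> (z i) \<in> carrier M" using z \<phi>_carr by simp
  have sz: "\<And>i. i \<in> {..<n} \<Longrightarrow> single R (z i) \<one> \<in> carrier ?FL" using z s by simp
  \<comment> \<open>A representative \<open>c\<close> is built along with the combination, so that
    its class and its image under \<open>h\<close> are known at the same time.\<close>
  have "\<exists>c. Poly_Mapping.keys c \<subseteq> gens M \<and> \<theta> (lc R M (\<lambda>i. \<phi> (z i)) u) = cls M c \<and>
      h c = lc R ?FL (\<lambda>i. single R (z i) \<one>) u"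
    using u
  proof (induction rule: fs_induct)
    case zero
    show ?case by (rule exI[of _ 0]) (simp add: lc_zero FL.lc_zero \<theta>_zero h0)
  next
    case (step i r v)
    then obtain c where c: "Poly_Mapping.keys c \<subseteq> gens M" "\<theta> (lc R M (\<lambda>i. \<phi> (z i)) v) = cls M c"
      "h c = lc R ?FL (\<lambda>i. single R (z i) \<one>) v" by blast
    have zi: "z i \<in> carrier M" using step z by simp
    have kf: "Poly_Mapping.keys (frag_of (r, z i)) \<subseteq> gens M" using zi step by simp
    have si: "single R i r \<in> carrier (fs R {..<n})" using step by (intro single_fs) auto
    have e1: "lc R M (\<lambda>i. \<phi> (z i)) (single R i r \<oplus>\<^bsub>fs R {..<n}\<^esub> v) = r \<bullet> \<phi> (z i) \<oplus>\<^bsub>M\<^esub> lc R M (\<lambda>i. \<phi> (z i)) v"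
      using lc_add[where f="\<lambda>i. \<phi> (z i)", OF \<phi>z si step(3)] lc_single[of r "\<lambda>i. \<phi> (z i)" i] step \<phi>_carr zi by simp
    have e2: "lc R ?FL (\<lambda>i. single R (z i) \<one>) (single R i r \<oplus>\<^bsub>fs R {..<n}\<^esub> v)
        = single R (z i) r \<oplus>\<^bsub>?FL\<^esub> lc R ?FL (\<lambda>i. single R (z i) \<one>) v"
      using FL.lc_add[where f="\<lambda>i. single R (z i) \<one>", OF sz si step(3)] FL.lc_single[of r "\<lambda>i. single R (z i) \<one>" i] step sz sm by simp
    have lv: "lc R M (\<lambda>i. \<phi> (z i)) v \<in> carrier M" by (rule lc_closed[OF \<phi>z step(3)])
    have "\<theta> (r \<bullet> \<phi> (z i) \<oplus>\<^bsub>M\<^esub> lc R M (\<lambda>i. \<phi> (z i)) v) = cls M (frag_of (r, z i) + c)"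
      using module_homD(2)[OF \<theta>_hom _ lv, of "r \<bullet> \<phi> (z i)"] \<theta>_smult_\<phi>[of r "z i"] step zi \<phi>_carr c(2)
      by (simp add: PS_add[OF M_op_closed])
    moreover have "h (frag_of (r, z i) + c) = single R (z i) r \<oplus>\<^bsub>?FL\<^esub> lc R ?FL (\<lambda>i. single R (z i) \<one>) v"
      using hadd[OF kf c(1)] hs[of r "z i"] step zi c(3) by simp
    moreover have "Poly_Mapping.keys (frag_of (r, z i) + c) \<subseteq> gens M" using keys_add[of "frag_of (r, z i)" c] kf c(1) by blast
    ultimately show ?case unfolding e1 e2 by blast
  qed
  then obtain c where c: "cls M 0 = cls M c" "h c = lc R ?FL (\<lambda>i. single R (z i) \<one>) u" using eq \<theta>_zero by auto
  then have "c \<in> T M" using cls_self[OF M_op_closed, of c] by (simp add: mem_cls[of _ M 0, symmetric] flip: c(1)) (simp add: mem_cls)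
  from hT[OF this] show ?thesis unfolding c(2) .
qed

sublocale semilinear_endo R F M \<phi>
  by (intro semilinear_endo.intro semilinear_endo_axioms.intro flat_endo_axioms module_axioms \<phi>_semilinear tensor_relations)

lemma \<theta>_span:
  assumes X: "X \<subseteq> carrier M" and d: "Poly_Mapping.keys d \<subseteq> carrier R \<times> X"
  shows "\<exists>w\<in>\<Phi> X. \<theta> w = cls M d"
  using d
proof (induction d rule: frag_induction)
  case zero then show ?case using \<theta>_zero submodule_zero[OF \<Phi>_submodule[OF X]] by blast
next
  case (one y)
  then obtain r x where y: "y = (r, x)" "r \<in> carrier R" "x \<in> X" by auto
  then have "r \<bullet> \<phi> x \<in> \<Phi> X" using submodule_smult[OF \<Phi>_submodule[OF X]] \<Phi>_incl[OF X] by blast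
  then show ?case using \<theta>_smult_\<phi>[of r x] y X by blast
next
  case (diff a b)
  then obtain v w where vw: "v \<in> \<Phi> X" "w \<in> \<Phi> X" "\<theta> v = cls M a" "\<theta> w = cls M b" by blast
  have vM: "v \<in> carrier M" "w \<in> carrier M" using vw submodule_carr[OF \<Phi>_submodule[OF X]] by blast+
  obtain c where c: "\<theta> (v \<ominus>\<^bsub>M\<^esub> w) = cls M c" using module_homD(1)[OF \<theta>_hom, of "v \<ominus>\<^bsub>M\<^esub> w"] vM PS_cases by blast
  have "\<theta> v = \<theta> (v \<ominus>\<^bsub>M\<^esub> w) \<oplus>\<^bsub>PS R p M\<^esub> \<theta> w"
    using module_homD(2)[OF \<theta>_hom, of "v \<ominus>\<^bsub>M\<^esub> w" w] vM by (simp add: a_minus_def M.a_assoc M.l_neg)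
  then have "a - (c + b) \<in> T M" using c vw by (simp add: PS_add[OF M_op_closed] cls_eq[OF M_op_closed])
  then have "- (a - (c + b)) \<in> T M" by (rule T_minus[OF M_op_closed])
  then have "c - (a - b) \<in> T M" by (simp add: algebra_simps)
  then have "\<theta> (v \<ominus>\<^bsub>M\<^esub> w) = cls M (a - b)" using c by (simp add: cls_eq[OF M_op_closed])
  then show ?case using submodule_diff[OF \<Phi>_submodule[OF X] vw(1,2)] by blast
qed

text \<open>\<open>Lf e\<close> is the image in \<open>M\<close> of \<open>PS_iter R p K e\<close>.
  It grows because it is compatible with the transition maps, exhausts \<open>M\<close> because
  \<open>M\<close> is the limit, and satisfies the recursion because \<open>\<theta>\<close> is
  induced by these same maps.\<close>

lemma generating_filtration:
  assumes K: "finitely_generated_module R K" and gen: "generating_morphism R p M \<theta> K \<beta>"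
  obtains G :: "'m set" and Lf where "finite G" "G \<subseteq> carrier M" "Lf 0 = lspan R M G" "\<And>e::nat. Lf (Suc e) = \<Phi> (Lf e)"
    "\<And>e. Lf e \<subseteq> Lf (Suc e)" "carrier M = (\<Union>e. Lf e)"
proof -
  have modK: "module R K" and \<beta>: "\<beta> \<in> module_hom R K (PS R p K)" using gen by (auto simp: generating_morphism_def)
  interpret K: module R K by (rule modK)
  let ?N = "PS_iter R p K" and ?g = "PS_iter_map R p K \<beta>"
  interpret DS: direct_system R ?N ?g
    by (intro direct_system.intro direct_system_axioms.intro is_cring iter_op_closed[OF modK] iter_map_hom[OF modK \<beta>])
  obtain \<psi> where \<psi>: "\<psi> \<in> module_iso R (direct_limit ?N ?g) M"
    and comp: "\<And>e x. x \<in> carrier (?N e) \<Longrightarrow>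
      \<theta> (\<psi> (DS.cl e x)) = PS_map R p M (\<lambda>x. \<psi> (DS.cl e x)) (PS_decode R p K e (?g e x))"
    using gen unfolding generating_morphism_def Let_def by blast
  define f where "f e x = \<psi> (DS.cl e x)" for e x
  have \<psi>h: "\<psi> \<in> module_hom R (direct_limit ?N ?g) M" and \<psi>b: "bij_betw \<psi> (carrier (direct_limit ?N ?g)) (carrier M)"
    using \<psi> by (auto simp: module_iso_def)
  have fh: "f e \<in> module_hom R (?N e) M" for e
    using module_hom_comp[OF DS.cl_hom \<psi>h, of e] by (simp add: f_def[abs_def] comp_def)
  have fg: "f (Suc e) (?g e x) = f e x" for e x using DS.cl_step[of e x] by (simp add: f_def)
  have Nc: "op_closed R (?N e)" for e by (rule iter_op_closed[OF modK])
  \<comment> \<open>The compatibility is used one level up: applying the functor first to the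
    transition map and then to \<open>f (Suc e)\<close> amounts to applying it to
    \<open>f e\<close>. So \<open>\<theta>\<close> on level \<open>e + 1\<close> is expressed
    through level \<open>e\<close>.\<close>
  have fcomp: "\<theta> (f (Suc e) y) = cls M (fmap (f e) c)"
    if y: "y \<in> carrier (?N (Suc e))" and c: "PS_decode R p K e y = cls (?N e) c" for e y c
  proof -
    have gh: "?g e \<in> module_hom R (?N e) (?N (Suc e))" by (rule DS.g)
    have dy: "PS_decode R p K e y \<in> carrier (PS R p (?N e))" by (rule module_homD(1)[OF decode_hom[OF modK] y])
    have "PS_decode R p K (Suc e) (?g (Suc e) y) = PS_map R p (?N (Suc e)) (?g e) (PS_decode R p K e y)"
      unfolding PS_iter_map.simps(2) comp_def
      by (rule decode_code[OF modK module_homD(1)[OF PS_map_hom[OF Nc Nc gh] dy]])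
    also have "\<dots> = cls (?N (Suc e)) (fmap (?g e) c)" unfolding c by (rule PS_map_cls[OF Nc Nc gh])
    finally have "\<theta> (f (Suc e) y) = PS_map R p M (f (Suc e)) (cls (?N (Suc e)) (fmap (?g e) c))"
      using comp[OF y] by (simp add: f_def[abs_def])
    also have "\<dots> = cls M (fmap (f (Suc e)) (fmap (?g e) c))" by (rule PS_map_cls[OF Nc M_op_closed fh])
    also have "fmap (f (Suc e)) (fmap (?g e) c) = fmap (f e) c"
      using subset_UNIV by (induction c rule: frag_induction) (auto simp: fmap_simps fg)
    finally show ?thesis .
  qed
  define Lf where "Lf e = f e ` carrier (?N e)" for e
  have inc: "Lf e \<subseteq> Lf (Suc e)" for e
    unfolding Lf_def using fg module_homD(1)[OF DS.g] by (metis (no_types, lifting) image_subsetI imageI)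
  have LM: "Lf e \<subseteq> carrier M" for e unfolding Lf_def using module_homD(1)[OF fh] by blast
  \<comment> \<open>The iterate is known only to be closed under the operations, so the zero of
    \<open>Lf e\<close> is later produced as \<open>\<zero>\<close> times some element.\<close>
  have ne: "Lf e \<noteq> {}" for e
  proof (induction e)
    case 0
    have "Base \<zero>\<^bsub>K\<^esub> \<in> carrier (?N 0)" by (simp add: transport_module_def Let_def)
    then show ?case by (auto simp: Lf_def)
  next
    case (Suc e) then show ?case using inc[of e] by blast
  qed
  have Lsub: "submodule (Lf e) R M" for e
  proof (rule submoduleI2)
    show "Lf e \<subseteq> carrier M" by (rule LM)
    show sm: "a \<bullet> x \<in> Lf e" if "a \<in> carrier R" "x \<in> Lf e" for a x
      using that module_homD(3)[OF fh, of a _ e] op_closedD(2)[OF Nc, of a _ e] by (auto simp: Lf_def) (metis imageI)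
    obtain x where x: "x \<in> Lf e" using ne by blast
    have "\<zero> \<in> carrier R" by simp
    from sm[OF this x] show "\<zero>\<^bsub>M\<^esub> \<in> Lf e" using subsetD[OF LM x] by simp
    show "a \<oplus>\<^bsub>M\<^esub> b \<in> Lf e" if "a \<in> Lf e" "b \<in> Lf e" for a b
      using that module_homD(2)[OF fh, of _ e] op_closedD(1)[OF Nc, of _ e] by (auto simp: Lf_def) (metis imageI)
  qed
  have LSuc: "Lf (Suc e) = \<Phi> (Lf e)" for e
  proof
    show "Lf (Suc e) \<subseteq> \<Phi> (Lf e)"
    proof
      fix a assume "a \<in> Lf (Suc e)"
      then obtain y where y: "y \<in> carrier (?N (Suc e))" "a = f (Suc e) y" unfolding Lf_def by blast
      obtain c where c: "PS_decode R p K e y = cls (?N e) c" "Poly_Mapping.keys c \<subseteq> gens (?N e)"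
        using PS_cases[OF module_homD(1)[OF decode_hom[OF modK] y(1)]] by blast
      have "Poly_Mapping.keys (fmap (f e) c) \<subseteq> carrier R \<times> Lf e"
        unfolding fmap_def using keys_frag_extend[of "\<lambda>(x, m). frag_of (x, f e m)" c] c(2) by (fastforce simp: Lf_def)
      then obtain w where w: "w \<in> \<Phi> (Lf e)" "\<theta> w = cls M (fmap (f e) c)" using \<theta>_span[OF LM] by blast
      then have "\<theta> w = \<theta> a" using fcomp[OF y(1) c(1)] y(2) by simp
      then have "w = a" using \<theta>_inj submodule_carr[OF \<Phi>_submodule[OF LM] w(1)] module_homD(1)[OF fh y(1)] y(2) by blast
      then show "a \<in> \<Phi> (Lf e)" using w by simp
    qed
    show "\<Phi> (Lf e) \<subseteq> Lf (Suc e)"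
    proof (rule \<Phi>_minimal[OF Lsub])
      fix x assume "x \<in> Lf e"
      then obtain m where m: "m \<in> carrier (?N e)" "x = f e m" unfolding Lf_def by blast
      let ?C = "cls (?N e) (frag_of (\<one>, m))"
      have C: "?C \<in> carrier (PS R p (?N e))" unfolding PS_carrier using m by (auto intro!: exI[of _ "frag_of (\<one>, m)"])
      let ?y = "PS_code R p (?N e) ?C"
      have y: "?y \<in> carrier (?N (Suc e))" unfolding iter_Suc_carrier using C by blast
      have "\<theta> (f (Suc e) ?y) = cls M (fmap (f e) (frag_of (\<one>, m)))"
        by (rule fcomp[OF y decode_code[OF modK C]])
      also have "\<dots> = \<theta> (\<phi> x)" using m module_homD(1)[OF fh m(1)] by (simp add: fmap_simps \<theta>_\<phi>)
      finally have "f (Suc e) ?y = \<phi> x"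
        using \<theta>_inj module_homD(1)[OF fh y] module_homD(1)[OF fh m(1)] \<phi>_carr m(2) by blast
      then show "\<phi> x \<in> Lf (Suc e)" using y unfolding Lf_def by (metis imageI)
    qed
  qed
  have un: "carrier M = (\<Union>e. Lf e)"
  proof -
    have "carrier M = \<psi> ` carrier (direct_limit ?N ?g)" using \<psi>b by (simp add: bij_betw_def)
    then show ?thesis unfolding DS.direct_limit_carrier Lf_def f_def image_UN image_image .
  qed
  obtain S where S: "S \<subseteq> carrier K" "finite S" "\<And>H. submodule H R K \<Longrightarrow> S \<subseteq> H \<Longrightarrow> H = carrier K"
    using K by (auto simp: finitely_generated_module_def)
  let ?\<chi> = "f 0 \<circ> Base"
  have injB: "inj_on Base (carrier K)" by (auto simp: inj_on_def)
  have clK: "op_closed R K" by (auto simp: op_closed_def)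
  have "Base \<in> module_hom R K (?N 0)" using transport_hom[OF injB clK] by simp
  then have \<chi>: "?\<chi> \<in> module_hom R K M" by (rule module_hom_comp[OF _ fh])
  then have \<chi>s: "semilinear R (\<lambda>r. r) K M ?\<chi>" by (simp add: module_hom_semilinear)
  let ?G = "?\<chi> ` S"
  have GM: "?G \<subseteq> carrier M" using module_homD(1)[OF \<chi>] S(1) by blast
  have L0: "Lf 0 = ?\<chi> ` carrier K" by (auto simp: Lf_def transport_module_def Let_def)
  have "{x \<in> carrier K. ?\<chi> x \<in> lspan R M ?G} = carrier K"
    using S(1) lspan_incl[OF GM] by (intro S(3) semilinear_vimage[OF modK module_axioms \<chi>s lspan_submodule[OF GM]]) auto
  then have "Lf 0 \<subseteq> lspan R M ?G" unfolding L0 by blast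
  moreover have "lspan R M ?G \<subseteq> Lf 0" by (rule lspan_minimal[OF Lsub]) (use S(1) L0 in auto)
  ultimately have "Lf 0 = lspan R M ?G" by blast
  then show ?thesis using that[of ?G Lf] S(2) GM LSuc inc un by blast
qed

end

section \<open>Supports of Koszul cohomology\<close>

text \<open>The premises are the few laws that the calculation with fractions uses; for a quotient
  they are easier to verify than the whole list of module axioms.\<close>

lemma Supp_iff:
  assumes R: "cring R" and P: "primeideal P R"
    and cl: "\<And>r x. r \<in> carrier R \<Longrightarrow> x \<in> carrier H \<Longrightarrow> r \<odot>\<^bsub>H\<^esub> x \<in> carrier H"
    and assoc: "\<And>r s x. r \<in> carrier R \<Longrightarrow> s \<in> carrier R \<Longrightarrow> x \<in> carrier H \<Longrightarrow>
      (r \<otimes>\<^bsub>R\<^esub> s) \<odot>\<^bsub>H\<^esub> x = r \<odot>\<^bsub>H\<^esub> (s \<odot>\<^bsub>H\<^esub> x)"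
    and one: "\<And>x. x \<in> carrier H \<Longrightarrow> \<one>\<^bsub>R\<^esub> \<odot>\<^bsub>H\<^esub> x = x"
    and zero: "\<zero>\<^bsub>H\<^esub> \<in> carrier H" "\<And>r. r \<in> carrier R \<Longrightarrow> r \<odot>\<^bsub>H\<^esub> \<zero>\<^bsub>H\<^esub> = \<zero>\<^bsub>H\<^esub>"
  shows "P \<notin> Supp R H \<longleftrightarrow> (\<forall>x\<in>carrier H. \<exists>s\<in>carrier R - P. s \<odot>\<^bsub>H\<^esub> x = \<zero>\<^bsub>H\<^esub>)"
proof -
  interpret cring R by (rule R)
  let ?S = "carrier R - P"
  interpret S: module R "self_module R" by (rule self_is_module)
  have oneS: "\<one>\<^bsub>R\<^esub> \<in> ?S" by (rule S.prime_one[OF P])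
  let ?fr = "fraction ?S H"
  have mem: "(y, t) \<in> ?fr x s \<longleftrightarrow> y \<in> carrier H \<and> t \<in> ?S \<and> (\<exists>u\<in>?S. u \<odot>\<^bsub>H\<^esub> (t \<odot>\<^bsub>H\<^esub> x) = u \<odot>\<^bsub>H\<^esub> (s \<odot>\<^bsub>H\<^esub> y))" for x y s t
    by (simp add: fraction_def)
  have z: "(y, t) \<in> ?fr \<zero>\<^bsub>H\<^esub> \<one>\<^bsub>R\<^esub> \<longleftrightarrow> y \<in> carrier H \<and> t \<in> ?S \<and> (\<exists>u\<in>?S. u \<odot>\<^bsub>H\<^esub> y = \<zero>\<^bsub>H\<^esub>)" for y t
  proof -
    have "u \<odot>\<^bsub>H\<^esub> (t \<odot>\<^bsub>H\<^esub> \<zero>\<^bsub>H\<^esub>) = u \<odot>\<^bsub>H\<^esub> (\<one>\<^bsub>R\<^esub> \<odot>\<^bsub>H\<^esub> y) \<longleftrightarrow> u \<odot>\<^bsub>H\<^esub> y = \<zero>\<^bsub>H\<^esub>"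
      if "y \<in> carrier H" "t \<in> ?S" "u \<in> ?S" for u
      using that zero(2)[of t] zero(2)[of u] one[of y] by auto
    then show ?thesis unfolding mem by blast
  qed
  have eq: "?fr x s = ?fr \<zero>\<^bsub>H\<^esub> \<one>\<^bsub>R\<^esub>" if x: "x \<in> carrier H" and s: "s \<in> ?S" and u: "u \<in> ?S" "u \<odot>\<^bsub>H\<^esub> x = \<zero>\<^bsub>H\<^esub>" for x s u
  proof (rule Set.set_eqI)
    fix a :: "'c \<times> 'a"
    obtain y t where a: "a = (y, t)" by (cases a)
    show "a \<in> ?fr x s \<longleftrightarrow> a \<in> ?fr \<zero>\<^bsub>H\<^esub> \<one>\<^bsub>R\<^esub>"
    proof
      assume "a \<in> ?fr x s"
      then obtain v where v: "y \<in> carrier H" "t \<in> ?S" "v \<in> ?S" "v \<odot>\<^bsub>H\<^esub> (t \<odot>\<^bsub>H\<^esub> x) = v \<odot>\<^bsub>H\<^esub> (s \<odot>\<^bsub>H\<^esub> y)"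
        unfolding a mem by blast
      have "(u \<otimes>\<^bsub>R\<^esub> (v \<otimes>\<^bsub>R\<^esub> s)) \<odot>\<^bsub>H\<^esub> y = u \<odot>\<^bsub>H\<^esub> (v \<odot>\<^bsub>H\<^esub> (t \<odot>\<^bsub>H\<^esub> x))"
        using u(1) v s by (simp add: assoc cl)
      also have "\<dots> = (v \<otimes>\<^bsub>R\<^esub> t \<otimes>\<^bsub>R\<^esub> u) \<odot>\<^bsub>H\<^esub> x"
        using u(1) v(1-3) x by (simp add: assoc[symmetric] cl m_ac)
      also have "\<dots> = \<zero>\<^bsub>H\<^esub>" using u v x zero by (simp add: assoc)
      finally show "a \<in> ?fr \<zero>\<^bsub>H\<^esub> \<one>\<^bsub>R\<^esub>"
        unfolding a z using v S.prime_mult[OF P u(1) S.prime_mult[OF P v(3) s]] by blast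
    next
      assume "a \<in> ?fr \<zero>\<^bsub>H\<^esub> \<one>\<^bsub>R\<^esub>"
      then obtain v where v: "y \<in> carrier H" "t \<in> ?S" "v \<in> ?S" "v \<odot>\<^bsub>H\<^esub> y = \<zero>\<^bsub>H\<^esub>" unfolding a z by blast
      have "(u \<otimes>\<^bsub>R\<^esub> v) \<odot>\<^bsub>H\<^esub> (t \<odot>\<^bsub>H\<^esub> x) = (v \<otimes>\<^bsub>R\<^esub> t) \<odot>\<^bsub>H\<^esub> (u \<odot>\<^bsub>H\<^esub> x)"
        using u(1) v(1-3) x by (simp add: assoc[symmetric] cl m_ac)
      moreover have "(u \<otimes>\<^bsub>R\<^esub> v) \<odot>\<^bsub>H\<^esub> (s \<odot>\<^bsub>H\<^esub> y) = (u \<otimes>\<^bsub>R\<^esub> s) \<odot>\<^bsub>H\<^esub> (v \<odot>\<^bsub>H\<^esub> y)"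
        using u(1) v(1-3) s by (simp add: assoc[symmetric] cl m_ac)
      ultimately have "(u \<otimes>\<^bsub>R\<^esub> v) \<odot>\<^bsub>H\<^esub> (t \<odot>\<^bsub>H\<^esub> x) = (u \<otimes>\<^bsub>R\<^esub> v) \<odot>\<^bsub>H\<^esub> (s \<odot>\<^bsub>H\<^esub> y)"
        using u v s zero by simp
      then show "a \<in> ?fr x s" unfolding a mem using v S.prime_mult[OF P u(1) v(3)] by blast
    qed
  qed
  have "P \<notin> Supp R H \<longleftrightarrow> {?fr x s |x s. x \<in> carrier H \<and> s \<in> ?S} = {?fr \<zero>\<^bsub>H\<^esub> \<one>\<^bsub>R\<^esub>}"
    using P by (simp add: Supp_def Spec_def localized_module_def)
  also have "\<dots> \<longleftrightarrow> (\<forall>x\<in>carrier H. \<exists>s\<in>?S. s \<odot>\<^bsub>H\<^esub> x = \<zero>\<^bsub>H\<^esub>)"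
  proof
    assume one_elt: "{?fr x s |x s. x \<in> carrier H \<and> s \<in> ?S} = {?fr \<zero>\<^bsub>H\<^esub> \<one>\<^bsub>R\<^esub>}"
    show "\<forall>x\<in>carrier H. \<exists>s\<in>?S. s \<odot>\<^bsub>H\<^esub> x = \<zero>\<^bsub>H\<^esub>"
    proof
      fix x assume x: "x \<in> carrier H"
      then have "?fr x \<one>\<^bsub>R\<^esub> = ?fr \<zero>\<^bsub>H\<^esub> \<one>\<^bsub>R\<^esub>" using one_elt oneS by blast
      moreover have "(x, \<one>\<^bsub>R\<^esub>) \<in> ?fr x \<one>\<^bsub>R\<^esub>" unfolding mem using x oneS by blast
      ultimately show "\<exists>s\<in>?S. s \<odot>\<^bsub>H\<^esub> x = \<zero>\<^bsub>H\<^esub>" using z by blast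
    qed
  next
    assume "\<forall>x\<in>carrier H. \<exists>s\<in>?S. s \<odot>\<^bsub>H\<^esub> x = \<zero>\<^bsub>H\<^esub>"
    then show "{?fr x s |x s. x \<in> carrier H \<and> s \<in> ?S} = {?fr \<zero>\<^bsub>H\<^esub> \<one>\<^bsub>R\<^esub>}"
      using eq zero(1) oneS by blast
  qed
  finally show ?thesis .
qed

section \<open>Koszul cohomology in terms of elements\<close>

context module
begin

lemma Supp_quotient_iff:
  assumes P: "primeideal P R" and Z: "submodule Z R M" and B: "submodule B R M"
  shows "P \<notin> Supp R (quotient_module (M\<lparr>carrier := Z\<rparr>) B) \<longleftrightarrow> (\<forall>x\<in>Z. \<exists>s\<in>carrier R - P. s \<bullet> x \<in> B)"
proof -
  let ?H = "quotient_module (M\<lparr>carrier := Z\<rparr>) B"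
  \<comment> \<open>The coset is formed with the addition of \<open>M\<close>; cutting the carrier
    down to \<open>Z\<close> changes nothing in it.\<close>
  define co where "co x = (\<lambda>b. b \<oplus>\<^bsub>M\<^esub> x) ` B" for x
  note Zc = submodule_carr[OF Z] and Bc = submodule_carr[OF B]
  have coset: "a_r_coset (M\<lparr>carrier := Z\<rparr>) B x = co x" for x
    by (auto simp: a_r_coset_def r_coset_def co_def)
  have carrH: "carrier ?H = co ` Z"
    by (auto simp: quotient_module_def A_RCOSETS_def RCOSETS_def a_r_coset_def[symmetric] r_coset_def co_def)
  have mem: "y \<in> co x \<longleftrightarrow> y \<in> carrier M \<and> y \<ominus>\<^bsub>M\<^esub> x \<in> B" if "x \<in> carrier M" for x y
  proof
    assume "y \<in> co x"
    then obtain b where b: "b \<in> B" "y = b \<oplus>\<^bsub>M\<^esub> x" by (auto simp: co_def)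
    then show "y \<in> carrier M \<and> y \<ominus>\<^bsub>M\<^esub> x \<in> B" using that Bc[OF b(1)] by (simp add: a_minus_def M.a_assoc M.r_neg)
  next
    assume y: "y \<in> carrier M \<and> y \<ominus>\<^bsub>M\<^esub> x \<in> B"
    then have "y = (y \<ominus>\<^bsub>M\<^esub> x) \<oplus>\<^bsub>M\<^esub> x" using that by (simp add: a_minus_def M.a_assoc M.l_neg)
    then show "y \<in> co x" using y by (auto simp: co_def)
  qed
  have co_eq: "co x = co y" if "x \<in> carrier M" "y \<in> carrier M" "x \<ominus>\<^bsub>M\<^esub> y \<in> B" for x y
  proof -
    have *: "z \<in> co y" if "z \<in> co x" "x \<in> carrier M" "y \<in> carrier M" "x \<ominus>\<^bsub>M\<^esub> y \<in> B" for x y z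
    proof -
      have z: "z \<in> carrier M" "z \<ominus>\<^bsub>M\<^esub> x \<in> B" using that mem by auto
      have "z \<ominus>\<^bsub>M\<^esub> y = (z \<ominus>\<^bsub>M\<^esub> x) \<oplus>\<^bsub>M\<^esub> (x \<ominus>\<^bsub>M\<^esub> y)"
        using z that by (simp add: a_minus_def M.a_assoc M.r_neg1 M.r_neg2)
      then show ?thesis using submodule_add[OF B z(2) that(4)] z that mem by simp
    qed
    have "y \<ominus>\<^bsub>M\<^esub> x = \<ominus>\<^bsub>M\<^esub> (x \<ominus>\<^bsub>M\<^esub> y)" using that by (simp add: a_minus_def M.minus_add M.a_comm)
    then have "y \<ominus>\<^bsub>M\<^esub> x \<in> B" using submodule_neg[OF B that(3)] by simp
    then show ?thesis using *[of _ x y] *[of _ y x] that by blast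
  qed
  have self: "x \<in> co x" if "x \<in> carrier M" for x
    using mem[OF that] that submodule_zero[OF B] by (simp add: a_minus_def M.r_neg)
  have zeroH: "\<zero>\<^bsub>?H\<^esub> = co \<zero>\<^bsub>M\<^esub>" using Bc by (auto simp: quotient_module_def co_def image_iff)
  have minus_zero: "x \<ominus>\<^bsub>M\<^esub> \<zero>\<^bsub>M\<^esub> = x" if "x \<in> carrier M" for x
    using that M.minus_equality[of "\<zero>\<^bsub>M\<^esub>" "\<zero>\<^bsub>M\<^esub>"] by (simp add: a_minus_def)
  have co_zero: "co x = co \<zero>\<^bsub>M\<^esub> \<longleftrightarrow> x \<in> B" if x: "x \<in> carrier M" for x
  proof
    assume "co x = co \<zero>\<^bsub>M\<^esub>"
    then show "x \<in> B" using self[OF x] mem[OF M.zero_closed] x by (simp add: minus_zero)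
  next
    assume "x \<in> B"
    then show "co x = co \<zero>\<^bsub>M\<^esub>" using co_eq[OF x M.zero_closed] x by (simp add: minus_zero)
  qed
  have smultH: "r \<odot>\<^bsub>?H\<^esub> co x = co (r \<bullet> x)" if r: "r \<in> carrier R" and x: "x \<in> carrier M" for r x
  proof -
    have "co (r \<bullet> y) = co (r \<bullet> x)" if y: "y \<in> co x" for y
    proof (rule co_eq)
      have yx: "y \<in> carrier M" "y \<ominus>\<^bsub>M\<^esub> x \<in> B" using mem[OF x] y by auto
      have "r \<bullet> y \<ominus>\<^bsub>M\<^esub> r \<bullet> x = r \<bullet> (y \<ominus>\<^bsub>M\<^esub> x)"
        using yx x r by (simp add: a_minus_def smult_r_distr smult_r_minus)
      then show "r \<bullet> y \<ominus>\<^bsub>M\<^esub> r \<bullet> x \<in> B" using submodule_smult[OF B r yx(2)] by simp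
      show "r \<bullet> y \<in> carrier M" "r \<bullet> x \<in> carrier M" using yx x r by auto
    qed
    then have "(\<Union>y\<in>co x. co (r \<bullet> y)) = co (r \<bullet> x)" using self[OF x] by blast
    then show ?thesis by (simp add: quotient_module_def coset)
  qed
  have "P \<notin> Supp R ?H \<longleftrightarrow> (\<forall>x\<in>carrier ?H. \<exists>s\<in>carrier R - P. s \<odot>\<^bsub>?H\<^esub> x = \<zero>\<^bsub>?H\<^esub>)"
  proof (rule Supp_iff[OF R.is_cring P])
    show "\<zero>\<^bsub>?H\<^esub> \<in> carrier ?H" unfolding zeroH carrH using submodule_zero[OF Z] by blast
    show "\<And>r. r \<in> carrier R \<Longrightarrow> r \<odot>\<^bsub>?H\<^esub> \<zero>\<^bsub>?H\<^esub> = \<zero>\<^bsub>?H\<^esub>" unfolding zeroH by (simp add: smultH)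
    show "r \<odot>\<^bsub>?H\<^esub> x \<in> carrier ?H" if "r \<in> carrier R" "x \<in> carrier ?H" for r x
      using that Zc submodule_smult[OF Z] unfolding carrH by (auto simp: smultH)
    show "(r \<otimes> s) \<odot>\<^bsub>?H\<^esub> x = r \<odot>\<^bsub>?H\<^esub> (s \<odot>\<^bsub>?H\<^esub> x)" if "r \<in> carrier R" "s \<in> carrier R" "x \<in> carrier ?H" for r s x
      using that Zc unfolding carrH by (auto simp: smultH smult_assoc1)
    show "\<one> \<odot>\<^bsub>?H\<^esub> x = x" if "x \<in> carrier ?H" for x
      using that Zc unfolding carrH by (auto simp: smultH)
  qed
  also have "\<dots> \<longleftrightarrow> (\<forall>x\<in>Z. \<exists>s\<in>carrier R - P. s \<bullet> x \<in> B)"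
    unfolding carrH zeroH using Zc by (auto simp: smultH co_zero)
  finally show ?thesis .
qed

lemma power_carrier: "xs \<in> carrier (power_module M k) \<longleftrightarrow> length xs = k \<and> (\<forall>i<k. xs ! i \<in> carrier M)"
  by (auto simp: power_module_def in_set_conv_nth subset_iff)

lemma power_simps:
  "xs \<oplus>\<^bsub>power_module M k\<^esub> ys = map2 (add M) xs ys"
  "\<zero>\<^bsub>power_module M k\<^esub> = replicate k \<zero>\<^bsub>M\<^esub>" "r \<odot>\<^bsub>power_module M k\<^esub> xs = map (smult M r) xs"
  by (auto simp: power_module_def)

lemma power_is_module: "module R (power_module M k)"
proof (rule moduleI)
  show "abelian_group (power_module M k)"
  proof (rule abelian_groupI)
    fix x assume x: "x \<in> carrier (power_module M k)"
    have "map (a_inv M) x \<in> carrier (power_module M k)" using x by (auto simp: power_carrier)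
    moreover have "map (a_inv M) x \<oplus>\<^bsub>power_module M k\<^esub> x = \<zero>\<^bsub>power_module M k\<^esub>"
      using x by (auto simp: power_carrier power_simps M.l_neg intro!: nth_equalityI)
    ultimately show "\<exists>y\<in>carrier (power_module M k). y \<oplus>\<^bsub>power_module M k\<^esub> x = \<zero>\<^bsub>power_module M k\<^esub>" by blast
  qed (auto simp: power_carrier power_simps M.a_ac intro!: nth_equalityI)
qed (auto simp: power_carrier power_simps smult_l_distr smult_r_distr smult_assoc1 R.is_cring in_set_conv_nth intro!: nth_equalityI)

lemma koszul_diff_hom:
  assumes f: "f1 \<in> carrier R" "f2 \<in> carrier R"
  shows "semilinear R (\<lambda>r. r) (koszul_module M i) (koszul_module M (i + 1)) (koszul_diff R f1 f2 M i)"
proof -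
  have c0: "xs \<in> carrier (koszul_module M 0) \<longleftrightarrow> (\<exists>x\<in>carrier M. xs = [x])" for xs
    by (auto simp: koszul_module_def koszul_rank_def power_carrier length_Suc_conv)
  have c1: "xs \<in> carrier (koszul_module M 1) \<longleftrightarrow> (\<exists>x\<in>carrier M. \<exists>y\<in>carrier M. xs = [x, y])" for xs
    by (auto simp: koszul_module_def koszul_rank_def power_carrier length_Suc_conv less_Suc_eq numeral_2_eq_2)
  have c2: "xs \<in> carrier (koszul_module M 2) \<longleftrightarrow> (\<exists>x\<in>carrier M. xs = [x])" for xs
    by (auto simp: koszul_module_def koszul_rank_def power_carrier length_Suc_conv)
  consider "i = 0" | "i = 1" | "i \<noteq> 0" "i \<noteq> 1" by blast
  then show ?thesis
  proof cases
    case 1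
    have "koszul_diff R f1 f2 M 0 ([x] \<oplus>\<^bsub>koszul_module M 0\<^esub> [x'])
      = koszul_diff R f1 f2 M 0 [x] \<oplus>\<^bsub>koszul_module M 1\<^esub> koszul_diff R f1 f2 M 0 [x']"
      if "x \<in> carrier M" "x' \<in> carrier M" for x x'
      using that f by (simp add: koszul_diff_def koszul_module_def power_simps smult_r_distr)
    moreover have "koszul_diff R f1 f2 M 0 (r \<odot>\<^bsub>koszul_module M 0\<^esub> [x])
      = r \<odot>\<^bsub>koszul_module M 1\<^esub> koszul_diff R f1 f2 M 0 [x]"
      if "x \<in> carrier M" "r \<in> carrier R" for x r
      using that f by (simp add: koszul_diff_def koszul_module_def power_simps smult_assoc1[symmetric] R.m_comm)
    moreover have "koszul_diff R f1 f2 M 0 [x] \<in> carrier (koszul_module M 1)" if "x \<in> carrier M" for x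
      using that f by (simp add: c1 koszul_diff_def)
    ultimately show ?thesis using 1 unfolding semilinear_def by (auto simp: c0)
  next
    case 2
    have "koszul_diff R f1 f2 M 1 ([x, y] \<oplus>\<^bsub>koszul_module M 1\<^esub> [x', y'])
      = koszul_diff R f1 f2 M 1 [x, y] \<oplus>\<^bsub>koszul_module M 2\<^esub> koszul_diff R f1 f2 M 1 [x', y']"
      if "x \<in> carrier M" "y \<in> carrier M" "x' \<in> carrier M" "y' \<in> carrier M" for x y x' y'
      using that f by (simp add: koszul_diff_def koszul_module_def power_simps smult_r_distr M.a_ac)
    moreover have "koszul_diff R f1 f2 M 1 (r \<odot>\<^bsub>koszul_module M 1\<^esub> [x, y])
      = r \<odot>\<^bsub>koszul_module M 2\<^esub> koszul_diff R f1 f2 M 1 [x, y]"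
      if "x \<in> carrier M" "y \<in> carrier M" "r \<in> carrier R" for x y r
      using that f by (simp add: koszul_diff_def koszul_module_def power_simps smult_r_distr smult_assoc1[symmetric] R.m_comm)
    moreover have "koszul_diff R f1 f2 M 1 [x, y] \<in> carrier (koszul_module M 2)" if "x \<in> carrier M" "y \<in> carrier M" for x y
      using that f by (simp add: c2 koszul_diff_def)
    ultimately show ?thesis using 2 unfolding semilinear_def by (auto simp: c1)
  next
    case 3
    interpret K: module R "koszul_module M (i + 1)" unfolding koszul_module_def by (rule power_is_module)
    show ?thesis using 3 unfolding semilinear_def by (auto simp: koszul_diff_def)
  qed
qed

lemma semilinear_image:
  assumes "module R K" "semilinear R (\<lambda>r. r) K M h"
  shows "submodule (h ` carrier K) R M"
proof -
  interpret K: module R K by fact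
  note D = semilinearD[OF assms(2)]
  show ?thesis
  proof (rule submoduleI2)
    show "h ` carrier K \<subseteq> carrier M" using D(1) by blast
    show "\<zero>\<^bsub>M\<^esub> \<in> h ` carrier K" using semilinear_zero[OF assms(1) module_axioms assms(2)] K.M.zero_closed by (metis imageI)
    fix a b assume "a \<in> h ` carrier K" "b \<in> h ` carrier K"
    then show "a \<oplus>\<^bsub>M\<^esub> b \<in> h ` carrier K" using D(2) by (auto simp: image_iff) (metis K.M.add.m_closed)
  next
    fix a x assume "a \<in> carrier R" "x \<in> h ` carrier K"
    then show "a \<bullet> x \<in> h ` carrier K" using D(3) by (auto simp: image_iff) (metis K.smult_closed)
  qed
qed

lemma Supp_koszul_iff:
  assumes f: "f1 \<in> carrier R" "f2 \<in> carrier R" and P: "primeideal P R"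
  shows "P \<notin> Supp R (koszul_cohomology R f1 f2 M i) \<longleftrightarrow>
    (\<forall>x\<in>carrier (koszul_module M i). koszul_diff R f1 f2 M i x = \<zero>\<^bsub>koszul_module M (i + 1)\<^esub> \<longrightarrow>
      (\<exists>s\<in>carrier R - P. s \<odot>\<^bsub>koszul_module M i\<^esub> x \<in> koszul_diff R f1 f2 M (i - 1) ` carrier (koszul_module M (i - 1))))"
proof -
  have mod: "module R (koszul_module M j)" for j unfolding koszul_module_def by (rule power_is_module)
  interpret K: module R "koszul_module M i" by (rule mod)
  have "submodule {x \<in> carrier (koszul_module M i). koszul_diff R f1 f2 M i x = \<zero>\<^bsub>koszul_module M (i + 1)\<^esub>} R (koszul_module M i)"
    by (rule semilinear_kernel[OF mod mod koszul_diff_hom[OF f]]) auto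
  moreover have "submodule (koszul_diff R f1 f2 M (i - 1) ` carrier (koszul_module M (i - 1))) R (koszul_module M i)"
    using K.semilinear_image[OF mod koszul_diff_hom[OF f, of "i - 1", simplified]] .
  ultimately show ?thesis unfolding koszul_cohomology_def cohomology_def
    by (subst K.Supp_quotient_iff[OF P]) auto
qed

lemma koszul_carriers:
  "carrier (koszul_module M 0) = (\<lambda>x. [x]) ` carrier M"
  "carrier (koszul_module M 1) = (\<lambda>(x, y). [x, y]) ` (carrier M \<times> carrier M)"
  "carrier (koszul_module M 2) = (\<lambda>x. [x]) ` carrier M"
  "i \<noteq> 0 \<Longrightarrow> i \<noteq> 1 \<Longrightarrow> i \<noteq> 2 \<Longrightarrow> carrier (koszul_module M i) = {[]}"
  by (auto simp: koszul_module_def koszul_rank_def power_carrier length_Suc_conv less_Suc_eq numeral_2_eq_2 image_iff)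

lemma koszul_simps:
  "r \<odot>\<^bsub>koszul_module M i\<^esub> xs = map (smult M r) xs"
  "\<zero>\<^bsub>koszul_module M 1\<^esub> = [\<zero>\<^bsub>M\<^esub>, \<zero>\<^bsub>M\<^esub>]" "\<zero>\<^bsub>koszul_module M 2\<^esub> = [\<zero>\<^bsub>M\<^esub>]" "\<zero>\<^bsub>koszul_module M 3\<^esub> = []"
  by (simp_all add: koszul_module_def koszul_rank_def power_simps numeral_2_eq_2)

lemma Supp_koszul_0:
  assumes f: "f1 \<in> carrier R" "f2 \<in> carrier R" and P: "primeideal P R"
  shows "P \<notin> Supp R (koszul_cohomology R f1 f2 M 0) \<longleftrightarrow>
    {x \<in> carrier M. f1 \<bullet> x = \<zero>\<^bsub>M\<^esub> \<and> f2 \<bullet> x = \<zero>\<^bsub>M\<^esub>} \<subseteq> sat R P M {\<zero>\<^bsub>M\<^esub>}"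
proof -
  have "koszul_diff R f1 f2 M (0 - 1) ` carrier (koszul_module M (0 - 1)) = {[\<zero>\<^bsub>M\<^esub>]}"
    using koszul_carriers(4)[of "-1"] by (simp add: koszul_diff_def koszul_module_def koszul_rank_def power_simps)
  then have im: "koszul_diff R f1 f2 M (0 - 1) ` carrier (koszul_module M (0 - 1)) = {[\<zero>\<^bsub>M\<^esub>]}" .
  show ?thesis unfolding Supp_koszul_iff[OF f P] im
    by (simp add: koszul_carriers koszul_diff_def koszul_simps sat_def subset_iff) blast
qed

lemma Supp_koszul_1:
  assumes f: "f1 \<in> carrier R" "f2 \<in> carrier R" and P: "primeideal P R"
  shows "P \<notin> Supp R (koszul_cohomology R f1 f2 M 1) \<longleftrightarrow>
    (\<forall>x\<in>carrier M. \<forall>y\<in>carrier M. f1 \<bullet> y = f2 \<bullet> x \<longrightarrow>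
      (\<exists>s\<in>carrier R - P. \<exists>z\<in>carrier M. s \<bullet> x = f1 \<bullet> z \<and> s \<bullet> y = f2 \<bullet> z))"
proof -
  have e: "(\<ominus> f2) \<bullet> x \<oplus>\<^bsub>M\<^esub> f1 \<bullet> y = \<zero>\<^bsub>M\<^esub> \<longleftrightarrow> f1 \<bullet> y = f2 \<bullet> x"
    if "x \<in> carrier M" "y \<in> carrier M" for x y
  proof
    assume "(\<ominus> f2) \<bullet> x \<oplus>\<^bsub>M\<^esub> f1 \<bullet> y = \<zero>\<^bsub>M\<^esub>"
    then have "\<ominus>\<^bsub>M\<^esub> (f1 \<bullet> y) = \<ominus>\<^bsub>M\<^esub> (f2 \<bullet> x)"
      using that f M.minus_equality[of "\<ominus>\<^bsub>M\<^esub> (f2 \<bullet> x)" "f1 \<bullet> y"] by (simp add: smult_l_minus)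
    then show "f1 \<bullet> y = f2 \<bullet> x" using that f M.minus_minus smult_closed by metis
  next
    assume "f1 \<bullet> y = f2 \<bullet> x"
    then show "(\<ominus> f2) \<bullet> x \<oplus>\<^bsub>M\<^esub> f1 \<bullet> y = \<zero>\<^bsub>M\<^esub>" using that f by (simp add: smult_l_minus M.l_neg)
  qed
  have im: "koszul_diff R f1 f2 M (1 - 1) ` carrier (koszul_module M (1 - 1))
    = {[f1 \<bullet> x, f2 \<bullet> x] |x. x \<in> carrier M}"
    by (simp add: koszul_carriers koszul_diff_def image_image) blast
  show ?thesis unfolding Supp_koszul_iff[OF f P] im
    by (simp add: koszul_carriers koszul_diff_def koszul_simps e) blast
qed

lemma Supp_koszul_2:
  assumes f: "f1 \<in> carrier R" "f2 \<in> carrier R" and P: "primeideal P R"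
  shows "P \<notin> Supp R (koszul_cohomology R f1 f2 M 2) \<longleftrightarrow>
    carrier M \<subseteq> sat R P M {(\<ominus> f2) \<bullet> a \<oplus>\<^bsub>M\<^esub> f1 \<bullet> b |a b. a \<in> carrier M \<and> b \<in> carrier M}"
proof -
  have im: "koszul_diff R f1 f2 M (2 - 1) ` carrier (koszul_module M (2 - 1))
    = {[(\<ominus> f2) \<bullet> a \<oplus>\<^bsub>M\<^esub> f1 \<bullet> b] |a b. a \<in> carrier M \<and> b \<in> carrier M}"
    by (simp add: koszul_carriers koszul_diff_def image_image) (auto simp: image_iff, blast+)
  show ?thesis unfolding Supp_koszul_iff[OF f P] im
    by (simp add: koszul_carriers koszul_diff_def koszul_simps sat_def subset_iff) (metis (no_types, lifting))
qed

lemma Supp_koszul_other: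
  assumes f: "f1 \<in> carrier R" "f2 \<in> carrier R" and P: "primeideal P R" and i: "i \<noteq> 0" "i \<noteq> 1" "i \<noteq> 2"
  shows "P \<notin> Supp R (koszul_cohomology R f1 f2 M i)"
proof -
  have mod: "module R (koszul_module M j)" for j unfolding koszul_module_def by (rule power_is_module)
  interpret K: module R "koszul_module M i" by (rule mod)
  have "\<zero>\<^bsub>koszul_module M i\<^esub> \<in> koszul_diff R f1 f2 M (i - 1) ` carrier (koszul_module M (i - 1))"
    using K.submodule_zero[OF K.semilinear_image[OF mod koszul_diff_hom[OF f, of "i - 1", simplified]]] .
  moreover have "\<zero>\<^bsub>koszul_module M i\<^esub> = []" using i by (simp add: koszul_module_def koszul_rank_def power_simps)
  ultimately show ?thesis unfolding Supp_koszul_iff[OF f P] koszul_carriers(4)[OF i]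
    using prime_one[OF P] by (auto simp: koszul_module_def power_simps)
qed

end

text \<open>The defining ideal is the intersection of the primes in \<open>Z\<close>. For a prime
  \<open>P\<close> outside \<open>Z\<close>, every prime avoiding a suitable
  \<open>g \<notin> P\<close> is outside \<open>Z\<close>; then \<open>g\<close> lies in the
  intersection but not in \<open>P\<close>.\<close>

lemma (in cring) zariski_closedI:
  assumes Z: "Z \<subseteq> Spec R"
    and op: "\<And>P. P \<in> Spec R \<Longrightarrow> P \<notin> Z \<Longrightarrow> \<exists>g\<in>carrier R - P. \<forall>Q\<in>Spec R. g \<notin> Q \<longrightarrow> Q \<notin> Z"
  shows "zariski_closed R Z"
proof -
  let ?I = "{r \<in> carrier R. \<forall>Q\<in>Z. r \<in> Q}"
  have pr: "submodule Q R Sm" if "Q \<in> Z" for Q using Z that sm_prime by (auto simp: Spec_def)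
  have "ideal ?I R" unfolding ideal_iff_submodule
    by (rule module.submoduleI2[OF self_is_module])
      (use pr sm_zero sm_add sm_mult in \<open>auto simp: self_simps\<close>)
  moreover have "Z = {P \<in> Spec R. ?I \<subseteq> P}"
  proof
    show "Z \<subseteq> {P \<in> Spec R. ?I \<subseteq> P}" using Z by auto
    show "{P \<in> Spec R. ?I \<subseteq> P} \<subseteq> Z"
    proof clarify
      fix P assume P: "P \<in> Spec R" "?I \<subseteq> P"
      show "P \<in> Z"
      proof (rule ccontr)
        assume "P \<notin> Z"
        then obtain g where g: "g \<in> carrier R - P" "\<forall>Q\<in>Spec R. g \<notin> Q \<longrightarrow> Q \<notin> Z" using op P by blast
        then have "g \<in> ?I" using Z by blast
        then show False using P g by blast
      qed
    qed
  qed
  ultimately show ?thesis unfolding zariski_closed_def by blast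
qed

section \<open>Propagation along the filtration\<close>

text \<open>The neighbourhoods given by \<open>g\<close> and \<open>h\<close> intersect in the one
  given by their product.\<close>

lemma (in cring) prime_ideal_complement_conj:
  assumes P: "primeideal P R"
    and "\<exists>g\<in>carrier R - P. \<forall>Q. primeideal Q R \<longrightarrow> g \<notin> Q \<longrightarrow> A Q"
    and "\<exists>g\<in>carrier R - P. \<forall>Q. primeideal Q R \<longrightarrow> g \<notin> Q \<longrightarrow> B Q"
  shows "\<exists>g\<in>carrier R - P. \<forall>Q. primeideal Q R \<longrightarrow> g \<notin> Q \<longrightarrow> A Q \<and> B Q"
proof -
  obtain g h where g: "g \<in> carrier R - P" "\<And>Q. primeideal Q R \<Longrightarrow> g \<notin> Q \<Longrightarrow> A Q"
    and h: "h \<in> carrier R - P" "\<And>Q. primeideal Q R \<Longrightarrow> h \<notin> Q \<Longrightarrow> B Q" using assms(2,3) by blast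
  have "g \<otimes> h \<in> carrier R - P" by (rule module.prime_mult[OF self_is_module P g(1) h(1)])
  moreover have "A Q \<and> B Q" if Q: "primeideal Q R" and gh: "g \<otimes> h \<notin> Q" for Q
  proof -
    interpret Q: primeideal Q R by (rule Q)
    have "g \<notin> Q" "h \<notin> Q" using gh g(1) h(1) Q.I_r_closed[of g h] Q.I_l_closed[of h g] by auto
    then show ?thesis using g(2)[OF Q] h(2)[OF Q] by blast
  qed
  ultimately show ?thesis by blast
qed

text \<open>A witness \<open>s\<close> found at \<open>P\<close> serves at every prime that avoids
  it, since \<open>C\<close> does not mention the prime. The product of finitely many witnesses then
  gives the neighbourhood.\<close>

lemma (in cring) prime_ideal_complement_open:
  assumes "finite A" and P: "primeideal P R" and "\<And>i. i \<in> A \<Longrightarrow> \<exists>s\<in>carrier R - P. C s i"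
  shows "\<exists>g\<in>carrier R - P. \<forall>Q. primeideal Q R \<longrightarrow> g \<notin> Q \<longrightarrow> (\<forall>i\<in>A. \<exists>s\<in>carrier R - Q. C s i)"
  using assms(1,3)
proof (induction A)
  case empty
  then show ?case using module.prime_one[OF self_is_module P] by blast
next
  case (insert i A)
  have "\<exists>g\<in>carrier R - P. \<forall>Q. primeideal Q R \<longrightarrow> g \<notin> Q \<longrightarrow> (\<forall>i\<in>A. \<exists>s\<in>carrier R - Q. C s i)"
    by (rule insert.IH) (rule insert.prems, simp)
  moreover obtain s where "s \<in> carrier R - P" "C s i" using insert.prems[of i] by auto
  then have "\<exists>g\<in>carrier R - P. \<forall>Q. primeideal Q R \<longrightarrow> g \<notin> Q \<longrightarrow> (\<exists>s\<in>carrier R - Q. C s i)" by blast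
  ultimately show ?case using prime_ideal_complement_conj[OF P] by simp
qed

context module
begin

lemma sat_open:
  assumes "finite H" and P: "primeideal P R" and "H \<subseteq> sat R P M X"
  shows "\<exists>g\<in>carrier R - P. \<forall>Q. primeideal Q R \<longrightarrow> g \<notin> Q \<longrightarrow> H \<subseteq> sat R Q M X"
proof -
  have H: "H \<subseteq> carrier M" and "\<And>h. h \<in> H \<Longrightarrow> \<exists>s\<in>carrier R - P. s \<bullet> h \<in> X" using assms(3) by (auto simp: sat_def)
  from R.prime_ideal_complement_open[where C = "\<lambda>s h. s \<bullet> h \<in> X", OF assms(1) P this(2)]
  obtain g where "g \<in> carrier R - P"
    "\<forall>Q. primeideal Q R \<longrightarrow> g \<notin> Q \<longrightarrow> (\<forall>h\<in>H. \<exists>s\<in>carrier R - Q. s \<bullet> h \<in> X)" by blast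
  then show ?thesis using H unfolding sat_def by (intro bexI[of _ g]) blast+
qed

lemma smult_left_comm:
  "a \<in> carrier R \<Longrightarrow> b \<in> carrier R \<Longrightarrow> x \<in> carrier M \<Longrightarrow> a \<bullet> (b \<bullet> x) = b \<bullet> (a \<bullet> x)"
  by (simp add: smult_assoc1[symmetric] R.m_comm)

lemma smult_r_diff:
  "a \<in> carrier R \<Longrightarrow> x \<in> carrier M \<Longrightarrow> y \<in> carrier M \<Longrightarrow>
    a \<bullet> (x \<ominus>\<^bsub>M\<^esub> y) = a \<bullet> x \<ominus>\<^bsub>M\<^esub> a \<bullet> y"
  by (simp add: a_minus_def smult_r_distr smult_r_minus)

lemma smult_image_submodule:
  assumes N: "submodule N R M" and a: "a \<in> carrier R"
  shows "submodule ((\<lambda>x. a \<bullet> x) ` N) R M"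
proof (rule submoduleI2)
  note Nc = submodule_carr[OF N]
  show "(\<lambda>x. a \<bullet> x) ` N \<subseteq> carrier M" using Nc a by auto
  show "\<zero>\<^bsub>M\<^esub> \<in> (\<lambda>x. a \<bullet> x) ` N" using submodule_zero[OF N] a by (auto simp: image_iff intro!: bexI[of _ "\<zero>\<^bsub>M\<^esub>"])
next
  fix x y assume "x \<in> (\<lambda>x. a \<bullet> x) ` N" "y \<in> (\<lambda>x. a \<bullet> x) ` N"
  then obtain u v where uv: "u \<in> N" "v \<in> N" "x = a \<bullet> u" "y = a \<bullet> v" by blast
  then have "x \<oplus>\<^bsub>M\<^esub> y = a \<bullet> (u \<oplus>\<^bsub>M\<^esub> v)" using submodule_carr[OF N] a by (simp add: smult_r_distr)
  then show "x \<oplus>\<^bsub>M\<^esub> y \<in> (\<lambda>x. a \<bullet> x) ` N" using submodule_add[OF N uv(1,2)] by blast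
next
  fix r x assume r: "r \<in> carrier R" and "x \<in> (\<lambda>x. a \<bullet> x) ` N"
  then obtain u where u: "u \<in> N" "x = a \<bullet> u" by blast
  then have "r \<bullet> x = a \<bullet> (r \<bullet> u)" using submodule_carr[OF N] a r by (simp add: smult_left_comm)
  then show "r \<bullet> x \<in> (\<lambda>x. a \<bullet> x) ` N" using submodule_smult[OF N r u(1)] by blast
qed

lemma annihilator_submodule:
  assumes N: "submodule N R M" and a: "a \<in> carrier R"
  shows "submodule {x \<in> N. a \<bullet> x = \<zero>\<^bsub>M\<^esub>} R M"
  using submodule_carr[OF N] submodule_zero[OF N] submodule_add[OF N] submodule_smult[OF N] a
  by (intro submoduleI2) (auto simp: smult_r_distr smult_left_comm[of a])

end

locale koszul_filtration = semilinear_endo R F M \<phi> for R (structure) and F and M (structure) and \<phi> +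
  fixes p :: nat and G :: "'c set" and Lf :: "nat \<Rightarrow> 'c set" and f1 f2 :: 'a
  assumes p: "0 < p" and F_pow: "F = (\<lambda>r. r [^] p)"
    and G: "finite G" "G \<subseteq> carrier M" and Lf_0: "Lf 0 = lspan R M G"
    and Lf_Suc: "\<And>e. Lf (Suc e) = \<Phi> (Lf e)" and Lf_incl: "\<And>e. Lf e \<subseteq> Lf (Suc e)"
    and Lf_union: "carrier M = (\<Union>e. Lf e)"
    and f1 [simp]: "f1 \<in> carrier R" and f2 [simp]: "f2 \<in> carrier R"
begin

lemma F_smult: "a \<in> carrier R \<Longrightarrow> x \<in> carrier M \<Longrightarrow> F a \<bullet> x = a \<bullet> (a [^] (p - 1) \<bullet> x)"
proof -
  assume a: "a \<in> carrier R" "x \<in> carrier M"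
  have "F a = a [^] (p - 1) \<otimes> a" using p nat_pow_Suc[of a "p - 1"] by (simp add: F_pow)
  then show ?thesis using a by (simp add: smult_assoc1 smult_left_comm)
qed

lemma F_notin: "primeideal Q R \<Longrightarrow> s \<in> carrier R - Q \<Longrightarrow> F s \<in> carrier R - Q"
  using prime_pow[of Q s p] by (auto simp: F_pow)

lemma sat_\<phi>:
  assumes Q: "primeideal Q R" and x: "x \<in> sat R Q M X" and XY: "\<And>x. x \<in> X \<Longrightarrow> \<phi> x \<in> Y"
  shows "\<phi> x \<in> sat R Q M Y"
proof -
  obtain s where s: "s \<in> carrier R - Q" "s \<bullet> x \<in> X" "x \<in> carrier M" using x by (auto simp: sat_def)
  then have "F s \<bullet> \<phi> x \<in> Y" using XY[OF s(2)] by (simp add: \<phi>_smult)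
  then show ?thesis using F_notin[OF Q s(1)] s by (auto simp: sat_def \<phi>_closed)
qed

text \<open>A denominator \<open>s\<close> becomes \<open>F s\<close>, a power of \<open>s\<close>
  and hence again outside \<open>Q\<close>. This is how local statements climb the filtration
  without shrinking the neighbourhood.\<close>

lemma \<Phi>_sat:
  assumes Q: "primeideal Q R" and X: "X \<subseteq> sat R Q M Y" and Z: "submodule Z R M" and YZ: "\<And>x. x \<in> Y \<Longrightarrow> \<phi> x \<in> Z"
  shows "\<Phi> X \<subseteq> sat R Q M Z"
  using X sat_\<phi>[OF Q _ YZ] by (intro \<Phi>_minimal[OF sat_submodule[OF Q Z]]) auto

text \<open>By semilinearity, the images under \<open>\<phi>\<close> of generators of
  \<open>Lf e\<close> generate \<open>Lf (Suc e)\<close>.\<close>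

lemma Lf_submodule: "submodule (Lf e) R M" and Lf_fg: "\<exists>H. finite H \<and> H \<subseteq> carrier M \<and> Lf e = lspan R M H"
proof -
  show fg: "\<exists>H. finite H \<and> H \<subseteq> carrier M \<and> Lf e = lspan R M H"
  proof (induction e)
    case 0 then show ?case using G Lf_0 by blast
  next
    case (Suc e)
    then obtain H where H: "finite H" "H \<subseteq> carrier M" "Lf e = lspan R M H" by blast
    have \<phi>H: "\<phi> ` H \<subseteq> carrier M" by (rule \<Phi>_sub[OF H(2)])
    have HL: "lspan R M H \<subseteq> carrier M" using submoduleE(1)[OF lspan_submodule[OF H(2)]] .
    have "\<phi> x \<in> lspan R M (\<phi> ` H)" if "x \<in> lspan R M H" for x
      by (rule semilinear_lspan[OF module_axioms module_axioms \<phi> lspan_submodule[OF \<phi>H] _ H(2) lspan_incl[OF \<phi>H] that]) auto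
    then have "\<Phi> (Lf e) \<subseteq> lspan R M (\<phi> ` H)"
      unfolding H(3) by (rule \<Phi>_minimal[OF lspan_submodule[OF \<phi>H]])
    moreover have "lspan R M (\<phi> ` H) \<subseteq> \<Phi> (Lf e)"
      using \<Phi>_mono[OF HL lspan_incl[OF H(2)]] by (simp add: \<Phi>_def H(3))
    ultimately show ?case using Lf_Suc[of e] H(1) \<phi>H by (intro exI[of _ "\<phi> ` H"]) auto
  qed
  then show "submodule (Lf e) R M" using lspan_submodule by auto
qed

lemma Lf_mono: "i \<le> j \<Longrightarrow> Lf i \<subseteq> Lf j"
  using lift_Suc_mono_le[of Lf, OF Lf_incl] by blast

lemmas Lf_carr = submodule_carr[OF Lf_submodule]

lemma Lf_mem: "x \<in> carrier M \<Longrightarrow> \<exists>e. x \<in> Lf e" using Lf_union by blast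

lemma submodule_Lf_fg:
  assumes "submodule N R M" "N \<subseteq> Lf e"
  obtains H where "finite H" "H \<subseteq> N" "N = lspan R M H"
proof -
  obtain H where "finite H" "H \<subseteq> carrier M" "Lf e = lspan R M H" using Lf_fg by blast
  then show ?thesis using noetherian_module_fg[OF noeth, of H N] assms that by auto
qed

text \<open>An element killed by \<open>a\<close> is killed by \<open>F a\<close>, a multiple of
  \<open>a\<close>, and this is the form that flatness takes as input.\<close>

lemma annihilator_Lf:
  assumes X: "submodule X R M" and x: "x \<in> \<Phi> X" and a: "a \<in> carrier R" "a \<bullet> x = \<zero>\<^bsub>M\<^esub>"
  shows "x \<in> \<Phi> {y \<in> X. a \<bullet> y = \<zero>\<^bsub>M\<^esub>}"
proof (rule annihilator_flat[OF X x a(1)])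
  have "x \<in> carrier M" using submodule_carr[OF \<Phi>_submodule[OF submoduleE(1)[OF X]] x] .
  then show "F a \<bullet> x = \<zero>\<^bsub>M\<^esub>" using a smult_left_comm[of a "a [^] (p - 1)" x] by (simp add: F_smult)
qed

section \<open>Degrees two and zero\<close>

definition coboundaries where
  "coboundaries = {(\<ominus> f2) \<bullet> a \<oplus>\<^bsub>M\<^esub> f1 \<bullet> b |a b. a \<in> carrier M \<and> b \<in> carrier M}"

lemma coboundaries_submodule: "submodule coboundaries R M"
proof (rule submoduleI2)
  show "coboundaries \<subseteq> carrier M" by (auto simp: coboundaries_def)
  have "\<zero>\<^bsub>M\<^esub> = (\<ominus> f2) \<bullet> \<zero>\<^bsub>M\<^esub> \<oplus>\<^bsub>M\<^esub> f1 \<bullet> \<zero>\<^bsub>M\<^esub>" by simp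
  then show "\<zero>\<^bsub>M\<^esub> \<in> coboundaries" unfolding coboundaries_def by blast
next
  fix x y assume "x \<in> coboundaries" "y \<in> coboundaries"
  then obtain a b a' b' where ab: "a \<in> carrier M" "b \<in> carrier M" "a' \<in> carrier M" "b' \<in> carrier M"
    "x = (\<ominus> f2) \<bullet> a \<oplus>\<^bsub>M\<^esub> f1 \<bullet> b" "y = (\<ominus> f2) \<bullet> a' \<oplus>\<^bsub>M\<^esub> f1 \<bullet> b'" unfolding coboundaries_def by blast
  then have "x \<oplus>\<^bsub>M\<^esub> y = (\<ominus> f2) \<bullet> (a \<oplus>\<^bsub>M\<^esub> a') \<oplus>\<^bsub>M\<^esub> f1 \<bullet> (b \<oplus>\<^bsub>M\<^esub> b')"
    by (simp add: smult_r_distr M.a_ac)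
  then show "x \<oplus>\<^bsub>M\<^esub> y \<in> coboundaries" unfolding coboundaries_def using ab(1-4) by blast
next
  fix r x assume r: "r \<in> carrier R" and "x \<in> coboundaries"
  then obtain a b where ab: "a \<in> carrier M" "b \<in> carrier M"
    "x = (\<ominus> f2) \<bullet> a \<oplus>\<^bsub>M\<^esub> f1 \<bullet> b" unfolding coboundaries_def by blast
  then have "r \<bullet> x = (\<ominus> f2) \<bullet> (r \<bullet> a) \<oplus>\<^bsub>M\<^esub> f1 \<bullet> (r \<bullet> b)"
    using r by (simp add: smult_r_distr smult_left_comm[of r])
  then show "r \<bullet> x \<in> coboundaries" unfolding coboundaries_def using ab(1,2) r by blast
qed

lemma \<phi>_coboundaries: "x \<in> coboundaries \<Longrightarrow> \<phi> x \<in> coboundaries"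
proof -
  assume "x \<in> coboundaries"
  then obtain a b where ab: "a \<in> carrier M" "b \<in> carrier M"
    "x = (\<ominus> f2) \<bullet> a \<oplus>\<^bsub>M\<^esub> f1 \<bullet> b" unfolding coboundaries_def by blast
  \<comment> \<open>Powers of \<open>\<ominus> f2\<close> are kept together, so that no sign
    depending on the parity of \<open>p\<close> appears.\<close>
  then have "\<phi> x = (\<ominus> f2) \<bullet> ((\<ominus> f2) [^] (p - 1) \<bullet> \<phi> a) \<oplus>\<^bsub>M\<^esub> f1 \<bullet> (f1 [^] (p - 1) \<bullet> \<phi> b)"
    by (simp add: \<phi>_add \<phi>_smult F_smult \<phi>_closed)
  moreover have "(\<ominus> f2) [^] (p - 1) \<bullet> \<phi> a \<in> carrier M" "f1 [^] (p - 1) \<bullet> \<phi> b \<in> carrier M"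
    using ab(1,2) by (simp_all add: \<phi>_closed)
  ultimately show ?thesis unfolding coboundaries_def by blast
qed

lemma coboundaries_open:
  assumes P: "primeideal P R" and MP: "carrier M \<subseteq> sat R P M coboundaries"
  shows "\<exists>g\<in>carrier R - P. \<forall>Q. primeideal Q R \<longrightarrow> g \<notin> Q \<longrightarrow> carrier M \<subseteq> sat R Q M coboundaries"
proof -
  obtain g where g: "g \<in> carrier R - P" "\<And>Q. primeideal Q R \<Longrightarrow> g \<notin> Q \<Longrightarrow> G \<subseteq> sat R Q M coboundaries"
    using sat_open[OF G(1) P] G(2) MP by blast
  have "carrier M \<subseteq> sat R Q M coboundaries" if Q: "primeideal Q R" and gQ: "g \<notin> Q" for Q
  proof -
    have "Lf e \<subseteq> sat R Q M coboundaries" for e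
    proof (induction e)
      case 0
      show ?case unfolding Lf_0 by (rule lspan_minimal[OF sat_submodule[OF Q coboundaries_submodule] g(2)[OF Q gQ]])
    next
      case (Suc e)
      then show ?case unfolding Lf_Suc by (rule \<Phi>_sat[OF Q _ coboundaries_submodule \<phi>_coboundaries])
    qed
    then show ?thesis using Lf_union by blast
  qed
  then show ?thesis using g(1) by blast
qed

lemma socle_open:
  assumes P: "primeideal P R"
    and MP: "{x \<in> carrier M. f1 \<bullet> x = \<zero>\<^bsub>M\<^esub> \<and> f2 \<bullet> x = \<zero>\<^bsub>M\<^esub>} \<subseteq> sat R P M {\<zero>\<^bsub>M\<^esub>}"
  shows "\<exists>g\<in>carrier R - P. \<forall>Q. primeideal Q R \<longrightarrow> g \<notin> Q \<longrightarrow>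
    {x \<in> carrier M. f1 \<bullet> x = \<zero>\<^bsub>M\<^esub> \<and> f2 \<bullet> x = \<zero>\<^bsub>M\<^esub>} \<subseteq> sat R Q M {\<zero>\<^bsub>M\<^esub>}"
proof -
  \<comment> \<open>The two conditions are nested so that \<open>annihilator_Lf\<close> applies
    first for \<open>f1\<close> and then, inside the result, for \<open>f2\<close>.\<close>
  define N where "N e = {x \<in> {x \<in> Lf e. f1 \<bullet> x = \<zero>\<^bsub>M\<^esub>}. f2 \<bullet> x = \<zero>\<^bsub>M\<^esub>}" for e
  have A: "submodule {x \<in> Lf e. f1 \<bullet> x = \<zero>\<^bsub>M\<^esub>} R M" for e by (rule annihilator_submodule[OF Lf_submodule f1])
  have N: "submodule (N e) R M" for e unfolding N_def by (rule annihilator_submodule[OF A f2])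
  have N_Suc: "N (Suc e) \<subseteq> \<Phi> (N e)" for e
  proof
    fix x assume "x \<in> N (Suc e)"
    then have x: "x \<in> \<Phi> (Lf e)" "f1 \<bullet> x = \<zero>\<^bsub>M\<^esub>" "f2 \<bullet> x = \<zero>\<^bsub>M\<^esub>" by (auto simp: N_def Lf_Suc)
    show "x \<in> \<Phi> (N e)" unfolding N_def
      by (rule annihilator_Lf[OF A annihilator_Lf[OF Lf_submodule x(1) f1 x(2)] f2 x(3)])
  qed
  obtain H where H: "finite H" "H \<subseteq> N 0" "N 0 = lspan R M H"
    using submodule_Lf_fg[OF N, of 0 0] by (auto simp: N_def)
  have "N 0 \<subseteq> {x \<in> carrier M. f1 \<bullet> x = \<zero>\<^bsub>M\<^esub> \<and> f2 \<bullet> x = \<zero>\<^bsub>M\<^esub>}" using Lf_carr by (auto simp: N_def)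
  then have "H \<subseteq> sat R P M {\<zero>\<^bsub>M\<^esub>}" using H(2) MP by blast
  then obtain g where g: "g \<in> carrier R - P" "\<And>Q. primeideal Q R \<Longrightarrow> g \<notin> Q \<Longrightarrow> H \<subseteq> sat R Q M {\<zero>\<^bsub>M\<^esub>}"
    using sat_open[OF H(1) P] by blast
  have "{x \<in> carrier M. f1 \<bullet> x = \<zero>\<^bsub>M\<^esub> \<and> f2 \<bullet> x = \<zero>\<^bsub>M\<^esub>} \<subseteq> sat R Q M {\<zero>\<^bsub>M\<^esub>}"
    if Q: "primeideal Q R" and gQ: "g \<notin> Q" for Q
  proof -
    have "N e \<subseteq> sat R Q M {\<zero>\<^bsub>M\<^esub>}" for e
    proof (induction e)
      case 0
      show ?case unfolding H(3) by (rule lspan_minimal[OF sat_submodule[OF Q zero_submodule] g(2)[OF Q gQ]])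
    next
      case (Suc e)
      have "\<Phi> (N e) \<subseteq> sat R Q M {\<zero>\<^bsub>M\<^esub>}" by (rule \<Phi>_sat[OF Q Suc zero_submodule]) (simp add: \<phi>_zero)
      then show ?case using N_Suc by blast
    qed
    moreover have "\<exists>e. x \<in> N e" if "x \<in> carrier M" "f1 \<bullet> x = \<zero>\<^bsub>M\<^esub>" "f2 \<bullet> x = \<zero>\<^bsub>M\<^esub>" for x
      using that Lf_mem[of x] by (auto simp: N_def)
    ultimately show ?thesis by blast
  qed
  then show ?thesis using g(1) by blast
qed

end

section \<open>The first cohomology\<close>

context module
begin

lemma pow_pow_smult: "a \<in> carrier R \<Longrightarrow> x \<in> carrier M \<Longrightarrow> a [^] (m::nat) \<bullet> (a [^] (n::nat) \<bullet> x) = a [^] (m + n) \<bullet> x"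
  by (simp add: smult_assoc1[symmetric] R.nat_pow_mult)

lemma pow_Suc_smult: "a \<in> carrier R \<Longrightarrow> x \<in> carrier M \<Longrightarrow> a [^] Suc n \<bullet> x = a [^] n \<bullet> (a \<bullet> x)"
  by (simp add: smult_assoc1)

lemma pow_smult_zero_mono:
  assumes "a \<in> carrier R" "x \<in> carrier M" "a [^] (k::nat) \<bullet> x = \<zero>\<^bsub>M\<^esub>" "k \<le> l"
  shows "a [^] l \<bullet> x = \<zero>\<^bsub>M\<^esub>"
  using pow_pow_smult[of a x "l - k" k] assms by simp

lemma diff_zero_iff: "x \<in> carrier M \<Longrightarrow> y \<in> carrier M \<Longrightarrow> x \<ominus>\<^bsub>M\<^esub> y = \<zero>\<^bsub>M\<^esub> \<longleftrightarrow> x = y"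
  by (metis M.add.inv_closed M.add.m_closed M.minus_equality M.minus_minus M.r_neg a_minus_def)

end

context koszul_filtration
begin

lemma \<phi>_pow_smult: "a \<in> carrier R \<Longrightarrow> x \<in> carrier M \<Longrightarrow> \<phi> (a [^] (k::nat) \<bullet> x) = a [^] (k * p) \<bullet> \<phi> x"
  by (simp add: \<phi>_smult F_pow nat_pow_pow)

section \<open>Torsion along both elements\<close>

definition torsion where
  "torsion = {x \<in> carrier M. \<exists>k::nat. f1 [^] k \<bullet> x = \<zero>\<^bsub>M\<^esub> \<and> f2 [^] k \<bullet> x = \<zero>\<^bsub>M\<^esub>}"

lemma torsionI:
  assumes "x \<in> carrier M" "f1 [^] (j::nat) \<bullet> x = \<zero>\<^bsub>M\<^esub>" "f2 [^] (k::nat) \<bullet> x = \<zero>\<^bsub>M\<^esub>"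
  shows "x \<in> torsion"
  unfolding torsion_def using assms pow_smult_zero_mono[of _ x _ "j + k"]
  by (auto intro!: exI[of _ "j + k"])

lemma torsionE:
  assumes "x \<in> torsion"
  obtains k :: nat where "x \<in> carrier M" "f1 [^] k \<bullet> x = \<zero>\<^bsub>M\<^esub>" "f2 [^] k \<bullet> x = \<zero>\<^bsub>M\<^esub>"
  using assms by (auto simp: torsion_def)

lemma torsion_carr: "x \<in> torsion \<Longrightarrow> x \<in> carrier M" by (simp add: torsion_def)

lemma torsion_submodule: "submodule torsion R M"
proof (rule submoduleI2)
  show "torsion \<subseteq> carrier M" by (auto simp: torsion_def)
  show "\<zero>\<^bsub>M\<^esub> \<in> torsion" by (rule torsionI[of _ 0 0]) simp_all
next
  fix x y assume "x \<in> torsion" "y \<in> torsion"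
  then obtain k l :: nat where
    k: "x \<in> carrier M" "f1 [^] k \<bullet> x = \<zero>\<^bsub>M\<^esub>" "f2 [^] k \<bullet> x = \<zero>\<^bsub>M\<^esub>" and
    l: "y \<in> carrier M" "f1 [^] l \<bullet> y = \<zero>\<^bsub>M\<^esub>" "f2 [^] l \<bullet> y = \<zero>\<^bsub>M\<^esub>" by (auto simp: torsion_def)
  have "f [^] (k + l) \<bullet> x = \<zero>\<^bsub>M\<^esub>" "f [^] (k + l) \<bullet> y = \<zero>\<^bsub>M\<^esub>" if "f = f1 \<or> f = f2" for f
    using that k l pow_smult_zero_mono[of f x k "k + l"] pow_smult_zero_mono[of f y l "k + l"] by auto
  then show "x \<oplus>\<^bsub>M\<^esub> y \<in> torsion" using k(1) l(1) by (intro torsionI[of _ "k + l" "k + l"]) (auto simp: smult_r_distr)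
next
  fix r x assume r: "r \<in> carrier R" and "x \<in> torsion"
  then obtain k :: nat where k: "x \<in> carrier M" "f1 [^] k \<bullet> x = \<zero>\<^bsub>M\<^esub>" "f2 [^] k \<bullet> x = \<zero>\<^bsub>M\<^esub>"
    by (auto simp: torsion_def)
  then show "r \<bullet> x \<in> torsion"
    using r smult_left_comm[of "f1 [^] k" r x] smult_left_comm[of "f2 [^] k" r x] by (intro torsionI[of _ k k]) auto
qed

lemma torsion_shift:
  assumes x: "x \<in> carrier M" and "f1 [^] (j::nat) \<bullet> x \<in> torsion" "f2 [^] (k::nat) \<bullet> x \<in> torsion"
  shows "x \<in> torsion"
proof -
  obtain m where m: "f1 [^] (m::nat) \<bullet> (f1 [^] j \<bullet> x) = \<zero>\<^bsub>M\<^esub>" using assms(2) by (rule torsionE) blast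
  obtain n where n: "f2 [^] (n::nat) \<bullet> (f2 [^] k \<bullet> x) = \<zero>\<^bsub>M\<^esub>" using assms(3) by (rule torsionE) blast
  show ?thesis using m n x by (intro torsionI[of x "m + j" "n + k"]) (auto simp: pow_pow_smult)
qed

text \<open>The cocycle condition exchanges the two kinds of torsion: \<open>f2^(k+1) x\<close>
  equals \<open>f1 f2^k y\<close>, and \<open>f1^(j+1) y\<close> equals \<open>f2 f1^j x\<close>. So
  \<open>x\<close>, controlled along \<open>f1\<close>, is also controlled along \<open>f2\<close>,
  and \<open>y\<close> the other way round.\<close>

lemma torsion_cocycle:
  assumes xy: "x \<in> carrier M" "y \<in> carrier M" and eq: "f1 \<bullet> y = f2 \<bullet> x"
    and t: "f1 [^] (j::nat) \<bullet> x \<in> torsion" "f2 [^] (k::nat) \<bullet> y \<in> torsion"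
  shows "x \<in> torsion" and "y \<in> torsion"
proof -
  have "f2 [^] Suc k \<bullet> x = f1 \<bullet> (f2 [^] k \<bullet> y)"
    unfolding pow_Suc_smult[OF f2 xy(1)] eq[symmetric] using xy by (simp add: smult_left_comm[of f1])
  then have "f2 [^] Suc k \<bullet> x \<in> torsion" using submodule_smult[OF torsion_submodule f1 t(2)] by simp
  then show "x \<in> torsion" by (rule torsion_shift[OF xy(1) t(1)])
  have "f1 [^] Suc j \<bullet> y = f2 \<bullet> (f1 [^] j \<bullet> x)"
    unfolding pow_Suc_smult[OF f1 xy(2)] eq using xy by (simp add: smult_left_comm[of f2])
  then have "f1 [^] Suc j \<bullet> y \<in> torsion" using submodule_smult[OF torsion_submodule f2 t(1)] by simp
  then show "y \<in> torsion" using t(2) by (rule torsion_shift[OF xy(2)])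
qed

lemma \<phi>_torsion: "x \<in> torsion \<Longrightarrow> \<phi> x \<in> torsion"
proof -
  assume "x \<in> torsion"
  then obtain k :: nat where k: "x \<in> carrier M" "f1 [^] k \<bullet> x = \<zero>\<^bsub>M\<^esub>" "f2 [^] k \<bullet> x = \<zero>\<^bsub>M\<^esub>" by (rule torsionE)
  show ?thesis
  proof (rule torsionI)
    show "\<phi> x \<in> carrier M" using k(1) by (rule \<phi>_closed)
    show "f1 [^] (k * p) \<bullet> \<phi> x = \<zero>\<^bsub>M\<^esub>" "f2 [^] (k * p) \<bullet> \<phi> x = \<zero>\<^bsub>M\<^esub>"
      using k(1) by (simp_all add: \<phi>_pow_smult[symmetric] k(2,3) \<phi>_zero)
  qed
qed

definition torsion_Lf where "torsion_Lf e = torsion \<inter> Lf e"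

lemma torsion_Lf_submodule: "submodule (torsion_Lf e) R M"
  unfolding torsion_Lf_def
  using torsion_carr submodule_zero submodule_add submodule_smult torsion_submodule Lf_submodule
  by (intro submoduleI2) auto

lemmas torsion_Lf_carr = submodule_carr[OF torsion_Lf_submodule]

lemma torsion_Lf_mono: "i \<le> j \<Longrightarrow> torsion_Lf i \<subseteq> torsion_Lf j" using Lf_mono by (auto simp: torsion_Lf_def)

lemma torsion_Lf_mem: "x \<in> torsion \<Longrightarrow> \<exists>e. x \<in> torsion_Lf e"
  using Lf_mem[of x] torsion_carr by (auto simp: torsion_Lf_def)

lemma \<phi>_torsion_Lf: "x \<in> torsion_Lf e \<Longrightarrow> \<phi> x \<in> torsion_Lf (Suc e)"
  using \<phi>_torsion \<Phi>_incl[OF submoduleE(1)[OF Lf_submodule], of x e] by (auto simp: torsion_Lf_def Lf_Suc)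

text \<open>The exponent \<open>k\<close> is not raised on the way down: flatness is applied to the
  scalars \<open>f1^k\<close> and \<open>f2^k\<close> themselves and yields elements of level
  \<open>e\<close> killed by the same powers.\<close>

lemma torsion_Lf_Suc: "torsion_Lf (Suc e) \<subseteq> \<Phi> (torsion_Lf e)"
proof
  fix x assume "x \<in> torsion_Lf (Suc e)"
  then have x: "x \<in> torsion" "x \<in> \<Phi> (Lf e)" by (auto simp: torsion_Lf_def Lf_Suc)
  obtain k :: nat where k: "x \<in> carrier M" "f1 [^] k \<bullet> x = \<zero>\<^bsub>M\<^esub>" "f2 [^] k \<bullet> x = \<zero>\<^bsub>M\<^esub>" using x(1) by (rule torsionE)
  have c: "f1 [^] k \<in> carrier R" "f2 [^] k \<in> carrier R" by auto
  have A: "submodule {y \<in> Lf e. f1 [^] k \<bullet> y = \<zero>\<^bsub>M\<^esub>} R M" by (rule annihilator_submodule[OF Lf_submodule c(1)])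
  have "x \<in> \<Phi> {y \<in> {y \<in> Lf e. f1 [^] k \<bullet> y = \<zero>\<^bsub>M\<^esub>}. f2 [^] k \<bullet> y = \<zero>\<^bsub>M\<^esub>}"
    by (rule annihilator_Lf[OF A annihilator_Lf[OF Lf_submodule x(2) c(1) k(2)] c(2) k(3)])
  moreover have "{y \<in> {y \<in> Lf e. f1 [^] k \<bullet> y = \<zero>\<^bsub>M\<^esub>}. f2 [^] k \<bullet> y = \<zero>\<^bsub>M\<^esub>} \<subseteq> torsion_Lf e"
    using torsionI[of _ k k] Lf_carr by (auto simp: torsion_Lf_def)
  ultimately show "x \<in> \<Phi> (torsion_Lf e)" using \<Phi>_mono[OF submoduleE(1)[OF torsion_Lf_submodule]] by blast
qed

text \<open>The pair is a coboundary at \<open>Q\<close> in the Koszul complex of \<open>a\<close>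
  and \<open>b\<close> on \<open>M\<close> modulo torsion. The scalars are parameters because the
  induction passes through \<open>F f1\<close> and \<open>F f2\<close>.\<close>

definition torsion_coboundary where
  "torsion_coboundary Q a b x y \<longleftrightarrow> x \<in> carrier M \<and> y \<in> carrier M \<and>
    (\<exists>s\<in>carrier R - Q. \<exists>z\<in>carrier M. s \<bullet> x \<ominus>\<^bsub>M\<^esub> a \<bullet> z \<in> torsion \<and> s \<bullet> y \<ominus>\<^bsub>M\<^esub> b \<bullet> z \<in> torsion)"

lemma torsion_coboundary_zero:
  assumes "primeideal Q R" "a \<in> carrier R" "b \<in> carrier R"
  shows "torsion_coboundary Q a b \<zero>\<^bsub>M\<^esub> \<zero>\<^bsub>M\<^esub>"
  unfolding torsion_coboundary_def using assms prime_one[OF assms(1)] submodule_zero[OF torsion_submodule] submodule_diff[OF torsion_submodule]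
  by (intro conjI bexI[of _ \<one>] bexI[of _ "\<zero>\<^bsub>M\<^esub>"]) auto

lemma torsion_coboundary_add:
  assumes Q: "primeideal Q R" and ab: "a \<in> carrier R" "b \<in> carrier R"
    and "torsion_coboundary Q a b x y" "torsion_coboundary Q a b x' y'"
  shows "torsion_coboundary Q a b (x \<oplus>\<^bsub>M\<^esub> x') (y \<oplus>\<^bsub>M\<^esub> y')"
proof -
  obtain s z s' z' where
    s: "s \<in> carrier R - Q" "z \<in> carrier M" "s \<bullet> x \<ominus>\<^bsub>M\<^esub> a \<bullet> z \<in> torsion" "s \<bullet> y \<ominus>\<^bsub>M\<^esub> b \<bullet> z \<in> torsion" and
    s': "s' \<in> carrier R - Q" "z' \<in> carrier M" "s' \<bullet> x' \<ominus>\<^bsub>M\<^esub> a \<bullet> z' \<in> torsion" "s' \<bullet> y' \<ominus>\<^bsub>M\<^esub> b \<bullet> z' \<in> torsion" and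
    c: "x \<in> carrier M" "y \<in> carrier M" "x' \<in> carrier M" "y' \<in> carrier M"
    using assms(4,5) unfolding torsion_coboundary_def by blast
  have sR: "s \<in> carrier R" "s' \<in> carrier R" using s s' by auto
  have *: "(s \<otimes> s') \<bullet> (u \<oplus>\<^bsub>M\<^esub> u') \<ominus>\<^bsub>M\<^esub> d \<bullet> (s' \<bullet> z \<oplus>\<^bsub>M\<^esub> s \<bullet> z') \<in> torsion"
    if u: "u \<in> carrier M" "u' \<in> carrier M" "d \<in> carrier R" "s \<bullet> u \<ominus>\<^bsub>M\<^esub> d \<bullet> z \<in> torsion" "s' \<bullet> u' \<ominus>\<^bsub>M\<^esub> d \<bullet> z' \<in> torsion" for u u' d
  proof -
    have "(s \<otimes> s') \<bullet> (u \<oplus>\<^bsub>M\<^esub> u') \<ominus>\<^bsub>M\<^esub> d \<bullet> (s' \<bullet> z \<oplus>\<^bsub>M\<^esub> s \<bullet> z')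
      = s' \<bullet> (s \<bullet> u \<ominus>\<^bsub>M\<^esub> d \<bullet> z) \<oplus>\<^bsub>M\<^esub> s \<bullet> (s' \<bullet> u' \<ominus>\<^bsub>M\<^esub> d \<bullet> z')"
      using u(1-3) s(2) s'(2) sR
      by (simp add: smult_assoc1 smult_r_distr smult_r_diff smult_r_minus smult_left_comm a_minus_def M.minus_add M.a_ac)
    then show ?thesis
      using submodule_add[OF torsion_submodule submodule_smult[OF torsion_submodule sR(2) u(4)] submodule_smult[OF torsion_submodule sR(1) u(5)]] by simp
  qed
  have "s' \<bullet> z \<oplus>\<^bsub>M\<^esub> s \<bullet> z' \<in> carrier M" using s s' by auto
  then show ?thesis unfolding torsion_coboundary_def
    using *[OF c(1,3) ab(1) s(3) s'(3)] *[OF c(2,4) ab(2) s(4) s'(4)] prime_mult[OF Q s(1) s'(1)] c by blast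
qed

lemma torsion_coboundary_smult:
  assumes Q: "primeideal Q R" and ab: "a \<in> carrier R" "b \<in> carrier R" and r: "r \<in> carrier R"
    and "torsion_coboundary Q a b x y"
  shows "torsion_coboundary Q a b (r \<bullet> x) (r \<bullet> y)"
proof -
  obtain s z where
    s: "s \<in> carrier R - Q" "z \<in> carrier M" "s \<bullet> x \<ominus>\<^bsub>M\<^esub> a \<bullet> z \<in> torsion" "s \<bullet> y \<ominus>\<^bsub>M\<^esub> b \<bullet> z \<in> torsion" and
    c: "x \<in> carrier M" "y \<in> carrier M" using assms(5) unfolding torsion_coboundary_def by blast
  have *: "s \<bullet> (r \<bullet> u) \<ominus>\<^bsub>M\<^esub> d \<bullet> (r \<bullet> z) \<in> torsion"
    if u: "u \<in> carrier M" "d \<in> carrier R" "s \<bullet> u \<ominus>\<^bsub>M\<^esub> d \<bullet> z \<in> torsion" for u d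
  proof -
    have "s \<bullet> (r \<bullet> u) \<ominus>\<^bsub>M\<^esub> d \<bullet> (r \<bullet> z) = r \<bullet> (s \<bullet> u \<ominus>\<^bsub>M\<^esub> d \<bullet> z)"
      using u(1,2) s(1,2) r by (simp add: smult_r_diff smult_left_comm[of r])
    then show ?thesis using submodule_smult[OF torsion_submodule r u(3)] by simp
  qed
  have "r \<bullet> z \<in> carrier M" using s r by auto
  then show ?thesis unfolding torsion_coboundary_def
    using *[OF c(1) ab(1) s(3)] *[OF c(2) ab(2) s(4)] s(1) c r by blast
qed

lemma \<phi>_torsion_coboundary:
  assumes Q: "primeideal Q R" and ab: "a \<in> carrier R" "b \<in> carrier R" and "torsion_coboundary Q a b x y"
  shows "torsion_coboundary Q (F a) (F b) (\<phi> x) (\<phi> y)"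
proof -
  obtain s z where
    s: "s \<in> carrier R - Q" "z \<in> carrier M" "s \<bullet> x \<ominus>\<^bsub>M\<^esub> a \<bullet> z \<in> torsion" "s \<bullet> y \<ominus>\<^bsub>M\<^esub> b \<bullet> z \<in> torsion" and
    c: "x \<in> carrier M" "y \<in> carrier M" using assms(4) unfolding torsion_coboundary_def by blast
  have *: "F s \<bullet> \<phi> u \<ominus>\<^bsub>M\<^esub> F d \<bullet> \<phi> z \<in> torsion"
    if u: "u \<in> carrier M" "d \<in> carrier R" "s \<bullet> u \<ominus>\<^bsub>M\<^esub> d \<bullet> z \<in> torsion" for u d
  proof -
    have "\<phi> (s \<bullet> u \<ominus>\<^bsub>M\<^esub> d \<bullet> z) = F s \<bullet> \<phi> u \<ominus>\<^bsub>M\<^esub> F d \<bullet> \<phi> z"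
      using u(1,2) s(1,2) by (simp add: a_minus_def \<phi>_add \<phi>_minus \<phi>_smult)
    then show ?thesis using \<phi>_torsion[OF u(3)] by simp
  qed
  show ?thesis unfolding torsion_coboundary_def
    using *[OF c(1) ab(1) s(3)] *[OF c(2) ab(2) s(4)] F_notin[OF Q s(1)] \<phi>_closed c s(2) by blast
qed

text \<open>
  Multiplication by powers of \<open>f1\<close> and \<open>f2\<close> turns a cocycle for \<open>f1, f2\<close> into one for \<open>F f1, F f2\<close>,
  and is invertible up to torsion.
\<close>

lemma torsion_coboundary_step:
  assumes Q: "primeideal Q R"
    and IH: "\<And>x y. x \<in> Lf e \<Longrightarrow> y \<in> Lf e \<Longrightarrow> f1 \<bullet> y = f2 \<bullet> x \<Longrightarrow> torsion_coboundary Q f1 f2 x y"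
    and xy: "x \<in> Lf (Suc e)" "y \<in> Lf (Suc e)" and eq: "f1 \<bullet> y = f2 \<bullet> x"
  shows "torsion_coboundary Q f1 f2 x y"
proof -
  let ?x = "f1 [^] (p - 1) \<bullet> x" and ?y = "f2 [^] (p - 1) \<bullet> y"
  have c: "x \<in> carrier M" "y \<in> carrier M" using xy Lf_carr by auto
  have pR: "f1 [^] (p - 1) \<in> carrier R" "f2 [^] (p - 1) \<in> carrier R" by auto
  have xy': "?x \<in> \<Phi> (Lf e)" "?y \<in> \<Phi> (Lf e)"
    using submodule_smult[OF Lf_submodule pR(1) xy(1)] submodule_smult[OF Lf_submodule pR(2) xy(2)] by (simp_all add: Lf_Suc)
  have "F f1 \<bullet> ?y = f1 [^] (p - 1) \<bullet> (f2 [^] (p - 1) \<bullet> (f1 \<bullet> y))"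
    using c pR by (simp add: F_smult smult_left_comm[of f1])
  also have "\<dots> = F f2 \<bullet> ?x"
    unfolding eq using c pR smult_left_comm[OF pR, of "f2 \<bullet> x"] by (simp add: F_smult smult_left_comm[OF _ f2])
  finally have e: "F f1 \<bullet> ?y = F f2 \<bullet> ?x" .
  have FR: "F f1 \<in> carrier R" "F f2 \<in> carrier R" by auto
  have "torsion_coboundary Q (F f1) (F f2) ?x ?y"
  proof (rule cocycle_flat[OF Lf_submodule xy' f1 f2 e, where K = "torsion_coboundary Q (F f1) (F f2)"])
    show "torsion_coboundary Q (F f1) (F f2) (\<phi> u) (\<phi> v)" if "u \<in> Lf e" "v \<in> Lf e" "f1 \<bullet> v = f2 \<bullet> u" for u v
      by (rule \<phi>_torsion_coboundary[OF Q f1 f2 IH[OF that]])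
  qed (auto intro: torsion_coboundary_zero[OF Q FR] torsion_coboundary_add[OF Q FR] torsion_coboundary_smult[OF Q FR])
  then obtain s z where s: "s \<in> carrier R - Q" "z \<in> carrier M"
    "s \<bullet> ?x \<ominus>\<^bsub>M\<^esub> F f1 \<bullet> z \<in> torsion" "s \<bullet> ?y \<ominus>\<^bsub>M\<^esub> F f2 \<bullet> z \<in> torsion"
    unfolding torsion_coboundary_def by blast
  have sR: "s \<in> carrier R" using s by simp
  \<comment> \<open>What is left after subtracting the coboundary of \<open>z\<close> is again a
    cocycle for \<open>f1\<close> and \<open>f2\<close>, and its multiples by
    \<open>f1^(p-1)\<close> and \<open>f2^(p-1)\<close> are torsion.\<close>
  let ?u = "s \<bullet> x \<ominus>\<^bsub>M\<^esub> f1 \<bullet> z" and ?v = "s \<bullet> y \<ominus>\<^bsub>M\<^esub> f2 \<bullet> z"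
  have uv: "?u \<in> carrier M" "?v \<in> carrier M" using c s sR by auto
  have "f1 \<bullet> ?v = f2 \<bullet> ?u"
    using c s(2) sR eq by (simp add: smult_r_diff smult_left_comm[of _ s] smult_left_comm[of f2 f1])
  moreover have "f1 [^] (p - 1) \<bullet> ?u = s \<bullet> ?x \<ominus>\<^bsub>M\<^esub> F f1 \<bullet> z"
    using c s(2) sR pR by (simp add: smult_r_diff F_smult smult_left_comm[of _ s] smult_left_comm[of f1])
  moreover have "f2 [^] (p - 1) \<bullet> ?v = s \<bullet> ?y \<ominus>\<^bsub>M\<^esub> F f2 \<bullet> z"
    using c s(2) sR pR by (simp add: smult_r_diff F_smult smult_left_comm[of _ s] smult_left_comm[of f2])
  ultimately have "?u \<in> torsion" "?v \<in> torsion"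
    using torsion_cocycle[OF uv, of "p - 1" "p - 1"] s(3,4) by simp_all
  then show ?thesis unfolding torsion_coboundary_def using s(1,2) c by blast
qed

text \<open>The cocycles in \<open>Lf 0\<close> are generated without forming a module of pairs:
  \<open>?Z\<close> is the projection to the first component, and \<open>?V\<close> holds the second
  components of cocycles with first component zero. A cocycle over each generator of
  \<open>?Z\<close>, together with the generators of \<open>?V\<close>, is enough to test. The
  higher levels follow from \<open>torsion_coboundary_step\<close> at the same primes.\<close>

lemma torsion_coboundaries_open:
  assumes P: "primeideal P R"
    and MP: "\<And>x y. x \<in> carrier M \<Longrightarrow> y \<in> carrier M \<Longrightarrow> f1 \<bullet> y = f2 \<bullet> x \<Longrightarrow> torsion_coboundary P f1 f2 x y"
  shows "\<exists>g\<in>carrier R - P. \<forall>Q. primeideal Q R \<longrightarrow> g \<notin> Q \<longrightarrow>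
    (\<forall>x\<in>carrier M. \<forall>y\<in>carrier M. f1 \<bullet> y = f2 \<bullet> x \<longrightarrow> torsion_coboundary Q f1 f2 x y)"
proof -
  let ?Z = "{x \<in> Lf 0. \<exists>y\<in>Lf 0. f1 \<bullet> y = f2 \<bullet> x}" and ?V = "{y \<in> Lf 0. f1 \<bullet> y = \<zero>\<^bsub>M\<^esub>}"
  note L = submodule_zero[OF Lf_submodule] submodule_add[OF Lf_submodule] submodule_smult[OF Lf_submodule]
  have Z: "submodule ?Z R M"
  proof (rule submoduleI2)
    show "?Z \<subseteq> carrier M" using Lf_carr by blast
    show "\<zero>\<^bsub>M\<^esub> \<in> ?Z" using L(1)[of 0] by (auto intro!: bexI[of _ "\<zero>\<^bsub>M\<^esub>"])
  next
    fix a b assume "a \<in> ?Z" "b \<in> ?Z"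
    then obtain y y' where y: "a \<in> Lf 0" "y \<in> Lf 0" "f1 \<bullet> y = f2 \<bullet> a" "b \<in> Lf 0" "y' \<in> Lf 0" "f1 \<bullet> y' = f2 \<bullet> b" by blast
    then have "f1 \<bullet> (y \<oplus>\<^bsub>M\<^esub> y') = f2 \<bullet> (a \<oplus>\<^bsub>M\<^esub> b)" using Lf_carr by (simp add: smult_r_distr)
    then show "a \<oplus>\<^bsub>M\<^esub> b \<in> ?Z" using L(2)[OF y(1,4)] L(2)[OF y(2,5)] by blast
  next
    fix r x assume r: "r \<in> carrier R" and "x \<in> ?Z"
    then obtain y where y: "x \<in> Lf 0" "y \<in> Lf 0" "f1 \<bullet> y = f2 \<bullet> x" by blast
    then have "f1 \<bullet> (r \<bullet> y) = f2 \<bullet> (r \<bullet> x)" using Lf_carr r by (simp add: smult_left_comm[of _ r])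
    then show "r \<bullet> x \<in> ?Z" using L(3)[OF r y(1)] L(3)[OF r y(2)] by blast
  qed
  have V: "submodule ?V R M" by (rule annihilator_submodule[OF Lf_submodule f1])
  obtain H where H: "finite H" "H \<subseteq> ?Z" "?Z = lspan R M H" by (rule submodule_Lf_fg[OF Z Collect_restrict])
  obtain W where W: "finite W" "W \<subseteq> ?V" "?V = lspan R M W" by (rule submodule_Lf_fg[OF V Collect_restrict])
  have "\<forall>h\<in>H. \<exists>y\<in>Lf 0. f1 \<bullet> y = f2 \<bullet> h" using H(2) by blast
  then obtain \<eta> where \<eta>: "\<And>h. h \<in> H \<Longrightarrow> \<eta> h \<in> Lf 0" "\<And>h. h \<in> H \<Longrightarrow> f1 \<bullet> \<eta> h = f2 \<bullet> h" by metis
  let ?A = "(\<lambda>h. (h, \<eta> h)) ` H \<union> Pair \<zero>\<^bsub>M\<^esub> ` W"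
  define C where "C s i \<longleftrightarrow> (\<exists>z\<in>carrier M. s \<bullet> fst i \<ominus>\<^bsub>M\<^esub> f1 \<bullet> z \<in> torsion
    \<and> s \<bullet> snd i \<ominus>\<^bsub>M\<^esub> f2 \<bullet> z \<in> torsion)" for s i
  have C: "torsion_coboundary Q f1 f2 x y \<longleftrightarrow> x \<in> carrier M \<and> y \<in> carrier M \<and> (\<exists>s\<in>carrier R - Q. C s (x, y))" for Q x y
    by (simp add: torsion_coboundary_def C_def)
  have A: "x \<in> Lf 0" "y \<in> Lf 0" "f1 \<bullet> y = f2 \<bullet> x" if "(x, y) \<in> ?A" for x y
    using that H(2) W(2) \<eta> L(1) by auto
  have "\<exists>s\<in>carrier R - P. C s i" if i: "i \<in> ?A" for i
  proof -
    obtain x y where xy: "i = (x, y)" by (cases i)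
    then have "torsion_coboundary P f1 f2 x y" using A[of x y] i by (intro MP Lf_carr) auto
    then show ?thesis unfolding xy C by blast
  qed
  then have "\<exists>g\<in>carrier R - P. \<forall>Q. primeideal Q R \<longrightarrow> g \<notin> Q \<longrightarrow> (\<forall>i\<in>?A. \<exists>s\<in>carrier R - Q. C s i)"
    using H(1) W(1) by (intro prime_ideal_complement_open[OF _ P]) blast+
  then obtain g where g: "g \<in> carrier R - P"
    "\<forall>Q. primeideal Q R \<longrightarrow> g \<notin> Q \<longrightarrow> (\<forall>i\<in>?A. \<exists>s\<in>carrier R - Q. C s i)" by blast
  have "torsion_coboundary Q f1 f2 x y"
    if Q: "primeideal Q R" and gQ: "g \<notin> Q" and xy: "x \<in> carrier M" "y \<in> carrier M" "f1 \<bullet> y = f2 \<bullet> x" for Q x y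
  proof -
    let ?B = "torsion_coboundary Q f1 f2"
    note add = torsion_coboundary_add[OF Q f1 f2] and sm = torsion_coboundary_smult[OF Q f1 f2] and
      zero = torsion_coboundary_zero[OF Q f1 f2]
    have "\<forall>i\<in>?A. \<exists>s\<in>carrier R - Q. C s i" using g(2) Q gQ by blast
    then have BA: "?B x y" if "(x, y) \<in> ?A" for x y
      unfolding C using that Lf_carr[OF A(1)[OF that]] Lf_carr[OF A(2)[OF that]] by blast
    have BV: "?B \<zero>\<^bsub>M\<^esub> y" if "y \<in> ?V" for y
    proof -
      have S: "submodule {y \<in> carrier M. ?B \<zero>\<^bsub>M\<^esub> y} R M"
        using zero add[of "\<zero>\<^bsub>M\<^esub>" _ "\<zero>\<^bsub>M\<^esub>"] sm[of _ "\<zero>\<^bsub>M\<^esub>"] by (intro submoduleI2) auto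
      have "lspan R M W \<subseteq> {y \<in> carrier M. ?B \<zero>\<^bsub>M\<^esub> y}"
        using W(2) BA Lf_carr by (intro lspan_minimal[OF S]) auto
      then show ?thesis using that W(3) by blast
    qed
    let ?D = "{x \<in> Lf 0. \<exists>y\<in>Lf 0. f1 \<bullet> y = f2 \<bullet> x \<and> ?B x y}"
    have D: "submodule ?D R M"
    proof (rule submoduleI2)
      show "?D \<subseteq> carrier M" using Lf_carr by blast
      show "\<zero>\<^bsub>M\<^esub> \<in> ?D" using L(1)[of 0] zero by (auto intro!: bexI[of _ "\<zero>\<^bsub>M\<^esub>"])
    next
      fix a b assume "a \<in> ?D" "b \<in> ?D"
      then obtain y y' where y: "a \<in> Lf 0" "y \<in> Lf 0" "f1 \<bullet> y = f2 \<bullet> a" "b \<in> Lf 0" "y' \<in> Lf 0" "f1 \<bullet> y' = f2 \<bullet> b" "?B a y" "?B b y'" by blast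
      then have "f1 \<bullet> (y \<oplus>\<^bsub>M\<^esub> y') = f2 \<bullet> (a \<oplus>\<^bsub>M\<^esub> b)" using Lf_carr by (simp add: smult_r_distr)
      then show "a \<oplus>\<^bsub>M\<^esub> b \<in> ?D" using L(2)[OF y(1,4)] L(2)[OF y(2,5)] add[OF y(7,8)] by blast
    next
      fix r x assume r: "r \<in> carrier R" and "x \<in> ?D"
      then obtain y where y: "x \<in> Lf 0" "y \<in> Lf 0" "f1 \<bullet> y = f2 \<bullet> x" "?B x y" by blast
      then have "f1 \<bullet> (r \<bullet> y) = f2 \<bullet> (r \<bullet> x)" using Lf_carr r by (simp add: smult_left_comm[of _ r])
      then show "r \<bullet> x \<in> ?D" using L(3)[OF r y(1)] L(3)[OF r y(2)] sm[OF r y(4)] by blast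
    qed
    have ZD: "?Z \<subseteq> ?D" unfolding H(3)
    proof (rule lspan_minimal[OF D], rule subsetI)
      fix h assume h: "h \<in> H"
      then have "h \<in> Lf 0" using H(2) by blast
      moreover have "?B h (\<eta> h)" using h by (intro BA) blast
      ultimately show "h \<in> ?D" using \<eta>[OF h] by blast
    qed
    have B0: "?B x y" if xy: "x \<in> Lf 0" "y \<in> Lf 0" "f1 \<bullet> y = f2 \<bullet> x" for x y
    proof -
      obtain y' where y': "y' \<in> Lf 0" "f1 \<bullet> y' = f2 \<bullet> x" "?B x y'" using ZD xy by blast
      have c: "x \<in> carrier M" "y \<in> carrier M" "y' \<in> carrier M" using xy y' Lf_carr by auto
      \<comment> \<open>Two cocycles over the same \<open>x\<close> differ by one with first
        component zero.\<close>
      have "y \<ominus>\<^bsub>M\<^esub> y' \<in> ?V"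
        using submodule_diff[OF Lf_submodule xy(2) y'(1)] c xy(3) y'(2) by (simp add: smult_r_diff diff_zero_iff)
      then have "?B (\<zero>\<^bsub>M\<^esub> \<oplus>\<^bsub>M\<^esub> x) ((y \<ominus>\<^bsub>M\<^esub> y') \<oplus>\<^bsub>M\<^esub> y')" by (intro add BV y'(3))
      moreover have "(y \<ominus>\<^bsub>M\<^esub> y') \<oplus>\<^bsub>M\<^esub> y' = y" using c by (simp add: a_minus_def M.a_assoc M.l_neg)
      ultimately show ?thesis using c by simp
    qed
    have Be: "?B x y" if "x \<in> Lf e" "y \<in> Lf e" "f1 \<bullet> y = f2 \<bullet> x" for e x y
      using that
    proof (induction e arbitrary: x y)
      case 0 then show ?case by (rule B0)
    next
      case (Suc e) show ?case by (rule torsion_coboundary_step[OF Q Suc.IH Suc.prems])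
    qed
    obtain i j where "x \<in> Lf i" "y \<in> Lf j" using Lf_mem xy by blast
    then have "x \<in> Lf (max i j)" "y \<in> Lf (max i j)" using Lf_mono[of i "max i j"] Lf_mono[of j "max i j"] by auto
    then show ?thesis using xy(3) by (rule Be)
  qed
  then show ?thesis using g(1) by blast
qed

section \<open>The kernel of the first element on the torsion\<close>

definition torsion_socle where "torsion_socle = {y \<in> torsion. f1 \<bullet> y = \<zero>\<^bsub>M\<^esub>}"

lemma torsion_socle_submodule: "submodule torsion_socle R M"
  unfolding torsion_socle_def by (rule annihilator_submodule[OF torsion_submodule f1])

text \<open>For \<open>n\<close> in the socle, \<open>\<phi> n\<close> is known to be killed by
  \<open>F f1\<close>, not by \<open>f1\<close>; the factor \<open>f1^(p-1)\<close> returns it to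
  the kernel of \<open>f1\<close>. The power \<open>F f2\<close> that \<open>\<phi>\<close> makes of
  \<open>f2\<close> is more than enough for divisibility by \<open>f2\<close>.\<close>

lemma \<phi>_socle:
  assumes Q: "primeideal Q R" and w: "w \<in> sat R Q M ((\<lambda>x. f2 \<bullet> x) ` torsion_socle)"
  shows "f1 [^] (p - 1) \<bullet> \<phi> w \<in> sat R Q M ((\<lambda>x. f2 \<bullet> x) ` torsion_socle)"
proof -
  obtain s n where s: "s \<in> carrier R - Q" "w \<in> carrier M" "s \<bullet> w = f2 \<bullet> n" "n \<in> torsion" "f1 \<bullet> n = \<zero>\<^bsub>M\<^esub>"
    using w by (auto simp: sat_def torsion_socle_def)
  have c: "s \<in> carrier R" "n \<in> carrier M" "\<phi> n \<in> carrier M" "\<phi> w \<in> carrier M"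
    "f1 [^] (p - 1) \<in> carrier R" "f2 [^] (p - 1) \<in> carrier R" using s torsion_carr \<phi>_closed by auto
  let ?n = "f2 [^] (p - 1) \<bullet> (f1 [^] (p - 1) \<bullet> \<phi> n)"
  have "F s \<bullet> \<phi> w = F f2 \<bullet> \<phi> n" using s(3) \<phi>_smult[OF c(1) s(2)] \<phi>_smult[OF f2 c(2)] by simp
  then have "F s \<bullet> (f1 [^] (p - 1) \<bullet> \<phi> w) = f1 [^] (p - 1) \<bullet> (F f2 \<bullet> \<phi> n)"
    using c smult_left_comm[of "F s" "f1 [^] (p - 1)" "\<phi> w"] by simp
  also have "\<dots> = F f2 \<bullet> (f1 [^] (p - 1) \<bullet> \<phi> n)" using c by (intro smult_left_comm) auto
  also have "\<dots> = f2 \<bullet> ?n" using c by (intro F_smult) auto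
  finally have e: "F s \<bullet> (f1 [^] (p - 1) \<bullet> \<phi> w) = f2 \<bullet> ?n" .
  have "?n \<in> torsion" by (intro submodule_smult[OF torsion_submodule] \<phi>_torsion s(4) c)
  moreover have "f1 \<bullet> ?n = f2 [^] (p - 1) \<bullet> (F f1 \<bullet> \<phi> n)"
    using c F_smult[OF f1 c(3)] smult_left_comm[OF f1 c(6), of "f1 [^] (p - 1) \<bullet> \<phi> n"] by simp
  moreover have "F f1 \<bullet> \<phi> n = \<zero>\<^bsub>M\<^esub>" using \<phi>_smult[OF f1 c(2)] s(5) by (simp add: \<phi>_zero)
  ultimately have "?n \<in> torsion_socle" using c by (simp add: torsion_socle_def)
  then have "F s \<bullet> (f1 [^] (p - 1) \<bullet> \<phi> w) \<in> (\<lambda>x. f2 \<bullet> x) ` torsion_socle" unfolding e by blast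
  moreover have "f1 [^] (p - 1) \<bullet> \<phi> w \<in> carrier M" using c by simp
  ultimately show ?thesis using F_notin[OF Q s(1)] unfolding sat_def by blast
qed

text \<open>Each application of \<open>\<phi>\<close> multiplies the exponent of \<open>f1\<close>
  by \<open>p\<close> and raises both levels by one. Hence the gap \<open>c\<close> between the
  levels is the same for all \<open>e\<close>, and one condition on \<open>torsion_Lf 0\<close>
  controls the whole filtration.\<close>

lemma torsion_Lf_divisible:
  assumes Q: "primeideal Q R" and T: "torsion_Lf 0 \<subseteq> sat R Q M ((\<lambda>x. f1 \<bullet> x) ` torsion_Lf c)"
  shows "torsion_Lf e \<subseteq> sat R Q M ((\<lambda>x. f1 [^] (p ^ e) \<bullet> x) ` torsion_Lf (c + e))"
proof (induction e)
  case 0 then show ?case using T by simp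
next
  case (Suc e)
  have im: "\<phi> x \<in> (\<lambda>x. f1 [^] (p ^ Suc e) \<bullet> x) ` torsion_Lf (c + Suc e)"
    if "x \<in> (\<lambda>x. f1 [^] (p ^ e) \<bullet> x) ` torsion_Lf (c + e)" for x
  proof -
    obtain y where y: "y \<in> torsion_Lf (c + e)" "x = f1 [^] (p ^ e) \<bullet> y" using \<open>x \<in> _\<close> by blast
    have "\<phi> x = f1 [^] (p ^ Suc e) \<bullet> \<phi> y"
      using \<phi>_pow_smult[OF f1 torsion_Lf_carr[OF y(1)], of "p ^ e"] y(2) by (simp add: mult.commute)
    then show ?thesis using \<phi>_torsion_Lf[OF y(1)] by auto
  qed
  have pR: "f1 [^] (p ^ Suc e) \<in> carrier R" by simp
  have "\<Phi> (torsion_Lf e) \<subseteq> sat R Q M ((\<lambda>x. f1 [^] (p ^ Suc e) \<bullet> x) ` torsion_Lf (c + Suc e))"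
    by (rule \<Phi>_sat[OF Q Suc smult_image_submodule[OF torsion_Lf_submodule pR] im])
  then show ?case using torsion_Lf_Suc by blast
qed

text \<open>One step uses flatness for the scalar \<open>f1^(p^e)\<close>, whose image under
  \<open>F\<close> is \<open>f1^(p^(e+1))\<close>. The second half is carried along because
  monotonicity of \<open>\<Phi>\<close> asks for subsets of the module.\<close>

lemma socle_iterate:
  "{y \<in> torsion_Lf (c + e). f1 [^] (p ^ e) \<bullet> y = \<zero>\<^bsub>M\<^esub>} \<subseteq> (\<Phi> ^^ e) {y \<in> torsion_Lf c. f1 \<bullet> y = \<zero>\<^bsub>M\<^esub>}
    \<and> (\<Phi> ^^ e) {y \<in> torsion_Lf c. f1 \<bullet> y = \<zero>\<^bsub>M\<^esub>} \<subseteq> carrier M"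
proof (induction e)
  case 0
  then show ?case using torsion_Lf_carr by auto
next
  case (Suc e)
  have "y \<in> \<Phi> {y \<in> torsion_Lf (c + e). f1 [^] (p ^ e) \<bullet> y = \<zero>\<^bsub>M\<^esub>}"
    if y: "y \<in> torsion_Lf (c + Suc e)" "f1 [^] (p ^ Suc e) \<bullet> y = \<zero>\<^bsub>M\<^esub>" for y
  proof (rule annihilator_flat[OF torsion_Lf_submodule])
    show "y \<in> \<Phi> (torsion_Lf (c + e))" using torsion_Lf_Suc[of "c + e"] y(1) by auto
    show "F (f1 [^] (p ^ e)) \<bullet> y = \<zero>\<^bsub>M\<^esub>" using y(2) by (simp add: F_pow nat_pow_pow mult.commute)
  qed simp
  moreover have "\<Phi> {y \<in> torsion_Lf (c + e). f1 [^] (p ^ e) \<bullet> y = \<zero>\<^bsub>M\<^esub>} \<subseteq> \<Phi> ((\<Phi> ^^ e) {y \<in> torsion_Lf c. f1 \<bullet> y = \<zero>\<^bsub>M\<^esub>})"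
    using Suc by (intro \<Phi>_mono) auto
  moreover have "\<Phi> ((\<Phi> ^^ e) {y \<in> torsion_Lf c. f1 \<bullet> y = \<zero>\<^bsub>M\<^esub>}) \<subseteq> carrier M"
    using Suc by (intro submoduleE(1)[OF \<Phi>_submodule]) auto
  ultimately show ?case by auto
qed

text \<open>The map \<open>f1^(p-1)\<close> times \<open>\<phi>\<close> preserves the local
  multiples of \<open>f2\<close> by \<open>\<phi>_socle\<close>, and its e-fold composite is
  \<open>f1^(p^e - 1)\<close> times that of \<open>\<phi>\<close>.\<close>

lemma socle_divisible:
  assumes Q: "primeideal Q R"
    and T: "{y \<in> torsion_Lf c. f1 \<bullet> y = \<zero>\<^bsub>M\<^esub>} \<subseteq> sat R Q M ((\<lambda>x. f2 \<bullet> x) ` torsion_socle)"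
    and x: "x \<in> (\<Phi> ^^ e) {y \<in> torsion_Lf c. f1 \<bullet> y = \<zero>\<^bsub>M\<^esub>}"
  shows "f1 [^] (p ^ e - 1) \<bullet> x \<in> sat R Q M ((\<lambda>x. f2 \<bullet> x) ` torsion_socle)"
  using x
proof (induction e arbitrary: x)
  case 0
  then show ?case using T torsion_Lf_carr by auto
next
  case (Suc e)
  let ?D = "sat R Q M ((\<lambda>x. f2 \<bullet> x) ` torsion_socle)"
  let ?X = "(\<Phi> ^^ e) {y \<in> torsion_Lf c. f1 \<bullet> y = \<zero>\<^bsub>M\<^esub>}"
  have XM: "?X \<subseteq> carrier M" using socle_iterate by blast
  have D: "submodule ?D R M" by (rule sat_submodule[OF Q smult_image_submodule[OF torsion_socle_submodule f2]])
  have pR: "f1 [^] (p ^ Suc e - 1) \<in> carrier R" by simp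
  have S: "submodule {x \<in> carrier M. f1 [^] (p ^ Suc e - 1) \<bullet> x \<in> ?D} R M"
    by (rule semilinear_vimage[OF module_axioms module_axioms smult_linear[OF pR] D]) auto
  have "\<Phi> ?X \<subseteq> {x \<in> carrier M. f1 [^] (p ^ Suc e - 1) \<bullet> x \<in> ?D}"
  proof (rule \<Phi>_minimal[OF S])
    fix y assume y: "y \<in> ?X"
    then have yM: "y \<in> carrier M" using XM by blast
    \<comment> \<open>The exponents add up as \<open>(p - 1) + (p^e - 1) p = p^(e+1) - 1\<close>;
      positivity of \<open>p^e\<close> makes the subtraction harmless.\<close>
    obtain k where "p ^ e = Suc k" using p gr0_implies_Suc[of "p ^ e"] by auto
    then have "(p - 1) + (p ^ e - 1) * p = p ^ Suc e - 1" using p by (simp add: mult.commute)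
    then have "f1 [^] (p ^ Suc e - 1) \<bullet> \<phi> y = f1 [^] (p - 1) \<bullet> \<phi> (f1 [^] (p ^ e - 1) \<bullet> y)"
      using pow_pow_smult[OF f1 \<phi>_closed[OF yM], of "p - 1" "(p ^ e - 1) * p"] \<phi>_pow_smult[OF f1 yM, of "p ^ e - 1"] by simp
    also have "\<dots> \<in> ?D" by (rule \<phi>_socle[OF Q Suc.IH[OF y]])
    finally show "\<phi> y \<in> {x \<in> carrier M. f1 [^] (p ^ Suc e - 1) \<bullet> x \<in> ?D}" using \<phi>_closed[OF yM] by simp
  qed
  then show ?case using Suc.prems by auto
qed

lemma torsion_socle_divisible:
  assumes Q: "primeideal Q R" and T2: "torsion_Lf 0 \<subseteq> sat R Q M ((\<lambda>x. f1 \<bullet> x) ` torsion_Lf c)"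
    and T3: "{y \<in> torsion_Lf c. f1 \<bullet> y = \<zero>\<^bsub>M\<^esub>} \<subseteq> sat R Q M ((\<lambda>x. f2 \<bullet> x) ` torsion_socle)"
  shows "torsion_socle \<subseteq> sat R Q M ((\<lambda>x. f2 \<bullet> x) ` torsion_socle)"
proof
  fix x assume "x \<in> torsion_socle"
  then have x: "x \<in> torsion" "x \<in> carrier M" "f1 \<bullet> x = \<zero>\<^bsub>M\<^esub>" using torsion_carr by (auto simp: torsion_socle_def)
  obtain e where "x \<in> torsion_Lf e" using torsion_Lf_mem x by blast
  then have "x \<in> sat R Q M ((\<lambda>x. f1 [^] (p ^ e) \<bullet> x) ` torsion_Lf (c + e))" using torsion_Lf_divisible[OF Q T2] by blast
  then obtain s y where s: "s \<in> carrier R - Q" "y \<in> torsion_Lf (c + e)" "s \<bullet> x = f1 [^] (p ^ e) \<bullet> y" by (auto simp: sat_def)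
  have yM: "y \<in> carrier M" and sR: "s \<in> carrier R" using torsion_Lf_carr s by auto
  have "f1 [^] (p ^ e) \<bullet> (f1 \<bullet> y) = f1 \<bullet> (s \<bullet> x)"
    using s(3) yM smult_left_comm[of "f1 [^] (p ^ e)" f1 y] by simp
  also have "\<dots> = \<zero>\<^bsub>M\<^esub>" using x sR smult_left_comm[of f1 s x] by simp
  finally have "f1 \<bullet> y \<in> (\<Phi> ^^ e) {y \<in> torsion_Lf c. f1 \<bullet> y = \<zero>\<^bsub>M\<^esub>}"
    using socle_iterate[of c e] submodule_smult[OF torsion_Lf_submodule f1 s(2)] by auto
  then have "f1 [^] (p ^ e - 1) \<bullet> (f1 \<bullet> y) \<in> sat R Q M ((\<lambda>x. f2 \<bullet> x) ` torsion_socle)"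
    by (rule socle_divisible[OF Q T3])
  \<comment> \<open>The exponent falls one short of \<open>p^e\<close>, and the factor in
    \<open>f1 \<bullet> y\<close> supplies the missing one.\<close>
  moreover have "f1 [^] (p ^ e - 1) \<bullet> (f1 \<bullet> y) = s \<bullet> x"
    using pow_Suc_smult[OF f1 yM, of "p ^ e - 1"] s(3) p by (simp del: nat_pow_Suc)
  ultimately show "x \<in> sat R Q M ((\<lambda>x. f2 \<bullet> x) ` torsion_socle)" using sat_cancel[OF Q s(1) x(2)] by simp
qed

lemma torsion_divisible:
  assumes Q: "primeideal Q R" and T2: "torsion_Lf 0 \<subseteq> sat R Q M ((\<lambda>x. f1 \<bullet> x) ` torsion_Lf c)" and x: "x \<in> torsion"
  shows "\<exists>s\<in>carrier R - Q. \<exists>y\<in>torsion. s \<bullet> x = f1 \<bullet> y"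
proof -
  obtain e where "x \<in> torsion_Lf e" using torsion_Lf_mem x by blast
  then have "x \<in> sat R Q M ((\<lambda>x. f1 [^] (p ^ e) \<bullet> x) ` torsion_Lf (c + e))" using torsion_Lf_divisible[OF Q T2] by blast
  then obtain s y where s: "s \<in> carrier R - Q" "y \<in> torsion_Lf (c + e)" "s \<bullet> x = f1 [^] (p ^ e) \<bullet> y" by (auto simp: sat_def)
  have y: "y \<in> torsion" "y \<in> carrier M" using s(2) torsion_Lf_carr by (auto simp: torsion_Lf_def)
  let ?y = "f1 [^] (p ^ e - 1) \<bullet> y"
  have "s \<bullet> x = f1 \<bullet> ?y"
    using pow_pow_smult[OF f1 y(2), of 1 "p ^ e - 1"] s(3) p y(2) by simp
  moreover have "?y \<in> torsion" by (intro submodule_smult[OF torsion_submodule] y(1)) simp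
  ultimately show ?thesis using s(1) by blast
qed

text \<open>The error of \<open>z\<close>, known to be torsion, is corrected in two steps. A torsion
  element \<open>w\<close> repairs the first component; the remaining error in the second lies in
  the socle and is \<open>f2 n\<close> with \<open>n\<close> in the socle, so that adding
  \<open>n\<close> does not disturb the first component again. All of this holds up to the
  denominators \<open>s\<close>, \<open>t\<close> and \<open>r\<close>.\<close>

lemma cocycle_coboundary:
  assumes Q: "primeideal Q R" and T1: "torsion_coboundary Q f1 f2 x y"
    and T2: "\<And>x. x \<in> torsion \<Longrightarrow> \<exists>s\<in>carrier R - Q. \<exists>y\<in>torsion. s \<bullet> x = f1 \<bullet> y"
    and T3: "torsion_socle \<subseteq> sat R Q M ((\<lambda>x. f2 \<bullet> x) ` torsion_socle)"
    and eq: "f1 \<bullet> y = f2 \<bullet> x"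
  shows "\<exists>s\<in>carrier R - Q. \<exists>z\<in>carrier M. s \<bullet> x = f1 \<bullet> z \<and> s \<bullet> y = f2 \<bullet> z"
proof -
  obtain s z where s: "s \<in> carrier R - Q" "z \<in> carrier M" "x \<in> carrier M" "y \<in> carrier M"
    "s \<bullet> x \<ominus>\<^bsub>M\<^esub> f1 \<bullet> z \<in> torsion" "s \<bullet> y \<ominus>\<^bsub>M\<^esub> f2 \<bullet> z \<in> torsion"
    using T1 unfolding torsion_coboundary_def by blast
  have sR: "s \<in> carrier R" using s by simp
  let ?u = "s \<bullet> x \<ominus>\<^bsub>M\<^esub> f1 \<bullet> z" and ?v = "s \<bullet> y \<ominus>\<^bsub>M\<^esub> f2 \<bullet> z"
  have uv: "?u \<in> carrier M" "?v \<in> carrier M" using s sR by auto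
  have e: "f1 \<bullet> ?v = f2 \<bullet> ?u"
    using s(2-4) sR eq by (simp add: smult_r_diff smult_left_comm[of _ s] smult_left_comm[of f2 f1])
  obtain t w where t: "t \<in> carrier R - Q" "w \<in> torsion" "t \<bullet> ?u = f1 \<bullet> w" using T2[OF s(5)] by blast
  have tR: "t \<in> carrier R" and wM: "w \<in> carrier M" using t torsion_carr by auto
  have fw: "f2 \<bullet> w \<in> carrier M" using wM by simp
  have "t \<bullet> ?v \<ominus>\<^bsub>M\<^esub> f2 \<bullet> w \<in> torsion"
    using submodule_diff[OF torsion_submodule submodule_smult[OF torsion_submodule tR s(6)] submodule_smult[OF torsion_submodule f2 t(2)]] .
  moreover have "f1 \<bullet> (t \<bullet> ?v \<ominus>\<^bsub>M\<^esub> f2 \<bullet> w) = \<zero>\<^bsub>M\<^esub>"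
  proof -
    have "f1 \<bullet> (t \<bullet> ?v) = f2 \<bullet> (t \<bullet> ?u)"
      using smult_left_comm[OF f1 tR uv(2)] smult_left_comm[OF f2 tR uv(1)] e by simp
    also have "\<dots> = f1 \<bullet> (f2 \<bullet> w)" unfolding t(3) by (rule smult_left_comm[OF f2 f1 wM])
    finally show ?thesis using smult_r_diff[OF f1 smult_closed[OF tR uv(2)] fw] fw diff_zero_iff by simp
  qed
  ultimately have "t \<bullet> ?v \<ominus>\<^bsub>M\<^esub> f2 \<bullet> w \<in> torsion_socle" by (simp add: torsion_socle_def)
  then obtain r n where r: "r \<in> carrier R - Q" "n \<in> torsion_socle" "r \<bullet> (t \<bullet> ?v \<ominus>\<^bsub>M\<^esub> f2 \<bullet> w) = f2 \<bullet> n"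
    using T3 by (auto simp: sat_def)
  have rR: "r \<in> carrier R" using r by simp
  have nM: "n \<in> carrier M" "f1 \<bullet> n = \<zero>\<^bsub>M\<^esub>" using r(2) torsion_carr by (auto simp: torsion_socle_def)
  let ?s = "r \<otimes> t \<otimes> s"
  let ?z = "r \<bullet> (t \<bullet> z) \<oplus>\<^bsub>M\<^esub> (r \<bullet> w \<oplus>\<^bsub>M\<^esub> n)"
  have add_diff: "a = b \<oplus>\<^bsub>M\<^esub> (a \<ominus>\<^bsub>M\<^esub> b)" if "a \<in> carrier M" "b \<in> carrier M" for a b
    using that by (simp add: a_minus_def M.a_lcomm M.r_neg)
  have sx: "s \<bullet> x = f1 \<bullet> z \<oplus>\<^bsub>M\<^esub> ?u" using s(2,3) sR by (intro add_diff) auto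
  have sy: "s \<bullet> y = f2 \<bullet> z \<oplus>\<^bsub>M\<^esub> ?v" using s(2,4) sR by (intro add_diff) auto
  have tv: "t \<bullet> ?v = f2 \<bullet> w \<oplus>\<^bsub>M\<^esub> (t \<bullet> ?v \<ominus>\<^bsub>M\<^esub> f2 \<bullet> w)" using uv tR fw by (intro add_diff) auto
  have fz: "f1 \<bullet> z \<in> carrier M" "f2 \<bullet> z \<in> carrier M" using s(2) by auto
  have "?s \<bullet> x = r \<bullet> (t \<bullet> (s \<bullet> x))" using s(3) sR tR rR by (simp add: smult_assoc1)
  also have "\<dots> = r \<bullet> (t \<bullet> (f1 \<bullet> z) \<oplus>\<^bsub>M\<^esub> f1 \<bullet> w)"
    using arg_cong[OF sx, of "\<lambda>v. r \<bullet> (t \<bullet> v)"] unfolding smult_r_distr[OF tR fz(1) uv(1)] t(3) .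
  also have "\<dots> = f1 \<bullet> ?z"
    using s(2) wM nM tR rR by (simp add: smult_r_distr smult_left_comm[of f1])
  finally have 1: "?s \<bullet> x = f1 \<bullet> ?z" .
  have "?s \<bullet> y = r \<bullet> (t \<bullet> (s \<bullet> y))" using s(4) sR tR rR by (simp add: smult_assoc1)
  also have "\<dots> = r \<bullet> (t \<bullet> (f2 \<bullet> z) \<oplus>\<^bsub>M\<^esub> t \<bullet> ?v)"
    using arg_cong[OF sy, of "\<lambda>v. r \<bullet> (t \<bullet> v)"] unfolding smult_r_distr[OF tR fz(2) uv(2)] .
  also have "\<dots> = r \<bullet> (t \<bullet> (f2 \<bullet> z)) \<oplus>\<^bsub>M\<^esub> r \<bullet> (t \<bullet> ?v)"
    using fz uv tR rR by (intro smult_r_distr) auto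
  also have "r \<bullet> (t \<bullet> ?v) = r \<bullet> (f2 \<bullet> w) \<oplus>\<^bsub>M\<^esub> f2 \<bullet> n"
  proof -
    have "t \<bullet> ?v \<ominus>\<^bsub>M\<^esub> f2 \<bullet> w \<in> carrier M" using uv(2) tR fw by simp
    then show ?thesis
      using arg_cong[OF tv, of "\<lambda>v. r \<bullet> v"] unfolding smult_r_distr[OF rR fw] r(3)
      by (simp only: smult_r_distr[OF rR fw] r(3))
  qed
  also have "r \<bullet> (t \<bullet> (f2 \<bullet> z)) \<oplus>\<^bsub>M\<^esub> (r \<bullet> (f2 \<bullet> w) \<oplus>\<^bsub>M\<^esub> f2 \<bullet> n) = f2 \<bullet> ?z"
    using s(2) wM nM tR rR by (simp add: smult_r_distr smult_left_comm[of f2])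
  finally have 2: "?s \<bullet> y = f2 \<bullet> ?z" .
  have "?s \<in> carrier R - Q" by (intro prime_mult[OF Q] r(1) t(1) s(1))
  moreover have "?z \<in> carrier M" using s(2) wM nM tR rR by auto
  ultimately show ?thesis using 1 2 by blast
qed

text \<open>Vanishing at \<open>P\<close> yields three conditions, each testable on finitely many
  elements, and these spread to a neighbourhood. The level \<open>c\<close> is found at
  \<open>P\<close> and then stays fixed, so that the third condition concerns one finitely generated
  submodule.\<close>

lemma cocycles_open:
  assumes P: "primeideal P R"
    and MP: "\<forall>x\<in>carrier M. \<forall>y\<in>carrier M. f1 \<bullet> y = f2 \<bullet> x \<longrightarrow>
      (\<exists>s\<in>carrier R - P. \<exists>z\<in>carrier M. s \<bullet> x = f1 \<bullet> z \<and> s \<bullet> y = f2 \<bullet> z)"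
  shows "\<exists>g\<in>carrier R - P. \<forall>Q. primeideal Q R \<longrightarrow> g \<notin> Q \<longrightarrow>
    (\<forall>x\<in>carrier M. \<forall>y\<in>carrier M. f1 \<bullet> y = f2 \<bullet> x \<longrightarrow>
      (\<exists>s\<in>carrier R - Q. \<exists>z\<in>carrier M. s \<bullet> x = f1 \<bullet> z \<and> s \<bullet> y = f2 \<bullet> z))"
proof -
  let ?T1 = "\<lambda>Q. \<forall>x\<in>carrier M. \<forall>y\<in>carrier M. f1 \<bullet> y = f2 \<bullet> x \<longrightarrow> torsion_coboundary Q f1 f2 x y"
  let ?S = "(\<lambda>x. f2 \<bullet> x) ` torsion_socle"
  have T1: "torsion_coboundary P f1 f2 x y" if xy: "x \<in> carrier M" "y \<in> carrier M" "f1 \<bullet> y = f2 \<bullet> x" for x y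
  proof -
    obtain s z where s: "s \<in> carrier R - P" "z \<in> carrier M" "s \<bullet> x = f1 \<bullet> z" "s \<bullet> y = f2 \<bullet> z" using MP xy by blast
    then have "s \<bullet> x \<ominus>\<^bsub>M\<^esub> f1 \<bullet> z \<in> torsion" "s \<bullet> y \<ominus>\<^bsub>M\<^esub> f2 \<bullet> z \<in> torsion"
      using submodule_zero[OF torsion_submodule] by (simp_all add: a_minus_def M.r_neg)
    then show ?thesis unfolding torsion_coboundary_def using s(1,2) xy by blast
  qed
  \<comment> \<open>For \<open>n\<close> in the socle, \<open>(\<zero>, n)\<close> is a cocycle. If
    a multiple of it is the coboundary of \<open>z\<close>, then \<open>z\<close> is killed by
    \<open>f1\<close> and \<open>f2 z\<close> is a multiple of \<open>n\<close>, so \<open>z\<close>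
    is torsion.\<close>
  have socle: "torsion_socle \<subseteq> sat R P M ?S"
  proof
    fix n assume "n \<in> torsion_socle"
    then have n: "n \<in> torsion" "f1 \<bullet> n = \<zero>\<^bsub>M\<^esub>" "n \<in> carrier M" using torsion_carr by (auto simp: torsion_socle_def)
    then have "f1 \<bullet> n = f2 \<bullet> \<zero>\<^bsub>M\<^esub>" by simp
    then obtain s z where s: "s \<in> carrier R - P" "z \<in> carrier M" "s \<bullet> \<zero>\<^bsub>M\<^esub> = f1 \<bullet> z" "s \<bullet> n = f2 \<bullet> z"
      using MP n(3) M.zero_closed by blast
    have sR: "s \<in> carrier R" using s by simp
    then have z1: "f1 \<bullet> z = \<zero>\<^bsub>M\<^esub>" using s(3) by simp
    have "f2 [^] (1::nat) \<bullet> z \<in> torsion" using submodule_smult[OF torsion_submodule sR n(1)] s(4) by simp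
    moreover have "f1 [^] (1::nat) \<bullet> z \<in> torsion" using z1 submodule_zero[OF torsion_submodule] by simp
    ultimately have "z \<in> torsion" by (rule torsion_shift[OF s(2), rotated])
    then have "z \<in> torsion_socle" using z1 by (simp add: torsion_socle_def)
    then show "n \<in> sat R P M ?S" using s(1,4) n(3) unfolding sat_def by blast
  qed
  \<comment> \<open>Induction on the power of \<open>f2\<close> that kills \<open>x\<close>. By
    induction some multiple \<open>s (f2 x)\<close> equals \<open>f1 y\<close> with \<open>y\<close>
    torsion; then \<open>(s x, y)\<close> is a cocycle, and the \<open>z\<close> of which it is
    locally the coboundary divides a multiple of \<open>x\<close> by \<open>f1\<close>.\<close>
  have div: "\<exists>s\<in>carrier R - P. \<exists>y\<in>torsion. s \<bullet> x = f1 \<bullet> y"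
    if "x \<in> torsion" "f2 [^] (k::nat) \<bullet> x = \<zero>\<^bsub>M\<^esub>" for x k
    using that
  proof (induction k arbitrary: x)
    case 0
    then have "x = \<zero>\<^bsub>M\<^esub>" using torsion_carr by simp
    then show ?case using prime_one[OF P] submodule_zero[OF torsion_submodule]
      by (intro bexI[of _ \<one>] bexI[of _ "\<zero>\<^bsub>M\<^esub>"]) auto
  next
    case (Suc k)
    have x: "x \<in> carrier M" using torsion_carr Suc by blast
    have "f2 \<bullet> x \<in> torsion" "f2 [^] k \<bullet> (f2 \<bullet> x) = \<zero>\<^bsub>M\<^esub>"
      using submodule_smult[OF torsion_submodule f2 Suc.prems(1)] Suc.prems(2) pow_Suc_smult[OF f2 x, of k] by simp_all
    then obtain s y where s: "s \<in> carrier R - P" "y \<in> torsion" "s \<bullet> (f2 \<bullet> x) = f1 \<bullet> y" using Suc.IH by blast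
    have sR: "s \<in> carrier R" and y: "y \<in> carrier M" using s torsion_carr by auto
    have "f1 \<bullet> y = f2 \<bullet> (s \<bullet> x)" using s(3) smult_left_comm[OF sR f2 x] by simp
    then obtain t z where t: "t \<in> carrier R - P" "z \<in> carrier M" "t \<bullet> (s \<bullet> x) = f1 \<bullet> z" "t \<bullet> y = f2 \<bullet> z"
      using MP y smult_closed[OF sR x] by blast
    have tR: "t \<in> carrier R" using t by simp
    have "f1 [^] (1::nat) \<bullet> z \<in> torsion" "f2 [^] (1::nat) \<bullet> z \<in> torsion"
      using submodule_smult[OF torsion_submodule tR submodule_smult[OF torsion_submodule sR Suc.prems(1)]]
        submodule_smult[OF torsion_submodule tR s(2)] t(3,4) by simp_all
    then have "z \<in> torsion" by (rule torsion_shift[OF t(2)])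
    moreover have "(t \<otimes> s) \<bullet> x = f1 \<bullet> z" using t(3) tR sR x by (simp add: smult_assoc1)
    ultimately show ?case using prime_mult[OF P t(1) s(1)] by blast
  qed
  obtain H where H: "finite H" "H \<subseteq> torsion_Lf 0" "torsion_Lf 0 = lspan R M H"
    by (rule submodule_Lf_fg[OF torsion_Lf_submodule, of 0 0]) (auto simp: torsion_Lf_def)
  have "\<exists>c. h \<in> sat R P M ((\<lambda>x. f1 \<bullet> x) ` torsion_Lf c)" if h: "h \<in> H" for h
  proof -
    have hT: "h \<in> torsion" "h \<in> carrier M" using h H(2) torsion_Lf_carr by (auto simp: torsion_Lf_def)
    obtain k :: nat where "f2 [^] k \<bullet> h = \<zero>\<^bsub>M\<^esub>" using hT(1) by (rule torsionE)
    then obtain s y where s: "s \<in> carrier R - P" "y \<in> torsion" "s \<bullet> h = f1 \<bullet> y" using div[OF hT(1)] by blast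
    obtain c where "y \<in> torsion_Lf c" using torsion_Lf_mem[OF s(2)] by blast
    then show ?thesis using s(1,3) hT(2) unfolding sat_def by blast
  qed
  then obtain \<gamma> where \<gamma>: "\<And>h. h \<in> H \<Longrightarrow> h \<in> sat R P M ((\<lambda>x. f1 \<bullet> x) ` torsion_Lf (\<gamma> h))" by metis
  \<comment> \<open>The filtration is increasing, so a common upper bound of the levels
    \<open>\<gamma> h\<close> is enough; the sum is one.\<close>
  define c where "c = (\<Sum>h\<in>H. \<gamma> h)"
  let ?T2 = "\<lambda>Q. H \<subseteq> sat R Q M ((\<lambda>x. f1 \<bullet> x) ` torsion_Lf c)"
  have T2: "?T2 P"
  proof
    fix h assume h: "h \<in> H"
    have "\<gamma> h \<le> c" unfolding c_def using H(1) h by (intro member_le_sum) auto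
    then have "(\<lambda>x. f1 \<bullet> x) ` torsion_Lf (\<gamma> h) \<subseteq> (\<lambda>x. f1 \<bullet> x) ` torsion_Lf c"
      using torsion_Lf_mono by (intro image_mono)
    then show "h \<in> sat R P M ((\<lambda>x. f1 \<bullet> x) ` torsion_Lf c)" using \<gamma>[OF h] sat_mono by blast
  qed
  let ?V = "{y \<in> torsion_Lf c. f1 \<bullet> y = \<zero>\<^bsub>M\<^esub>}"
  have V: "submodule ?V R M" by (rule annihilator_submodule[OF torsion_Lf_submodule f1])
  obtain W where W: "finite W" "W \<subseteq> ?V" "?V = lspan R M W"
    by (rule submodule_Lf_fg[OF V, of c]) (auto simp: torsion_Lf_def)
  let ?T3 = "\<lambda>Q. W \<subseteq> sat R Q M ?S"
  have T3: "?T3 P" using W(2) socle by (auto simp: torsion_socle_def torsion_Lf_def)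
  have "\<exists>g\<in>carrier R - P. \<forall>Q. primeideal Q R \<longrightarrow> g \<notin> Q \<longrightarrow> ?T1 Q \<and> ?T2 Q \<and> ?T3 Q"
    by (intro prime_ideal_complement_conj[OF P] torsion_coboundaries_open[OF P T1] sat_open[OF H(1) P T2] sat_open[OF W(1) P T3])
  then obtain g where g: "g \<in> carrier R - P" "\<And>Q. primeideal Q R \<Longrightarrow> g \<notin> Q \<Longrightarrow> ?T1 Q \<and> ?T2 Q \<and> ?T3 Q" by blast
  have "\<exists>s\<in>carrier R - Q. \<exists>z\<in>carrier M. s \<bullet> x = f1 \<bullet> z \<and> s \<bullet> y = f2 \<bullet> z"
    if Q: "primeideal Q R" and gQ: "g \<notin> Q" and xy: "x \<in> carrier M" "y \<in> carrier M" "f1 \<bullet> y = f2 \<bullet> x" for Q x y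
  proof -
    note gs = g(2)[OF Q gQ]
    have t2: "torsion_Lf 0 \<subseteq> sat R Q M ((\<lambda>x. f1 \<bullet> x) ` torsion_Lf c)" unfolding H(3)
      using gs by (intro lspan_minimal[OF sat_submodule[OF Q smult_image_submodule[OF torsion_Lf_submodule f1]]]) blast
    have t3: "?V \<subseteq> sat R Q M ?S" unfolding W(3)
      using gs by (intro lspan_minimal[OF sat_submodule[OF Q smult_image_submodule[OF torsion_socle_submodule f2]]]) blast
    have t1: "torsion_coboundary Q f1 f2 x y" using gs xy by blast
    show ?thesis
      by (rule cocycle_coboundary[OF Q t1 torsion_divisible[OF Q t2] torsion_socle_divisible[OF Q t2 t3] xy(3)])
  qed
  then show ?thesis using g(1) by blast
qed

end

theorem theorem5p4:
  fixes R :: "('a, 'r) ring_scheme"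
    and p :: nat
    and f1 f2 :: 'a
    and L :: "('a, 'l, 'c) module_scheme"
    and \<theta> :: "'l \<Rightarrow> ('a \<times> 'l \<Rightarrow>\<^sub>0 int) set"
    and i :: int
  assumes "noetherian_regular_ring R"
    and "Factorial_Ring.prime p" and "has_characteristic R p"
    and "regular_sequence R [f1, f2]"
    and "F_module R p L \<theta>"
    and "F_finite TYPE('m) R p L \<theta>"
  shows "zariski_closed R (Supp R (koszul_cohomology R f1 f2 L i))"
proof -
  let ?F = "\<lambda>r. r [^]\<^bsub>R\<^esub> p"
  interpret flat_endo R ?F by (rule frobenius_flat[OF assms(1-3)])
  have L: "module R L" "\<theta> \<in> module_iso R L (PS R p L)" using assms(5) by (auto simp: F_module_def)
  interpret module R L by (rule L)
  have f: "f1 \<in> carrier R" "f2 \<in> carrier R" using assms(4) by (auto simp: regular_sequence_def)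
  have p: "0 < p" using assms(2) by (rule prime_gt_0_nat)
  obtain K :: "('a, 'm) module" and \<beta> where K: "finitely_generated_module R K" "generating_morphism R p L \<theta> K \<beta>"
    using assms(6) by (auto simp: F_finite_def)
  interpret FM: frobenius_module R ?F p L \<theta>
    using L F by (intro frobenius_module.intro frobenius_module_axioms.intro peskine_szpiro.intro
        flat_endo_axioms module_axioms is_cring refl)
  obtain G Lf where G: "finite G" "G \<subseteq> carrier L" "Lf 0 = lspan R L G" "\<And>e::nat. Lf (Suc e) = FM.\<Phi> (Lf e)"
    "\<And>e. Lf e \<subseteq> Lf (Suc e)" "carrier L = (\<Union>e. Lf e)"
    by (rule FM.generating_filtration[OF K]) blast
  interpret KF: koszul_filtration R ?F L FM.\<phi> p G Lf f1 f2
    using G f p by (intro koszul_filtration.intro koszul_filtration_axioms.intro FM.semilinear_endo_axioms refl)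
  show ?thesis
  proof (rule zariski_closedI)
    show "Supp R (koszul_cohomology R f1 f2 L i) \<subseteq> Spec R" by (auto simp: Supp_def)
    fix P assume "P \<in> Spec R" and PS: "P \<notin> Supp R (koszul_cohomology R f1 f2 L i)"
    then have P: "primeideal P R" by (simp add: Spec_def)
    consider "i = 0" | "i = 1" | "i = 2" | "i \<noteq> 0" "i \<noteq> 1" "i \<noteq> 2" by blast
    then have "\<exists>g\<in>carrier R - P. \<forall>Q. primeideal Q R \<longrightarrow> g \<notin> Q \<longrightarrow> Q \<notin> Supp R (koszul_cohomology R f1 f2 L i)"
    proof cases
      case 1
      then show ?thesis using KF.socle_open[OF P] PS Supp_koszul_0[OF f] P by simp
    next
      case 2
      then show ?thesis using KF.cocycles_open[OF P] PS Supp_koszul_1[OF f] P by simp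
    next
      case 3
      then show ?thesis using KF.coboundaries_open[OF P] PS Supp_koszul_2[OF f] P by (simp add: KF.coboundaries_def)
    next
      case 4
      \<comment> \<open>The support is empty in these degrees, so \<open>\<one>\<close> serves as
        \<open>g\<close>.\<close>
      then show ?thesis using Supp_koszul_other[OF f] prime_one[OF P] by blast
    qed
    then show "\<exists>g\<in>carrier R - P. \<forall>Q\<in>Spec R. g \<notin> Q \<longrightarrow> Q \<notin> Supp R (koszul_cohomology R f1 f2 L i)"
      by (auto simp: Spec_def)
  qed
qed

end
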